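(* Assume $b\in L^\infty(0,T;C^{0,\beta}_b(\mathbb R^n;\mathbb R^n))$, $\beta\in(0,1)$, $\sigma$ Borel locally bounded, $A\in\mathbb R^{n\times n}$, $L$ with generating triplet $(Q,0,\nu)$ and $\mathbb E[|L_1|^\theta]<\infty$ for some $\theta\in(0,1)$, and that (E) satisfies Hypothesis (H1). Then there exists a $\mathcal B([0,T]^2\times\mathbb R^n)\otimes\mathcal F$-measurable map $\psi:[0,T]\times[0,T]\times\mathbb R^n\times\Omega\to\mathbb R^n$ such that for each $(s,x)$, $(\psi(s,t,x,\cdot))_{t\in[0,T]}$ is a strong solution of (D) starting from $x$ at time $s$, and an event $\Omega'$ with $\mathbb P(\Omega')=1$ such that for every $\omega\in\Omega'$: (i) for $s\in(0,T)$, $r_m\to s^+$, $s_j\to s^-$ and every $R>0$: $\lim_m\sup_{|x|\le R}\sup_{t\in[0,T]}|\psi(r_m,t,x,\omega)-\psi(s,t,x,\omega)|=0$ and $\lim_j\sup_{|x|\le R}\sup_{t\in[0,T]}|\psi(s_j,t,x,\omega)-\psi(s-,t,x,\omega)|=0$ (analogously at $s=0,T$); (ii) $\psi(s,t,x,\omega)=x$ for $t\le s$ and $\psi(s,t,x,\omega)=x+\int_s^t\tilde b(r,\psi(s,r,x,\omega))\,dr+\tilde M_t(\omega)-\tilde M_s(\omega)$ for $t\in[s,T]$, for all $x,s$; (iii) $x\mapsto\psi(s,t,x,\omega)$ is continuous uniformly in $t$, and for each integer $m>2n$ there is a $\mathcal B([0,T])\otimes\mathcal F$-measurable $V_m:[0,T]\times\Omega\to[0,\infty]$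 with $\int_0^TV_m(s,\omega)ds<\infty$ and $\sup_{t\in[0,T]}|\psi(s,t,x,\omega)-\psi(s,t,y,\omega)|\le V_m(s,\omega)|x-y|^{\frac{m-2n}{m}}[(|x|\vee|y|)^{\frac{2n+1}{m}}\vee1]$ for all $x,y$, $s$; (iv) $\psi(s,t,x,\omega)=\psi(r,t,\psi(s,r,x,\omega),\omega)$ for $0\le s<r\le t\le T$, $x\in\mathbb R^n$; (v) for $s_0\in[0,T)$, $\tau=\tau(\omega)\in(s_0,T]$, $x\in\mathbb R^n$, there is a unique càdlàg $g:[s_0,\tau)\to\mathbb R^n$ solving $g(t)=x+\int_{s_0}^t\tilde b(r,g(r))\,dr+\tilde M_t(\omega)-\tilde M_{s_0}(\omega)$ on $[s_0,\tau)$, namely $g(r)=\psi(s_0,r,x,\omega)$.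
   Context: Fix $T>0$, $1\le d\le n$; $(\Omega,\mathcal F,\mathbb P)$ complete probability space, $L$ an $\mathbb R^d$-valued Lévy process with generating triplet $(Q,0,\nu)$. $\mathcal F^L_{s,t}$ is the completion of $\sigma(L_r-L_s:s\le r\le t)$. $M_t=\int_0^t\sigma(r)dL_r$, $\tilde M_t=\int_0^te^{-rA}\sigma(r)dL_r$, $\tilde b(r,x)=e^{-rA}b(r,e^{rA}x)$. $L^\infty(0,T;C^{0,\beta}_b)$ = Borel bounded $b$, $\beta$-Hölder in $x$ uniformly in $t$. (E): $Z_t=x+\int_s^t[b(r,Z_r)+AZ_r]dr+M_t-M_s$. (D): $U_t=x+\int_s^t\tilde b(r,U_r)dr+\tilde M_t-\tilde M_s$, $t\in[s,T]$. A strong solution starting from $x$ at time $s$: a process $(V_t)_{t\in[0,T]}$ with $V_t=x$ for $t\le s$, $V_t$ $\mathcal F^L_{s,t}$-measurable for $t\ge s$, such that on an a.s. event (independent of $t$) $V$ is càdlàg on $[s,T]$, $L$ is càdlàg with $L_0=0$, and the equation holds for all $t\in[s,T]$. Hypothesis (H1): (i) strong solutions exist for all $s\in[0,T]$, $x\in\mathbb R^n$; (ii) for every $p\ge2$ there is $C_T>0$ independent of $s,x,y$ with $\mathbb E[\sup_{s\le t\le T}|Z^{s,x}_t-Z^{s,y}_t|^p]\le C_T|x-y|^p$ for any two strong solutions. *)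

theory Defs
  imports "HOL-Probability.Probability"
begin

section \<open>Matrix exponential\<close>

definition mexp :: "real \<Rightarrow> real^'n^'n \<Rightarrow> real^'n^'n" where
  "mexp t A = (\<Sum>k. ((t ^ k) / fact k) *\<^sub>R (((**) A) ^^ k) (mat 1))"

section \<open>Cadlag functions on a set of times\<close>

definition cadlag_on :: "real set \<Rightarrow> (real \<Rightarrow> 'b::metric_space) \<Rightarrow> bool" where
  "cadlag_on S f \<longleftrightarrow>
     (\<forall>t\<in>S. (f \<longlongrightarrow> f t) (at t within (S \<inter> {t..})) \<and>
            (\<exists>l. (f \<longlongrightarrow> l) (at t within (S \<inter> {..<t}))))"

section \<open>Levy processes with generating triplet (Q,0,nu)\<close>

definition levy_exponent ::
  "real^'d^'d \<Rightarrow> (real^'d) measure \<Rightarrow> real^'d \<Rightarrow> complex" where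
  "levy_exponent Q \<nu> u =
     complex_of_real (- (1/2) * (u \<bullet> (Q *v u))) +
     (\<integral>y. cis (u \<bullet> y) - 1 - \<i> * complex_of_real (u \<bullet> y) * indicator (cball 0 1) y \<partial>\<nu>)"

definition levy_measure :: "(real^'d) measure \<Rightarrow> bool" where
  "levy_measure \<nu> \<longleftrightarrow> sets \<nu> = sets borel \<and> emeasure \<nu> {0} = 0 \<and>
     (\<integral>\<^sup>+ y. ennreal (min 1 ((norm y)\<^sup>2)) \<partial>\<nu>) < \<infinity>"

definition levy_process_triplet ::
  "'a measure \<Rightarrow> (real \<Rightarrow> 'a \<Rightarrow> real^'d) \<Rightarrow> real^'d^'d \<Rightarrow> (real^'d) measure \<Rightarrow> bool" where
  "levy_process_triplet P L Q \<nu> \<longleftrightarrow>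
     prob_space P \<and>
     (\<forall>t\<ge>0. L t \<in> borel_measurable P) \<and>
     (AE \<omega> in P. L 0 \<omega> = 0 \<and> cadlag_on {0..} (\<lambda>t. L t \<omega>)) \<and>
     (\<forall>tt :: nat \<Rightarrow> real. \<forall>k. 0 \<le> tt 0 \<and> (\<forall>i<k. tt i < tt (Suc i)) \<longrightarrow>
        prob_space.indep_vars P (\<lambda>_. borel) (\<lambda>i \<omega>. L (tt (Suc i)) \<omega> - L (tt i) \<omega>) {..<k}) \<and>
     (\<forall>t\<ge>0. \<forall>h\<ge>0. distr P borel (\<lambda>\<omega>. L (t + h) \<omega> - L t \<omega>) = distr P borel (L h)) \<and>
     transpose Q = Q \<and> (\<forall>u. 0 \<le> u \<bullet> (Q *v u)) \<and> levy_measure \<nu> \<and>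
     (\<forall>t\<ge>0. \<forall>u. (\<integral>\<omega>. cis (u \<bullet> L t \<omega>) \<partial>P) = exp (complex_of_real t * levy_exponent Q \<nu> u))"

section \<open>Stochastic integral of a deterministic integrand\<close>

text \<open>Step function with partition p 0 < ... < p m and value c i on (p i, p (i+1)].\<close>
definition step_fun :: "(nat \<Rightarrow> real) \<Rightarrow> (nat \<Rightarrow> 'b::real_vector) \<Rightarrow> nat \<Rightarrow> real \<Rightarrow> 'b" where
  "step_fun p c m s = (\<Sum>i<m. if p i < s \<and> s \<le> p (Suc i) then c i else 0)"

definition step_int ::
  "(real \<Rightarrow> 'a \<Rightarrow> real^'d) \<Rightarrow> (nat \<Rightarrow> real) \<Rightarrow> (nat \<Rightarrow> real^'d^'n) \<Rightarrow> nat \<Rightarrow> 'a \<Rightarrow> real^'n" where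
  "step_int L p c m \<omega> = (\<Sum>i<m. c i *v (L (p (Suc i)) \<omega> - L (p i) \<omega>))"

definition conv_in_prob :: "'a measure \<Rightarrow> (nat \<Rightarrow> 'a \<Rightarrow> 'b::metric_space) \<Rightarrow> ('a \<Rightarrow> 'b) \<Rightarrow> bool" where
  "conv_in_prob P Y X \<longleftrightarrow>
     (\<forall>\<epsilon>>0. (\<lambda>k. measure P {\<omega> \<in> space P. dist (Y k \<omega>) (X \<omega>) > \<epsilon>}) \<longlonglongrightarrow> 0)"

text \<open>X t is (a version of) the integral of f over (0,t] against L, for all t in [0,T]:
  the limit in probability of the integrals of any uniformly bounded sequence of step functions
  converging Lebesgue-a.e. on [0,t] to f.\<close>
definition is_stoch_int ::
  "'a measure \<Rightarrow> (real \<Rightarrow> 'a \<Rightarrow> real^'d) \<Rightarrow> real \<Rightarrow> (real \<Rightarrow> real^'d^'n) \<Rightarrow> (real \<Rightarrow> 'a \<Rightarrow> real^'n) \<Rightarrow> bool" where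
  "is_stoch_int P L T f X \<longleftrightarrow>
     (\<forall>t\<in>{0..T}. X t \<in> borel_measurable P \<and>
       (\<forall>(p :: nat \<Rightarrow> nat \<Rightarrow> real) (c :: nat \<Rightarrow> nat \<Rightarrow> real^'d^'n) (m :: nat \<Rightarrow> nat) K.
          (\<forall>k. p k 0 = 0 \<and> p k (m k) = t \<and> (\<forall>i<m k. p k i < p k (Suc i)) \<and>
               (\<forall>i<m k. norm (c k i) \<le> K)) \<and>
          (AE s in lborel. s \<in> {0..t} \<longrightarrow> (\<lambda>k. step_fun (p k) (c k) (m k) s) \<longlonglongrightarrow> f s)
          \<longrightarrow> conv_in_prob P (\<lambda>k. step_int L (p k) (c k) (m k)) (X t)))"

section \<open>Filtration and strong solutions\<close>

definition FL :: "'a measure \<Rightarrow> (real \<Rightarrow> 'a \<Rightarrow> real^'d) \<Rightarrow> real \<Rightarrow> real \<Rightarrow> 'a set set" where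
  "FL P L s t =
     (let G = sigma_sets (space P)
                {(\<lambda>\<omega>. L r \<omega> - L s \<omega>) -` B \<inter> space P | r B. r \<in> {s..t} \<and> B \<in> sets borel}
      in {A. A \<subseteq> space P \<and> (\<exists>B\<in>G. \<exists>N\<in>null_sets P. (A - B) \<union> (B - A) \<subseteq> N)})"

text \<open>Strong solution on [0,T] of V t = x + int_s^t F(r, V r) dr + N t - N s, starting from x at time s.\<close>
definition strong_sol ::
  "'a measure \<Rightarrow> (real \<Rightarrow> 'a \<Rightarrow> real^'d) \<Rightarrow> real \<Rightarrow> real \<Rightarrow> real^'n
    \<Rightarrow> (real \<Rightarrow> real^'n \<Rightarrow> real^'n) \<Rightarrow> (real \<Rightarrow> 'a \<Rightarrow> real^'n) \<Rightarrow> (real \<Rightarrow> 'a \<Rightarrow> real^'n) \<Rightarrow> bool" where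
  "strong_sol P L T s x F N V \<longleftrightarrow>
     (\<forall>t\<in>{0..s}. \<forall>\<omega>\<in>space P. V t \<omega> = x) \<and>
     (\<forall>t\<in>{s..T}. \<forall>B\<in>sets borel. V t -` B \<inter> space P \<in> FL P L s t) \<and>
     (AE \<omega> in P. cadlag_on {s..T} (\<lambda>t. V t \<omega>) \<and> cadlag_on {0..T} (\<lambda>t. L t \<omega>) \<and> L 0 \<omega> = 0 \<and>
        (\<forall>t\<in>{s..T}. V t \<omega> = x + (LINT r:{s..t}|lborel. F r (V r \<omega>)) + N t \<omega> - N s \<omega>))"

text \<open>Hypothesis (H1) for the equation (E) with drift b(r,z) + A z and noise M.\<close>
definition H1 ::
  "'a measure \<Rightarrow> (real \<Rightarrow> 'a \<Rightarrow> real^'d) \<Rightarrow> real \<Rightarrow> (real \<Rightarrow> real^'n \<Rightarrow> real^'n) \<Rightarrow> real^'n^'n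
     \<Rightarrow> (real \<Rightarrow> 'a \<Rightarrow> real^'n) \<Rightarrow> bool" where
  "H1 P L T b A M \<longleftrightarrow>
     (let F = (\<lambda>r z. b r z + A *v z) in
       (\<forall>s\<in>{0..T}. \<forall>x. \<exists>Z. strong_sol P L T s x F M Z) \<and>
       (\<forall>p::real. p \<ge> 2 \<longrightarrow> (\<exists>C>0. \<forall>s\<in>{0..T}. \<forall>x y Z Z'.
          strong_sol P L T s x F M Z \<and> strong_sol P L T s y F M Z' \<longrightarrow>
          (\<integral>\<^sup>+ \<omega>. (\<Squnion>t\<in>{s..T}. ennreal (norm (Z t \<omega> - Z' t \<omega>) powr p)) \<partial>P)
            \<le> ennreal (C * norm (x - y) powr p))))"

definition btilde ::
  "real^'n^'n \<Rightarrow> (real \<Rightarrow> real^'n \<Rightarrow> real^'n) \<Rightarrow> real \<Rightarrow> real^'n \<Rightarrow> real^'n" where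
  "btilde A b r x = mexp (- r) A *v b r (mexp r A *v x)"

end

theory Submission
  imports Defs "HOL-Complex_Analysis.Great_Picard"
begin

text \<open>
  By pathwise integration by parts, the equations (E) and (D) are exchanged by \<open>z = e^(tA) u\<close>, so (D)
  inherits existence and the moment bounds of (H1). Chaining turns these bounds into Hoelder estimates
  in \<open>x\<close>, of an order as close to one as desired, for strong solutions of (D) started at a fixed time
  \<open>s\<close>, with integrable random constants whose mean is bounded uniformly in \<open>s\<close>.

  For a fixed path \<open>m\<close> of the noise, \<open>z = u - m\<close> solves an ordinary equation with bounded drift that is
  Hoelder continuous in space. The strong solutions started at dyadic times form a flow on one almost
  sure event, and there the averages of their Hoelder constants over the dyadic grids grow slowly enough
  for Davie's telescoping argument: it yields uniqueness of solutions for every starting time and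
  starting point. Existence at non-dyadic starting times follows from the Arzela-Ascoli theorem. The
  solution map of the ordinary equation is therefore jointly continuous, and the flow, its one-sided
  limits in \<open>s\<close> and its measurability are read off from \<open>\<psi>(s,t,x) = Z(s,t,x - m(s)) + m(max s t)\<close>.
  The estimate (iii) holds because \<open>\<psi>(s,\<cdot>,x)\<close> is a modification of the strong solution for every \<open>s\<close>.
\<close>

text \<open>(H1) speaks about one pair \<open>(s, x)\<close> at a time, each with its own null set,
  while the theorem wants one event for all pairs; and a drift that is only Hoelder in space leaves
  no Gronwall argument to bridge the gap. The numbers fit together as follows. Two solutions that
  leave a common point separate by O(h^(1+beta)) in time h. A flow that is gamma-Hoelder in space
  carries this to a later time as O(h^((1+beta) gamma)), and about T/h such errors add up, so the
  argument needs (1+beta) gamma > 1. Moments of order 2m give, by chaining in dimension n, gamma = 1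
  - 2n/m, hence the choice m > 2n (1+beta)/beta. The Hoelder constant of the flow started at s is
  random, and only its mean is bounded in s; no supremum over s is under control. What is needed,
  however, is only its sum over the 2^k + 1 points of a grid, multiplied by h^((1+beta) gamma):
  these quantities have geometrically decaying means and tend to zero almost surely. The same
  moment, integrated over s, supplies the function V of (iii).\<close>

section \<open>Cadlag paths and Caratheodory integrands\<close>

lemma cadlag_on_subset:
  assumes "cadlag_on S f" "S' \<subseteq> S" shows "cadlag_on S' f"
  unfolding cadlag_on_def
proof (intro ballI conjI)
  fix t assume t: "t \<in> S'"
  then have "(f \<longlongrightarrow> f t) (at t within (S \<inter> {t..}))" "\<exists>l. (f \<longlongrightarrow> l) (at t within (S \<inter> {..<t}))"
    using assms unfolding cadlag_on_def by auto
  then show "(f \<longlongrightarrow> f t) (at t within (S' \<inter> {t..}))" "\<exists>l. (f \<longlongrightarrow> l) (at t within (S' \<inter> {..<t}))"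
    using assms(2) by (meson Int_mono order_refl tendsto_within_subset)+
qed

lemma cadlag_on_cong:
  assumes "\<And>t. t \<in> S \<Longrightarrow> f t = g t" shows "cadlag_on S f \<longleftrightarrow> cadlag_on S g"
proof -
  have *: "(f \<longlongrightarrow> l) (at t within (S \<inter> A)) \<longleftrightarrow> (g \<longlongrightarrow> l) (at t within (S \<inter> A))" for l t A
    by (rule Lim_cong_within) (use assms in auto)
  show ?thesis unfolding cadlag_on_def using assms by (auto simp: *)
qed

lemma continuous_imp_cadlag_on:
  assumes "continuous_on S f" shows "cadlag_on S f"
  unfolding cadlag_on_def
proof (intro ballI conjI)
  fix t assume "t \<in> S"
  then have "(f \<longlongrightarrow> f t) (at t within S)" using assms by (auto simp: continuous_on_def)
  then show "(f \<longlongrightarrow> f t) (at t within (S \<inter> {t..}))" "\<exists>l. (f \<longlongrightarrow> l) (at t within (S \<inter> {..<t}))"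
    by (meson Int_lower1 tendsto_within_subset)+
qed

lemma cadlag_on_bilinear:
  fixes h :: "'b::real_normed_vector \<Rightarrow> 'c::real_normed_vector \<Rightarrow> 'd::real_normed_vector"
  assumes "bounded_bilinear h" "cadlag_on S f" "cadlag_on S g"
  shows "cadlag_on S (\<lambda>t. h (f t) (g t))"
  unfolding cadlag_on_def
proof (intro ballI conjI)
  fix t assume t: "t \<in> S"
  show "((\<lambda>t. h (f t) (g t)) \<longlongrightarrow> h (f t) (g t)) (at t within S \<inter> {t..})"
    using assms t unfolding cadlag_on_def by (auto intro: bounded_bilinear.tendsto)
  obtain l1 l2 where "(f \<longlongrightarrow> l1) (at t within (S \<inter> {..<t}))" "(g \<longlongrightarrow> l2) (at t within (S \<inter> {..<t}))"
    using assms t unfolding cadlag_on_def by blast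
  then show "\<exists>l. ((\<lambda>t. h (f t) (g t)) \<longlongrightarrow> l) (at t within S \<inter> {..<t})"
    using bounded_bilinear.tendsto[OF assms(1)] by blast
qed

lemma cadlag_on_add:
  fixes f g :: "real \<Rightarrow> 'b::real_normed_vector"
  assumes "cadlag_on S f" "cadlag_on S g"
  shows "cadlag_on S (\<lambda>t. f t + g t)"
  unfolding cadlag_on_def
proof (intro ballI conjI)
  fix t assume t: "t \<in> S"
  show "((\<lambda>t. f t + g t) \<longlongrightarrow> f t + g t) (at t within S \<inter> {t..})"
    using assms t unfolding cadlag_on_def by (auto intro: tendsto_add)
  obtain l1 l2 where "(f \<longlongrightarrow> l1) (at t within (S \<inter> {..<t}))" "(g \<longlongrightarrow> l2) (at t within (S \<inter> {..<t}))"
    using assms t unfolding cadlag_on_def by blast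
  then show "\<exists>l. ((\<lambda>t. f t + g t) \<longlongrightarrow> l) (at t within S \<inter> {..<t})"
    using tendsto_add by blast
qed

lemma cadlag_on_diff:
  fixes f g :: "real \<Rightarrow> 'b::real_normed_vector"
  assumes "cadlag_on S f" "cadlag_on S g"
  shows "cadlag_on S (\<lambda>t. f t - g t)"
  unfolding cadlag_on_def
proof (intro ballI conjI)
  fix t assume t: "t \<in> S"
  show "((\<lambda>t. f t - g t) \<longlongrightarrow> f t - g t) (at t within S \<inter> {t..})"
    using assms t unfolding cadlag_on_def by (auto intro: tendsto_diff)
  obtain l1 l2 where "(f \<longlongrightarrow> l1) (at t within (S \<inter> {..<t}))" "(g \<longlongrightarrow> l2) (at t within (S \<inter> {..<t}))"
    using assms t unfolding cadlag_on_def by blast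
  then show "\<exists>l. ((\<lambda>t. f t - g t) \<longlongrightarrow> l) (at t within S \<inter> {..<t})"
    using tendsto_diff by blast
qed

lemma cadlag_on_const: "cadlag_on S (\<lambda>t. c)"
  by (simp add: continuous_imp_cadlag_on)

lemma cadlag_on_tendsto_right:
  assumes "cadlag_on S f" "t \<in> S" "\<And>k. h k \<in> S" "\<And>k. t \<le> h k" "h \<longlonglongrightarrow> t"
  shows "(\<lambda>k. f (h k)) \<longlonglongrightarrow> f t"
proof -
  have "(f \<longlongrightarrow> f t) (at t within (S \<inter> {t..}))" using assms unfolding cadlag_on_def by auto
  then have "continuous (at t within (S \<inter> {t..})) f"
    by (simp add: continuous_within)
  then show ?thesis
    using assms unfolding continuous_within_sequentially o_def by auto
qed

text \<open>Right continuity makes \<open>f\<close> the pointwise limit of its compositions with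
  rounding up, each of which takes only countably many values.\<close>

lemma cadlag_on_borel:
  fixes f :: "real \<Rightarrow> 'b::metric_space"
  assumes cad: "cadlag_on {a..b} f"
  shows "f \<in> borel_measurable (restrict_space borel {a..b})"
proof (cases "a \<le> b")
  case False then show ?thesis by (simp add: measurable_restrict_space1 space_restrict_space measurable_def)
next
  case True
  \<comment> \<open>Rounding up to the mesh \<open>1 / (k + 1)\<close>, so that \<open>t\<close> is
    approached from the right; the clipping lets \<open>b\<close> approximate itself.\<close>
  define h where "h k t = max a (min b ((real_of_int \<lfloor>t * real (Suc k)\<rfloor> + 1) / real (Suc k)))" for k :: nat and t :: real
  show ?thesis
  proof (rule borel_measurable_LIMSEQ_metric)
    fix k
    have "(\<lambda>t. f (max a (min b ((real_of_int \<lfloor>t * real (Suc k)\<rfloor> + 1) / real (Suc k))))) \<in> borel_measurable borel"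
      by measurable
    then show "(\<lambda>t. f (h k t)) \<in> borel_measurable (restrict_space borel {a..b})"
      unfolding h_def by (rule measurable_restrict_space1)
  next
    fix t assume "t \<in> space (restrict_space borel {a..b})"
    then have t: "a \<le> t" "t \<le> b" by (auto simp: space_restrict_space)
    have up: "t \<le> (real_of_int \<lfloor>t * real (Suc k)\<rfloor> + 1) / real (Suc k)" for k
      by (subst pos_le_divide_eq) (simp_all del: of_nat_Suc, linarith?)
    have dn: "(real_of_int \<lfloor>t * real (Suc k)\<rfloor> + 1) / real (Suc k) \<le> t + 1 / real (Suc k)" for k
    proof -
      have "(real_of_int \<lfloor>t * real (Suc k)\<rfloor> + 1) / real (Suc k) \<le> (t * real (Suc k) + 1) / real (Suc k)"
        by (intro divide_right_mono) auto
      also have "\<dots> = t + 1 / real (Suc k)" by (simp add: add_divide_distrib del: of_nat_Suc)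
      finally show ?thesis .
    qed
    show "(\<lambda>k. f (h k t)) \<longlonglongrightarrow> f t"
    proof (rule cadlag_on_tendsto_right[OF cad])
      show "t \<in> {a..b}" using t by simp
      show "h k t \<in> {a..b}" for k unfolding h_def using True by auto
      show le: "t \<le> h k t" for k unfolding h_def using up[of k] t by (auto simp: max_def min_def)
      have le2: "h k t \<le> t + 1 / real (Suc k)" for k
        unfolding h_def using dn[of k] t
        by (smt (verit) divide_nonneg_nonneg of_nat_0_le_iff)
      have "(\<lambda>k. t + 1 / real (Suc k)) \<longlonglongrightarrow> t + 0"
        by (intro tendsto_intros LIMSEQ_Suc[OF lim_1_over_n])
      then show "(\<lambda>k. h k t) \<longlonglongrightarrow> t"
        using le le2 by (intro tendsto_sandwich[of "\<lambda>_. t" "\<lambda>k. h k t" sequentially "\<lambda>k. t + 1 / real (Suc k)"]) auto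
    qed
  qed
qed

text \<open>Near each \<open>t\<close> the values lie within 1 of the left limit or of
  \<open>f t\<close>; by compactness finitely many such neighbourhoods cover the interval.\<close>

lemma cadlag_on_bounded:
  fixes f :: "real \<Rightarrow> 'b::metric_space"
  assumes cad: "cadlag_on {a..b} f"
  shows "bounded (f ` {a..b})"
proof -
  have loc: "\<exists>e>0. bounded (f ` ({a..b} \<inter> ball t e))" if t: "t \<in> {a..b}" for t
  proof -
    obtain l where l: "(f \<longlongrightarrow> l) (at t within ({a..b} \<inter> {..<t}))"
      and r: "(f \<longlongrightarrow> f t) (at t within ({a..b} \<inter> {t..}))"
      using cad t unfolding cadlag_on_def by blast
    obtain d1 where d1: "d1 > 0" "\<And>x. x \<in> {a..b} \<inter> {..<t} \<Longrightarrow> 0 < dist x t \<Longrightarrow> dist x t < d1 \<Longrightarrow> dist (f x) l < 1"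
      using l unfolding Lim_within by (metis zero_less_one)
    obtain d2 where d2: "d2 > 0" "\<And>x. x \<in> {a..b} \<inter> {t..} \<Longrightarrow> 0 < dist x t \<Longrightarrow> dist x t < d2 \<Longrightarrow> dist (f x) (f t) < 1"
      using r unfolding Lim_within by (metis zero_less_one)
    have "f ` ({a..b} \<inter> ball t (min d1 d2)) \<subseteq> ball l 1 \<union> ball (f t) 1"
    proof
      fix y assume "y \<in> f ` ({a..b} \<inter> ball t (min d1 d2))"
      then obtain x where x: "y = f x" "a \<le> x" "x \<le> b" "dist x t < d1" "dist x t < d2"
        by (auto simp: dist_commute)
      consider "x = t" | "x < t" | "x > t" by linarith
      then have "dist y l < 1 \<or> dist y (f t) < 1"
        by cases (use d1(2)[of x] d2(2)[of x] x in auto)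
      then show "y \<in> ball l 1 \<union> ball (f t) 1" by (auto simp: dist_commute)
    qed
    then have "bounded (f ` ({a..b} \<inter> ball t (min d1 d2)))"
      by (rule bounded_subset[rotated]) auto
    then show ?thesis using d1(1) d2(1) by (intro exI[of _ "min d1 d2"]) auto
  qed
  then obtain e where e: "\<And>t. t \<in> {a..b} \<Longrightarrow> e t > 0 \<and> bounded (f ` ({a..b} \<inter> ball t (e t)))"
    by metis
  obtain C where C: "C \<subseteq> {a..b}" "finite C" "{a..b} \<subseteq> (\<Union>t\<in>C. ball t (e t))"
    by (rule compactE_image[of "{a..b}" "{a..b}" "\<lambda>t. ball t (e t)"]) (use e in \<open>auto intro: bexI centre_in_ball[THEN iffD2]\<close>)
  have "f ` {a..b} \<subseteq> (\<Union>t\<in>C. f ` ({a..b} \<inter> ball t (e t)))" using C(3) by blast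
  moreover have "bounded (\<Union>t\<in>C. f ` ({a..b} \<inter> ball t (e t)))"
    using C e by (intro bounded_UN) auto
  ultimately show ?thesis using bounded_subset by blast
qed

lemma caratheodory_borel:
  fixes B :: "real \<Rightarrow> 'a::euclidean_space \<Rightarrow> 'b::euclidean_space"
  assumes B: "(\<lambda>(t, x). B t x) \<in> borel_measurable (restrict_space borel ({0..T} \<times> UNIV))"
    and z: "z \<in> borel_measurable (restrict_space borel {s..t})" and "0 \<le> s" "t \<le> T"
  shows "(\<lambda>r. B r (z r)) \<in> borel_measurable (restrict_space borel {s..t})"
proof -
  have "(\<lambda>r. (r, z r)) \<in> borel_measurable (restrict_space borel {s..t})"
    by (rule borel_measurable_Pair) (use z in \<open>auto intro: measurable_restrict_space1\<close>)
  then have "(\<lambda>r. (r, z r)) \<in> measurable (restrict_space borel {s..t}) (restrict_space borel ({0..T} \<times> UNIV))"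
    by (rule measurable_restrict_space2[rotated]) (use assms in \<open>auto simp: space_restrict_space\<close>)
  from measurable_compose[OF this B] show ?thesis by simp
qed

lemma bounded_set_integrable:
  fixes g :: "real \<Rightarrow> 'b::euclidean_space"
  assumes g: "g \<in> borel_measurable (restrict_space borel {s..t})" and "\<And>r. r \<in> {s..t} \<Longrightarrow> norm (g r) \<le> K"
  shows "set_integrable lborel {s..t} g"
proof -
  have m: "(\<lambda>x. indicator {s..t} x *\<^sub>R g x) \<in> borel_measurable borel"
    using g by (subst (asm) borel_measurable_restrict_space_iff) auto
  have "set_integrable lborel {s..t} (\<lambda>_. K)"
    unfolding set_integrable_def by (intro integrable_scaleR_left integrable_real_indicator) (auto simp: emeasure_lborel_Icc_eq)
  then show ?thesis
  proof (rule set_integrable_bound)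
    show "set_borel_measurable lborel {s..t} g" using m by (simp add: set_borel_measurable_def)
    show "AE x\<in>{s..t} in lborel. norm (g x) \<le> norm K"
      using assms(2) by (intro AE_I2 impI) (metis abs_ge_self order_trans real_norm_def)
  qed
qed

lemma set_integral_singleton:
  fixes g :: "real \<Rightarrow> 'b::euclidean_space"
  shows "(LINT r:{a..a}|lborel. g r) = 0"
  unfolding set_lebesgue_integral_def
proof (rule integral_eq_zero_AE)
  show "AE r in lborel. indicat_real {a..a} r *\<^sub>R g r = 0"
    using AE_lborel_singleton[of a] by eventually_elim auto
qed

lemma set_integral_split:
  fixes g :: "real \<Rightarrow> 'b::euclidean_space"
  assumes "set_integrable lborel {s..t} g" "s \<le> u" "u \<le> t"
  shows "(LINT r:{s..t}|lborel. g r) = (LINT r:{s..u}|lborel. g r) + (LINT r:{u..t}|lborel. g r)"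
proof -
  have i: "set_integrable lborel {s..u} g" "set_integrable lborel {u..t} g"
    using set_integrable_subset[OF assms(1)] assms by auto
  show ?thesis
    unfolding set_borel_integral_eq_integral(2)[OF assms(1)] set_borel_integral_eq_integral(2)[OF i(1)] set_borel_integral_eq_integral(2)[OF i(2)]
    by (rule Henstock_Kurzweil_Integration.integral_combine[symmetric]) (use assms set_borel_integral_eq_integral(1) in auto)
qed

lemma set_integral_bound:
  fixes g :: "real \<Rightarrow> 'b::euclidean_space"
  assumes "set_integrable lborel {s..t} g" "s \<le> t" "\<And>r. r \<in> {s..t} \<Longrightarrow> norm (g r) \<le> K"
  shows "norm (LINT r:{s..t}|lborel. g r) \<le> K * (t - s)"
proof -
  have "0 \<le> K" using assms(2) assms(3)[of s] norm_ge_zero order_trans by (metis atLeastAtMost_iff order_refl)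
  then have "norm (integral {s..t} g) \<le> K * Henstock_Kurzweil_Integration.content {s..t}"
    using assms set_borel_integral_eq_integral(1)[OF assms(1)]
    by (intro has_integral_bound_real[where f=g and S="{}"]) (auto simp: integrable_integral)
  then show ?thesis
    unfolding set_borel_integral_eq_integral(2)[OF assms(1)] using assms(2) by simp
qed

lemma set_integral_indefinite_continuous:
  fixes g :: "real \<Rightarrow> 'b::euclidean_space"
  assumes "g \<in> borel_measurable (restrict_space borel {a..b})" "\<And>r. r \<in> {a..b} \<Longrightarrow> norm (g r) \<le> K"
  shows "continuous_on {a..b} (\<lambda>t. LINT r:{a..t}|lborel. g r)"
proof -
  have i: "set_integrable lborel {a..b} g" by (rule bounded_set_integrable[OF assms])
  have "continuous_on {a..b} (\<lambda>t. integral {a..t} g)"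
    by (rule indefinite_integral_continuous_1[OF set_borel_integral_eq_integral(1)[OF i]])
  then show ?thesis
  proof (rule continuous_on_cong[THEN iffD1, rotated -1, OF _ refl])
    fix t assume "t \<in> {a..b}"
    then have "set_integrable lborel {a..t} g" by (intro set_integrable_subset[OF i]) auto
    then show "integral {a..t} g = (LINT r:{a..t}|lborel. g r)"
      by (simp add: set_borel_integral_eq_integral(2))
  qed
qed

text \<open>A countable set that approaches every point of the interval from the right, so that it
  determines a cadlag path and suprema over it are measurable. The point \<open>b\<close> is added
  because nothing in the interval lies to its right.\<close>

definition right_dense :: "real \<Rightarrow> real \<Rightarrow> real set" where
  "right_dense a b = ({a..b} \<inter> \<rat>) \<union> {b}"

lemma countable_right_dense: "countable (right_dense a b)"
  unfolding right_dense_def by (intro countable_Un countable_Int2 countable_rat) auto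

lemma right_dense_tendsto:
  assumes "t \<in> {a..b}"
  obtains h where "\<And>k. h k \<in> right_dense a b" "\<And>k. t \<le> h k" "h \<longlonglongrightarrow> t"
proof (cases "t = b")
  case True then show ?thesis using that[of "\<lambda>_. b"] by (auto simp: right_dense_def)
next
  case False
  then have tb: "t < b" using assms by auto
  have "\<exists>q\<in>\<rat>. t < q \<and> q < min b (t + 1 / real (Suc k))" for k
    by (rule Rats_dense_in_real) (use tb in auto)
  then obtain q where q: "\<And>k. q k \<in> \<rat> \<and> t < q k \<and> q k < min b (t + 1 / real (Suc k))" by metis
  have "(\<lambda>k. t + 1 / real (Suc k)) \<longlonglongrightarrow> t + 0" by (intro tendsto_intros LIMSEQ_Suc[OF lim_1_over_n])
  then have "(\<lambda>k. t + 1 / real (Suc k)) \<longlonglongrightarrow> t" by simp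
  then have "q \<longlonglongrightarrow> t"
    using q by (intro tendsto_sandwich[of "\<lambda>_. t" q sequentially "\<lambda>k. t + 1 / real (Suc k)"]) (auto intro!: always_eventually less_imp_le)
  moreover have "q k \<in> right_dense a b" "t \<le> q k" for k
    using q[of k] assms by (auto simp: right_dense_def)
  ultimately show ?thesis using that[of q] by blast
qed

lemma right_dense_subset: "a \<le> b \<Longrightarrow> right_dense a b \<subseteq> {a..b}"
  by (auto simp: right_dense_def)

lemma cadlag_on_eqI:
  fixes f g :: "real \<Rightarrow> 'b::metric_space"
  assumes "cadlag_on {a..b} f" "cadlag_on {a..b} g" "\<And>t. t \<in> right_dense a b \<Longrightarrow> f t = g t" "t \<in> {a..b}"
  shows "f t = g t"
proof -
  obtain h where h: "\<And>k. h k \<in> right_dense a b" "\<And>k. t \<le> h k" "h \<longlonglongrightarrow> t"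
    by (rule right_dense_tendsto[OF assms(4)]) blast
  have ab: "h k \<in> {a..b}" for k using h(1)[of k] right_dense_subset[of a b] assms(4) by auto
  have "(\<lambda>k. f (h k)) \<longlonglongrightarrow> f t" "(\<lambda>k. g (h k)) \<longlonglongrightarrow> g t"
    using cadlag_on_tendsto_right assms ab h by blast+
  then show ?thesis using assms(3)[OF h(1)] LIMSEQ_unique by simp
qed

section \<open>Ordinary equations with bounded Hoelder drift\<close>

locale bounded_drift =
  fixes f :: "real \<Rightarrow> 'a::euclidean_space \<Rightarrow> 'a" and T K C \<beta> :: real
  assumes T_pos: "0 < T"
    and f_borel: "(\<lambda>(t, x). f t x) \<in> borel_measurable (restrict_space borel ({0..T} \<times> UNIV))"
    and f_bounded: "\<And>t x. t \<in> {0..T} \<Longrightarrow> norm (f t x) \<le> K"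
    and f_hoelder: "\<And>t x y. t \<in> {0..T} \<Longrightarrow> norm (f t x - f t y) \<le> C * norm (x - y) powr \<beta>"
    and C_nonneg: "0 \<le> C" and beta_pos: "0 < \<beta>"
begin

definition ode_sol :: "real \<Rightarrow> real \<Rightarrow> 'a \<Rightarrow> (real \<Rightarrow> 'a) \<Rightarrow> bool" where
  "ode_sol s u c z \<longleftrightarrow> continuous_on {s..u} z \<and>
     (\<forall>t\<in>{s..u}. z t = c + (LINT r:{s..t}|lborel. f r (z r)))"

lemma K_nonneg: "0 \<le> K"
  using f_bounded[of 0] T_pos norm_ge_zero order_trans by (metis atLeastAtMost_iff less_imp_le order_refl)

lemma drift_integrable:
  assumes "continuous_on {s..u} z" "0 \<le> s" "u \<le> T"
  shows "set_integrable lborel {s..u} (\<lambda>r. f r (z r))"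
proof (rule bounded_set_integrable)
  show "(\<lambda>r. f r (z r)) \<in> borel_measurable (restrict_space borel {s..u})"
    by (rule caratheodory_borel[OF f_borel]) (use assms borel_measurable_continuous_on_restrict in auto)
  show "norm (f r (z r)) \<le> K" if "r \<in> {s..u}" for r
    using f_bounded that assms by auto
qed

lemma ode_sol_increment:
  assumes z: "ode_sol s u c z" and "0 \<le> s" "u \<le> T" "s \<le> t" "t \<le> t'" "t' \<le> u"
  shows "z t' = z t + (LINT r:{t..t'}|lborel. f r (z r))"
    "norm (z t' - z t) \<le> K * (t' - t)"
proof -
  have c: "continuous_on {s..u} z" using z by (simp add: ode_sol_def)
  have i: "set_integrable lborel {s..t'} (\<lambda>r. f r (z r))"
    by (rule drift_integrable) (use assms continuous_on_subset[OF c] in auto)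
  show e: "z t' = z t + (LINT r:{t..t'}|lborel. f r (z r))"
    using z set_integral_split[OF i, of t] assms unfolding ode_sol_def by auto
  have "set_integrable lborel {t..t'} (\<lambda>r. f r (z r))"
    by (rule set_integrable_subset[OF i]) (use assms in auto)
  then show "norm (z t' - z t) \<le> K * (t' - t)"
    unfolding e add_diff_cancel_left'
    by (rule set_integral_bound) (use assms f_bounded in auto)
qed

lemma ode_sol_initial: "ode_sol s u c z \<Longrightarrow> s \<le> u \<Longrightarrow> z s = c"
  unfolding ode_sol_def using AE_lborel_singleton[of s]
  by (auto simp: set_lebesgue_integral_def intro!: integral_eq_zero_AE simp: indicator_def elim!: AE_mp)

lemma ode_sol_bound:
  assumes "ode_sol s u c z" "0 \<le> s" "u \<le> T" "s \<le> t" "t \<le> u"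
  shows "norm (z t - c) \<le> K * (t - s)"
  using ode_sol_increment(2)[OF assms(1,2,3), of s t] ode_sol_initial[OF assms(1)] assms by auto

lemma ode_sol_restrict:
  assumes z: "ode_sol s u c z" and "0 \<le> s" "u \<le> T" "s \<le> s'" "s' \<le> u" "u' \<le> u"
  shows "ode_sol s' u' (z s') z"
  unfolding ode_sol_def
proof (intro conjI ballI)
  show "continuous_on {s'..u'} z"
    using z assms unfolding ode_sol_def by (auto intro: continuous_on_subset)
  show "z t = z s' + (LINT r:{s'..t}|lborel. f r (z r))" if "t \<in> {s'..u'}" for t
    by (rule ode_sol_increment(1)[OF z]) (use assms that in auto)
qed

text \<open>Both solutions stay within \<open>K * (r - s)\<close> of \<open>c\<close>, so by the
  Hoelder condition their drifts differ by O((t - s)^beta), and integration gains one more power.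
  The total order \<open>1 + \<beta>\<close>, greater than one, is what Davie's argument rests
  on.\<close>

lemma ode_sol_close:
  assumes z: "ode_sol s u c z" and z': "ode_sol s u c z'" and "0 \<le> s" "u \<le> T" "s \<le> t" "t \<le> u"
  shows "norm (z t - z' t) \<le> C * (2 * K * (t - s)) powr \<beta> * (t - s)"
proof -
  have cz: "continuous_on {s..t} z" "continuous_on {s..t} z'"
    using z z' assms unfolding ode_sol_def by (auto intro: continuous_on_subset)
  have i: "set_integrable lborel {s..t} (\<lambda>r. f r (z r))" "set_integrable lborel {s..t} (\<lambda>r. f r (z' r))"
    using drift_integrable cz assms by auto
  have d: "norm (f r (z r) - f r (z' r)) \<le> C * (2 * K * (t - s)) powr \<beta>" if r: "r \<in> {s..t}" for r
  proof -
    have "norm (z r - z' r) \<le> norm (z r - c) + norm (z' r - c)"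
      using norm_triangle_ineq4[of "z r - c" "z' r - c"] by simp
    also have "\<dots> \<le> 2 * K * (r - s)"
      using ode_sol_bound[OF z, of r] ode_sol_bound[OF z', of r] assms r by auto
    also have "\<dots> \<le> 2 * K * (t - s)" using r K_nonneg by (intro mult_left_mono) auto
    finally have "norm (z r - z' r) powr \<beta> \<le> (2 * K * (t - s)) powr \<beta>"
      using beta_pos by (intro powr_mono2) auto
    then show ?thesis
      using f_hoelder[of r "z r" "z' r"] r assms C_nonneg
      by (smt (verit) atLeastAtMost_iff mult_left_mono)
  qed
  have "z t - z' t = (LINT r:{s..t}|lborel. f r (z r) - f r (z' r))"
    using z z' assms unfolding ode_sol_def set_integral_diff(2)[OF i] by auto
  then show ?thesis
    using set_integral_bound[OF set_integral_diff(1)[OF i] _ d] assms by simp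
qed

text \<open>Freezing a solution at \<open>c\<close> before time \<open>s\<close> keeps it
  \<open>K\<close>-Lipschitz. Solutions with different starting times thereby get the common domain
  \<open>{0..T}\<close> that Arzela-Ascoli needs.\<close>

lemma ode_sol_const_before:
  assumes z: "ode_sol s T c z" and "0 \<le> s" "s \<le> T" "0 \<le> t" "t \<le> t'" "t' \<le> T"
  shows "norm ((if t' < s then c else z t') - (if t < s then c else z t)) \<le> K * (t' - t)"
proof -
  consider "t' < s" | "t < s" "s \<le> t'" | "s \<le> t" by linarith
  then show ?thesis
  proof cases
    case 1 then show ?thesis using assms K_nonneg by auto
  next
    case 2
    then have "norm (z t' - c) \<le> K * (t' - s)" using ode_sol_bound[OF z] assms by auto
    also have "\<dots> \<le> K * (t' - t)" using 2 K_nonneg by (intro mult_left_mono) auto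
    finally show ?thesis using 2 by auto
  next
    case 3 then show ?thesis using ode_sol_increment(2)[OF z] assms by auto
  qed
qed

lemma ode_sol_compact:
  fixes s :: "nat \<Rightarrow> real" and c :: "nat \<Rightarrow> 'a"
  assumes sT: "\<And>k. 0 \<le> s k" "\<And>k. s k \<le> T" and s: "s \<longlonglongrightarrow> s0" and c: "c \<longlonglongrightarrow> c0"
    and z: "\<And>k. ode_sol (s k) T (c k) (z k)"
  obtains \<kappa> z0 where "strict_mono (\<kappa> :: nat \<Rightarrow> nat)" "ode_sol s0 T c0 z0"
    "uniform_limit {0..T} (\<lambda>k t. if t < s (\<kappa> k) then c (\<kappa> k) else z (\<kappa> k) t)
       (\<lambda>t. if t < s0 then c0 else z0 t) sequentially"
proof -
  define E where "E k t = (if t < s k then c k else z k t)" for k t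
  have lip: "norm (E k t - E k t') \<le> K * \<bar>t - t'\<bar>" if "t \<in> {0..T}" "t' \<in> {0..T}" for k t t'
    using ode_sol_const_before[OF z[of k], of t t'] ode_sol_const_before[OF z[of k], of t' t] sT[of k] that
    unfolding E_def by (cases "t \<le> t'") (auto simp: norm_minus_commute)
  obtain Mc where Mc: "\<And>k. norm (c k) \<le> Mc"
    using convergent_imp_Bseq[OF convergentI[OF c]] by (auto simp: Bseq_def)
  have bd: "norm (E k t) \<le> Mc + K * T" if "t \<in> {0..T}" for k t
  proof (cases "t < s k")
    case True then show ?thesis using Mc[of k] K_nonneg T_pos by (simp add: E_def) (smt (verit) mult_nonneg_nonneg)
  next
    case False
    then have "norm (z k t - c k) \<le> K * (t - s k)" using ode_sol_bound[OF z[of k], of t] sT[of k] that by auto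
    also have "\<dots> \<le> K * T" using K_nonneg that sT(1)[of k] by (intro mult_left_mono) auto
    finally show ?thesis using False Mc[of k] norm_triangle_sub[of "z k t" "c k"] by (simp add: E_def)
  qed
  have equi: "\<exists>d>0. \<forall>n y. y \<in> {0..T} \<and> norm (t - y) < d \<longrightarrow> norm (E n t - E n y) < e"
    if "t \<in> {0..T}" "0 < e" for t e
  proof (intro exI[of _ "e / (K + 1)"] conjI allI impI)
    show "0 < e / (K + 1)" using that K_nonneg by auto
    fix n y assume y: "y \<in> {0..T} \<and> norm (t - y) < e / (K + 1)"
    then have "(K + 1) * \<bar>t - y\<bar> < e" using K_nonneg by (simp add: pos_less_divide_eq mult.commute)
    moreover have "K * \<bar>t - y\<bar> \<le> (K + 1) * \<bar>t - y\<bar>" by (intro mult_right_mono) auto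
    ultimately show "norm (E n t - E n y) < e" using lip[of t y n] that y by linarith
  qed
  obtain g \<kappa> where g: "continuous_on {0..T} g" and \<kappa>: "strict_mono (\<kappa> :: nat \<Rightarrow> nat)"
    and lim: "\<And>e. 0 < e \<Longrightarrow> \<exists>N. \<forall>n x. n \<ge> N \<and> x \<in> {0..T} \<longrightarrow> norm (E (\<kappa> n) x - g x) < e"
    using Arzela_Ascoli[of "{0..T}" E, OF _ bd equi] by auto
  have ul: "uniform_limit {0..T} (\<lambda>k. E (\<kappa> k)) g sequentially"
    unfolding uniform_limit_iff eventually_sequentially dist_norm using lim by blast
  have pt: "(\<lambda>k. E (\<kappa> k) t) \<longlonglongrightarrow> g t" if "t \<in> {0..T}" for t
    using tendsto_uniform_limitI[OF ul that] .
  have s0: "0 \<le> s0" "s0 \<le> T" using LIMSEQ_le_const[OF s] LIMSEQ_le_const2[OF s] sT by blast+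
  have s\<kappa>: "(\<lambda>k. s (\<kappa> k)) \<longlonglongrightarrow> s0" and c\<kappa>: "(\<lambda>k. c (\<kappa> k)) \<longlonglongrightarrow> c0"
    using LIMSEQ_subseq_LIMSEQ[OF s \<kappa>] LIMSEQ_subseq_LIMSEQ[OF c \<kappa>] by (auto simp: o_def)
  have Econt: "continuous_on {0..T} (E k)" for k
  proof (rule continuous_on_iff[THEN iffD2], intro ballI allI impI)
    fix t and e :: real assume "t \<in> {0..T}" "e > 0"
    from equi[OF this] show "\<exists>d>0. \<forall>x'\<in>{0..T}. dist x' t < d \<longrightarrow> dist (E k x') (E k t) < e"
      by (metis dist_commute dist_norm)
  qed
  have ind_int: "integrable lborel (\<lambda>r. indicator {a..b} r *\<^sub>R f r (h r))"
    if "continuous_on {0..T} h" "0 \<le> a" "b \<le> T" for h a b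
    using drift_integrable[of a b h] that continuous_on_subset[OF that(1)] by (auto simp: set_integrable_def)
  have eq: "g t = c0 + (LINT r:{s0..t}|lborel. f r (g r))" if t: "t \<in> {0..T}" for t
  proof -
    have Eeq: "E k t = c k + (LINT r:{s k..t}|lborel. f r (E k r))" for k
    proof (cases "t < s k")
      case True then show ?thesis by (simp add: E_def set_lebesgue_integral_def)
    next
      case False
      then have "z k t = c k + (LINT r:{s k..t}|lborel. f r (z k r))"
        using z[of k] t by (auto simp: ode_sol_def)
      also have "(LINT r:{s k..t}|lborel. f r (z k r)) = (LINT r:{s k..t}|lborel. f r (E k r))"
        by (intro set_lebesgue_integral_cong) (auto simp: E_def)
      finally show ?thesis using False by (simp add: E_def)
    qed
    have "(\<lambda>k. LINT r:{s (\<kappa> k)..t}|lborel. f r (E (\<kappa> k) r)) \<longlonglongrightarrow> (LINT r:{s0..t}|lborel. f r (g r))"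
      unfolding set_lebesgue_integral_def
    proof (rule integral_dominated_convergence[where w="\<lambda>r. indicator {0..T} r *\<^sub>R K"])
      show "(\<lambda>r. indicat_real {s0..t} r *\<^sub>R f r (g r)) \<in> borel_measurable lborel"
        using ind_int[OF g s0(1), of t] t by auto
      show "(\<lambda>r. indicat_real {s (\<kappa> k)..t} r *\<^sub>R f r (E (\<kappa> k) r)) \<in> borel_measurable lborel" for k
        using ind_int[OF Econt sT(1), of t] t by auto
      show "integrable lborel (\<lambda>r. indicat_real {0..T} r *\<^sub>R K)"
        by (intro integrable_scaleR_left integrable_real_indicator) (auto simp: emeasure_lborel_Icc_eq)
      show "AE x in lborel. (\<lambda>k. indicat_real {s (\<kappa> k)..t} x *\<^sub>R f x (E (\<kappa> k) x)) \<longlonglongrightarrow> indicat_real {s0..t} x *\<^sub>R f x (g x)"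
      \<comment> \<open>At \<open>s0\<close> itself the indicators of
        \<open>{s (\<kappa> k)..t}\<close> need not converge, but one point is a null set.\<close>
      proof (rule AE_mp[OF AE_lborel_singleton[of s0]], intro AE_I2 impI)
        fix x assume x: "x \<noteq> s0"
        show "(\<lambda>k. indicat_real {s (\<kappa> k)..t} x *\<^sub>R f x (E (\<kappa> k) x)) \<longlonglongrightarrow> indicat_real {s0..t} x *\<^sub>R f x (g x)"
        proof (cases "0 \<le> x \<and> x \<le> t")
          case False
          then have "x \<notin> {s0..t}" "x \<notin> {s (\<kappa> k)..t}" for k using s0 sT(1)[of "\<kappa> k"] by auto
          then show ?thesis by simp
        next
          case True
          then have xT: "x \<in> {0..T}" using t by auto
          have "(\<lambda>k. norm (E (\<kappa> k) x - g x) powr \<beta>) \<longlonglongrightarrow> 0"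
            by (rule tendsto_zero_powrI[of _ _ _ \<beta>]) (use tendsto_norm_zero[OF LIM_zero[OF pt[OF xT]]] beta_pos in auto)
          then have "(\<lambda>k. C * norm (E (\<kappa> k) x - g x) powr \<beta>) \<longlonglongrightarrow> 0"
            by (rule tendsto_mult_right_zero)
          then have "(\<lambda>k. f x (E (\<kappa> k) x) - f x (g x)) \<longlonglongrightarrow> 0"
            by (rule Lim_null_comparison[rotated]) (rule always_eventually, use f_hoelder[OF xT] in blast)
          then have fl: "(\<lambda>k. f x (E (\<kappa> k) x)) \<longlonglongrightarrow> f x (g x)"
            by (rule LIM_zero_cancel)
          have "eventually (\<lambda>k. indicat_real {s (\<kappa> k)..t} x = indicat_real {s0..t} x) sequentially"
          proof (cases "x < s0")
            case True then show ?thesis using order_tendstoD(1)[OF s\<kappa> True] by (auto elim!: eventually_mono)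
          next
            case False
            then have "s0 < x" using x by auto
            from order_tendstoD(2)[OF s\<kappa> this] show ?thesis using \<open>s0 < x\<close> True by (auto elim!: eventually_mono)
          qed
          then have "(\<lambda>k. indicat_real {s (\<kappa> k)..t} x) \<longlonglongrightarrow> indicat_real {s0..t} x"
            by (rule tendsto_eventually)
          then show ?thesis using fl by (rule tendsto_scaleR)
        qed
      qed
      show "AE x in lborel. norm (indicat_real {s (\<kappa> k)..t} x *\<^sub>R f x (E (\<kappa> k) x)) \<le> indicat_real {0..T} x *\<^sub>R K" for k
        using sT(1)[of "\<kappa> k"] t f_bounded K_nonneg by (intro AE_I2) (auto simp: indicator_def)
    qed
    then have "(\<lambda>k. E (\<kappa> k) t) \<longlonglongrightarrow> c0 + (LINT r:{s0..t}|lborel. f r (g r))"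
      unfolding Eeq by (rule tendsto_add[OF c\<kappa>])
    then show ?thesis using pt[OF t] LIMSEQ_unique by blast
  qed
  have "ode_sol s0 T c0 g"
    unfolding ode_sol_def using continuous_on_subset[OF g] s0 eq by auto
  moreover have "uniform_limit {0..T} (\<lambda>k t. if t < s (\<kappa> k) then c (\<kappa> k) else z (\<kappa> k) t)
       (\<lambda>t. if t < s0 then c0 else g t) sequentially"
  proof (rule uniform_limit_cong'[THEN iffD2, OF _ _ ul])
    show "(if y < s (\<kappa> x) then c (\<kappa> x) else z (\<kappa> x) y) = E (\<kappa> x) y" if "y \<in> {0..T}" for x y
      by (simp add: E_def)
    show "(if y < s0 then c0 else g y) = g y" if "y \<in> {0..T}" for y
      using eq[OF that] by (simp add: set_lebesgue_integral_def)
  qed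
  ultimately show ?thesis using that[of \<kappa> g] \<kappa> by blast
qed

end

section \<open>Dyadic starting times and uniqueness for the ordinary equation\<close>

definition dyadic_grid :: "real \<Rightarrow> real set" where
  "dyadic_grid T = {T * real i / 2 ^ k | i k. i \<le> 2 ^ k}"

lemma dyadic_gridI: "i \<le> 2 ^ k \<Longrightarrow> T * real i / 2 ^ k \<in> dyadic_grid T"
  by (auto simp: dyadic_grid_def)

lemma dyadic_grid_bounds: 
  assumes "0 \<le> T" "s \<in> dyadic_grid T" shows "0 \<le> s" "s \<le> T"
proof -
  obtain i k where s: "s = T * real i / 2 ^ k" "i \<le> 2 ^ k" using assms unfolding dyadic_grid_def by auto
  have "real i \<le> 2 ^ k" using s(2) by (metis of_nat_le_iff of_nat_numeral of_nat_power)
  then show "0 \<le> s" "s \<le> T" using s assms(1) by (auto simp: divide_le_eq mult_left_mono)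
qed

lemma countable_dyadic_grid: "countable (dyadic_grid T)"
proof -
  have "dyadic_grid T \<subseteq> (\<lambda>(i, k). T * real i / 2 ^ k) ` (UNIV :: (nat \<times> nat) set)"
    by (auto simp: dyadic_grid_def)
  then show ?thesis by (rule countable_subset) auto
qed

definition grid_up :: "real \<Rightarrow> nat \<Rightarrow> real \<Rightarrow> nat" where
  "grid_up T k s = nat \<lceil>s * 2 ^ k / T\<rceil>"

lemma grid_up:
  assumes "0 < T" "0 \<le> s" "s \<le> T"
  shows "s \<le> T * real (grid_up T k s) / 2 ^ k" "T * real (grid_up T k s) / 2 ^ k \<le> s + T / 2 ^ k"
    "grid_up T k s \<le> 2 ^ k" "s \<le> T * real j / 2 ^ k \<Longrightarrow> grid_up T k s \<le> j"
proof -
  have nn: "0 \<le> \<lceil>s * 2 ^ k / T\<rceil>" using assms by (simp add: ceiling_mono zero_le_ceiling) (smt (verit) divide_nonneg_nonneg mult_nonneg_nonneg zero_le_power)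
  then have r: "real (grid_up T k s) = of_int \<lceil>s * 2 ^ k / T\<rceil>" by (simp add: grid_up_def)
  have "s * 2 ^ k / T \<le> real (grid_up T k s)" unfolding r by linarith
  then show "s \<le> T * real (grid_up T k s) / 2 ^ k" using assms by (simp add: field_simps)
  have "real (grid_up T k s) \<le> s * 2 ^ k / T + 1" unfolding r by linarith
  then show "T * real (grid_up T k s) / 2 ^ k \<le> s + T / 2 ^ k" using assms by (simp add: field_simps)
  show *: "grid_up T k s \<le> j" if "s \<le> T * real j / 2 ^ k" for j
  proof -
    have "s * 2 ^ k / T \<le> real j" using that assms by (simp add: field_simps)
    then show ?thesis unfolding grid_up_def by (simp add: ceiling_le_iff nat_le_iff)
  qed
  show "grid_up T k s \<le> 2 ^ k" by (rule *) (use assms in simp)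
qed

lemma grid_up_tendsto:
  assumes "0 < T" "0 \<le> s" "s \<le> T"
  shows "(\<lambda>k. T * real (grid_up T k s) / 2 ^ k) \<longlonglongrightarrow> s"
proof (rule tendsto_sandwich[of "\<lambda>_. s" _ _ "\<lambda>k. s + T / 2 ^ k"])
  have "(\<lambda>k. T * (1/2) ^ k) \<longlonglongrightarrow> T * 0" by (intro tendsto_intros LIMSEQ_realpow_zero) auto
  then have "(\<lambda>k. s + T * (1/2) ^ k) \<longlonglongrightarrow> s + 0" by (intro tendsto_intros) auto
  then show "(\<lambda>k. s + T / 2 ^ k) \<longlonglongrightarrow> s" by (simp add: power_one_over)
qed (use grid_up[OF assms] in auto)

text \<open>What one path of the noise has to provide for uniqueness. \<open>W s\<close> is the
  Hoelder constant of the flow started at \<open>s\<close>, up to a factor \<open>H\<close> that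
  depends only on the ball of starting points. \<open>W\<close> need not be bounded over the grid
  times: only its grid sums are controlled, by \<open>grid_sum\<close>.\<close>

locale grid_flow = bounded_drift +
  fixes \<Phi> :: "real \<Rightarrow> real \<Rightarrow> 'a \<Rightarrow> 'a" and W :: "real \<Rightarrow> real" and \<gamma> :: real
  assumes gamma_pos: "0 < \<gamma>"
    and W_nonneg: "\<And>s. 0 \<le> W s"
    and grid_sol: "\<And>s c. s \<in> dyadic_grid T \<Longrightarrow> ode_sol s T c (\<lambda>t. \<Phi> s t c)"
    and grid_flow: "\<And>s s' t c. \<lbrakk>s \<in> dyadic_grid T; s' \<in> dyadic_grid T; s < s'; s' \<le> t; t \<le> T\<rbrakk>
       \<Longrightarrow> \<Phi> s' t (\<Phi> s s' c) = \<Phi> s t c"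
    and grid_hoelder: "\<And>R. \<exists>H\<ge>0. \<forall>s\<in>dyadic_grid T. \<forall>t\<in>{s..T}. \<forall>c c'. norm c \<le> R \<longrightarrow> norm c' \<le> R \<longrightarrow>
       norm (\<Phi> s t c - \<Phi> s t c') \<le> H * W s * norm (c - c') powr \<gamma>"
    and grid_sum: "(\<lambda>k. (T / 2 ^ k) powr ((1 + \<beta>) * \<gamma>) * (\<Sum>i\<le>2 ^ k. W (T * real i / 2 ^ k))) \<longlonglongrightarrow> 0"
begin

lemma ode_sol_close_step:
  assumes z: "ode_sol s u c z" and z': "ode_sol s u c z'" and "0 \<le> s" "u \<le> T" "s \<le> t" "t \<le> u" "t - s \<le> h"
  shows "norm (z t - z' t) powr \<gamma> \<le> (C * (2 * K) powr \<beta>) powr \<gamma> * h powr ((1 + \<beta>) * \<gamma>)"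
proof (cases "h = 0")
  case True
  then have "t = s" using assms by auto
  then have "z t = z' t" using ode_sol_initial[OF z] ode_sol_initial[OF z'] assms by auto
  then show ?thesis using gamma_pos by simp
next
  case False
  then have h: "h > 0" using assms by auto
  have "norm (z t - z' t) \<le> C * (2 * K * (t - s)) powr \<beta> * (t - s)"
    by (rule ode_sol_close) (use assms in auto)
  also have "\<dots> \<le> C * (2 * K * h) powr \<beta> * h"
    using assms C_nonneg K_nonneg beta_pos
    by (intro mult_mono mult_left_mono powr_mono2 mult_nonneg_nonneg) auto
  also have "\<dots> = (C * (2 * K) powr \<beta>) * h powr (1 + \<beta>)"
    using h K_nonneg by (simp add: powr_mult powr_add)
  finally have "norm (z t - z' t) powr \<gamma> \<le> ((C * (2 * K) powr \<beta>) * h powr (1 + \<beta>)) powr \<gamma>"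
    using gamma_pos by (intro powr_mono2) auto
  also have "\<dots> = (C * (2 * K) powr \<beta>) powr \<gamma> * h powr ((1 + \<beta>) * \<gamma>)"
    using C_nonneg by (simp add: powr_mult powr_powr)
  finally show ?thesis .
qed

text \<open>Davie's telescoping argument: \<open>\<lambda>s. \<Phi> s t (z s)\<close> is nearly constant along the grid, because two
  solutions that agree at a grid point differ at the next one by \<open>O(h powr (1 + \<beta>))\<close>; condition
  \<open>grid_sum\<close> makes the accumulated error vanish as the mesh \<open>h\<close> tends to zero.\<close>

lemma grid_approx:
  fixes k :: nat
  defines "p \<equiv> (\<lambda>i. T * real i / 2 ^ k)"
  assumes z: "ode_sol s u c z" and "0 \<le> s" "u \<le> T" and R: "norm c + 2 * K * T \<le> R"
    and H: "0 \<le> H" "\<And>s t c c'. s \<in> dyadic_grid T \<Longrightarrow> t \<in> {s..T} \<Longrightarrow> norm c \<le> R \<Longrightarrow> norm c' \<le> R \<Longrightarrow>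
       norm (\<Phi> s t c - \<Phi> s t c') \<le> H * W s * norm (c - c') powr \<gamma>"
    and j: "j \<le> 2 ^ k" "p j \<le> u" and "i \<le> j" "s \<le> p i"
  shows "norm (\<Phi> (p i) (p j) (z (p i)) - z (p j))
     \<le> H * (C * (2 * K) powr \<beta>) powr \<gamma> * (T / 2 ^ k) powr ((1 + \<beta>) * \<gamma>) * (\<Sum>l\<in>{i<..j}. W (p l))"
  using \<open>i \<le> j\<close> \<open>s \<le> p i\<close>
\<comment> \<open>Downward induction from \<open>j\<close>. Passing from \<open>Suc i\<close> to
  \<open>i\<close> adds the error of the cell between \<open>p i\<close> and
  \<open>p (Suc i)\<close>, carried to \<open>p j\<close> by the flow at the price of the constant
  \<open>W (p (Suc i))\<close>.\<close>
proof (induction rule: inc_induct)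
  case base
  have "\<Phi> (p j) (p j) (z (p j)) = z (p j)"
    by (rule ode_sol_initial[OF grid_sol]) (use j(1) dyadic_gridI dyadic_grid_bounds[of T "p j"] T_pos in \<open>auto simp: p_def\<close>)
  then show ?case by simp
next
  case (step i)
  define D where "D = H * (C * (2 * K) powr \<beta>) powr \<gamma> * (T / 2 ^ k) powr ((1 + \<beta>) * \<gamma>)"
  have pm: "p a \<le> p b" if "a \<le> b" for a b
    using that T_pos unfolding p_def by (intro divide_right_mono mult_left_mono) auto
  have g: "p l \<in> dyadic_grid T" if "l \<le> j" for l
    using that j(1) unfolding p_def by (intro dyadic_gridI) auto
  have o: "s \<le> p i" "p i < p (Suc i)" "p (Suc i) \<le> p j" "p j \<le> T" "0 \<le> p i"
    using step pm[of "Suc i" j] pm[of i "Suc i"] j assms(3,4) T_pos unfolding p_def by (auto simp: divide_strict_right_mono)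
  have IH: "norm (\<Phi> (p (Suc i)) (p j) (z (p (Suc i))) - z (p j)) \<le> D * (\<Sum>l\<in>{Suc i<..j}. W (p l))"
    unfolding D_def using step.IH o by auto
  have zz: "ode_sol (p i) (p (Suc i)) (z (p i)) z"
    by (rule ode_sol_restrict[OF z]) (use assms o j in auto)
  have pp: "ode_sol (p i) (p (Suc i)) (z (p i)) (\<lambda>t. \<Phi> (p i) t (z (p i)))"
    using ode_sol_restrict[OF grid_sol[OF g[of i], of "z (p i)"], of "p i" "p (Suc i)"] o step.hyps
      ode_sol_initial[OF grid_sol[OF g[of i], of "z (p i)"]] by auto
  have nz: "norm (z t) \<le> norm c + K * T" if "s \<le> t" "t \<le> u" for t
  proof -
    have "norm (z t - c) \<le> K * (t - s)" using ode_sol_bound[OF z] assms that by auto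
    also have "\<dots> \<le> K * T" using K_nonneg that assms by (intro mult_left_mono) auto
    finally show ?thesis using norm_triangle_sub[of "z t" c] by simp
  qed
  have KT: "0 \<le> K * T" using K_nonneg T_pos by simp
  have "norm (\<Phi> (p i) (p (Suc i)) (z (p i)) - z (p i)) \<le> K * (p (Suc i) - p i)"
    using ode_sol_bound[OF pp, of "p (Suc i)"] o by auto
  also have "\<dots> \<le> K * T" using o K_nonneg by (intro mult_left_mono) auto
  finally have "norm (\<Phi> (p i) (p (Suc i)) (z (p i))) \<le> norm (z (p i)) + K * T"
    using norm_triangle_sub[of "\<Phi> (p i) (p (Suc i)) (z (p i))" "z (p i)"] by simp
  \<comment> \<open>One \<open>K * T\<close> bounds the motion of \<open>z\<close>, a second one the
    step of \<open>\<Phi>\<close> that starts on \<open>z\<close>: hence \<open>2 * K * T\<close> in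
    the condition on \<open>R\<close>.\<close>
  then have nR: "norm (\<Phi> (p i) (p (Suc i)) (z (p i))) \<le> R" "norm (z (p (Suc i))) \<le> R"
    using nz[of "p i"] nz[of "p (Suc i)"] R o j KT by auto
  have "norm (\<Phi> (p (Suc i)) (p j) (\<Phi> (p i) (p (Suc i)) (z (p i))) - \<Phi> (p (Suc i)) (p j) (z (p (Suc i))))
     \<le> H * W (p (Suc i)) * norm (\<Phi> (p i) (p (Suc i)) (z (p i)) - z (p (Suc i))) powr \<gamma>"
    by (rule H(2)) (use g[of "Suc i"] step.hyps o nR in auto)
  also have "\<dots> \<le> H * W (p (Suc i)) * ((C * (2 * K) powr \<beta>) powr \<gamma> * (T / 2 ^ k) powr ((1 + \<beta>) * \<gamma>))"
  proof (intro mult_left_mono ode_sol_close_step[OF pp zz])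
    show "p (Suc i) - p i \<le> T / 2 ^ k" unfolding p_def by (simp add: field_simps)
  qed (use o H W_nonneg in auto)
  also have "\<dots> = D * W (p (Suc i))" by (simp add: D_def)
  also have "\<Phi> (p (Suc i)) (p j) (\<Phi> (p i) (p (Suc i)) (z (p i))) = \<Phi> (p i) (p j) (z (p i))"
    by (rule grid_flow) (use g[of i] g[of "Suc i"] step.hyps o in auto)
  finally have "norm (\<Phi> (p i) (p j) (z (p i)) - z (p j)) \<le> D * W (p (Suc i)) + D * (\<Sum>l\<in>{Suc i<..j}. W (p l))"
    using IH norm_triangle_ineq[of "\<Phi> (p i) (p j) (z (p i)) - \<Phi> (p (Suc i)) (p j) (z (p (Suc i)))" "\<Phi> (p (Suc i)) (p j) (z (p (Suc i))) - z (p j)"]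
    by simp
  also have "\<dots> = D * (\<Sum>l\<in>{i<..j}. W (p l))"
  proof -
    have "{i<..j} = insert (Suc i) {Suc i<..j}" using step.hyps by auto
    then show ?thesis by (simp add: distrib_left)
  qed
  finally show ?case unfolding D_def .
qed

lemma unique_on_grid:
  assumes z: "ode_sol s u c z" and z': "ode_sol s u c z'" and s: "0 \<le> s" "u \<le> T"
    and t: "t \<in> dyadic_grid T" "s \<le> t" "t \<le> u"
  shows "z t = z' t"
proof -
  define R where "R = norm c + 2 * K * T"
  obtain H where H: "0 \<le> H" "\<And>s t c c'. s \<in> dyadic_grid T \<Longrightarrow> t \<in> {s..T} \<Longrightarrow> norm c \<le> R \<Longrightarrow> norm c' \<le> R \<Longrightarrow>
       norm (\<Phi> s t c - \<Phi> s t c') \<le> H * W s * norm (c - c') powr \<gamma>"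
    using grid_hoelder[of R] by blast
  obtain j0 k0 where jk: "t = T * real j0 / 2 ^ k0" "j0 \<le> 2 ^ k0"
    using t unfolding dyadic_grid_def by auto
  define S where "S k = (T / 2 ^ k) powr ((1 + \<beta>) * \<gamma>) * (\<Sum>i\<le>2 ^ k. W (T * real i / 2 ^ k))" for k :: nat
  define D where "D = H * (C * (2 * K) powr \<beta>) powr \<gamma>"
  have D: "0 \<le> D" using H by (simp add: D_def)
  \<comment> \<open>Three errors of the same size: the gap between \<open>z\<close> and
    \<open>z'\<close> at the first grid point \<open>p i\<close> after \<open>s\<close>, carried to
    \<open>t\<close> by the flow, and the two telescoping errors of \<open>z\<close> and of
    \<open>z'\<close> between \<open>p i\<close> and \<open>t\<close>. For \<open>k \<ge> k0\<close>
    the time \<open>t\<close> is itself a grid point \<open>p j\<close>.\<close>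
  have est: "norm (z t - z' t) \<le> 3 * D * S k" if k: "k \<ge> k0" for k
  proof -
    define p where "p = (\<lambda>i. T * real i / 2 ^ k)"
    define j where "j = j0 * 2 ^ (k - k0)"
    define i where "i = grid_up T k s"
    have "(2::real) ^ k = 2 ^ k0 * 2 ^ (k - k0)" using k by (metis le_add_diff_inverse power_add)
    then have j: "t = p j" unfolding jk p_def j_def by (simp add: field_simps)
    have "j \<le> 2 ^ k0 * 2 ^ (k - k0)" using jk(2) unfolding j_def by (rule mult_le_mono1)
    also have "\<dots> = 2 ^ k" using k by (simp flip: power_add)
    finally have j2: "j \<le> 2 ^ k" .
    have sT: "s \<le> T" using t s by auto
    note gu = grid_up[OF T_pos s(1) sT, where k=k, folded i_def p_def]
    have i: "s \<le> p i" "p i \<le> s + T / 2 ^ k" "i \<le> j" "i \<le> 2 ^ k"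
      using gu(4)[of j] gu(1-3) t(2) j by (auto simp: p_def)
    have pij: "p i \<le> p j" using i T_pos unfolding p_def by (intro divide_right_mono mult_left_mono) auto
    have gi: "p i \<in> dyadic_grid T" using i(4) unfolding p_def by (rule dyadic_gridI)
    have sub: "(\<Sum>l\<in>{i<..j}. W (p l)) \<le> (\<Sum>l\<le>2 ^ k. W (p l))" "W (p i) \<le> (\<Sum>l\<le>2 ^ k. W (p l))"
      using W_nonneg j2 i by (auto intro!: sum_mono2 member_le_sum)
    have ap: "norm (\<Phi> (p i) (p j) (y (p i)) - y (p j)) \<le> D * S k" if y: "ode_sol s u c y" for y
    proof -
      have "norm (\<Phi> (p i) (p j) (y (p i)) - y (p j)) \<le> D * (T / 2 ^ k) powr ((1 + \<beta>) * \<gamma>) * (\<Sum>l\<in>{i<..j}. W (p l))"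
        unfolding p_def D_def by (rule grid_approx[OF y s _ H]) (use j2 t i j in \<open>auto simp: p_def R_def\<close>)
      also have "\<dots> \<le> D * (T / 2 ^ k) powr ((1 + \<beta>) * \<gamma>) * (\<Sum>l\<le>2 ^ k. W (p l))"
        using D sub by (intro mult_left_mono) auto
      finally show ?thesis by (simp add: S_def p_def mult.assoc)
    qed
    have nz: "norm (y (p i)) \<le> R" if y: "ode_sol s u c y" for y
    proof -
      have pu: "p i \<le> u" using pij t(3) j by simp
      have "norm (y (p i) - c) \<le> K * (p i - s)" by (rule ode_sol_bound[OF y s i(1) pu])
      also have "\<dots> \<le> K * T" using K_nonneg s i(1) pu by (intro mult_left_mono) linarith+
      finally have "norm (y (p i)) \<le> norm c + K * T" using norm_triangle_sub[of "y (p i)" c] by linarith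
      moreover have "0 \<le> K * T" using K_nonneg T_pos by simp
      ultimately show ?thesis unfolding R_def by linarith
    qed
    have "norm (\<Phi> (p i) (p j) (z (p i)) - \<Phi> (p i) (p j) (z' (p i))) \<le> H * W (p i) * norm (z (p i) - z' (p i)) powr \<gamma>"
      by (rule H(2)[OF gi _ nz[OF z] nz[OF z']]) (use pij t(3) s(2) j in simp)
    also have "\<dots> \<le> H * W (p i) * ((C * (2 * K) powr \<beta>) powr \<gamma> * (T / 2 ^ k) powr ((1 + \<beta>) * \<gamma>))"
      by (intro mult_left_mono ode_sol_close_step[OF z z' s]) (use i(1,2) pij t(3) j H(1) W_nonneg in simp_all)
    also have "\<dots> = D * (T / 2 ^ k) powr ((1 + \<beta>) * \<gamma>) * W (p i)" by (simp add: D_def)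
    also have "\<dots> \<le> D * (T / 2 ^ k) powr ((1 + \<beta>) * \<gamma>) * (\<Sum>l\<le>2 ^ k. W (p l))"
        using D sub by (intro mult_left_mono) auto
    also have "\<dots> = D * S k" by (simp add: S_def p_def mult.assoc)
    finally have "norm (\<Phi> (p i) (p j) (z (p i)) - \<Phi> (p i) (p j) (z' (p i))) \<le> D * S k" .
    then show ?thesis using ap[OF z] ap[OF z']
        norm_triangle_ineq[of "z t - \<Phi> (p i) (p j) (z (p i))" "\<Phi> (p i) (p j) (z (p i)) - z' t"]
        norm_triangle_ineq[of "\<Phi> (p i) (p j) (z (p i)) - \<Phi> (p i) (p j) (z' (p i))" "\<Phi> (p i) (p j) (z' (p i)) - z' t"]
      unfolding j by (simp add: norm_minus_commute)
  qed
  have "(\<lambda>k. 3 * D * S k) \<longlonglongrightarrow> 3 * D * 0"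
    using grid_sum unfolding S_def by (intro tendsto_intros)
  then have "norm (z t - z' t) \<le> 0"
    by (intro LIMSEQ_le_const) (use est in auto)
  then show ?thesis by simp
qed

lemma ode_sol_unique:
  assumes z: "ode_sol s u c z" and z': "ode_sol s u c z'" and s: "0 \<le> s" "u \<le> T"
    and t: "s \<le> t" "t \<le> u"
  shows "z t = z' t"
proof (cases "t = s")
  case True then show ?thesis using ode_sol_initial[OF z] ode_sol_initial[OF z'] t by auto
next
  case False
  then have st: "s < t" using t by auto
  \<comment> \<open>Rounding \<open>t\<close> down to the grid is done by rounding
    \<open>T - t\<close> up.\<close>
  define q where "q k = T - T * real (grid_up T k (T - t)) / 2 ^ k" for k
  have Tt: "0 \<le> T - t" "T - t \<le> T" using s t by auto
  have "(\<lambda>k. T - T * real (grid_up T k (T - t)) / 2 ^ k) \<longlonglongrightarrow> T - (T - t)"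
    by (intro tendsto_intros grid_up_tendsto T_pos Tt)
  then have q: "q \<longlonglongrightarrow> t" by (simp add: q_def[abs_def])
  have qt: "q k \<le> t" for k using grid_up(1)[OF T_pos Tt, of k] by (simp add: q_def)
  have qg: "q k \<in> dyadic_grid T" for k
  proof -
    have g: "grid_up T k (T - t) \<le> 2 ^ k" using grid_up(3)[OF T_pos Tt] .
    then have "q k = T * real (2 ^ k - grid_up T k (T - t)) / 2 ^ k"
      by (simp add: q_def of_nat_diff field_simps)
    then show ?thesis using dyadic_gridI[of "2 ^ k - grid_up T k (T - t)" k T] by simp
  qed
  \<comment> \<open>The finitely many \<open>q k\<close> below \<open>s\<close> are replaced by
    \<open>t\<close>, so that the sequence stays in the domain of the two solutions.\<close>
  define q' where "q' k = (if s \<le> q k then q k else t)" for k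
  have ev: "eventually (\<lambda>k. q' k = q k) sequentially"
    using order_tendstoD(1)[OF q st] by eventually_elim (auto simp: q'_def)
  have "q' \<longlonglongrightarrow> t" using q tendsto_cong[OF ev] by simp
  moreover have q's: "q' k \<in> {s..u}" for k using qt[of k] t by (auto simp: q'_def)
  ultimately have *: "(\<lambda>k. y (q' k)) \<longlonglongrightarrow> y t" if "continuous_on {s..u} y" for y :: "real \<Rightarrow> 'a"
    using that t unfolding continuous_on_sequentially by (auto simp: o_def)
  have "(\<lambda>k. z (q' k)) \<longlonglongrightarrow> z t" "(\<lambda>k. z' (q' k)) \<longlonglongrightarrow> z' t"
    using * z z' by (auto simp: ode_sol_def)
  moreover have "eventually (\<lambda>k. z (q' k) = z' (q' k)) sequentially"
    using ev
  proof eventually_elim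
    case (elim k)
    then show ?case using unique_on_grid[OF z z' s qg[of k]] q's[of k] by auto
  qed
  ultimately show ?thesis using LIMSEQ_unique[of "\<lambda>k. z' (q' k)" "z t" "z' t"] tendsto_cong[of "\<lambda>k. z (q' k)" "\<lambda>k. z' (q' k)"] by blast
qed

lemma ode_sol_exists:
  assumes "0 \<le> s" "s \<le> T" shows "\<exists>z. ode_sol s T c z"
proof -
  define q where "q k = T * real (grid_up T k s) / 2 ^ k" for k
  have g: "q k \<in> dyadic_grid T" for k using grid_up(3)[OF T_pos assms] unfolding q_def by (rule dyadic_gridI)
  show ?thesis
  proof (rule ode_sol_compact[of q s "\<lambda>_. c" c "\<lambda>k t. \<Phi> (q k) t c"])
    show "q \<longlonglongrightarrow> s" unfolding q_def[abs_def] by (rule grid_up_tendsto[OF T_pos assms])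
  qed (use g grid_sol dyadic_grid_bounds[OF less_imp_le[OF T_pos] g] in auto)
qed

definition sol_map :: "real \<Rightarrow> real \<Rightarrow> 'a \<Rightarrow> 'a" where
  "sol_map s t c = (if t < s then c else (SOME z. ode_sol s T c z) t)"

lemma sol_map_sol:
  assumes "0 \<le> s" "s \<le> T" shows "ode_sol s T c (\<lambda>t. sol_map s t c)"
proof -
  have 1: "ode_sol s T c (SOME z. ode_sol s T c z)" using ode_sol_exists[OF assms] by (rule someI_ex)
  have eq: "sol_map s t c = (SOME z. ode_sol s T c z) t" if "s \<le> t" for t
    using that by (simp add: sol_map_def)
  have "(LINT r:{s..t}|lborel. f r (sol_map s r c)) = (LINT r:{s..t}|lborel. f r ((SOME z. ode_sol s T c z) r))" for t
    by (intro set_lebesgue_integral_cong) (auto simp: eq)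
  moreover have "continuous_on {s..T} (\<lambda>t. sol_map s t c)"
    using 1[unfolded ode_sol_def, THEN conjunct1, folded ode_sol_def]
      continuous_on_cong[OF refl, of "{s..T}" "\<lambda>t. sol_map s t c" "SOME z. ode_sol s T c z"] eq by auto
  ultimately show ?thesis
    using 1[unfolded ode_sol_def, THEN conjunct2, folded ode_sol_def] by (subst ode_sol_def) (auto simp: eq)
qed

lemma sol_map_before: "t \<le> s \<Longrightarrow> 0 \<le> s \<Longrightarrow> s \<le> T \<Longrightarrow> sol_map s t c = c"
  using ode_sol_initial[OF sol_map_sol, of s c] by (cases "t = s") (auto simp: sol_map_def)

lemma sol_map_unique:
  assumes "ode_sol s u c z" "0 \<le> s" "u \<le> T" "s \<le> t" "t \<le> u"
  shows "z t = sol_map s t c"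
proof (rule ode_sol_unique[OF assms(1) _ assms(2-)])
  have "ode_sol s u (sol_map s s c) (\<lambda>t. sol_map s t c)"
    by (rule ode_sol_restrict[OF sol_map_sol]) (use assms in auto)
  then show "ode_sol s u c (\<lambda>t. sol_map s t c)" using sol_map_before[of s s c] assms by simp
qed

text \<open>Along a sequence that violates continuity, compactness yields a subsequence of solutions
  converging uniformly in time to a solution with the limiting data; by uniqueness that limit is the
  solution map itself. The moving time argument costs only the Lipschitz constant
  \<open>K\<close>.\<close>

lemma sol_map_continuous:
  "continuous_on ({0..T} \<times> {0..T} \<times> UNIV) (\<lambda>(s, t, c). sol_map s t c)"
  unfolding continuous_on_sequentially
proof (intro allI ballI impI, elim conjE)
  fix x :: "nat \<Rightarrow> real \<times> real \<times> 'a" and a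
  assume a: "a \<in> {0..T} \<times> {0..T} \<times> UNIV" and x: "\<forall>n. x n \<in> {0..T} \<times> {0..T} \<times> UNIV" and xa: "x \<longlonglongrightarrow> a"
  obtain s0 t0 c0 where a_eq: "a = (s0, t0, c0)" by (cases a) auto
  define s t c where "s = (\<lambda>n. fst (x n))" and "t = (\<lambda>n. fst (snd (x n)))" and "c = (\<lambda>n. snd (snd (x n)))"
  have x_eq: "x n = (s n, t n, c n)" for n by (simp add: s_def t_def c_def)
  have lim: "s \<longlonglongrightarrow> s0" "t \<longlonglongrightarrow> t0" "c \<longlonglongrightarrow> c0"
    using tendsto_fst[OF xa] tendsto_fst[OF tendsto_snd[OF xa]] tendsto_snd[OF tendsto_snd[OF xa]]
    by (auto simp: s_def t_def c_def a_eq)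
  have r: "0 \<le> s n" "s n \<le> T" "t n \<in> {0..T}" for n using x[rule_format, of n] unfolding x_eq by auto
  have r0: "0 \<le> s0" "s0 \<le> T" "t0 \<in> {0..T}" using a a_eq by auto
  have "(\<lambda>n. sol_map (s n) (t n) (c n)) \<longlonglongrightarrow> sol_map s0 t0 c0"
  proof (rule ccontr)
    assume "\<not> ?thesis"
    then obtain e where e: "e > 0" "\<not> eventually (\<lambda>n. dist (sol_map (s n) (t n) (c n)) (sol_map s0 t0 c0) < e) sequentially"
      unfolding tendsto_iff by blast
    then obtain \<rho> where \<rho>: "strict_mono (\<rho> :: nat \<Rightarrow> nat)"
        "\<And>n. \<not> dist (sol_map (s (\<rho> n)) (t (\<rho> n)) (c (\<rho> n))) (sol_map s0 t0 c0) < e"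
      using not_eventually_sequentiallyD[OF e(2)] by blast
    have lr: "(\<lambda>n. s (\<rho> n)) \<longlonglongrightarrow> s0" "(\<lambda>n. c (\<rho> n)) \<longlonglongrightarrow> c0" "(\<lambda>n. t (\<rho> n)) \<longlonglongrightarrow> t0"
      using LIMSEQ_subseq_LIMSEQ[OF lim(1) \<rho>(1)] LIMSEQ_subseq_LIMSEQ[OF lim(2) \<rho>(1)] LIMSEQ_subseq_LIMSEQ[OF lim(3) \<rho>(1)]
      by (auto simp: o_def)
    obtain \<kappa> z0 where \<kappa>: "strict_mono (\<kappa> :: nat \<Rightarrow> nat)" and z0: "ode_sol s0 T c0 z0"
      and ul: "uniform_limit {0..T} (\<lambda>k u. if u < s (\<rho> (\<kappa> k)) then c (\<rho> (\<kappa> k)) else sol_map (s (\<rho> (\<kappa> k))) u (c (\<rho> (\<kappa> k))))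
       (\<lambda>u. if u < s0 then c0 else z0 u) sequentially"
      by (rule ode_sol_compact[of "\<lambda>n. s (\<rho> n)" s0 "\<lambda>n. c (\<rho> n)" c0 "\<lambda>n u. sol_map (s (\<rho> n)) u (c (\<rho> n))", OF _ _ lr(1,2)])
         (use r sol_map_sol in auto)
    define m where "m k = \<rho> (\<kappa> k)" for k
    have ul': "uniform_limit {0..T} (\<lambda>k u. sol_map (s (m k)) u (c (m k))) (\<lambda>u. sol_map s0 u c0) sequentially"
    proof (rule uniform_limit_cong'[THEN iffD2, OF _ _ ul])
      show "sol_map (s (m k)) u (c (m k)) = (if u < s (\<rho> (\<kappa> k)) then c (\<rho> (\<kappa> k)) else sol_map (s (\<rho> (\<kappa> k))) u (c (\<rho> (\<kappa> k))))" for k u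
        by (simp add: m_def sol_map_def)
      show "sol_map s0 u c0 = (if u < s0 then c0 else z0 u)" if "u \<in> {0..T}" for u
        using sol_map_unique[OF z0, of u] that r0 by (auto simp: sol_map_def)
    qed
    have tm: "(\<lambda>k. t (m k)) \<longlonglongrightarrow> t0" "(\<lambda>k. s (m k)) \<longlonglongrightarrow> s0"
      using LIMSEQ_subseq_LIMSEQ[OF lr(3) \<kappa>] LIMSEQ_subseq_LIMSEQ[OF lr(1) \<kappa>] by (auto simp: o_def m_def)
    have l0: "(\<lambda>k. sol_map (s (m k)) t0 (c (m k))) \<longlonglongrightarrow> sol_map s0 t0 c0"
      by (rule tendsto_uniform_limitI[OF ul' r0(3)])
    have lip: "norm (sol_map s' u c' - sol_map s' u' c') \<le> K * \<bar>u - u'\<bar>"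
      if "0 \<le> s'" "s' \<le> T" "u \<in> {0..T}" "u' \<in> {0..T}" for s' u u' c'
    proof -
      have "(if v < s' then c' else sol_map s' v c') = sol_map s' v c'" for v by (simp add: sol_map_def)
      then show ?thesis
        using ode_sol_const_before[OF sol_map_sol[OF that(1,2), of c'], of u u']
          ode_sol_const_before[OF sol_map_sol[OF that(1,2), of c'], of u' u] that
        by (cases "u \<le> u'") (auto simp: norm_minus_commute)
    qed
    have "(\<lambda>k. K * \<bar>t (m k) - t0\<bar>) \<longlonglongrightarrow> K * \<bar>t0 - t0\<bar>"
      by (intro tendsto_intros tm)
    then have l1: "(\<lambda>k. K * \<bar>t (m k) - t0\<bar>) \<longlonglongrightarrow> 0" by simp
    have "eventually (\<lambda>k. norm (sol_map (s (m k)) (t (m k)) (c (m k)) - sol_map (s (m k)) t0 (c (m k))) \<le> K * \<bar>t (m k) - t0\<bar>) sequentially"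
      using lip[OF r(1,2,3) r0(3)] by simp
    from Lim_null_comparison[OF this l1] have "(\<lambda>k. sol_map (s (m k)) (t (m k)) (c (m k)) - sol_map (s (m k)) t0 (c (m k))) \<longlonglongrightarrow> 0"
      .
    from tendsto_add[OF this l0] have "(\<lambda>k. sol_map (s (m k)) (t (m k)) (c (m k))) \<longlonglongrightarrow> sol_map s0 t0 c0"
      by simp
    from tendstoD[OF this e(1)] obtain k where "dist (sol_map (s (m k)) (t (m k)) (c (m k))) (sol_map s0 t0 c0) < e"
      by (auto simp: eventually_sequentially)
    then show False using \<rho>(2)[of "\<kappa> k"] by (simp add: m_def)
  qed
  then show "((\<lambda>(s, t, c). sol_map s t c) \<circ> x) \<longlonglongrightarrow> (\<lambda>(s, t, c). sol_map s t c) a"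
    by (simp add: o_def x_eq a_eq)
qed

end

lemma SUP_SUP_tendsto_zero:
  fixes d :: "nat \<Rightarrow> 'x \<Rightarrow> 'y \<Rightarrow> real"
  assumes "\<And>e. 0 < e \<Longrightarrow> eventually (\<lambda>k. \<forall>x\<in>X. \<forall>t\<in>S. d k x t \<le> e) sequentially"
  shows "(\<lambda>k. \<Squnion>x\<in>X. \<Squnion>t\<in>S. ennreal (d k x t)) \<longlonglongrightarrow> 0"
proof (rule order_tendstoI)
  fix a :: ennreal assume "0 < a"
  then obtain e where e: "0 < e" "e < a" using dense by blast
  then have "e < \<top>" using less_top order.strict_trans2 by (metis order_less_le_trans top_greatest)
  then obtain e' where e': "e = ennreal e'" "0 \<le> e'" by (cases e) auto
  then have "0 < e'" using e(1) by (simp add: ennreal_less_zero_iff)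
  from assms[OF this] show "eventually (\<lambda>k. (\<Squnion>x\<in>X. \<Squnion>t\<in>S. ennreal (d k x t)) < a) sequentially"
  proof eventually_elim
    case (elim k)
    have "(\<Squnion>x\<in>X. \<Squnion>t\<in>S. ennreal (d k x t)) \<le> e"
      unfolding e'(1) by (intro SUP_least ennreal_leI) (use elim in auto)
    then show ?case using e(2) by (rule le_less_trans)
  qed
qed simp

section \<open>Equations driven by a fixed path\<close>

locale noisy_path =
  fixes B :: "real \<Rightarrow> 'a::euclidean_space \<Rightarrow> 'a" and m :: "real \<Rightarrow> 'a" and T K C \<beta> :: real
  assumes T0: "0 < T"
    and B_borel: "(\<lambda>(t, x). B t x) \<in> borel_measurable (restrict_space borel ({0..T} \<times> UNIV))"
    and B_bounded: "\<And>t x. t \<in> {0..T} \<Longrightarrow> norm (B t x) \<le> K"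
    and B_hoelder: "\<And>t x y. t \<in> {0..T} \<Longrightarrow> norm (B t x - B t y) \<le> C * norm (x - y) powr \<beta>"
    and C0: "0 \<le> C" and b0: "0 < \<beta>"
    and m_cadlag: "cadlag_on {0..T} m"
begin

sublocale bounded_drift "\<lambda>r z. B r (m r + z)" T K C \<beta>
proof
  let ?R = "restrict_space borel ({0..T} \<times> UNIV) :: (real \<times> 'a) measure"
  have fs: "fst \<in> borel_measurable ?R" "snd \<in> borel_measurable ?R"
    by (intro measurable_restrict_space1 borel_measurable_continuous_onI continuous_on_fst continuous_on_snd continuous_on_id)+
  have f: "fst \<in> measurable ?R (restrict_space borel {0..T})"
    by (rule measurable_restrict_space2[OF _ fs(1)]) (auto simp: space_restrict_space)
  have "(\<lambda>p. m (fst p)) \<in> borel_measurable ?R"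
    by (rule measurable_compose[OF f cadlag_on_borel[OF m_cadlag]])
  then have "(\<lambda>p. m (fst p) + snd p) \<in> borel_measurable ?R"
    by (rule borel_measurable_add[OF _ fs(2)])
  then have "(\<lambda>p. (fst p, m (fst p) + snd p)) \<in> borel_measurable ?R"
    by (intro borel_measurable_Pair fs)
  then have "(\<lambda>p. (fst p, m (fst p) + snd p)) \<in> measurable ?R ?R"
    by (rule measurable_restrict_space2[rotated]) (auto simp: space_restrict_space)
  from measurable_compose[OF this B_borel]
  show "(\<lambda>(t, x). B t (m t + x)) \<in> borel_measurable ?R"
    by (simp add: case_prod_unfold)
  show "norm (B t (m t + x) - B t (m t + y)) \<le> C * norm (x - y) powr \<beta>" if "t \<in> {0..T}" for t x y
    using B_hoelder[OF that, of "m t + x" "m t + y"] by simp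
qed (use T0 B_bounded C0 b0 in auto)

definition noisy_sol :: "real \<Rightarrow> real \<Rightarrow> 'a \<Rightarrow> (real \<Rightarrow> 'a) \<Rightarrow> bool" where
  "noisy_sol s u x g \<longleftrightarrow> cadlag_on {s..u} g \<and>
     (\<forall>t\<in>{s..u}. g t = x + (LINT r:{s..t}|lborel. B r (g r)) + m t - m s)"

lemma noisy_sol_cong:
  assumes "noisy_sol s u x g" "\<And>t. t \<in> {s..u} \<Longrightarrow> g t = g' t"
  shows "noisy_sol s u x g'"
proof -
  have "(LINT r:{s..t}|lborel. B r (g r)) = (LINT r:{s..t}|lborel. B r (g' r))" if "t \<in> {s..u}" for t
    by (rule set_lebesgue_integral_cong) (use assms(2) that in auto)
  then show ?thesis
    using assms cadlag_on_cong[of "{s..u}" g g', OF assms(2)] unfolding noisy_sol_def by auto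
qed

text \<open>\<open>g - m\<close> is continuous because the equation exhibits it as an indefinite
  integral of a bounded function; conversely, adding the cadlag path \<open>m\<close> restores the
  jumps.\<close>

lemma noisy_sol_iff:
  assumes "0 \<le> s" "u \<le> T"
  shows "noisy_sol s u x g \<longleftrightarrow> ode_sol s u (x - m s) (\<lambda>t. g t - m t)"
proof
  have mc: "cadlag_on {s..u} m" by (rule cadlag_on_subset[OF m_cadlag]) (use assms in auto)
  show "ode_sol s u (x - m s) (\<lambda>t. g t - m t)" if g: "noisy_sol s u x g"
  proof -
    have gc: "cadlag_on {s..u} g" using g by (simp add: noisy_sol_def)
    have Bm: "(\<lambda>r. B r (g r)) \<in> borel_measurable (restrict_space borel {s..u})"
      by (rule caratheodory_borel[OF B_borel cadlag_on_borel[OF gc] assms])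
    have "continuous_on {s..u} (\<lambda>t. (x - m s) + (LINT r:{s..t}|lborel. B r (g r)))"
      by (intro continuous_intros set_integral_indefinite_continuous[OF Bm, of K]) (use B_bounded assms in auto)
    moreover have eq: "g t - m t = (x - m s) + (LINT r:{s..t}|lborel. B r (g r))" if "t \<in> {s..u}" for t
      using g that by (simp add: noisy_sol_def)
    ultimately have "continuous_on {s..u} (\<lambda>t. g t - m t)"
      by (subst continuous_on_cong[OF refl eq]) auto
    then show ?thesis unfolding ode_sol_def using eq by simp
  qed
  show "noisy_sol s u x g" if z: "ode_sol s u (x - m s) (\<lambda>t. g t - m t)"
  proof -
    have "cadlag_on {s..u} (\<lambda>t. (g t - m t) + m t)"
      using z by (intro cadlag_on_add continuous_imp_cadlag_on mc) (simp add: ode_sol_def)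
    moreover have "g t = x + (LINT r:{s..t}|lborel. B r (g r)) + m t - m s" if "t \<in> {s..u}" for t
    proof -
      have "g t - m t = x - m s + (LINT r:{s..t}|lborel. B r (m r + (g r - m r)))"
        using z that unfolding ode_sol_def by blast
      then show ?thesis by (simp add: algebra_simps)
    qed
    ultimately show ?thesis by (simp add: noisy_sol_def)
  qed
qed

lemma ode_sol_concat:
  assumes z: "ode_sol s s' c z" and z': "ode_sol s' u (z s') z'" and "0 \<le> s" "s \<le> s'" "s' \<le> u" "u \<le> T"
  shows "ode_sol s u c (\<lambda>t. if t < s' then z t else z' t)"
proof -
  let ?z = "\<lambda>t. if t < s' then z t else z' t"
  have z's: "z' s' = z s'" by (rule ode_sol_initial[OF z']) (use assms in auto)
  have eq1: "?z t = z t" if "t \<le> s'" for t using that z's by (cases "t = s'") auto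
  have c1: "continuous_on {s..s'} ?z"
    using z unfolding ode_sol_def by (subst continuous_on_cong[OF refl, of _ _ z]) (auto simp: z's)
  have c2: "continuous_on {s'..u} ?z"
    using z' unfolding ode_sol_def by (subst continuous_on_cong[OF refl, of _ _ z']) auto
  have "continuous_on ({s..s'} \<union> {s'..u}) ?z"
    by (rule continuous_on_closed_Un[OF _ _ c1 c2]) auto
  moreover have "{s..s'} \<union> {s'..u} = {s..u}" using assms by auto
  ultimately have c: "continuous_on {s..u} ?z" by simp
  have "?z t = c + (LINT r:{s..t}|lborel. B r (m r + ?z r))" if t: "t \<in> {s..u}" for t
  proof (cases "t \<le> s'")
    case True
    have "(LINT r:{s..t}|lborel. B r (m r + ?z r)) = (LINT r:{s..t}|lborel. B r (m r + z r))"
      by (rule set_lebesgue_integral_cong) (use True eq1 in auto)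
    then show ?thesis using z t True eq1[OF True] unfolding ode_sol_def by auto
  next
    case False
    have i: "set_integrable lborel {s..t} (\<lambda>r. B r (m r + ?z r))"
      by (rule drift_integrable[OF continuous_on_subset[OF c]]) (use t assms in auto)
    have e1: "(LINT r:{s..s'}|lborel. B r (m r + ?z r)) = (LINT r:{s..s'}|lborel. B r (m r + z r))"
      by (rule set_lebesgue_integral_cong) (use eq1 in auto)
    have e2: "(LINT r:{s'..t}|lborel. B r (m r + ?z r)) = (LINT r:{s'..t}|lborel. B r (m r + z' r))"
      by (rule set_lebesgue_integral_cong) auto
    have "z' t = z s' + (LINT r:{s'..t}|lborel. B r (m r + z' r))"
      using z' t False unfolding ode_sol_def by auto
    moreover have "z s' = c + (LINT r:{s..s'}|lborel. B r (m r + z r))"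
      using z assms unfolding ode_sol_def by auto
    ultimately show ?thesis
      using set_integral_split[OF i, of s'] assms False e1 e2 by auto
  qed
  then show ?thesis unfolding ode_sol_def using c by auto
qed

text \<open>Formulated for an arbitrary \<open>Z\<close>, so that one can be selected for each path
  of the noise. Uniqueness is required on every interval \<open>{s..u}\<close>, since (v) concerns
  solutions that exist only up to a time \<open>\<tau>\<close>.\<close>

definition solution_map :: "(real \<Rightarrow> real \<Rightarrow> 'a \<Rightarrow> 'a) \<Rightarrow> bool" where
  "solution_map Z \<longleftrightarrow>
     (\<forall>s\<in>{0..T}. \<forall>c. ode_sol s T c (\<lambda>t. Z s t c)) \<and>
     (\<forall>s\<in>{0..T}. \<forall>c. \<forall>t\<le>s. Z s t c = c) \<and>
     (\<forall>s u c z. \<forall>t\<in>{s..u}. 0 \<le> s \<and> u \<le> T \<and> ode_sol s u c z \<longrightarrow> z t = Z s t c) \<and>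
     continuous_on ({0..T} \<times> {0..T} \<times> UNIV) (\<lambda>(s, t, c). Z s t c)"

text \<open>The argument \<open>max s t\<close> of the noise makes the formula valid before time \<open>s\<close> too, where the
  solution is frozen at \<open>x\<close>.\<close>

definition noisy_flow :: "(real \<Rightarrow> real \<Rightarrow> 'a \<Rightarrow> 'a) \<Rightarrow> real \<Rightarrow> real \<Rightarrow> 'a \<Rightarrow> 'a" where
  "noisy_flow Z s t x = Z s t (x - m s) + m (max s t)"

context
  fixes Z :: "real \<Rightarrow> real \<Rightarrow> 'a \<Rightarrow> 'a" assumes Z: "solution_map Z"
begin

lemma Z_sol: "s \<in> {0..T} \<Longrightarrow> ode_sol s T c (\<lambda>t. Z s t c)"
  using Z[unfolded solution_map_def, THEN conjunct1] by blast

lemma Z_unique: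
  assumes "ode_sol s u c z" "0 \<le> s" "u \<le> T" "s \<le> t" "t \<le> u" shows "z t = Z s t c"
proof -
  have "t \<in> {s..u}" using assms by simp
  then show ?thesis
    using Z[unfolded solution_map_def, THEN conjunct2, THEN conjunct2, THEN conjunct1] assms by blast
qed

lemma noisy_flow_sol:
  assumes "s \<in> {0..T}" shows "noisy_sol s T x (\<lambda>t. noisy_flow Z s t x)"
proof -
  have "ode_sol s T (x - m s) (\<lambda>t. Z s t (x - m s))" by (rule Z_sol[OF assms])
  then have "noisy_sol s T x (\<lambda>t. Z s t (x - m s) + m t)"
    by (subst noisy_sol_iff) (use assms in auto)
  moreover have eq: "Z s t (x - m s) + m t = noisy_flow Z s t x" if "s \<le> t" for t
    using that by (simp add: noisy_flow_def)
  moreover have "(LINT r:{s..t}|lborel. B r (Z s r (x - m s) + m r)) = (LINT r:{s..t}|lborel. B r (noisy_flow Z s r x))" for t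
    by (rule set_lebesgue_integral_cong) (auto simp: eq)
  moreover have "cadlag_on {s..T} (\<lambda>t. Z s t (x - m s) + m t) \<longleftrightarrow> cadlag_on {s..T} (\<lambda>t. noisy_flow Z s t x)"
    by (rule cadlag_on_cong) (simp add: eq)
  ultimately show ?thesis unfolding noisy_sol_def by auto
qed

lemma noisy_flow_before: "s \<in> {0..T} \<Longrightarrow> t \<le> s \<Longrightarrow> noisy_flow Z s t x = x"
  using Z by (auto simp: solution_map_def noisy_flow_def)

lemma noisy_flow_unique:
  assumes "noisy_sol s u x g" "0 \<le> s" "u \<le> T" "s \<le> t" "t \<le> u"
  shows "g t = noisy_flow Z s t x"
proof -
  have "ode_sol s u (x - m s) (\<lambda>t. g t - m t)" using assms noisy_sol_iff by blast
  then have "g t - m t = Z s t (x - m s)" using Z_unique[of s u "x - m s" "\<lambda>t. g t - m t" t] assms by simp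
  then show ?thesis using assms by (simp add: noisy_flow_def algebra_simps)
qed

lemma noisy_flow_flow:
  assumes "0 \<le> s" "s < r" "r \<le> t" "t \<le> T"
  shows "noisy_flow Z s t x = noisy_flow Z r t (noisy_flow Z s r x)"
proof -
  have "ode_sol s T (x - m s) (\<lambda>t. Z s t (x - m s))" by (rule Z_sol) (use assms in auto)
  then have "ode_sol r T (Z s r (x - m s)) (\<lambda>t. Z s t (x - m s))"
    by (rule ode_sol_restrict) (use assms in auto)
  then have "Z s t (x - m s) = Z r t (Z s r (x - m s))" using Z_unique[of r T "Z s r (x - m s)" "\<lambda>t. Z s t (x - m s)" t] assms by simp
  then show ?thesis using assms by (simp add: noisy_flow_def)
qed

lemma Z_uniform:
  assumes "0 < e"
  obtains d where "0 < d" "\<And>s t c s' t' c'. \<lbrakk>s \<in> {0..T}; s' \<in> {0..T}; t \<in> {0..T}; t' \<in> {0..T}; norm c \<le> R; norm c' \<le> R;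
     \<bar>s - s'\<bar> < d; \<bar>t - t'\<bar> < d; norm (c - c') < d\<rbrakk> \<Longrightarrow> norm (Z s t c - Z s' t' c') < e"
proof -
  let ?S = "{0..T} \<times> {0..T} \<times> cball (0::'a) R"
  have "continuous_on ({0..T} \<times> {0..T} \<times> UNIV) (\<lambda>(s, t, c). Z s t c)" using Z by (simp add: solution_map_def)
  then have "continuous_on ?S (\<lambda>(s, t, c). Z s t c)" by (rule continuous_on_subset) auto
  moreover have "compact ?S" by (intro compact_Times) auto
  ultimately have "uniformly_continuous_on ?S (\<lambda>(s, t, c). Z s t c)"
    by (rule compact_uniformly_continuous)
  then obtain d where d: "d > 0" and d2: "\<And>p p'. p \<in> ?S \<Longrightarrow> p' \<in> ?S \<Longrightarrow> dist p' p < d \<Longrightarrow> dist ((\<lambda>(s, t, c). Z s t c) p') ((\<lambda>(s, t, c). Z s t c) p) < e"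
    unfolding uniformly_continuous_on_def using assms by metis
  show ?thesis
  proof (rule that[of "d / 3"])
    fix s t s' t' :: real and c c' :: 'a
    assume a: "s \<in> {0..T}" "s' \<in> {0..T}" "t \<in> {0..T}" "t' \<in> {0..T}" "norm c \<le> R" "norm c' \<le> R"
      "\<bar>s - s'\<bar> < d / 3" "\<bar>t - t'\<bar> < d / 3" "norm (c - c') < d / 3"
    have "dist (s, t, c) (s', t', c') \<le> dist s s' + (dist t t' + dist c c')"
      unfolding dist_Pair_Pair
      by (intro order_trans[OF sqrt_sum_squares_le_sum] add_left_mono) auto
    also have "\<dots> < d" using a by (simp add: dist_norm)
    finally show "norm (Z s t c - Z s' t' c') < e"
      using d2[of "(s', t', c')" "(s, t, c)"] a by (simp add: dist_norm)
  qed (use d in auto)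
qed

lemma m_bound: obtains X where "0 \<le> X" "\<And>t. t \<in> {0..T} \<Longrightarrow> norm (m t) \<le> X"
proof -
  obtain X where "\<forall>t\<in>{0..T}. norm (m t) \<le> X" using cadlag_on_bounded[OF m_cadlag] by (auto simp: bounded_iff)
  then show ?thesis using that[of "max 0 X"] by (simp add: le_max_iff_disj)
qed

lemma noisy_flow_continuous:
  assumes "s \<in> {0..T}" "0 < e"
  obtains d where "0 < d" "\<And>y t. dist y x < d \<Longrightarrow> t \<in> {0..T} \<Longrightarrow> dist (noisy_flow Z s t y) (noisy_flow Z s t x) < e"
proof -
  define R where "R = norm (x - m s) + 1"
  obtain d where d: "0 < d" "\<And>s t c s' t' c'. \<lbrakk>s \<in> {0..T}; s' \<in> {0..T}; t \<in> {0..T}; t' \<in> {0..T}; norm c \<le> R; norm c' \<le> R;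
     \<bar>s - s'\<bar> < d; \<bar>t - t'\<bar> < d; norm (c - c') < d\<rbrakk> \<Longrightarrow> norm (Z s t c - Z s' t' c') < e"
    by (rule Z_uniform[OF assms(2), of R]) (rule that)
  show ?thesis
  proof (rule that[of "min 1 d"])
    fix y t assume y: "dist y x < min 1 d" and t: "t \<in> {0..T}"
    have "norm (y - m s) \<le> R" "norm (x - m s) \<le> R"
      using norm_triangle_ineq[of "y - x" "x - m s"] y by (simp_all add: dist_norm R_def)
    then have "norm (Z s t (y - m s) - Z s t (x - m s)) < e"
      using d y t assms(1) by (intro d(2)) (auto simp: dist_norm)
    then show "dist (noisy_flow Z s t y) (noisy_flow Z s t x) < e" by (simp add: noisy_flow_def dist_norm)
  qed (use d in auto)
qed

text \<open>The common core of right continuity and of left limits in \<open>s\<close>. The flow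
  depends on \<open>s\<close> through the continuous map \<open>Z\<close>, through
  \<open>m s\<close> and through \<open>t \<mapsto> m (max s t)\<close>; \<open>ml\<close> and
  \<open>N\<close> are the limits of the last two, the latter uniform in \<open>t\<close>.\<close>

lemma noisy_flow_tendsto:
  fixes r :: "nat \<Rightarrow> real" and N :: "real \<Rightarrow> 'a"
  assumes s: "s \<in> {0..T}" and rT: "\<And>k. r k \<in> {0..T}" and r: "r \<longlonglongrightarrow> s" and ml: "(\<lambda>k. m (r k)) \<longlonglongrightarrow> ml"
    and N: "\<And>e. 0 < e \<Longrightarrow> eventually (\<lambda>k. \<forall>t\<in>{0..T}. norm (m (max (r k) t) - N t) \<le> e) sequentially"
  shows "(\<lambda>k. \<Squnion>x\<in>cball 0 R. \<Squnion>t\<in>{0..T}. ennreal (dist (noisy_flow Z (r k) t x) (Z s t (x - ml) + N t))) \<longlonglongrightarrow> 0"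
proof (rule SUP_SUP_tendsto_zero)
  fix e :: real assume e: "0 < e"
  have e2: "0 < e / 2" using e by simp
  obtain X where X: "0 \<le> X" "\<And>t. t \<in> {0..T} \<Longrightarrow> norm (m t) \<le> X" by (rule m_bound) blast
  have mlX: "norm ml \<le> X"
    by (rule LIMSEQ_le_const2[OF tendsto_norm[OF ml]]) (use X(2)[OF rT] in blast)
  obtain d where d: "0 < d" "\<And>s t c s' t' c'. \<lbrakk>s \<in> {0..T}; s' \<in> {0..T}; t \<in> {0..T}; t' \<in> {0..T}; norm c \<le> R + X; norm c' \<le> R + X;
     \<bar>s - s'\<bar> < d; \<bar>t - t'\<bar> < d; norm (c - c') < d\<rbrakk> \<Longrightarrow> norm (Z s t c - Z s' t' c') < e / 2"
    by (rule Z_uniform[OF e2, of "R + X"]) (rule that)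
  show "eventually (\<lambda>k. \<forall>x\<in>cball 0 R. \<forall>t\<in>{0..T}. dist (noisy_flow Z (r k) t x) (Z s t (x - ml) + N t) \<le> e) sequentially"
    using tendstoD[OF r d(1)] tendstoD[OF ml d(1)] N[OF e2]
  proof eventually_elim
    case (elim k)
    show ?case
    proof (intro ballI)
      fix x t assume x: "x \<in> cball (0::'a) R" and t: "t \<in> {0..T}"
      have "norm (Z (r k) t (x - m (r k)) - Z s t (x - ml)) < e / 2"
      proof (rule d(2))
        show "norm (x - m (r k)) \<le> R + X" using norm_triangle_ineq4[of x "m (r k)"] x X(2)[OF rT[of k]] by simp
        show "norm (x - ml) \<le> R + X" using norm_triangle_ineq4[of x ml] x mlX by simp
        show "norm (x - m (r k) - (x - ml)) < d" using elim(2) by (simp add: dist_norm norm_minus_commute)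
      qed (use s rT t elim d in \<open>auto simp: dist_norm\<close>)
      moreover have "norm (m (max (r k) t) - N t) \<le> e / 2" using elim(3) t by blast
      ultimately show "dist (noisy_flow Z (r k) t x) (Z s t (x - ml) + N t) \<le> e"
        using norm_triangle_ineq[of "Z (r k) t (x - m (r k)) - Z s t (x - ml)" "m (max (r k) t) - N t"]
        by (simp add: noisy_flow_def dist_norm algebra_simps)
    qed
  qed
qed

lemma noisy_flow_right:
  assumes s: "s \<in> {0..<T}" and r: "\<And>k. s < r k \<and> r k \<le> T" "r \<longlonglongrightarrow> s"
  shows "(\<lambda>k. \<Squnion>x\<in>cball 0 R. \<Squnion>t\<in>{0..T}. ennreal (dist (noisy_flow Z (r k) t x) (noisy_flow Z s t x))) \<longlonglongrightarrow> 0"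
proof -
  have sT: "s \<in> {0..T}" and rT: "r k \<in> {0..T}" for k using s r(1)[of k] by auto
  have ml: "(\<lambda>k. m (r k)) \<longlonglongrightarrow> m s"
    by (rule cadlag_on_tendsto_right[OF m_cadlag sT rT _ r(2)]) (use r(1) in \<open>auto intro: less_imp_le\<close>)
  \<comment> \<open>The two arguments differ only for \<open>t < r k\<close>, and then both lie in
    \<open>{s..r k}\<close>, where \<open>m\<close> is close to \<open>m s\<close>.\<close>
  have "eventually (\<lambda>k. \<forall>t\<in>{0..T}. norm (m (max (r k) t) - m (max s t)) \<le> e) sequentially" if e: "0 < e" for e
  proof -
    have "(m \<longlongrightarrow> m s) (at s within ({0..T} \<inter> {s..}))" using m_cadlag sT unfolding cadlag_on_def by blast
    from tendstoD[OF this, of "e / 2"] e obtain d where d: "0 < d" "\<And>u. u \<in> {0..T} \<inter> {s..} \<Longrightarrow> u \<noteq> s \<Longrightarrow> dist u s < d \<Longrightarrow> dist (m u) (m s) < e / 2"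
      unfolding eventually_at by auto
    have d': "norm (m u - m s) \<le> e / 2" if "s \<le> u" "u \<le> T" "u < s + d" for u
      using d(2)[of u] that s e by (cases "u = s") (auto simp: dist_norm)
    show ?thesis using tendstoD[OF r(2) d(1)]
    proof eventually_elim
      case (elim k)
      then have rk: "s < r k" "r k \<le> T" "r k < s + d" using r(1)[of k] by (auto simp: dist_real_def)
      show ?case
      proof
        fix t assume t: "t \<in> {0..T}"
        show "norm (m (max (r k) t) - m (max s t)) \<le> e"
        proof (cases "r k \<le> t")
          case True then show ?thesis using rk e by (simp add: max_def)
        next
          case False
          then have "norm (m (max (r k) t) - m s) \<le> e / 2" "norm (m (max s t) - m s) \<le> e / 2"
            using rk d' t by (auto simp: max_def)
          then show ?thesis using norm_triangle_ineq4[of "m (max (r k) t) - m s" "m (max s t) - m s"] by simp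
        qed
      qed
    qed
  qed
  from noisy_flow_tendsto[OF sT rT r(2) ml this] show ?thesis by (simp add: noisy_flow_def[symmetric])
qed

lemma noisy_flow_left:
  assumes s: "s \<in> {0<..T}"
  shows "\<exists>\<psi>m. \<forall>R>0. \<forall>r :: nat \<Rightarrow> real. (\<forall>k. 0 \<le> r k \<and> r k < s) \<and> r \<longlonglongrightarrow> s \<longrightarrow>
     (\<lambda>k. \<Squnion>x\<in>cball 0 R. \<Squnion>t\<in>{0..T}. ennreal (dist (noisy_flow Z (r k) t x) (\<psi>m t x))) \<longlonglongrightarrow> 0"
proof -
  have sT: "s \<in> {0..T}" using s by auto
  obtain ml where ml: "(m \<longlongrightarrow> ml) (at s within ({0..T} \<inter> {..<s}))" using m_cadlag sT unfolding cadlag_on_def by blast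
  \<comment> \<open>For \<open>t < s\<close> the argument \<open>max (r k) t\<close> lies between
    \<open>r k\<close> and \<open>s\<close>, hence tends to \<open>s\<close> from the left uniformly
    in \<open>t\<close>; for \<open>t \<ge> s\<close> it equals \<open>t\<close>.\<close>
  define N where "N t = (if t < s then ml else m t)" for t
  have "(\<lambda>k. \<Squnion>x\<in>cball 0 R. \<Squnion>t\<in>{0..T}. ennreal (dist (noisy_flow Z (r k) t x) (Z s t (x - ml) + N t))) \<longlonglongrightarrow> 0"
    if r: "\<forall>k. 0 \<le> r k \<and> r k < s" "r \<longlonglongrightarrow> s" for R and r :: "nat \<Rightarrow> real"
  proof (rule noisy_flow_tendsto[OF sT _ r(2)])
    show rT: "r k \<in> {0..T}" for k using r(1)[rule_format, of k] s by auto
    have near: "\<exists>d>0. \<forall>u. 0 \<le> u \<and> u < s \<and> s - d < u \<longrightarrow> norm (m u - ml) \<le> e" if e: "0 < e" for e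
    proof -
      from tendstoD[OF ml e] obtain d where d: "0 < d" "\<And>u. u \<in> {0..T} \<inter> {..<s} \<Longrightarrow> u \<noteq> s \<Longrightarrow> dist u s < d \<Longrightarrow> dist (m u) ml < e"
        unfolding eventually_at by auto
      show ?thesis
        using d s by (intro exI[of _ d]) (force simp: dist_norm intro: less_imp_le)
    qed
    show ev: "eventually (\<lambda>k. \<forall>t\<in>{0..T}. norm (m (max (r k) t) - N t) \<le> e) sequentially" if e: "0 < e" for e
    proof -
      obtain d where d: "0 < d" "\<And>u. 0 \<le> u \<Longrightarrow> u < s \<Longrightarrow> s - d < u \<Longrightarrow> norm (m u - ml) \<le> e" using near[OF e] by blast
      show ?thesis using tendstoD[OF r(2) d(1)]
      proof eventually_elim
        case (elim k)
        have "s - d < r k" using elim by (simp add: dist_real_def)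
        then show ?case using r(1)[rule_format, of k] d(2) e by (auto simp: N_def max_def)
      qed
    qed
    show "(\<lambda>k. m (r k)) \<longlonglongrightarrow> ml"
    proof (rule tendstoI)
      fix e :: real assume e: "0 < e"
      then have e2: "0 < e / 2" by simp
      obtain d where d: "0 < d" "\<And>u. 0 \<le> u \<Longrightarrow> u < s \<Longrightarrow> s - d < u \<Longrightarrow> norm (m u - ml) \<le> e / 2" using near[OF e2] by blast
      show "eventually (\<lambda>k. dist (m (r k)) ml < e) sequentially" using tendstoD[OF r(2) d(1)]
      proof eventually_elim
        case (elim k)
        have "s - d < r k" using elim by (simp add: dist_real_def)
        then have "norm (m (r k) - ml) \<le> e / 2" using r(1)[rule_format, of k] d(2) by auto
        then show ?case using e by (simp add: dist_norm)
      qed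
    qed
  qed
  then show ?thesis by (intro exI[of _ "\<lambda>t x. Z s t (x - ml) + N t"]) auto
qed

end

end

section \<open>Dyadic chaining\<close>

definition dyadic_points :: "(real^'n) set" where
  "dyadic_points = {x. \<exists>i::nat. \<forall>c. \<exists>z::int. x $ c = of_int z / 2 ^ i}"

definition dyadic_floor :: "nat \<Rightarrow> real^'n \<Rightarrow> real^'n" where
  "dyadic_floor k x = (\<chi> c. of_int \<lfloor>2 ^ k * x $ c\<rfloor> / 2 ^ k)"

definition cube_grid :: "nat \<Rightarrow> (real^'n) set" where
  "cube_grid i = {x. \<forall>c. \<exists>z::int. \<bar>z\<bar> \<le> 2 ^ i \<and> x $ c = of_int z / 2 ^ i}"

text \<open>The tolerance of two meshes serves both kinds of links in the chaining: the roundings of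
  one point at consecutive levels, and the roundings at level \<open>i\<close> of two points that
  are at most \<open>2 / 2 ^ i\<close> apart in each coordinate.\<close>

definition near_pairs :: "nat \<Rightarrow> ((real^'n) \<times> (real^'n)) set" where
  "near_pairs i = {(u, v). u \<in> cube_grid i \<and> v \<in> cube_grid i \<and> (\<forall>c. \<bar>u $ c - v $ c\<bar> \<le> 2 / 2 ^ i)}"

lemma dyadic_floor_dyadic_points: "dyadic_floor k x \<in> dyadic_points"
  unfolding dyadic_points_def dyadic_floor_def by auto

lemma dyadic_floor_close: "0 \<le> x $ c - dyadic_floor k x $ c" "x $ c - dyadic_floor k x $ c \<le> 1 / 2 ^ k"
proof -
  have a: "of_int \<lfloor>2 ^ k * x $ c\<rfloor> \<le> x $ c * 2 ^ k" "x $ c * 2 ^ k \<le> of_int \<lfloor>2 ^ k * x $ c\<rfloor> + 1"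
    using floor_correct[of "2 ^ k * x $ c"] by (simp_all add: mult.commute)
  have "x $ c \<le> (of_int \<lfloor>2 ^ k * x $ c\<rfloor> + 1) / 2 ^ k" using a(2) by (simp add: pos_le_divide_eq)
  moreover have "of_int \<lfloor>2 ^ k * x $ c\<rfloor> / 2 ^ k \<le> x $ c" using a(1) by (simp add: pos_divide_le_eq)
  ultimately show "0 \<le> x $ c - dyadic_floor k x $ c" "x $ c - dyadic_floor k x $ c \<le> 1 / 2 ^ k"
    unfolding dyadic_floor_def by (auto simp: add_divide_distrib)
qed

lemma dyadic_floor_tendsto: "(\<lambda>k. dyadic_floor k x) \<longlonglongrightarrow> x"
proof (rule vec_tendstoI)
  fix c
  have "(\<lambda>k. (1/2::real) ^ k) \<longlonglongrightarrow> 0" by (rule LIMSEQ_realpow_zero) auto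
  then have "(\<lambda>k. dyadic_floor k x $ c - x $ c) \<longlonglongrightarrow> 0"
    by (rule Lim_null_comparison[rotated])
       (use dyadic_floor_close[where x=x and c=c] in \<open>auto intro!: always_eventually simp: power_one_over abs_le_iff intro: order_trans\<close>)
  then show "(\<lambda>k. dyadic_floor k x $ c) \<longlonglongrightarrow> x $ c" by (rule LIM_zero_cancel)
qed


lemma countable_dyadic_points: "countable (dyadic_points :: (real^'n) set)"
proof -
  have "(dyadic_points :: (real^'n) set) \<subseteq> (\<Union>i. vec_lambda ` PiE UNIV (\<lambda>_. range (\<lambda>z::int. of_int z / 2 ^ i)))"
  proof
    fix x :: "real^'n" assume "x \<in> dyadic_points"
    then obtain i :: nat where "\<forall>c. \<exists>z::int. x $ c = of_int z / 2 ^ i" unfolding dyadic_points_def by auto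
    then have "vec_nth x \<in> PiE UNIV (\<lambda>_. range (\<lambda>z::int. of_int z / 2 ^ i))" by (auto simp: PiE_def)
    moreover have "x = vec_lambda (vec_nth x)" by simp
    ultimately show "x \<in> (\<Union>i. vec_lambda ` PiE UNIV (\<lambda>_. range (\<lambda>z::int. of_int z / 2 ^ i)))" by blast
  qed
  moreover have "countable (\<Union>i. vec_lambda ` PiE UNIV (\<lambda>_::'n. range (\<lambda>z::int. real_of_int z / 2 ^ (i::nat))))"
    by (intro countable_UN countable_image countable_PiE) auto
  ultimately show ?thesis using countable_subset by blast
qed

lemma cube_grid_finite: "finite (cube_grid i :: (real^'n) set)"
  and cube_grid_card: "card (cube_grid i :: (real^'n) set) \<le> (2 ^ (i + 2)) ^ CARD('n)"
proof -
  define S where "S = (\<lambda>z::int. real_of_int z / 2 ^ i) ` {- (2 ^ i)..2 ^ i}"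
  have fS: "finite S" by (simp add: S_def)
  have "card S \<le> card {- (2 ^ i)..2 ^ i::int}" unfolding S_def by (rule card_image_le) simp
  also have "\<dots> = nat (2 * 2 ^ i + 1)" by simp
  also have "\<dots> \<le> 2 ^ (i + 2)"
  proof -
    have "1 \<le> (2::int) ^ i" by simp
    moreover have "(2::int) ^ (i + 2) = 4 * 2 ^ i" by (simp add: power_add)
    ultimately have "(2::int) * 2 ^ i + 1 \<le> 2 ^ (i + 2)" by linarith
    then show ?thesis by (simp add: nat_le_iff)
  qed
  finally have cS: "card S \<le> 2 ^ (i + 2)" .
  have sub: "(cube_grid i :: (real^'n) set) \<subseteq> vec_lambda ` PiE UNIV (\<lambda>_. S)"
  proof
    fix x :: "real^'n" assume "x \<in> cube_grid i"
    then have "vec_nth x \<in> PiE UNIV (\<lambda>_. S)" unfolding cube_grid_def S_def by (fastforce simp: PiE_def abs_le_iff)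
    moreover have "x = vec_lambda (vec_nth x)" by simp
    ultimately show "x \<in> vec_lambda ` PiE UNIV (\<lambda>_. S)" by blast
  qed
  have fP: "finite (PiE (UNIV :: 'n set) (\<lambda>_. S))" using fS by (intro finite_PiE) auto
  show "finite (cube_grid i :: (real^'n) set)" by (rule finite_subset[OF sub]) (use fP in simp)
  have "card (cube_grid i :: (real^'n) set) \<le> card (vec_lambda ` PiE (UNIV :: 'n set) (\<lambda>_. S))"
    by (rule card_mono[OF _ sub]) (use fP in simp)
  also have "\<dots> \<le> card (PiE (UNIV :: 'n set) (\<lambda>_. S))" by (rule card_image_le[OF fP])
  also have "\<dots> = card S ^ CARD('n)" by (simp add: card_PiE)
  also have "\<dots> \<le> (2 ^ (i + 2)) ^ CARD('n)" by (rule power_mono[OF cS]) simp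
  finally show "card (cube_grid i :: (real^'n) set) \<le> (2 ^ (i + 2)) ^ CARD('n)" .
qed

lemma near_pairs_finite: "finite (near_pairs i :: ((real^'n) \<times> (real^'n)) set)"
  and near_pairs_card: "card (near_pairs i :: ((real^'n) \<times> (real^'n)) set) \<le> 2 ^ (2 * (i + 2) * CARD('n))"
proof -
  have sub: "(near_pairs i :: ((real^'n) \<times> (real^'n)) set) \<subseteq> cube_grid i \<times> cube_grid i"
    by (auto simp: near_pairs_def)
  show "finite (near_pairs i :: ((real^'n) \<times> (real^'n)) set)"
    by (rule finite_subset[OF sub]) (simp add: cube_grid_finite)
  have "card (near_pairs i :: ((real^'n) \<times> (real^'n)) set) \<le> card (cube_grid i \<times> cube_grid i :: ((real^'n) \<times> (real^'n)) set)"
    by (rule card_mono[OF _ sub]) (simp add: cube_grid_finite)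
  also have "\<dots> \<le> (2 ^ (i + 2)) ^ CARD('n) * (2 ^ (i + 2)) ^ CARD('n)"
    unfolding card_cartesian_product by (intro mult_mono cube_grid_card) auto
  also have "\<dots> = 2 ^ (2 * (i + 2) * CARD('n))"
    by (simp only: power_mult[symmetric] power_add[symmetric]) (simp add: algebra_simps)
  finally show "card (near_pairs i :: ((real^'n) \<times> (real^'n)) set) \<le> 2 ^ (2 * (i + 2) * CARD('n))" .
qed

lemma cube_grid_mono: "x \<in> cube_grid i \<Longrightarrow> i \<le> j \<Longrightarrow> x \<in> cube_grid j"
  unfolding cube_grid_def
proof (clarify)
  fix c assume x: "\<forall>c. \<exists>z::int. \<bar>z\<bar> \<le> 2 ^ i \<and> x $ c = of_int z / 2 ^ i" and ij: "i \<le> j"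
  then obtain z :: int where z: "\<bar>z\<bar> \<le> 2 ^ i" "x $ c = of_int z / 2 ^ i" by blast
  have p: "(2::int) ^ j = 2 ^ i * 2 ^ (j - i)" "(2::real) ^ j = 2 ^ i * 2 ^ (j - i)"
    using ij by (metis le_add_diff_inverse power_add)+
  have "\<bar>z * 2 ^ (j - i)\<bar> \<le> 2 ^ j" unfolding p abs_mult using z(1) by simp
  moreover have "x $ c = of_int (z * 2 ^ (j - i)) / 2 ^ j" unfolding p z(2) by simp
  ultimately show "\<exists>z::int. \<bar>z\<bar> \<le> 2 ^ j \<and> x $ c = of_int z / 2 ^ j" by blast
qed

lemma cube_grid_component: "x \<in> cube_grid i \<Longrightarrow> \<bar>x $ c\<bar> \<le> 1"
proof -
  assume "x \<in> cube_grid i"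
  then obtain z :: int where z: "\<bar>z\<bar> \<le> 2 ^ i" "x $ c = of_int z / 2 ^ i" unfolding cube_grid_def by blast
  have "\<bar>real_of_int z\<bar> \<le> 2 ^ i" using z(1) by (metis of_int_abs of_int_le_iff of_int_numeral of_int_power)
  then show ?thesis unfolding z(2) by (simp add: divide_le_eq)
qed

lemma dyadic_floor_cube_grid: "x \<in> cube_grid i \<Longrightarrow> dyadic_floor k x \<in> cube_grid k"
  unfolding cube_grid_def[of k]
proof (clarify)
  fix c assume x: "x \<in> cube_grid i"
  have "\<bar>2 ^ k * x $ c\<bar> \<le> 2 ^ k" using cube_grid_component[OF x, of c] by (simp add: abs_mult)
  then have l: "2 ^ k * x $ c \<le> 2 ^ k" "- (2 ^ k) \<le> 2 ^ k * x $ c" by linarith+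
  have "\<lfloor>2 ^ k * x $ c\<rfloor> \<le> \<lfloor>2 ^ k :: real\<rfloor>" by (rule floor_mono[OF l(1)])
  moreover have "- (2 ^ k) \<le> \<lfloor>2 ^ k * x $ c\<rfloor>" using l(2) by (simp add: le_floor_iff)
  ultimately have "\<lfloor>2 ^ k * x $ c\<rfloor> \<le> 2 ^ k" "- (2 ^ k) \<le> \<lfloor>2 ^ k * x $ c\<rfloor>" by simp_all
  then show "\<exists>z::int. \<bar>z\<bar> \<le> 2 ^ k \<and> dyadic_floor k x $ c = of_int z / 2 ^ k"
    by (intro exI[of _ "\<lfloor>2 ^ k * x $ c\<rfloor>"]) (auto simp: dyadic_floor_def)
qed

lemma dyadic_floor_id: "x \<in> cube_grid i \<Longrightarrow> dyadic_floor i x = x"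
proof (subst vec_eq_iff, intro allI)
  fix c assume "x \<in> cube_grid i"
  then obtain z :: int where z: "x $ c = of_int z / 2 ^ i" unfolding cube_grid_def by blast
  then show "dyadic_floor i x $ c = x $ c" by (simp add: dyadic_floor_def)
qed

text \<open>Kolmogorov's chaining. Each point is joined to its rounding at level \<open>k\<close>
  through the finer levels, and the two roundings are joined by one more link. The level
  \<open>k\<close> is the first one whose mesh is smaller than the distance of the points in some
  coordinate: then the roundings are still near each other, and \<open>a ^ k\<close> is comparable
  to a power of the distance.\<close>

lemma cube_grid_chaining:
  fixes f :: "real^'n \<Rightarrow> 'b::real_normed_vector"
  assumes a: "0 < a" "a < 1" and K: "0 \<le> K"
    and near: "\<And>i u v. (u, v) \<in> near_pairs i \<Longrightarrow> norm (f u - f v) \<le> K * a ^ i"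
    and x: "x \<in> cube_grid N" and y: "y \<in> cube_grid N" and "x \<noteq> y"
  obtains k :: nat where "1 / 2 ^ k \<le> norm (x - y)" "norm (f x - f y) \<le> (1 + 2 * (a / (1 - a))) * K * a ^ k"
proof -
  \<comment> \<open>The fixed point of \<open>Q = a * (Q + 1)\<close>: adding a link of size
    \<open>K * a ^ Suc k\<close> to the bound at level \<open>Suc k\<close> reproduces the bound at
    level \<open>k\<close>.\<close>
  define Q where "Q = a / (1 - a)"
  have Q: "a * (Q + 1) = Q" using a by (simp add: Q_def field_simps)
  have Q0: "0 \<le> Q" using a by (simp add: Q_def)
  have chain: "norm (f w - f (dyadic_floor k w)) \<le> K * Q * a ^ k" if "w \<in> cube_grid N" "k \<le> N" for w k N
    using that(2)
  proof (induction rule: inc_induct)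
    case base
    then show ?case using K Q0 a by (simp add: dyadic_floor_id[OF that(1)])
  next
    case (step k)
    have "(dyadic_floor (Suc k) w, dyadic_floor k w) \<in> near_pairs (Suc k)"
      unfolding near_pairs_def
    proof (clarify, intro conjI allI)
      show "dyadic_floor (Suc k) w \<in> cube_grid (Suc k)" using dyadic_floor_cube_grid[OF that(1)] .
      show "dyadic_floor k w \<in> cube_grid (Suc k)"
        by (rule cube_grid_mono[OF dyadic_floor_cube_grid[OF that(1)]]) simp
      fix c
      have "(1::real) / 2 ^ k = 2 / 2 ^ Suc k" by simp
      moreover have "(1::real) / 2 ^ Suc k \<le> 2 / 2 ^ Suc k" by (rule divide_right_mono) auto
      ultimately show "\<bar>dyadic_floor (Suc k) w $ c - dyadic_floor k w $ c\<bar> \<le> 2 / 2 ^ Suc k"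
        using dyadic_floor_close[of w c k] dyadic_floor_close[of w c "Suc k"] by linarith
    qed
    from near[OF this] have "norm (f (dyadic_floor (Suc k) w) - f (dyadic_floor k w)) \<le> K * a ^ Suc k" .
    then have "norm (f w - f (dyadic_floor k w)) \<le> K * Q * a ^ Suc k + K * a ^ Suc k"
      using step.IH norm_triangle_ineq[of "f w - f (dyadic_floor (Suc k) w)" "f (dyadic_floor (Suc k) w) - f (dyadic_floor k w)"] by simp
    also have "\<dots> = K * (a * (Q + 1)) * a ^ k" by (simp add: algebra_simps)
    finally show ?case unfolding Q .
  qed
  obtain c0 where c0: "x $ c0 \<noteq> y $ c0" using \<open>x \<noteq> y\<close> by (auto simp: vec_eq_iff)
  define P where "P k \<longleftrightarrow> (\<exists>c. 1 / 2 ^ k < \<bar>x $ c - y $ c\<bar>)" for k :: nat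
  have "\<exists>k. P k"
  proof -
    obtain k where "(1/2::real) ^ k < \<bar>x $ c0 - y $ c0\<bar>"
      using real_arch_pow_inv[of "\<bar>x $ c0 - y $ c0\<bar>" "1/2"] c0 by auto
    then show ?thesis by (auto simp: P_def power_one_over)
  qed
  define k where "k = (LEAST k. P k)"
  have Pk: "P k" unfolding k_def using \<open>\<exists>k. P k\<close> by (rule LeastI_ex)
  have le: "\<bar>x $ c - y $ c\<bar> \<le> 2 / 2 ^ k" for c
  proof (cases k)
    case 0
    then show ?thesis using cube_grid_component[OF x, of c] cube_grid_component[OF y, of c] by simp
  next
    case (Suc k')
    then have "\<not> P k'" unfolding k_def by (metis lessI not_less_Least)
    then have "\<bar>x $ c - y $ c\<bar> \<le> 1 / 2 ^ k'" by (auto simp: P_def not_less)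
    then show ?thesis by (simp add: Suc)
  qed
  \<comment> \<open>The level \<open>k\<close> may exceed \<open>N\<close>; both points belong to
    all finer grids as well.\<close>
  define N' where "N' = max N k"
  have xN: "x \<in> cube_grid N'" "y \<in> cube_grid N'" "k \<le> N'" using cube_grid_mono[OF x, of N'] cube_grid_mono[OF y, of N'] by (auto simp: N'_def)
  have "(dyadic_floor k x, dyadic_floor k y) \<in> near_pairs k"
    unfolding near_pairs_def
  proof (clarify, intro conjI allI)
    fix c
    have "\<bar>2 ^ k * x $ c - 2 ^ k * y $ c\<bar> = \<bar>x $ c - y $ c\<bar> * 2 ^ k"
      by (simp add: abs_mult flip: right_diff_distrib)
    also have "\<dots> \<le> 2" using le[of c] by (simp add: pos_le_divide_eq)
    finally have "\<bar>2 ^ k * x $ c - 2 ^ k * y $ c\<bar> \<le> 2" .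
    then have "\<bar>\<lfloor>2 ^ k * x $ c\<rfloor> - \<lfloor>2 ^ k * y $ c\<rfloor>\<bar> \<le> 2" by linarith
    then have "\<bar>real_of_int \<lfloor>2 ^ k * x $ c\<rfloor> - real_of_int \<lfloor>2 ^ k * y $ c\<rfloor>\<bar> \<le> 2" by linarith
    then show "\<bar>dyadic_floor k x $ c - dyadic_floor k y $ c\<bar> \<le> 2 / 2 ^ k"
      unfolding dyadic_floor_def by (simp add: diff_divide_distrib[symmetric] divide_right_mono)
  qed (use dyadic_floor_cube_grid x y in auto)
  from near[OF this] have m: "norm (f (dyadic_floor k x) - f (dyadic_floor k y)) \<le> K * a ^ k" .
  have "norm (f x - f y) \<le> K * Q * a ^ k + K * a ^ k + K * Q * a ^ k"
    using chain[OF xN(1,3)] chain[OF xN(2,3)] m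
      norm_triangle_ineq[of "f x - f (dyadic_floor k x)" "f (dyadic_floor k x) - f y"]
      norm_triangle_ineq[of "f (dyadic_floor k x) - f (dyadic_floor k y)" "f (dyadic_floor k y) - f y"]
    by (simp add: norm_minus_commute)
  also have "\<dots> = (1 + 2 * Q) * K * a ^ k" by (simp add: algebra_simps)
  finally have 1: "norm (f x - f y) \<le> (1 + 2 * (a / (1 - a))) * K * a ^ k" by (simp add: Q_def)
  obtain c where "1 / 2 ^ k < \<bar>x $ c - y $ c\<bar>" using Pk by (auto simp: P_def)
  also have "\<dots> \<le> norm (x - y)" using component_le_norm_cart[of "x - y" c] by simp
  finally show ?thesis using that[of k] 1 by simp
qed

text \<open>A random bound for the \<open>2m\<close>-th power of the weighted Hoelder constant of a random field: the
  summand with index \<open>j\<close> controls the field on the cube of half-side \<open>2 ^ j\<close>, the one with index \<open>i\<close> its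
  increments over the mesh \<open>2 ^ (j - i)\<close>. The \<open>2m\<close>-th moment is so large that a union bound over all
  pairs of grid points suffices.\<close>

definition hoelder_moment :: "nat \<Rightarrow> ((real^'n) \<Rightarrow> (real^'n) \<Rightarrow> ennreal) \<Rightarrow> ennreal" where
  "hoelder_moment m \<rho> = (\<Sum>j. \<Sum>i. \<Sum>(u, v)\<in>near_pairs i.
     ennreal (2 ^ (i * (2 * m - 4 * CARD('n))) / 2 ^ (j * (2 * m + 2))) * \<rho> (2 ^ j *\<^sub>R u) (2 ^ j *\<^sub>R v))"

text \<open>With n the dimension, the weight 2^(i (2m - 4n)) leaves a factor 2^(-4ni) of the moment
  bound 2^(-2mi). At most 2^(2n (i + 2)) pairs consume half of this exponent, and the remaining
  2^(-2ni) is summable in \<open>i\<close>. In the same way the weight leaves 4^(-j) of the growth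
  2^(2mj) of the cubes. The bound is linear in \<open>C\<close>, with a factor \<open>B\<close> that
  depends on neither \<open>P\<close> nor \<open>\<rho>\<close>.\<close>

lemma hoelder_moment_bound:
  assumes m: "2 * CARD('n) < m"
  obtains B where "\<And>P (\<rho> :: 'a \<Rightarrow> real^'n \<Rightarrow> real^'n \<Rightarrow> ennreal) C. \<lbrakk>0 \<le> C; \<And>x y. (\<lambda>\<omega>. \<rho> \<omega> x y) \<in> borel_measurable P;
     \<And>x y. (\<integral>\<^sup>+\<omega>. \<rho> \<omega> x y \<partial>P) \<le> ennreal (C * norm (x - y) powr (2 * real m))\<rbrakk>
     \<Longrightarrow> (\<integral>\<^sup>+\<omega>. hoelder_moment m (\<rho> \<omega>) \<partial>P) \<le> ennreal (C * B)"
proof -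
  define n where "n = CARD('n)"
  have n0: "0 < n" by (simp add: n_def)
  \<comment> \<open>By the l1 norm, a near pair of level \<open>i\<close> is at distance at most
    \<open>2 * n / 2 ^ i\<close>.\<close>
  define c :: real where "c = (2 * real n) ^ (2 * m)"
  have main: "(\<integral>\<^sup>+\<omega>. hoelder_moment m (\<rho> \<omega>) \<partial>P) \<le> ennreal (C * (c * 2 ^ (4 * n) * (4/3) * (4/3)))"
    if C: "0 \<le> C" and meas: "\<And>x y. (\<lambda>\<omega>. \<rho> \<omega> x y) \<in> borel_measurable P"
     and mom: "\<And>x y. (\<integral>\<^sup>+\<omega>. \<rho> \<omega> x y \<partial>P) \<le> ennreal (C * norm (x - y) powr (2 * real m))"
   for P and \<rho> :: "'a \<Rightarrow> real^'n \<Rightarrow> real^'n \<Rightarrow> ennreal" and C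
  proof -
    let ?w = "\<lambda>i j. 2 ^ (i * (2 * m - 4 * n)) / 2 ^ (j * (2 * m + 2)) :: real"
    have pair: "(\<integral>\<^sup>+\<omega>. ennreal (?w i j) * \<rho> \<omega> (2 ^ j *\<^sub>R u) (2 ^ j *\<^sub>R v) \<partial>P) \<le> ennreal (C * c * ((1/4) ^ j * (1 / 2 ^ (4 * n * i))))"
      if uv: "(u, v) \<in> near_pairs i" for u v i j
    proof -
      have "norm (2 ^ j *\<^sub>R u - 2 ^ j *\<^sub>R v) = 2 ^ j * norm (u - v)" by (simp flip: scaleR_right_diff_distrib)
      also have "norm (u - v) \<le> (\<Sum>c\<in>UNIV. \<bar>(u - v) $ c\<bar>)" by (rule norm_le_l1_cart)
      also have "\<dots> \<le> (\<Sum>c\<in>(UNIV::'n set). 2 / 2 ^ i)" using uv by (intro sum_mono) (auto simp: near_pairs_def)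
      also have "\<dots> = 2 * real n / 2 ^ i" by (simp add: n_def)
      finally have le: "norm (2 ^ j *\<^sub>R u - 2 ^ j *\<^sub>R v) \<le> 2 ^ j * (2 * real n / 2 ^ i)" by simp
      have "norm (2 ^ j *\<^sub>R u - 2 ^ j *\<^sub>R v) powr (2 * real m) \<le> (2 ^ j * (2 * real n / 2 ^ i)) powr (2 * real m)"
        by (rule powr_mono2[OF _ _ le]) auto
      also have "\<dots> = (2 ^ j * (2 * real n / 2 ^ i)) ^ (2 * m)"
        using n0 by (subst powr_realpow[symmetric]) auto
      also have "\<dots> = c * (2 ^ (j * (2 * m)) / 2 ^ (i * (2 * m)))"
        by (simp add: c_def power_mult_distrib power_divide power_mult[symmetric])
      finally have pw: "norm (2 ^ j *\<^sub>R u - 2 ^ j *\<^sub>R v) powr (2 * real m) \<le> c * (2 ^ (j * (2 * m)) / 2 ^ (i * (2 * m)))" .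
      have "(\<integral>\<^sup>+\<omega>. ennreal (?w i j) * \<rho> \<omega> (2 ^ j *\<^sub>R u) (2 ^ j *\<^sub>R v) \<partial>P) = ennreal (?w i j) * (\<integral>\<^sup>+\<omega>. \<rho> \<omega> (2 ^ j *\<^sub>R u) (2 ^ j *\<^sub>R v) \<partial>P)"
        by (rule nn_integral_cmult[OF meas])
      also have "\<dots> \<le> ennreal (?w i j) * ennreal (C * (c * (2 ^ (j * (2 * m)) / 2 ^ (i * (2 * m)))))"
        by (intro mult_left_mono order_trans[OF mom] ennreal_leI pw C) auto
      also have "\<dots> = ennreal (?w i j * (C * (c * (2 ^ (j * (2 * m)) / 2 ^ (i * (2 * m))))))"
        by (subst ennreal_mult) (auto simp: C c_def)
      also have "?w i j * (C * (c * (2 ^ (j * (2 * m)) / 2 ^ (i * (2 * m))))) = C * c * ((1/4) ^ j * (1 / 2 ^ (4 * n * i)))"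
      proof -
        have "(2::real) ^ (j * (2 * m + 2)) = 2 ^ (j * (2 * m)) * (2 ^ 2) ^ j"
          by (simp only: power_mult[symmetric] power_add[symmetric]) (simp add: algebra_simps)
        then have e1: "(2::real) ^ (j * (2 * m + 2)) = 2 ^ (j * (2 * m)) * 4 ^ j" by simp
        have "i * (2 * m) = i * (2 * m - 4 * n) + 4 * n * i" using m by (simp add: n_def algebra_simps diff_mult_distrib2)
        then have e2: "(2::real) ^ (i * (2 * m)) = 2 ^ (i * (2 * m - 4 * n)) * 2 ^ (4 * n * i)" by (simp add: power_add)
        show ?thesis unfolding e1 e2 by (simp add: power_one_over field_simps)
      qed
      finally show ?thesis .
    qed
    have level: "(\<Sum>(u, v)\<in>near_pairs i. \<integral>\<^sup>+\<omega>. ennreal (?w i j) * \<rho> \<omega> (2 ^ j *\<^sub>R u) (2 ^ j *\<^sub>R v) \<partial>P)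
        \<le> ennreal (C * c * 2 ^ (4 * n) * ((1/4) ^ j * (1/4) ^ i))" for i j
    proof -
      have "(\<Sum>(u, v)\<in>near_pairs i. \<integral>\<^sup>+\<omega>. ennreal (?w i j) * \<rho> \<omega> (2 ^ j *\<^sub>R u) (2 ^ j *\<^sub>R v) \<partial>P)
        \<le> (\<Sum>(u, v)\<in>(near_pairs i :: ((real^'n) \<times> (real^'n)) set). ennreal (C * c * ((1/4) ^ j * (1 / 2 ^ (4 * n * i)))))"
        by (intro sum_mono) (use pair in auto)
      also have "\<dots> = ennreal (real (card (near_pairs i :: ((real^'n) \<times> (real^'n)) set)) * (C * c * ((1/4) ^ j * (1 / 2 ^ (4 * n * i)))))"
        unfolding case_prod_unfold sum_constant ennreal_of_nat_eq_real_of_nat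
        by (rule ennreal_mult[symmetric]) (auto simp: C c_def)
      also have "\<dots> \<le> ennreal (2 ^ (2 * (i + 2) * n) * (C * c * ((1/4) ^ j * (1 / 2 ^ (4 * n * i)))))"
      proof (intro ennreal_leI mult_right_mono)
        show "real (card (near_pairs i :: ((real^'n) \<times> (real^'n)) set)) \<le> 2 ^ (2 * (i + 2) * n)"
          using near_pairs_card[of i, where 'n='n] unfolding n_def by (metis of_nat_le_iff of_nat_numeral of_nat_power)
      qed (use C in \<open>auto simp: c_def\<close>)
      also have "\<dots> \<le> ennreal (C * c * 2 ^ (4 * n) * ((1/4) ^ j * (1/4) ^ i))"
      proof (rule ennreal_leI)
        have e: "(2::real) ^ (2 * (i + 2) * n) = 2 ^ (2 * n * i) * 2 ^ (4 * n)"
          by (simp add: power_add[symmetric] algebra_simps)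
        have e2: "(2::real) ^ (4 * n * i) = 2 ^ (2 * n * i) * 2 ^ (2 * n * i)"
          by (simp add: power_add[symmetric] algebra_simps)
        have "(2::real) ^ (2 * i) \<le> 2 ^ (2 * n * i)" using n0 by (intro power_increasing) auto
        then have "1 / (2::real) ^ (2 * n * i) \<le> (1/4) ^ i"
          by (simp add: power_mult power_one_over frac_le)
        then have "C * c * 2 ^ (4 * n) * (1/4) ^ j * (1 / 2 ^ (2 * n * i)) \<le> C * c * 2 ^ (4 * n) * (1/4) ^ j * (1/4) ^ i"
          by (intro mult_left_mono) (auto simp: C c_def)
        then show "2 ^ (2 * (i + 2) * n) * (C * c * ((1/4) ^ j * (1 / 2 ^ (4 * n * i)))) \<le> C * c * 2 ^ (4 * n) * ((1/4) ^ j * (1/4) ^ i)"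
          unfolding e e2 by (simp add: field_simps)
      qed
      finally show ?thesis .
    qed
    have geo: "(\<Sum>i. ennreal (D * (1/4) ^ i)) = ennreal (D * (4/3))" if "0 \<le> D" for D
    proof -
      have "(\<lambda>i. D * (1/4) ^ i) sums (D * (1 / (1 - 1/4)))" by (intro sums_mult geometric_sums) auto
      then have "(\<lambda>i. D * (1/4) ^ i) sums (D * (4/3))" by simp
      then show ?thesis using that by (intro suminf_ennreal_eq) auto
    qed
    have "(\<integral>\<^sup>+\<omega>. hoelder_moment m (\<rho> \<omega>) \<partial>P) =
      (\<Sum>j. \<Sum>i. \<Sum>(u, v)\<in>near_pairs i. \<integral>\<^sup>+\<omega>. ennreal (?w i j) * \<rho> \<omega> (2 ^ j *\<^sub>R u) (2 ^ j *\<^sub>R v) \<partial>P)"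
    proof -
      have t: "(\<lambda>\<omega>. ennreal (?w i j) * \<rho> \<omega> (2 ^ j *\<^sub>R u) (2 ^ j *\<^sub>R v)) \<in> borel_measurable P" for i j u v
        by (intro borel_measurable_times_ennreal meas borel_measurable_const)
      have s: "(\<lambda>\<omega>. \<Sum>p\<in>near_pairs i. ennreal (?w i j) * \<rho> \<omega> (2 ^ j *\<^sub>R fst p) (2 ^ j *\<^sub>R snd p)) \<in> borel_measurable P" for i j
        by (intro borel_measurable_sum t)
      have "(\<integral>\<^sup>+\<omega>. hoelder_moment m (\<rho> \<omega>) \<partial>P) = (\<Sum>j. \<integral>\<^sup>+\<omega>. (\<Sum>i. \<Sum>p\<in>near_pairs i. ennreal (?w i j) * \<rho> \<omega> (2 ^ j *\<^sub>R fst p) (2 ^ j *\<^sub>R snd p)) \<partial>P)"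
        unfolding hoelder_moment_def n_def[symmetric] case_prod_unfold
        by (rule nn_integral_suminf) (intro borel_measurable_suminf_order s)
      also have "\<dots> = (\<Sum>j. \<Sum>i. \<integral>\<^sup>+\<omega>. (\<Sum>p\<in>near_pairs i. ennreal (?w i j) * \<rho> \<omega> (2 ^ j *\<^sub>R fst p) (2 ^ j *\<^sub>R snd p)) \<partial>P)"
        by (intro suminf_cong nn_integral_suminf s)
      also have "\<dots> = (\<Sum>j. \<Sum>i. \<Sum>(u, v)\<in>near_pairs i. \<integral>\<^sup>+\<omega>. ennreal (?w i j) * \<rho> \<omega> (2 ^ j *\<^sub>R u) (2 ^ j *\<^sub>R v) \<partial>P)"
        unfolding case_prod_unfold by (intro suminf_cong nn_integral_sum t)
      finally show ?thesis .
    qed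
    also have "\<dots> \<le> (\<Sum>j. \<Sum>i. ennreal (C * c * 2 ^ (4 * n) * ((1/4) ^ j * (1/4) ^ i)))"
      by (intro suminf_le level summableI)
    also have "\<dots> = (\<Sum>j. \<Sum>i. ennreal (C * c * 2 ^ (4 * n) * (1/4) ^ j * (1/4) ^ i))"
      by (simp add: mult.assoc)
    also have "\<dots> = (\<Sum>j. ennreal (C * c * 2 ^ (4 * n) * (1/4) ^ j * (4/3)))"
      by (subst geo) (auto simp: C c_def)
    also have "\<dots> = (\<Sum>j. ennreal (C * c * 2 ^ (4 * n) * (4/3) * (1/4) ^ j))"
      by (simp add: mult_ac)
    also have "\<dots> = ennreal (C * c * 2 ^ (4 * n) * (4/3) * (4/3))"
      by (subst geo) (auto simp: C c_def)
    finally show ?thesis by (simp add: mult.assoc)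
  qed
  show ?thesis using that[OF main] by blast
qed

lemma dyadic_points_scaled_cube_grid:
  fixes x :: "real^'n"
  assumes x: "x \<in> dyadic_points" "\<And>c. \<bar>x $ c\<bar> \<le> 2 ^ j"
  obtains N where "(1 / 2 ^ j) *\<^sub>R x \<in> cube_grid N"
proof -
  obtain i :: nat where i: "\<forall>c. \<exists>z::int. x $ c = of_int z / 2 ^ i" using x(1) unfolding dyadic_points_def by auto
  have "(1 / 2 ^ j) *\<^sub>R x \<in> cube_grid (i + j)"
    unfolding cube_grid_def
  proof (clarify)
    fix c
    obtain z :: int where z: "x $ c = of_int z / 2 ^ i" using i by blast
    have "\<bar>real_of_int z\<bar> \<le> 2 ^ (i + j)"
      using x(2)[of c] unfolding z by (simp add: abs_divide pos_divide_le_eq power_add mult.commute)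
    then have "\<bar>z\<bar> \<le> 2 ^ (i + j)" by (metis of_int_abs of_int_le_iff of_int_numeral of_int_power)
    then show "\<exists>z::int. \<bar>z\<bar> \<le> 2 ^ (i + j) \<and> ((1 / 2 ^ j) *\<^sub>R x) $ c = of_int z / 2 ^ (i + j)"
      using z by (intro exI[of _ z]) (simp add: power_add)
  qed
  then show ?thesis by (rule that)
qed

lemma hoelder_moment_term:
  assumes "(u, v) \<in> near_pairs i"
  shows "ennreal (2 ^ (i * (2 * m - 4 * CARD('n))) / 2 ^ (j * (2 * m + 2))) * \<rho> (2 ^ j *\<^sub>R u) (2 ^ j *\<^sub>R (v :: real^'n)) \<le> hoelder_moment m \<rho>"
proof -
  let ?w = "\<lambda>j i u v. ennreal (2 ^ (i * (2 * m - 4 * CARD('n))) / 2 ^ (j * (2 * m + 2))) * \<rho> (2 ^ j *\<^sub>R u) (2 ^ j *\<^sub>R (v :: real^'n))"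
  have "?w j i u v \<le> (\<Sum>(u, v)\<in>near_pairs i. ?w j i u v)"
    using member_le_sum[OF assms _ near_pairs_finite, of "\<lambda>(u, v). ?w j i u v"] by simp
  also have "\<dots> \<le> (\<Sum>i. \<Sum>(u, v)\<in>near_pairs i. ?w j i u v)"
    using sum_le_suminf[OF summableI, of "{i}" "\<lambda>i. \<Sum>(u, v)\<in>near_pairs i. ?w j i u v"] by simp
  also have "\<dots> \<le> (\<Sum>j. \<Sum>i. \<Sum>(u, v)\<in>near_pairs i. ?w j i u v)"
    using sum_le_suminf[OF summableI, of "{j}" "\<lambda>j. \<Sum>i. \<Sum>(u, v)\<in>near_pairs i. ?w j i u v"] by simp
  finally show ?thesis by (simp add: hoelder_moment_def)
qed

text \<open>Each single summand of the moment is at most \<open>w\<close>; taking roots of order 2m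
  turns this into a bound for the increments over near pairs, to which chaining applies. This is the
  origin of the exponents: with n the dimension, (2m - 4n)/(2m) is \<open>\<gamma>\<close>, the
  weight of the cube of half-side 2^j costs 2^(j (m + 1)/m), and rescaling that cube to the unit
  cube gives back 2^(-j gamma), so that (m + 1)/m - gamma = (2n + 1)/m, which is \<open>e\<close>,
  remains.\<close>

lemma hoelder_moment_estimate:
  assumes m: "2 * CARD('n) < m"
  defines "\<gamma> \<equiv> (real m - 2 * real CARD('n)) / real m" and "e \<equiv> (2 * real CARD('n) + 1) / real m"
  obtains D where "0 \<le> D" "\<And>(X :: real^'n \<Rightarrow> 'b::real_normed_vector) \<rho> w x y. \<lbrakk>0 \<le> w; hoelder_moment m \<rho> \<le> ennreal w;
      \<And>x y. ennreal (norm (X x - X y) powr (2 * real m)) \<le> \<rho> x y; x \<in> dyadic_points; y \<in> dyadic_points\<rbrakk>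
     \<Longrightarrow> norm (X x - X y) \<le> D * (1 + w) * (norm (x - y) powr \<gamma> * max (max (norm x) (norm y) powr e) 1)"
proof -
  define n where "n = CARD('n)"
  have m0: "0 < real m" "0 < m" using m by auto
  have g: "0 < \<gamma>" "\<gamma> \<le> 1" using m unfolding \<gamma>_def by (auto simp: field_simps)
  have e0: "0 < e" using m0 unfolding e_def by (intro divide_pos_pos) auto
  define a where "a = (2::real) powr (- \<gamma>)"
  have a: "0 < a" "a < 1" using g powr_less_mono[of "-\<gamma>" 0 2] by (simp_all add: a_def)
  define D where "D = (1 + 2 * (a / (1 - a))) * 2 powr e"
  have D0: "0 \<le> D" using a by (simp add: D_def)
  have main: "norm (X x - X y) \<le> D * (1 + w) * (norm (x - y) powr \<gamma> * max (max (norm x) (norm y) powr e) 1)"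
    if w: "0 \<le> w" and W: "hoelder_moment m \<rho> \<le> ennreal w"
      and \<rho>: "\<And>x y. ennreal (norm (X x - X y) powr (2 * real m)) \<le> \<rho> x y"
      and x: "x \<in> dyadic_points" and y: "y \<in> dyadic_points"
    for X :: "real^'n \<Rightarrow> 'b" and \<rho> w x y
  proof (cases "x = y")
    case True then show ?thesis using D0 w by simp
  next
    case False
    define P where "P j \<longleftrightarrow> (\<forall>c. \<bar>x $ c\<bar> \<le> 2 ^ j \<and> \<bar>y $ c\<bar> \<le> 2 ^ j)" for j :: nat
    have "\<exists>j. P j"
    proof -
      obtain j where j: "max (norm x) (norm y) < 2 ^ j" using real_arch_pow[of 2 "max (norm x) (norm y)"] by auto
      have "\<bar>x $ c\<bar> \<le> 2 ^ j \<and> \<bar>y $ c\<bar> \<le> 2 ^ j" for c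
        using component_le_norm_cart[of x c] component_le_norm_cart[of y c] j by auto
      then show ?thesis by (auto simp: P_def)
    qed
    define j where "j = (LEAST j. P j)"
    have Pj: "P j" unfolding j_def using \<open>\<exists>j. P j\<close> by (rule LeastI_ex)
    define M where "M = max (norm x) (norm y)"
    \<comment> \<open>Minimality of \<open>j\<close> compares the half-side with the norms, except
      on the smallest cube; this exception is the source of the \<open>max _ 1\<close> in the
      weight.\<close>
    have jM: "2 ^ j \<le> 2 * max M 1"
    proof (cases j)
      case 0 then show ?thesis by simp
    next
      case (Suc j')
      then have "\<not> P j'" unfolding j_def by (metis lessI not_less_Least)
      then obtain c where "2 ^ j' < \<bar>x $ c\<bar> \<or> 2 ^ j' < \<bar>y $ c\<bar>" by (auto simp: P_def not_le)
      then have "2 ^ j' \<le> M" using component_le_norm_cart[of x c] component_le_norm_cart[of y c] by (auto simp: M_def)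
      then show ?thesis by (simp add: Suc)
    qed
    obtain N1 N2 where N: "(1 / 2 ^ j) *\<^sub>R x \<in> cube_grid N1" "(1 / 2 ^ j) *\<^sub>R y \<in> cube_grid N2"
      using dyadic_points_scaled_cube_grid[OF x, of j] dyadic_points_scaled_cube_grid[OF y, of j] Pj unfolding P_def by metis
    define K where "K = (1 + w) * 2 powr (real j * ((real m + 1) / real m))"
    have K0: "0 \<le> K" using w by (simp add: K_def)
    have near: "norm (X (2 ^ j *\<^sub>R u) - X (2 ^ j *\<^sub>R v)) \<le> K * a ^ i" if uv: "(u, v) \<in> near_pairs i" for i u v
    proof -
      let ?d = "norm (X (2 ^ j *\<^sub>R u) - X (2 ^ j *\<^sub>R v))"
      let ?c = "2 ^ (i * (2 * m - 4 * n)) / 2 ^ (j * (2 * m + 2)) :: real"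
      have "ennreal (?c * ?d powr (2 * real m)) = ennreal ?c * ennreal (?d powr (2 * real m))"
        by (rule ennreal_mult) auto
      also have "\<dots> \<le> ennreal ?c * \<rho> (2 ^ j *\<^sub>R u) (2 ^ j *\<^sub>R v)" by (intro mult_left_mono \<rho>) auto
      also have "\<dots> \<le> ennreal w"
        unfolding n_def by (rule order_trans[OF hoelder_moment_term[OF uv] W])
      finally have le: "?c * ?d powr (2 * real m) \<le> w" using w by (simp add: ennreal_le_iff)
      \<comment> \<open>The root of \<open>w\<close> is bounded by \<open>1 + w\<close>: the
        resulting constant is linear in the moment, whose mean is known.\<close>
      have "w \<le> (1 + w) powr (2 * real m)"
      proof -
        have "(1 + w) powr 1 \<le> (1 + w) powr (2 * real m)" using w m0 by (intro powr_mono) auto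
        then show ?thesis using w by simp
      qed
      with le have le2: "?c * ?d powr (2 * real m) \<le> (1 + w) powr (2 * real m)" by linarith
      have c1: "?c = (2 powr (real i * \<gamma> - real j * ((real m + 1) / real m))) powr (2 * real m)"
      proof -
        have 1: "(2::real) ^ (i * (2 * m - 4 * n)) = 2 powr (real i * (2 * real m - 4 * real n))"
          using m by (subst powr_realpow[symmetric]) (auto simp: n_def of_nat_diff)
        have 2: "(2::real) ^ (j * (2 * m + 2)) = 2 powr (real j * (2 * real m + 2))"
          by (subst powr_realpow[symmetric]) (simp_all add: algebra_simps)
        have "\<gamma> * real m = real m - 2 * real n" "((real m + 1) / real m) * real m = real m + 1"
          using m0 by (simp_all add: \<gamma>_def n_def)
        moreover have "(real i * \<gamma> - real j * ((real m + 1) / real m)) * (2 * real m)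
            = real i * (2 * (\<gamma> * real m)) - real j * (2 * (((real m + 1) / real m) * real m))"
          by (simp add: algebra_simps)
        ultimately have "(real i * \<gamma> - real j * ((real m + 1) / real m)) * (2 * real m) = real i * (2 * real m - 4 * real n) - real j * (2 * real m + 2)"
          by simp
        then show ?thesis unfolding 1 2 powr_diff[symmetric] powr_powr by simp
      qed
      have "(2 powr (real i * \<gamma> - real j * ((real m + 1) / real m)) * ?d) powr (2 * real m) \<le> (1 + w) powr (2 * real m)"
        using le2 unfolding c1 by (simp add: powr_mult)
      then have "2 powr (real i * \<gamma> - real j * ((real m + 1) / real m)) * ?d \<le> 1 + w"
        using powr_less_mono2[of "2 * real m" "1 + w" "2 powr (real i * \<gamma> - real j * ((real m + 1) / real m)) * ?d"] m0 w
        by (meson add_nonneg_nonneg leD le_less_linear mult_pos_pos zero_le_one zero_less_numeral)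
      then have "2 powr (real j * ((real m + 1) / real m) - real i * \<gamma>) * (2 powr (real i * \<gamma> - real j * ((real m + 1) / real m)) * ?d)
          \<le> 2 powr (real j * ((real m + 1) / real m) - real i * \<gamma>) * (1 + w)"
        by (intro mult_left_mono) auto
      then have "?d \<le> 2 powr (real j * ((real m + 1) / real m) - real i * \<gamma>) * (1 + w)"
        by (simp add: mult.assoc[symmetric] powr_add[symmetric])
      also have "\<dots> = K * a ^ i"
      proof -
        have "a ^ i = 2 powr (- (real i * \<gamma>))"
          unfolding a_def by (subst powr_realpow[symmetric]) (auto simp: powr_powr mult.commute)
        then show ?thesis by (simp add: K_def powr_diff powr_minus divide_inverse mult_ac)
      qed
      finally show ?thesis .
    qed
    have xy: "(1 / 2 ^ j) *\<^sub>R x \<noteq> (1 / 2 ^ j) *\<^sub>R y" using False by simp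
    have N': "(1 / 2 ^ j) *\<^sub>R x \<in> cube_grid (max N1 N2)" "(1 / 2 ^ j) *\<^sub>R y \<in> cube_grid (max N1 N2)"
      using cube_grid_mono[OF N(1), of "max N1 N2"] cube_grid_mono[OF N(2), of "max N1 N2"] by auto
    obtain k :: nat where k: "1 / 2 ^ k \<le> norm ((1 / 2 ^ j) *\<^sub>R x - (1 / 2 ^ j) *\<^sub>R y)"
      "norm (X (2 ^ j *\<^sub>R ((1 / 2 ^ j) *\<^sub>R x)) - X (2 ^ j *\<^sub>R ((1 / 2 ^ j) *\<^sub>R y))) \<le> (1 + 2 * (a / (1 - a))) * K * a ^ k"
      by (rule cube_grid_chaining[where f="\<lambda>z. X (2 ^ j *\<^sub>R z)", OF a K0 near N' xy]) (assumption | rule that)+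
    have h: "(1 / 2 ^ k :: real) = 2 powr (- real k)" by (simp add: powr_minus powr_realpow divide_inverse)
    have "a ^ k = a powr real k" using a by (simp add: powr_realpow)
    also have "\<dots> = (1 / 2 ^ k) powr \<gamma>" unfolding h a_def powr_powr by (simp add: mult.commute)
    also have "(1 / 2 ^ k) powr \<gamma> \<le> norm ((1 / 2 ^ j) *\<^sub>R x - (1 / 2 ^ j) *\<^sub>R y) powr \<gamma>"
      using g k(1) by (intro powr_mono2) auto
    also have "norm ((1 / 2 ^ j) *\<^sub>R x - (1 / 2 ^ j) *\<^sub>R y) = norm (x - y) / 2 ^ j"
      by (simp flip: scaleR_right_diff_distrib)
    also have "(norm (x - y) / 2 ^ j) powr \<gamma> = norm (x - y) powr \<gamma> * 2 powr (- (real j * \<gamma>))"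
    proof -
      have "norm (x - y) / 2 ^ j = norm (x - y) * 2 powr (- real j)" by (simp add: powr_minus powr_realpow divide_inverse)
      then show ?thesis by (simp add: powr_mult powr_powr)
    qed
    finally have ak: "a ^ k \<le> norm (x - y) powr \<gamma> * 2 powr (- (real j * \<gamma>))" .
    have "(2 ^ j) powr e \<le> (2 * max M 1) powr e" using e0 jM by (intro powr_mono2) auto
    also have "\<dots> = 2 powr e * max (M powr e) 1"
    proof (cases "M \<le> 1")
      case True
      have M0: "0 \<le> M" unfolding M_def by (simp add: le_max_iff_disj)
      then have "M powr e \<le> 1" using e0 powr_mono2[of e M 1] True by simp
      then show ?thesis using True by (simp add: max_def)
    next
      case False
      then have "1 \<le> M powr e" using e0 by (intro ge_one_powr_ge_zero) auto
      then show ?thesis using False by (simp add: max_def powr_mult)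
    qed
    finally have jb: "(2 ^ j) powr e \<le> 2 powr e * max (M powr e) 1" .
    have "norm (X x - X y) \<le> (1 + 2 * (a / (1 - a))) * K * a ^ k" using k(2) by simp
    also have "\<dots> \<le> (1 + 2 * (a / (1 - a))) * K * (norm (x - y) powr \<gamma> * 2 powr (- (real j * \<gamma>)))"
      using a K0 by (intro mult_left_mono ak mult_nonneg_nonneg) auto
    also have "\<dots> = (1 + 2 * (a / (1 - a))) * (1 + w) * norm (x - y) powr \<gamma> * (2 powr (real j * ((real m + 1) / real m)) * 2 powr (- (real j * \<gamma>)))"
      by (simp add: K_def mult_ac)
    also have "2 powr (real j * ((real m + 1) / real m)) * 2 powr (- (real j * \<gamma>)) = (2 ^ j) powr e"
    proof -
      have "real j * ((real m + 1) / real m) + - (real j * \<gamma>) = real j * e"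
        using m0 by (simp add: \<gamma>_def e_def field_simps)
      then show ?thesis by (simp add: powr_add[symmetric] powr_realpow[symmetric] powr_powr)
    qed
    finally have "norm (X x - X y) \<le> (1 + 2 * (a / (1 - a))) * (1 + w) * norm (x - y) powr \<gamma> * (2 ^ j) powr e" .
    also have "\<dots> \<le> (1 + 2 * (a / (1 - a))) * (1 + w) * norm (x - y) powr \<gamma> * (2 powr e * max (M powr e) 1)"
      using a w by (intro mult_left_mono jb mult_nonneg_nonneg add_nonneg_nonneg) auto
    finally show ?thesis
      using a w by (simp add: D_def M_def mult_ac)
  qed
  show ?thesis by (rule that[OF D0 main])
qed

section \<open>From a dense set of starting points to the solution map of one path\<close>

definition hoelder_weight :: "real \<Rightarrow> real \<Rightarrow> 'a::real_normed_vector \<Rightarrow> 'a \<Rightarrow> real" where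
  "hoelder_weight \<gamma> e x y = norm (x - y) powr \<gamma> * max (max (norm x) (norm y) powr e) 1"

lemma hoelder_weight_tendsto:
  assumes "0 < \<gamma>" "0 < e" "x \<longlonglongrightarrow> x0" "y \<longlonglongrightarrow> y0"
  shows "(\<lambda>k. hoelder_weight \<gamma> e (x k) (y k)) \<longlonglongrightarrow> hoelder_weight \<gamma> e x0 y0"
proof -
  have "(\<lambda>k. norm (x k - y k) powr \<gamma>) \<longlonglongrightarrow> norm (x0 - y0) powr \<gamma>"
    by (rule tendsto_powr'[OF tendsto_norm[OF tendsto_diff[OF assms(3,4)]] tendsto_const]) (use assms(1) in simp)
  moreover have "(\<lambda>k. max (norm (x k)) (norm (y k)) powr e) \<longlonglongrightarrow> max (norm x0) (norm y0) powr e"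
    by (rule tendsto_powr'[OF tendsto_max[OF tendsto_norm[OF assms(3)] tendsto_norm[OF assms(4)]] tendsto_const])
       (use assms(2) in \<open>simp add: le_max_iff_disj\<close>)
  ultimately show ?thesis
    unfolding hoelder_weight_def by (intro tendsto_mult tendsto_max tendsto_const)
qed

lemma hoelder_weight_same: "hoelder_weight \<gamma> e x x = 0"
  by (simp add: hoelder_weight_def)

lemma hoelder_weight_nonneg: "0 \<le> hoelder_weight \<gamma> e x y"
  by (simp add: hoelder_weight_def le_max_iff_disj)

lemma hoelder_weight_bounded:
  assumes "0 < e" "norm x \<le> R" "norm y \<le> R"
  shows "hoelder_weight \<gamma> e x y \<le> max (R powr e) 1 * norm (x - y) powr \<gamma>"
proof -
  have "max (norm x) (norm y) powr e \<le> R powr e"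
    by (rule powr_mono2) (use assms in \<open>auto simp: le_max_iff_disj\<close>)
  then show ?thesis unfolding hoelder_weight_def
    by (subst mult.commute, intro mult_right_mono) auto
qed

text \<open>At a general \<open>x\<close> the solutions started at \<open>a k x\<close> have, by
  compactness, a subsequence converging to a solution. The Hoelder estimate survives in these limits
  and then forces the whole sequence to converge. The last conclusion thus represents the extension
  by a limit along the fixed approximations \<open>a k x\<close>, from which adaptedness will
  follow.\<close>

lemma (in noisy_path) flow_extension:
  fixes u :: "'a \<Rightarrow> real \<Rightarrow> 'a"
  assumes s: "s \<in> {0..T}" and g: "0 < \<gamma>" "0 < e" and D: "0 \<le> D"
    and approx: "\<And>x k. a k x \<in> A" "\<And>x. (\<lambda>k::nat. a k x) \<longlonglongrightarrow> x"
    and sol: "\<And>x. x \<in> A \<Longrightarrow> noisy_sol s T x (u x)"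
    and hoel: "\<And>x y t. x \<in> A \<Longrightarrow> y \<in> A \<Longrightarrow> t \<in> {s..T} \<Longrightarrow> norm (u x t - u y t) \<le> D * hoelder_weight \<gamma> e x y"
  obtains \<Psi> where "\<And>x. noisy_sol s T x (\<lambda>t. \<Psi> t x)"
    "\<And>x y t. t \<in> {s..T} \<Longrightarrow> norm (\<Psi> t x - \<Psi> t y) \<le> D * hoelder_weight \<gamma> e x y"
    "\<And>x t. x \<in> A \<Longrightarrow> t \<in> {s..T} \<Longrightarrow> \<Psi> t x = u x t"
    "\<And>x t. t \<in> {s..T} \<Longrightarrow> (\<lambda>k. u (a k x) t) \<longlonglongrightarrow> \<Psi> t x"
proof -
  have "\<exists>\<kappa> p. strict_mono (\<kappa> :: nat \<Rightarrow> nat) \<and> noisy_sol s T x p \<and> (\<forall>t\<in>{s..T}. (\<lambda>k. u (a (\<kappa> k) x) t) \<longlonglongrightarrow> p t)" for x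
  proof -
    have st: "\<And>k::nat. 0 \<le> s" "\<And>k::nat. s \<le> T" using s by auto
    have c: "(\<lambda>k. a k x - m s) \<longlonglongrightarrow> x - m s"
      by (intro tendsto_intros approx)
    have z: "ode_sol s T (a k x - m s) (\<lambda>t. u (a k x) t - m t)" for k
      using sol[OF approx(1)[of k x]] noisy_sol_iff s by auto
    obtain \<kappa> z0 where k: "strict_mono (\<kappa> :: nat \<Rightarrow> nat)" "ode_sol s T (x - m s) z0"
      and ul: "uniform_limit {0..T} (\<lambda>k t. if t < s then a (\<kappa> k) x - m s else u (a (\<kappa> k) x) t - m t)
       (\<lambda>t. if t < s then x - m s else z0 t) sequentially"
      by (rule ode_sol_compact[OF st tendsto_const c z]) (rule that)
    have "(\<lambda>k. u (a (\<kappa> k) x) t) \<longlonglongrightarrow> z0 t + m t" if t: "t \<in> {s..T}" for t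
    proof -
      have "t \<in> {0..T}" using t s by auto
      from tendsto_uniform_limitI[OF ul this] t have "(\<lambda>k. u (a (\<kappa> k) x) t - m t) \<longlonglongrightarrow> z0 t" by auto
      from tendsto_add[OF this tendsto_const[of "m t"]] show ?thesis by simp
    qed
    moreover have "noisy_sol s T x (\<lambda>t. z0 t + m t)"
      using k(2) s by (subst noisy_sol_iff) auto
    ultimately show ?thesis using k(1) by (intro exI[of _ \<kappa>] exI[of _ "\<lambda>t. z0 t + m t"]) blast
  qed
  then obtain \<kappa> p where k: "\<And>x. strict_mono (\<kappa> x :: nat \<Rightarrow> nat)" and p: "\<And>x. noisy_sol s T x (p x)"
    and lim: "\<And>x t. t \<in> {s..T} \<Longrightarrow> (\<lambda>k. u (a (\<kappa> x k) x) t) \<longlonglongrightarrow> p x t" by metis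
  have ak: "(\<lambda>k. a (\<kappa> x k) x) \<longlonglongrightarrow> x" for x
    using LIMSEQ_subseq_LIMSEQ[OF approx(2)[of x] k[of x]] by (simp add: o_def)
  have H: "norm (p x t - p y t) \<le> D * hoelder_weight \<gamma> e x y" if t: "t \<in> {s..T}" for x y t
  proof (rule LIMSEQ_le)
    show "(\<lambda>k. norm (u (a (\<kappa> x k) x) t - u (a (\<kappa> y k) y) t)) \<longlonglongrightarrow> norm (p x t - p y t)"
      by (intro tendsto_intros lim t)
    show "(\<lambda>k. D * hoelder_weight \<gamma> e (a (\<kappa> x k) x) (a (\<kappa> y k) y)) \<longlonglongrightarrow> D * hoelder_weight \<gamma> e x y"
      by (intro tendsto_intros hoelder_weight_tendsto g ak)
    show "\<exists>N. \<forall>n\<ge>N. norm (u (a (\<kappa> x n) x) t - u (a (\<kappa> y n) y) t) \<le> D * hoelder_weight \<gamma> e (a (\<kappa> x n) x) (a (\<kappa> y n) y)"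
      using hoel approx(1) t by blast
  qed
  have same: "p x t = u x t" if x: "x \<in> A" and t: "t \<in> {s..T}" for x t
  proof -
    have "(\<lambda>k. D * hoelder_weight \<gamma> e (a (\<kappa> x k) x) x) \<longlonglongrightarrow> D * hoelder_weight \<gamma> e x x"
      by (intro tendsto_intros hoelder_weight_tendsto g ak)
    then have l0: "(\<lambda>k. D * hoelder_weight \<gamma> e (a (\<kappa> x k) x) x) \<longlonglongrightarrow> 0" by (simp add: hoelder_weight_same)
    have "eventually (\<lambda>k. norm (u (a (\<kappa> x k) x) t - u x t) \<le> D * hoelder_weight \<gamma> e (a (\<kappa> x k) x) x) sequentially"
      using hoel[OF approx(1) x t] by simp
    from LIM_zero_cancel[OF Lim_null_comparison[OF this l0]] lim[OF t, of x] show ?thesis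
      using LIMSEQ_unique by blast
  qed
  have conv: "(\<lambda>k. u (a k x) t) \<longlonglongrightarrow> p x t" if t: "t \<in> {s..T}" for x t
  proof -
    have "(\<lambda>k. D * hoelder_weight \<gamma> e (a k x) x) \<longlonglongrightarrow> D * hoelder_weight \<gamma> e x x"
      by (intro tendsto_intros hoelder_weight_tendsto g approx)
    then have l0: "(\<lambda>k. D * hoelder_weight \<gamma> e (a k x) x) \<longlonglongrightarrow> 0" by (simp add: hoelder_weight_same)
    have "eventually (\<lambda>k. norm (u (a k x) t - p x t) \<le> D * hoelder_weight \<gamma> e (a k x) x) sequentially"
      using H[OF t] same[OF approx(1) t] by (intro always_eventually allI) metis
    from LIM_zero_cancel[OF Lim_null_comparison[OF this l0]] show ?thesis .
  qed
  show ?thesis by (rule that[of "\<lambda>t x. p x t"]) (use p H same conv in auto)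
qed

text \<open>The conditions on \<open>u\<close> concern only dyadic times and points of
  \<open>A\<close>; with a countable \<open>A\<close> they can all be met on one almost sure event.
  The flow condition is stated as a limit because \<open>u s x s'\<close> is in general not a point
  of \<open>A\<close>.\<close>

theorem (in noisy_path) solution_map_exists:
  fixes u :: "real \<Rightarrow> 'a \<Rightarrow> real \<Rightarrow> 'a" and W :: "real \<Rightarrow> real"
  assumes g: "0 < \<gamma>" "0 < e" and W: "\<And>s. 0 \<le> W s"
    and approx: "\<And>x k. a k x \<in> A" "\<And>x. (\<lambda>k::nat. a k x) \<longlonglongrightarrow> x"
    and sol: "\<And>s x. s \<in> dyadic_grid T \<Longrightarrow> x \<in> A \<Longrightarrow> noisy_sol s T x (u s x)"
    and hoel: "\<And>s x y t. s \<in> dyadic_grid T \<Longrightarrow> x \<in> A \<Longrightarrow> y \<in> A \<Longrightarrow> t \<in> {s..T} \<Longrightarrow>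
        norm (u s x t - u s y t) \<le> W s * hoelder_weight \<gamma> e x y"
    and flow: "\<And>s s' x t. \<lbrakk>s \<in> dyadic_grid T; s' \<in> dyadic_grid T; s < s'; x \<in> A; t \<in> {s'..T}\<rbrakk> \<Longrightarrow>
        (\<lambda>k. u s' (a k (u s x s')) t) \<longlonglongrightarrow> u s x t"
    and sum0: "(\<lambda>k. (T / 2 ^ k) powr ((1 + \<beta>) * \<gamma>) * (\<Sum>i\<le>2 ^ k. W (T * real i / 2 ^ k))) \<longlonglongrightarrow> 0"
  shows "\<exists>Z. solution_map Z"
proof -
  note gb = dyadic_grid_bounds[OF less_imp_le[OF T0]]
  define Q where "Q s \<Psi> \<longleftrightarrow> (\<forall>x. noisy_sol s T x (\<lambda>t. \<Psi> t x)) \<and>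
    (\<forall>x y. \<forall>t\<in>{s..T}. norm (\<Psi> t x - \<Psi> t y) \<le> W s * hoelder_weight \<gamma> e x y) \<and>
    (\<forall>x\<in>A. \<forall>t\<in>{s..T}. \<Psi> t x = u s x t) \<and>
    (\<forall>x. \<forall>t\<in>{s..T}. (\<lambda>k. u s (a k x) t) \<longlonglongrightarrow> \<Psi> t x)" for s and \<Psi> :: "real \<Rightarrow> 'a \<Rightarrow> 'a"
  have "\<forall>s\<in>dyadic_grid T. \<exists>\<Psi>. Q s \<Psi>"
  proof
    fix s assume s: "s \<in> dyadic_grid T"
    have sT: "s \<in> {0..T}" using gb[OF s] by simp
    show "\<exists>\<Psi>. Q s \<Psi>" unfolding Q_def
      by (rule flow_extension[OF sT g W approx sol[OF s] hoel[OF s]]) blast+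
  qed
  from bchoice[OF this] obtain \<Psi> where Q: "\<And>s. s \<in> dyadic_grid T \<Longrightarrow> Q s (\<Psi> s)" by blast
  have \<Psi>: "\<And>s x. s \<in> dyadic_grid T \<Longrightarrow> noisy_sol s T x (\<lambda>t. \<Psi> s t x)"
    "\<And>s x y t. s \<in> dyadic_grid T \<Longrightarrow> t \<in> {s..T} \<Longrightarrow> norm (\<Psi> s t x - \<Psi> s t y) \<le> W s * hoelder_weight \<gamma> e x y"
    "\<And>s x t. s \<in> dyadic_grid T \<Longrightarrow> x \<in> A \<Longrightarrow> t \<in> {s..T} \<Longrightarrow> \<Psi> s t x = u s x t"
    "\<And>s x t. s \<in> dyadic_grid T \<Longrightarrow> t \<in> {s..T} \<Longrightarrow> (\<lambda>k. u s (a k x) t) \<longlonglongrightarrow> \<Psi> s t x"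
    using Q unfolding Q_def by blast+
  have \<Psi>c: "(\<lambda>k. \<Psi> s t (y k)) \<longlonglongrightarrow> \<Psi> s t x" if s: "s \<in> dyadic_grid T" "t \<in> {s..T}" and y: "y \<longlonglongrightarrow> x" for s t x y
  proof -
    have "(\<lambda>k. W s * hoelder_weight \<gamma> e (y k) x) \<longlonglongrightarrow> W s * hoelder_weight \<gamma> e x x"
      by (intro tendsto_intros hoelder_weight_tendsto g y)
    then have l0: "(\<lambda>k. W s * hoelder_weight \<gamma> e (y k) x) \<longlonglongrightarrow> 0" by (simp add: hoelder_weight_same)
    have "eventually (\<lambda>k. norm (\<Psi> s t (y k) - \<Psi> s t x) \<le> W s * hoelder_weight \<gamma> e (y k) x) sequentially"
      using \<Psi>(2)[OF s] by simp
    from LIM_zero_cancel[OF Lim_null_comparison[OF this l0]] show ?thesis .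
  qed
  have \<Psi>flow: "\<Psi> s' t (\<Psi> s s' x) = \<Psi> s t x"
    if s: "s \<in> dyadic_grid T" "s' \<in> dyadic_grid T" "s < s'" and t: "s' \<le> t" "t \<le> T" for s s' t x
  proof -
    have ts: "t \<in> {s..T}" "t \<in> {s'..T}" "s' \<in> {s..T}" using s t by auto
    have A: "\<Psi> s' t (\<Psi> s s' y) = \<Psi> s t y" if y: "y \<in> A" for y
      using LIMSEQ_unique[OF \<Psi>(4)[OF s(2) ts(2), of "\<Psi> s s' y"], of "u s y t"] flow[OF s y ts(2)]
        \<Psi>(3)[OF s(1) y ts(3)] \<Psi>(3)[OF s(1) y ts(1)] by simp
    have "(\<lambda>k. \<Psi> s' t (\<Psi> s s' (a k x))) \<longlonglongrightarrow> \<Psi> s' t (\<Psi> s s' x)"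
      by (intro \<Psi>c s ts approx(2))
    moreover have "(\<lambda>k. \<Psi> s t (a k x)) \<longlonglongrightarrow> \<Psi> s t x" by (intro \<Psi>c s ts approx(2))
    ultimately show ?thesis unfolding A[OF approx(1)] using LIMSEQ_unique by blast
  qed
  define \<Phi> where "\<Phi> s t c = \<Psi> s t (c + m s) - m t" for s t c
  obtain X where X: "\<forall>t\<in>{0..T}. norm (m t) \<le> X" using cadlag_on_bounded[OF m_cadlag] by (auto simp: bounded_iff)
  interpret gf: grid_flow "\<lambda>r z. B r (m r + z)" T K C \<beta> \<Phi> W \<gamma>
  proof
    show "ode_sol s T c (\<lambda>t. \<Phi> s t c)" if s: "s \<in> dyadic_grid T" for s c
      using \<Psi>(1)[OF s, of "c + m s"] gb[OF s] noisy_sol_iff[of s T "c + m s"] by (simp add: \<Phi>_def)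
    show "\<Phi> s' t (\<Phi> s s' c) = \<Phi> s t c"
      if "s \<in> dyadic_grid T" "s' \<in> dyadic_grid T" "s < s'" "s' \<le> t" "t \<le> T" for s s' t c
      using \<Psi>flow[OF that] by (simp add: \<Phi>_def)
    fix R
    show "\<exists>H\<ge>0. \<forall>s\<in>dyadic_grid T. \<forall>t\<in>{s..T}. \<forall>c c'. norm c \<le> R \<longrightarrow> norm c' \<le> R \<longrightarrow>
       norm (\<Phi> s t c - \<Phi> s t c') \<le> H * W s * norm (c - c') powr \<gamma>"
    \<comment> \<open>In the coordinate without noise, starting points of norm at most
      \<open>R\<close> correspond to points of norm at most \<open>R + X\<close>; on that ball the
      growing factor of the weight is bounded.\<close>
    proof (intro exI[of _ "max ((R + X) powr e) 1"] conjI ballI allI impI)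
      show "0 \<le> max ((R + X) powr e) 1" by (simp add: le_max_iff_disj)
      fix s t and c c' :: 'a assume s: "s \<in> dyadic_grid T" and t: "t \<in> {s..T}" and c: "norm c \<le> R" "norm c' \<le> R"
      have "norm (m s) \<le> X" using X gb[OF s] by auto
      then have "norm (c + m s) \<le> R + X" "norm (c' + m s) \<le> R + X" using c by (auto intro: norm_triangle_mono)
      then have "hoelder_weight \<gamma> e (c + m s) (c' + m s) \<le> max ((R + X) powr e) 1 * norm ((c + m s) - (c' + m s)) powr \<gamma>"
        by (rule hoelder_weight_bounded[OF g(2)])
      then have "W s * hoelder_weight \<gamma> e (c + m s) (c' + m s) \<le> W s * (max ((R + X) powr e) 1 * norm ((c + m s) - (c' + m s)) powr \<gamma>)"
        using W by (rule mult_left_mono)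
      then show "norm (\<Phi> s t c - \<Phi> s t c') \<le> max ((R + X) powr e) 1 * W s * norm (c - c') powr \<gamma>"
        using \<Psi>(2)[OF s t, of "c + m s" "c' + m s"] by (simp add: \<Phi>_def mult_ac)
    qed
  qed (use g W sum0 in auto)
  have "solution_map gf.sol_map"
    unfolding solution_map_def
  proof (intro conjI ballI allI impI)
    show "ode_sol s T c (\<lambda>t. gf.sol_map s t c)" if "s \<in> {0..T}" for s c using gf.sol_map_sol that by auto
    show "gf.sol_map s t c = c" if "s \<in> {0..T}" "t \<le> s" for s t c using gf.sol_map_before that by auto
    show "z t = gf.sol_map s t c" if "t \<in> {s..u}" "0 \<le> s \<and> u \<le> T \<and> ode_sol s u c z" for s u c z t
      using gf.sol_map_unique[of s u c z t] that by auto
  qed (rule gf.sol_map_continuous)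
  then show ?thesis by blast
qed

section \<open>The matrix exponential\<close>

lemma bounded_bilinear_matrix_vector_mult:
  "bounded_bilinear ((*v) :: real^'n^'m \<Rightarrow> real^'n \<Rightarrow> real^'m)"
proof -
  have "linear (\<lambda>y. x *v y)" for x :: "real^'n^'m"
    by (rule matrix_vector_mul_linear)
  moreover have "linear (\<lambda>x :: real^'n^'m. x *v y)" for y :: "real^'n"
    by (rule linearI) (simp_all add: matrix_vector_mult_add_rdistrib scaleR_matrix_vector_assoc)
  ultimately have "bilinear ((*v) :: real^'n^'m \<Rightarrow> real^'n \<Rightarrow> real^'m)"
    by (simp add: bilinear_def)
  then show ?thesis by (simp add: bilinear_conv_bounded_bilinear)
qed

lemma bounded_bilinear_matrix_matrix_mult:
  "bounded_bilinear ((**) :: real^'n^'m \<Rightarrow> real^'p^'n \<Rightarrow> real^'p^'m)"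
proof -
  have "linear (\<lambda>y :: real^'p^'n. x ** y)" for x :: "real^'n^'m"
    by (rule linearI) (simp_all add: matrix_matrix_mult_def vec_eq_iff distrib_left sum.distrib sum_distrib_left mult.left_commute)
  moreover have "linear (\<lambda>x :: real^'n^'m. x ** y)" for y :: "real^'p^'n"
    by (rule linearI) (simp_all add: matrix_matrix_mult_def vec_eq_iff distrib_right sum.distrib sum_distrib_left mult.assoc)
  ultimately have "bilinear ((**) :: real^'n^'m \<Rightarrow> real^'p^'n \<Rightarrow> real^'p^'m)"
    by (simp add: bilinear_def)
  then show ?thesis by (simp add: bilinear_conv_bounded_bilinear)
qed

text \<open>The sum of the absolute values of the entries is submultiplicative. Hence every entry of
  the exponential is an everywhere convergent real power series, and limits and derivatives can be
  taken entry by entry.\<close>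

lemma matrix_power_entry_bound:
  fixes A :: "real^'n^'n"
  shows "\<bar>(((**) A) ^^ k) (mat 1) $ i $ j\<bar> \<le> (\<Sum>i\<in>UNIV. \<Sum>j\<in>UNIV. \<bar>A $ i $ j\<bar>) ^ k"
proof (induction k arbitrary: i j)
  case 0 then show ?case by (simp add: mat_def)
next
  case (Suc k)
  let ?c = "\<Sum>i\<in>UNIV. \<Sum>j\<in>UNIV. \<bar>A $ i $ j\<bar>"
  have "\<bar>(((**) A) ^^ Suc k) (mat 1) $ i $ j\<bar> = \<bar>\<Sum>l\<in>UNIV. A $ i $ l * (((**) A) ^^ k) (mat 1) $ l $ j\<bar>"
    by (simp add: matrix_matrix_mult_def)
  also have "\<dots> \<le> (\<Sum>l\<in>UNIV. \<bar>A $ i $ l\<bar> * \<bar>(((**) A) ^^ k) (mat 1) $ l $ j\<bar>)"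
    by (rule order_trans[OF sum_abs]) (simp add: abs_mult)
  also have "\<dots> \<le> (\<Sum>l\<in>UNIV. \<bar>A $ i $ l\<bar> * ?c ^ k)"
    by (intro sum_mono mult_left_mono Suc.IH) auto
  also have "\<dots> = (\<Sum>l\<in>UNIV. \<bar>A $ i $ l\<bar>) * ?c ^ k" by (simp add: sum_distrib_right)
  also have "\<dots> \<le> ?c * ?c ^ k"
    by (intro mult_right_mono member_le_sum[of i UNIV "\<lambda>i. \<Sum>j\<in>UNIV. \<bar>A $ i $ j\<bar>"]) (auto intro!: sum_nonneg zero_le_power)
  finally show ?case by simp
qed

lemma mexp_entry_summable:
  fixes A :: "real^'n^'n"
  shows "summable (\<lambda>k. ((((**) A) ^^ k) (mat 1) $ i $ j / fact k) * t ^ k)"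
proof -
  let ?c = "\<Sum>i\<in>UNIV. \<Sum>j\<in>UNIV. \<bar>A $ i $ j\<bar>"
  have "summable (\<lambda>k. inverse (fact k) * (?c * \<bar>t\<bar>) ^ k)" by (rule summable_exp)
  then show ?thesis
  proof (rule summable_comparison_test'[where N=0])
    fix k
    have "norm ((((**) A) ^^ k) (mat 1) $ i $ j / fact k * t ^ k) = \<bar>(((**) A) ^^ k) (mat 1) $ i $ j\<bar> * (inverse (fact k) * \<bar>t\<bar> ^ k)"
      by (simp add: abs_mult power_abs divide_inverse mult.assoc)
    also have "\<dots> \<le> ?c ^ k * (inverse (fact k) * \<bar>t\<bar> ^ k)"
      by (intro mult_right_mono matrix_power_entry_bound) auto
    finally show "norm ((((**) A) ^^ k) (mat 1) $ i $ j / fact k * t ^ k) \<le> inverse (fact k) * (?c * \<bar>t\<bar>) ^ k"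
      by (simp add: power_mult_distrib mult_ac)
  qed
qed

lemma mexp_sums:
  fixes A :: "real^'n^'n"
  shows "(\<lambda>k. ((t ^ k) / fact k) *\<^sub>R (((**) A) ^^ k) (mat 1)) sums mexp t A"
    and mexp_entry: "mexp t A $ i $ j = (\<Sum>k. ((((**) A) ^^ k) (mat 1) $ i $ j / fact k) * t ^ k)"
proof -
  define S :: "real^'n^'n" where "S = (\<chi> i j. \<Sum>k. ((((**) A) ^^ k) (mat 1) $ i $ j / fact k) * t ^ k)"
  have s: "(\<lambda>k. ((t ^ k) / fact k) *\<^sub>R (((**) A) ^^ k) (mat 1)) sums S"
    unfolding sums_def
  proof (intro vec_tendstoI)
    fix i j
    have "(\<lambda>k. ((((**) A) ^^ k) (mat 1) $ i $ j / fact k) * t ^ k) sums (S $ i $ j)"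
      using summable_sums[OF mexp_entry_summable[of A i j t]] by (simp add: S_def)
    then show "(\<lambda>n. (\<Sum>k<n. ((t ^ k) / fact k) *\<^sub>R (((**) A) ^^ k) (mat 1)) $ i $ j) \<longlonglongrightarrow> S $ i $ j"
      unfolding sums_def by (simp add: mult.commute)
  qed
  then have "mexp t A = S" by (simp add: mexp_def sums_iff)
  then show "(\<lambda>k. ((t ^ k) / fact k) *\<^sub>R (((**) A) ^^ k) (mat 1)) sums mexp t A"
    "mexp t A $ i $ j = (\<Sum>k. ((((**) A) ^^ k) (mat 1) $ i $ j / fact k) * t ^ k)"
    using s by (auto simp: S_def)
qed

lemma mexp_0: "mexp 0 A = mat 1"
proof -
  have "(\<lambda>k. ((0 ^ k) / fact k) *\<^sub>R (((**) A) ^^ k) (mat 1)) sums (\<Sum>k\<in>{0}. ((0 ^ k) / fact k) *\<^sub>R (((**) A) ^^ k) (mat 1))"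
    by (rule sums_finite) (auto simp: power_0_left)
  with mexp_sums[of 0 A] show ?thesis using sums_unique2 by fastforce
qed

lemma mexp_uminus:
  fixes A :: "real^'a^'a"
  shows "mexp (- t) A = mexp t (- A)"
proof -
  interpret bounded_bilinear "(**) :: real^'a^'a \<Rightarrow> real^'a^'a \<Rightarrow> real^'a^'a"
    by (rule bounded_bilinear_matrix_matrix_mult)
  have "(((**) (- A)) ^^ k) (mat 1) = (-1) ^ k *\<^sub>R (((**) A) ^^ k) (mat 1)" for k
    by (induction k) (simp_all add: minus_left scaleR_right)
  then have "((t ^ k) / fact k) *\<^sub>R (((**) (- A)) ^^ k) (mat 1) = (((- t) ^ k) / fact k) *\<^sub>R (((**) A) ^^ k) (mat 1)" for k
    by (simp add: power_minus[of t])
  then show ?thesis unfolding mexp_def by simp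
qed

lemma mexp_commute:
  fixes A :: "real^'a^'a"
  shows "A ** mexp t A = mexp t A ** A"
proof -
  have c: "A ** (((**) A) ^^ k) (mat 1) = (((**) A) ^^ k) (mat 1) ** A" for k
  proof (induction k)
    case (Suc k)
    then show ?case by (simp only: funpow.simps o_def) (metis matrix_mul_assoc)
  qed simp
  have s: "summable (\<lambda>k. ((t ^ k) / fact k) *\<^sub>R (((**) A) ^^ k) (mat 1))"
    using mexp_sums(1) sums_summable by blast
  interpret bounded_bilinear "(**) :: real^'a^'a \<Rightarrow> real^'a^'a \<Rightarrow> real^'a^'a"
    by (rule bounded_bilinear_matrix_matrix_mult)
  show ?thesis
    unfolding mexp_def bounded_linear.suminf[OF bounded_linear_right s] bounded_linear.suminf[OF bounded_linear_left s]
    by (simp add: scaleR_left scaleR_right c)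
qed

lemma mexp_has_vector_derivative:
  fixes A :: "real^'a^'a"
  shows "((\<lambda>t. mexp t A) has_vector_derivative (A ** mexp t A)) (at t within S)"
proof -
  have e: "((\<lambda>t. mexp t A $ i $ j) has_real_derivative (A ** mexp t A) $ i $ j) (at t)" for i j
  proof -
    let ?c = "\<lambda>k. (((**) A) ^^ k) (mat 1) $ i $ j / fact k"
    have d: "((\<lambda>t. \<Sum>k. ?c k * t ^ k) has_real_derivative (\<Sum>k. diffs ?c k * t ^ k)) (at t)"
      by (rule termdiffs_strong_converges_everywhere) (rule mexp_entry_summable)
    have mult_entry: "(A ** B) $ i $ j = (\<Sum>l\<in>UNIV. A $ i $ l * B $ l $ j)" for B
      by (simp add: matrix_matrix_mult_def)
    \<comment> \<open>\<open>diffs\<close> turns the coefficients of A^k / k! into those of A^(k+1)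
      / k!, from which one factor A splits off.\<close>
    have dk: "diffs ?c k * t ^ k = (\<Sum>l\<in>UNIV. A $ i $ l * (((((**) A) ^^ k) (mat 1) $ l $ j / fact k) * t ^ k))" for k
    proof -
      have "diffs ?c k = (((**) A) ^^ Suc k) (mat 1) $ i $ j / fact k"
        unfolding diffs_def fact_Suc by (simp del: funpow.simps of_nat_Suc)
      also have "\<dots> = (\<Sum>l\<in>UNIV. A $ i $ l * ((((**) A) ^^ k) (mat 1) $ l $ j)) / fact k"
        by (simp add: matrix_matrix_mult_def)
      finally show ?thesis by (simp add: sum_divide_distrib sum_distrib_right mult.assoc)
    qed
    have "(\<Sum>k. diffs ?c k * t ^ k) = (\<Sum>l\<in>UNIV. \<Sum>k. A $ i $ l * (((((**) A) ^^ k) (mat 1) $ l $ j / fact k) * t ^ k))"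
      unfolding dk by (intro suminf_sum summable_mult mexp_entry_summable)
    also have "\<dots> = (A ** mexp t A) $ i $ j"
      unfolding mult_entry mexp_entry suminf_mult[OF mexp_entry_summable] ..
    finally show ?thesis using d by (simp add: mexp_entry)
  qed
  have "((\<lambda>t. mexp t A) has_vector_derivative (A ** mexp t A)) (at t)"
    unfolding has_vector_derivative_def
  proof (rule has_derivative_componentwise_within[THEN iffD2], intro ballI)
    fix u :: "real^'a^'a" assume "u \<in> Basis"
    then obtain i v where u1: "u = axis i v" "v \<in> Basis" unfolding Basis_vec_def[where 'b='a and 'a="real^'a"] by blast
    from u1(2) obtain j where v: "v = axis j 1" unfolding Basis_vec_def[where 'b='a and 'a=real] by auto
    have in_u: "M \<bullet> u = M $ i $ j" for M :: "real^'a^'a"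
      unfolding u1(1) v by (simp only: inner_axis) simp
    have "(\<lambda>x. x * (A ** mexp t A) $ i $ j) = (*) ((A ** mexp t A) $ i $ j)"
      by (rule ext) (rule mult.commute)
    then show "((\<lambda>x. mexp x A \<bullet> u) has_derivative (\<lambda>x. (x *\<^sub>R (A ** mexp t A)) \<bullet> u)) (at t)"
      unfolding in_u vector_scaleR_component real_scaleR_def
      using e[of i j, unfolded has_field_derivative_def] by argo
  qed
  then show ?thesis by (rule has_vector_derivative_at_within)
qed

lemma mexp_continuous_on: "continuous_on S (\<lambda>t. mexp t A)"
  using mexp_has_vector_derivative has_vector_derivative_continuous continuous_on_eq_continuous_within by metis

text \<open>The derivative of the product vanishes because \<open>A\<close> commutes with its
  exponential, and at zero the product is the identity.\<close>

lemma mexp_minus_mult: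
  fixes A :: "real^'a^'a"
  shows "mexp (- t) A ** mexp t A = mat 1"
proof -
  interpret bounded_bilinear "(**) :: real^'a^'a \<Rightarrow> real^'a^'a \<Rightarrow> real^'a^'a"
    by (rule bounded_bilinear_matrix_matrix_mult)
  have d: "((\<lambda>t. mexp (- t) A ** mexp t A) has_vector_derivative 0) (at t within UNIV)" for t
  proof -
    have "((\<lambda>t. mexp (- t) A) has_vector_derivative (- A ** mexp t (- A))) (at t within UNIV)"
      using mexp_has_vector_derivative[of "- A"] by (simp add: mexp_uminus)
    from has_vector_derivative[OF this mexp_has_vector_derivative[of A t UNIV]]
    show ?thesis
      using mexp_commute[of "-A" t]
      by (simp add: mexp_uminus minus_left minus_right matrix_mul_assoc)
  qed
  obtain c where c: "\<And>t. mexp (- t) A ** mexp t A = c"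
    by (rule has_vector_derivative_zero_constant[of UNIV "\<lambda>t. mexp (- t) A ** mexp t A"]) (use d in auto)
  have "c = mat 1" using c[of 0] by (simp add: mexp_0)
  then show ?thesis using c by simp
qed

lemma mexp_mult_minus: "mexp t A ** mexp (- t) A = mat 1"
  using mexp_minus_mult[of "- t" A] by simp

lemma mexp_bounded:
  fixes A :: "real^'a^'a"
  obtains c where "c > 0" "\<And>t v. t \<in> {a..b} \<Longrightarrow> norm (mexp t A *v v) \<le> c * norm v"
proof -
  have "bounded ((\<lambda>t. mexp t A) ` {a..b})"
    by (intro compact_imp_bounded compact_continuous_image mexp_continuous_on) auto
  then obtain B where B: "B > 0" "\<And>t. t \<in> {a..b} \<Longrightarrow> norm (mexp t A) \<le> B" by (auto simp: bounded_pos)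
  obtain D where D: "D > 0" and "\<forall>(M :: real^'a^'a) v. norm (M *v v) \<le> norm M * norm v * D"
    using bounded_bilinear.pos_bounded[OF bounded_bilinear_matrix_vector_mult[where 'n='a and 'm='a]] by auto
  then have D2: "norm (M *v v) \<le> norm M * norm v * D" for M :: "real^'a^'a" and v by simp
  show ?thesis
  proof (rule that[of "B * D"])
    show "norm (mexp t A *v v) \<le> B * D * norm v" if "t \<in> {a..b}" for t v
    proof -
      have "norm (mexp t A *v v) \<le> norm (mexp t A) * norm v * D" by (rule D2)
      also have "\<dots> \<le> B * norm v * D" using B(2)[OF that] D by (intro mult_right_mono) auto
      finally show ?thesis by (simp add: mult_ac)
    qed
  qed (use B D in auto)
qed

lemma mexp_vec_has_vector_derivative:
  "((\<lambda>t. mexp t A *v v) has_vector_derivative (mexp t A *v (A *v v))) (at t within S)"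
proof -
  have "bounded_linear (\<lambda>M :: real^'a^'a. M *v v)"
    by (rule bounded_bilinear.bounded_linear_left[OF bounded_bilinear_matrix_vector_mult])
  from bounded_linear.has_vector_derivative[OF this mexp_has_vector_derivative]
  show ?thesis by (simp add: mexp_commute matrix_vector_mul_assoc)
qed

section \<open>Integration by parts for the stochastic integral\<close>

text \<open>A metric for convergence in probability. Having a single number for each pair of random
  variables makes triangle inequalities and diagonal choices possible.\<close>

definition dprob :: "'a measure \<Rightarrow> ('a \<Rightarrow> 'b::euclidean_space) \<Rightarrow> ('a \<Rightarrow> 'b) \<Rightarrow> real" where
  "dprob P X Y = (\<integral>\<omega>. min 1 (dist (X \<omega>) (Y \<omega>)) \<partial>P)"

context prob_space
begin

lemma integrable_min_dist:
  fixes X Y :: "'a \<Rightarrow> 'b::euclidean_space"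
  assumes [measurable]: "X \<in> borel_measurable M" "Y \<in> borel_measurable M"
  shows "integrable M (\<lambda>\<omega>. min 1 (dist (X \<omega>) (Y \<omega>)))"
  by (rule integrable_const_bound[of _ 1]) auto

lemma dprob_nonneg: "0 \<le> dprob M X Y"
  unfolding dprob_def by (rule integral_nonneg_AE) auto

lemma dprob_commute: "dprob M X Y = dprob M Y X"
  by (simp add: dprob_def dist_commute)

lemma dprob_triangle:
  fixes X Y Z :: "'a \<Rightarrow> 'b::euclidean_space"
  assumes "X \<in> borel_measurable M" "Y \<in> borel_measurable M" "Z \<in> borel_measurable M"
  shows "dprob M X Z \<le> dprob M X Y + dprob M Y Z"
  unfolding dprob_def
  apply (subst Bochner_Integration.integral_add[symmetric])
    apply (intro integrable_min_dist assms)+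
  apply (intro integral_mono Bochner_Integration.integrable_add integrable_min_dist assms)
  subgoal for x using dist_triangle[of "X x" "Z x" "Y x"] zero_le_dist[of "X x" "Y x"] zero_le_dist[of "Y x" "Z x"] unfolding min_def by (smt (verit))
  done

lemma dprob_zero:
  fixes X Y :: "'a \<Rightarrow> 'b::euclidean_space"
  assumes "X \<in> borel_measurable M" "Y \<in> borel_measurable M" "dprob M X Y = 0"
  shows "AE \<omega> in M. X \<omega> = Y \<omega>"
proof -
  have "AE \<omega> in M. min 1 (dist (X \<omega>) (Y \<omega>)) = 0"
    using integral_nonneg_eq_0_iff_AE[OF integrable_min_dist[OF assms(1,2)]] assms(3) by (simp add: dprob_def)
  then show ?thesis by eventually_elim (auto simp: min_def split: if_splits)
qed

lemma dprob_tendsto_AE: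
  fixes X :: "nat \<Rightarrow> 'a \<Rightarrow> 'b::euclidean_space"
  assumes [measurable]: "\<And>n. X n \<in> borel_measurable M" "Y \<in> borel_measurable M"
    and "AE \<omega> in M. (\<lambda>n. X n \<omega>) \<longlonglongrightarrow> Y \<omega>"
  shows "(\<lambda>n. dprob M (X n) Y) \<longlonglongrightarrow> 0"
proof -
  have "(\<lambda>n. \<integral>\<omega>. min 1 (dist (X n \<omega>) (Y \<omega>)) \<partial>M) \<longlonglongrightarrow> (\<integral>\<omega>. 0 \<partial>M)"
  proof (rule integral_dominated_convergence[where w="\<lambda>_. 1"])
    show "AE x in M. (\<lambda>i. min 1 (dist (X i x) (Y x))) \<longlonglongrightarrow> 0"
      using assms(3)
    proof eventually_elim
      case (elim x)
      from tendsto_min[OF tendsto_const[of 1] iffD1[OF tendsto_dist_iff elim]]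
      show ?case by simp
    qed
  qed auto
  then show ?thesis by (simp add: dprob_def)
qed

lemma dprob_tendsto_conv_in_prob:
  fixes X :: "nat \<Rightarrow> 'a \<Rightarrow> 'b::euclidean_space"
  assumes [measurable]: "\<And>n. X n \<in> borel_measurable M" "Y \<in> borel_measurable M"
    and c: "conv_in_prob M X Y"
  shows "(\<lambda>n. dprob M (X n) Y) \<longlonglongrightarrow> 0"
proof (rule LIMSEQ_I)
  fix e :: real assume e: "0 < e"
  have "(\<lambda>k. measure M {\<omega> \<in> space M. dist (X k \<omega>) (Y \<omega>) > e / 2}) \<longlonglongrightarrow> 0"
    using c[unfolded conv_in_prob_def, rule_format, of "e / 2"] e by simp
  from LIMSEQ_D[OF this, of "e/2"] e obtain N where
    N: "\<And>n. n \<ge> N \<Longrightarrow> measure M {\<omega> \<in> space M. dist (X n \<omega>) (Y \<omega>) > e / 2} < e / 2" by auto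
  show "\<exists>N. \<forall>n\<ge>N. norm (dprob M (X n) Y - 0) < e"
  proof (intro exI allI impI)
    fix n assume n: "n \<ge> N"
    let ?S = "{\<omega> \<in> space M. dist (X n \<omega>) (Y \<omega>) > e / 2}"
    have iS: "integrable M (indicat_real ?S)" by (rule integrable_real_indicator) (auto simp: emeasure_eq_measure)
    have "dprob M (X n) Y \<le> (\<integral>\<omega>. e / 2 + indicator ?S \<omega> \<partial>M)"
      unfolding dprob_def
      by (intro integral_mono integrable_min_dist Bochner_Integration.integrable_add iS)
         (use e in \<open>auto simp: indicator_def min_def\<close>)
    also have "\<dots> = e / 2 + measure M ?S"
      by (subst Bochner_Integration.integral_add) (auto simp: integrable_real_indicator emeasure_eq_measure prob_space)
    also have "\<dots> < e" using N[OF n] by simp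
    finally show "norm (dprob M (X n) Y - 0) < e" using dprob_nonneg[of "X n" Y] by simp
  qed
qed

lemma dprob_tendsto_sum:
  fixes X :: "nat \<Rightarrow> 'i \<Rightarrow> 'a \<Rightarrow> 'b::euclidean_space" and B :: "'i \<Rightarrow> 'b \<Rightarrow> 'c::euclidean_space"
  assumes J: "finite J" and X: "\<And>n j. j \<in> J \<Longrightarrow> X n j \<in> borel_measurable M" and Y: "\<And>j. j \<in> J \<Longrightarrow> Y j \<in> borel_measurable M"
    and B: "\<And>j. j \<in> J \<Longrightarrow> bounded_linear (B j)"
    and c: "\<And>j. j \<in> J \<Longrightarrow> (\<lambda>n. dprob M (X n j) (Y j)) \<longlonglongrightarrow> 0"
  shows "(\<lambda>n. dprob M (\<lambda>\<omega>. \<Sum>j\<in>J. B j (X n j \<omega>)) (\<lambda>\<omega>. \<Sum>j\<in>J. B j (Y j \<omega>))) \<longlonglongrightarrow> 0"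
proof -
  \<comment> \<open>Constants of at least 1 are chosen so that one summand with distance at least 1
    already dominates the truncation at 1.\<close>
  have "\<exists>b\<ge>1. \<forall>x. norm (B j x) \<le> norm x * b" if j: "j \<in> J" for j
  proof -
    obtain b where "\<forall>x. norm (B j x) \<le> norm x * b" using bounded_linear.bounded[OF B[OF j]] by blast
    then have "norm (B j x) \<le> norm x * max 1 b" for x
      by (meson max.cobounded2 mult_left_mono norm_ge_zero order_trans)
    then show ?thesis by (intro exI[of _ "max 1 b"]) auto
  qed
  then obtain b where b: "\<And>j. j \<in> J \<Longrightarrow> 1 \<le> b j" "\<And>j x. j \<in> J \<Longrightarrow> norm (B j x) \<le> norm x * b j" by metis
  have Bm: "(\<lambda>\<omega>. B j (Z \<omega>)) \<in> borel_measurable M" if "j \<in> J" "Z \<in> borel_measurable M" for j Z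
    using measurable_compose[OF that(2) borel_measurable_continuous_onI[OF linear_continuous_on[OF B[OF that(1)]]]] by simp
  have le: "dprob M (\<lambda>\<omega>. \<Sum>j\<in>J. B j (X n j \<omega>)) (\<lambda>\<omega>. \<Sum>j\<in>J. B j (Y j \<omega>)) \<le> (\<Sum>j\<in>J. b j * dprob M (X n j) (Y j))" for n
  proof -
    have pt: "min 1 (dist (\<Sum>j\<in>J. B j (x j)) (\<Sum>j\<in>J. B j (y j))) \<le> (\<Sum>j\<in>J. b j * min 1 (dist (x j) (y j)))" (is "?l \<le> ?r") for x y
    proof (cases "\<exists>j\<in>J. dist (x j) (y j) \<ge> 1")
      case True
      then obtain j where j: "j \<in> J" "dist (x j) (y j) \<ge> 1" by auto
      have "1 \<le> b j * min 1 (dist (x j) (y j))" using b(1)[OF j(1)] j(2) by simp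
      also have "\<dots> \<le> ?r"
        using J j b(1) by (intro member_le_sum) (auto intro!: mult_nonneg_nonneg simp: order_trans[OF zero_le_one])
      finally show ?thesis by simp
    next
      case False
      have "?l \<le> norm (\<Sum>j\<in>J. B j (x j) - B j (y j))" by (simp add: dist_norm sum_subtractf)
      also have "\<dots> \<le> (\<Sum>j\<in>J. norm (B j (x j - y j)))"
        by (rule order_trans[OF norm_sum]) (auto intro!: sum_mono simp: linear_diff[OF bounded_linear.linear[OF B]])
      also have "\<dots> \<le> ?r"
      proof (rule sum_mono)
        fix j assume j: "j \<in> J"
        have "norm (B j (x j - y j)) \<le> norm (x j - y j) * b j" by (rule b(2)[OF j])
        also have "\<dots> = b j * min 1 (dist (x j) (y j))" using False j by (auto simp: dist_norm min_def)
        finally show "norm (B j (x j - y j)) \<le> b j * min 1 (dist (x j) (y j))" .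
      qed
      finally show ?thesis .
    qed
    have "dprob M (\<lambda>\<omega>. \<Sum>j\<in>J. B j (X n j \<omega>)) (\<lambda>\<omega>. \<Sum>j\<in>J. B j (Y j \<omega>)) \<le> (\<integral>\<omega>. (\<Sum>j\<in>J. b j * min 1 (dist (X n j \<omega>) (Y j \<omega>))) \<partial>M)"
      unfolding dprob_def
      by (intro integral_mono integrable_min_dist Bochner_Integration.integrable_sum integrable_mult_right borel_measurable_sum Bm pt X Y)
    also have "\<dots> = (\<Sum>j\<in>J. b j * dprob M (X n j) (Y j))"
      unfolding dprob_def
      by (subst Bochner_Integration.integral_sum) (auto intro!: integrable_mult_right integrable_min_dist X Y)
    finally show ?thesis .
  qed
  have "(\<lambda>n. \<Sum>j\<in>J. b j * dprob M (X n j) (Y j)) \<longlonglongrightarrow> (\<Sum>j\<in>J. b j * 0)"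
    by (intro tendsto_intros c)
  then have "(\<lambda>n. \<Sum>j\<in>J. b j * dprob M (X n j) (Y j)) \<longlonglongrightarrow> 0" by simp
  then show ?thesis
    by (rule tendsto_sandwich[OF _ _ tendsto_const, rotated 2]) (auto simp: le dprob_nonneg)
qed

end

section \<open>Step functions on dyadic partitions and Riemann sums with the matrix
  exponential\<close>

lemma step_fun_prefix:
  assumes "m \<le> m'" "\<And>i. m \<le> i \<Longrightarrow> s \<le> p i"
  shows "step_fun p c m s = step_fun p c m' s"
  unfolding step_fun_def
proof (rule sum.mono_neutral_left)
  show "\<forall>i\<in>{..<m'} - {..<m}. (if p i < s \<and> s \<le> p (Suc i) then c i else 0) = 0"
  proof
    fix i assume "i \<in> {..<m'} - {..<m}"
    then have "s \<le> p i" using assms(2) by simp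
    then show "(if p i < s \<and> s \<le> p (Suc i) then c i else 0) = 0" by simp
  qed
qed (use assms in auto)

lemma step_fun_dyadic:
  assumes "0 < t" "0 < s" "s \<le> t"
  obtains i where "i < 2 ^ k" "t * real i / 2 ^ k < s" "s \<le> t * real (Suc i) / 2 ^ k"
    "\<And>c :: nat \<Rightarrow> 'b::real_vector. step_fun (\<lambda>i. t * real i / 2 ^ k) c (2 ^ k) s = c i"
proof -
  define j where "j = nat \<lceil>s * 2 ^ k / t\<rceil>"
  have pos: "0 < s * 2 ^ k / t" using assms by simp
  then have jr: "real j = of_int \<lceil>s * 2 ^ k / t\<rceil>" unfolding j_def by (simp add: less_ceiling_iff le_of_int_ceiling order_trans)
  then have j1: "s * 2 ^ k / t \<le> real j" "real j < s * 2 ^ k / t + 1" by linarith+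
  have "j \<noteq> 0" using pos j1 by (intro notI) simp
  then obtain i where i: "j = Suc i" by (cases j) auto
  have a: "t * real i / 2 ^ k < s" "s \<le> t * real (Suc i) / 2 ^ k"
    using j1 assms(1) unfolding i by (simp_all add: field_simps)
  have "real i < 2 ^ k"
  proof -
    have "t * real i / 2 ^ k < t" using a assms by linarith
    then show ?thesis using assms(1) by (simp add: field_simps)
  qed
  then have i2: "i < 2 ^ k" by (metis of_nat_less_iff of_nat_numeral of_nat_power)
  have u: "i' = i" if "t * real i' / 2 ^ k < s" "s \<le> t * real (Suc i') / 2 ^ k" for i'
  proof -
    have "t * real i' / 2 ^ k < t * real (Suc i) / 2 ^ k" "t * real i / 2 ^ k < t * real (Suc i') / 2 ^ k" using a that by linarith+
    then show ?thesis using assms(1) by (simp add: divide_less_cancel mult_less_cancel_left)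
  qed
  have "step_fun (\<lambda>i. t * real i / 2 ^ k) c (2 ^ k) s = c i" for c :: "nat \<Rightarrow> 'b::real_vector"
  proof -
    have "step_fun (\<lambda>i. t * real i / 2 ^ k) c (2 ^ k) s = (\<Sum>i'\<in>{i}. if t * real i' / 2 ^ k < s \<and> s \<le> t * real (Suc i') / 2 ^ k then c i' else 0)"
      unfolding step_fun_def by (rule sum.mono_neutral_right) (use i2 u in auto)
    then show ?thesis using a by simp
  qed
  then show ?thesis using that i2 a by blast
qed

text \<open>A measurable function is almost everywhere a limit of continuous ones. Projecting these
  onto the ball of radius \<open>K\<close> keeps continuity and restores the bound, and uniform
  continuity allows their replacement by step functions on fine dyadic partitions. The condition
  \<open>n \<le> \<kappa> n\<close> makes the n-th partition refine all dyadic partitions of level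
  at most \<open>n\<close>.\<close>

lemma dyadic_step_approximation:
  fixes f :: "real \<Rightarrow> 'b::euclidean_space"
  assumes f: "f \<in> borel_measurable (restrict_space borel {0..T})" and K: "\<And>r. r \<in> {0..T} \<Longrightarrow> norm (f r) \<le> K"
    and t: "0 < t" "t \<le> T"
  obtains \<kappa> :: "nat \<Rightarrow> nat" and c :: "nat \<Rightarrow> nat \<Rightarrow> 'b"
  where "\<And>n. n \<le> \<kappa> n" "\<And>n i. norm (c n i) \<le> K"
    "AE s in lborel. s \<in> {0<..t} \<longrightarrow> (\<lambda>n. step_fun (\<lambda>i. t * real i / 2 ^ \<kappa> n) (c n) (2 ^ \<kappa> n) s) \<longlonglongrightarrow> f s"
proof -
  have "0 \<le> norm (f 0)" by simp
  then have K0: "0 \<le> K" using K[of 0] t by (simp add: order_trans[OF norm_ge_zero])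
  define f' where "f' = (\<lambda>x. indicator {0..T} x *\<^sub>R f x)"
  have "f' \<in> borel_measurable borel" unfolding f'_def
    using f by (subst (asm) borel_measurable_restrict_space_iff) auto
  then have "f' \<in> borel_measurable lebesgue"
    by (simp add: measurable_completion)
  then have "f' measurable_on UNIV"
    by (rule lebesgue_measurable_imp_measurable_on) simp
  then obtain N g where N: "negligible N" and g: "\<And>n. continuous_on UNIV (g n)" "\<And>x. x \<notin> N \<Longrightarrow> (\<lambda>n. g n x) \<longlonglongrightarrow> f' x"
    unfolding measurable_on_def by auto
  define h where "h n x = closest_point (cball 0 K) (g n x)" for n :: nat and x
  have cp: "convex (cball 0 K :: 'b set)" "closed (cball 0 K :: 'b set)" "(cball 0 K :: 'b set) \<noteq> {}"
    using K0 by auto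
  have hc: "continuous_on UNIV (h n)" for n
    unfolding h_def using continuous_on_compose[OF g(1)[of n] continuous_on_closest_point[OF cp, of "range (g n)"]] by (simp add: o_def)
  have hK: "norm (h n x) \<le> K" for n x
    using closest_point_in_set[OF cp(2,3), of "g n x"] by (simp add: h_def)
  have hl: "(\<lambda>n. h n x) \<longlonglongrightarrow> f x" if x: "x \<notin> N" "x \<in> {0..T}" for x
  proof -
    have "isCont (closest_point (cball 0 K)) (f' x)" by (rule continuous_at_closest_point[OF cp])
    from isCont_tendsto_compose[OF this g(2)[OF x(1)]]
    have "(\<lambda>n. h n x) \<longlonglongrightarrow> closest_point (cball 0 K) (f' x)" unfolding h_def .
    moreover have "closest_point (cball 0 K) (f' x) = f x"
      using x K[OF x(2)] by (simp add: f'_def closest_point_self)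
    ultimately show ?thesis by simp
  qed
  have "\<exists>k\<ge>n. \<forall>x\<in>{0..t}. \<forall>y\<in>{0..t}. \<bar>x - y\<bar> \<le> t / 2 ^ k \<longrightarrow> norm (h n x - h n y) < 1 / real (Suc n)" for n
  proof -
    have "uniformly_continuous_on {0..t} (h n)"
      by (intro compact_uniformly_continuous continuous_on_subset[OF hc]) auto
    then obtain d where d: "d > 0" "\<And>x y. x \<in> {0..t} \<Longrightarrow> y \<in> {0..t} \<Longrightarrow> dist x y < d \<Longrightarrow> dist (h n x) (h n y) < 1 / real (Suc n)"
      unfolding uniformly_continuous_on_def by (metis of_nat_0_less_iff zero_less_Suc zero_less_divide_1_iff)
    have "(\<lambda>k. t * (1/2) ^ k) \<longlonglongrightarrow> t * 0" by (intro tendsto_intros LIMSEQ_realpow_zero) auto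
    then have "eventually (\<lambda>k. t * (1/2) ^ k < d) sequentially"
      using d(1) by (simp add: order_tendstoD(2))
    then have "eventually (\<lambda>k. t * (1/2) ^ k < d \<and> k \<ge> n) sequentially"
      using eventually_ge_at_top[of n] by eventually_elim auto
    then obtain k where k: "t * (1/2) ^ k < d" "k \<ge> n" by (auto simp: eventually_sequentially)
    then show ?thesis
      using d(2) by (intro exI[of _ k]) (auto simp: dist_norm power_one_over)
  qed
  then obtain \<kappa> where \<kappa>: "\<And>n. n \<le> \<kappa> n" "\<And>n x y. x \<in> {0..t} \<Longrightarrow> y \<in> {0..t} \<Longrightarrow> \<bar>x - y\<bar> \<le> t / 2 ^ \<kappa> n \<Longrightarrow> norm (h n x - h n y) < 1 / real (Suc n)"
    by metis
  define c where "c n i = h n (min t (t * real (Suc i) / 2 ^ \<kappa> n))" for n i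
  have conv: "(\<lambda>n. step_fun (\<lambda>i. t * real i / 2 ^ \<kappa> n) (c n) (2 ^ \<kappa> n) s) \<longlonglongrightarrow> f s" if s: "s \<notin> N" "s \<in> {0<..t}" for s
  proof -
    have st: "0 < s" "s \<le> t" using s by auto
    have b: "norm (step_fun (\<lambda>i. t * real i / 2 ^ \<kappa> n) (c n) (2 ^ \<kappa> n) s - h n s) \<le> 1 / real (Suc n)" for n
    proof -
      obtain i where i: "i < 2 ^ \<kappa> n" "t * real i / 2 ^ \<kappa> n < s" "s \<le> t * real (Suc i) / 2 ^ \<kappa> n"
        "\<And>c :: nat \<Rightarrow> 'b. step_fun (\<lambda>i. t * real i / 2 ^ \<kappa> n) c (2 ^ \<kappa> n) s = c i"
        by (rule step_fun_dyadic[OF t(1) st, where k="\<kappa> n" and ?'b='b]) (rule that)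
      have "\<bar>min t (t * real (Suc i) / 2 ^ \<kappa> n) - s\<bar> \<le> t / 2 ^ \<kappa> n"
        using i(2,3) st by (simp add: field_simps min_def abs_if)
      then have "norm (c n i - h n s) < 1 / real (Suc n)"
        unfolding c_def using st i by (intro \<kappa>(2)) auto
      then show ?thesis unfolding i(4) by simp
    qed
    have "(\<lambda>n. step_fun (\<lambda>i. t * real i / 2 ^ \<kappa> n) (c n) (2 ^ \<kappa> n) s - h n s) \<longlonglongrightarrow> 0"
      by (rule Lim_null_comparison[OF always_eventually[OF allI] LIMSEQ_Suc[OF lim_1_over_n]]) (rule b)
    from tendsto_add[OF this hl[of s]] s t show ?thesis by simp
  qed
  have "AE s in lborel. s \<in> {0<..t} \<longrightarrow> (\<lambda>n. step_fun (\<lambda>i. t * real i / 2 ^ \<kappa> n) (c n) (2 ^ \<kappa> n) s) \<longlonglongrightarrow> f s"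
  proof -
    have "N \<in> null_sets lebesgue" using N by (simp add: negligible_iff_null_sets)
    then have "AE s in lebesgue. s \<notin> N" by (rule AE_not_in)
    then have "AE s in lborel. s \<notin> N" by (simp add: AE_completion_iff)
    then show ?thesis by eventually_elim (use conv in auto)
  qed
  then show ?thesis using that[of \<kappa> c] \<kappa>(1) hK by (simp add: c_def)
qed

lemma summation_by_parts:
  fixes G :: "nat \<Rightarrow> real^'n^'n" and x :: "nat \<Rightarrow> real^'n"
  shows "(\<Sum>j<n. G j *v (x (Suc j) - x j)) = G n *v x n - G 0 *v x 0 - (\<Sum>j<n. (G (Suc j) - G j) *v x (Suc j))"
proof (induction n)
  case (Suc n)
  then show ?case
    by (simp add: matrix_vector_mult_diff_distrib matrix_vector_mult_diff_rdistrib)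
qed simp

lemma mexp_integral:
  fixes A :: "real^'n^'n"
  assumes "a \<le> b"
  shows "(mexp (- b) A - mexp (- a) A) *v v = - (LINT r:{a..b}|lborel. mexp (- r) A *v (A *v v))"
proof -
  have c: "continuous_on {a..b} (\<lambda>r. mexp (- r) A *v (A *v v))"
    unfolding mexp_uminus
    by (intro bounded_bilinear.continuous_on[OF bounded_bilinear_matrix_vector_mult] mexp_continuous_on continuous_intros)
  have i: "set_integrable lborel {a..b} (\<lambda>r. mexp (- r) A *v (A *v v))"
    using borel_integrable_compact[of "{a..b}" "\<lambda>r. mexp (- r) A *v (A *v v)"] c
    by (auto simp: set_integrable_def indicator_scaleR_eq_if)
  have "((\<lambda>r. mexp r (- A) *v ((- A) *v v)) has_integral (mexp b (- A) *v v - mexp a (- A) *v v)) {a..b}"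
    by (rule fundamental_theorem_of_calculus[OF assms]) (rule mexp_vec_has_vector_derivative)
  moreover have "mexp r (- A) *v ((- A) *v v) = - (mexp (- r) A *v (A *v v))" for r
    by (simp add: mexp_uminus bounded_bilinear.minus_left[OF bounded_bilinear_matrix_vector_mult] bounded_bilinear.minus_right[OF bounded_bilinear_matrix_vector_mult])
  ultimately have "((\<lambda>r. - (mexp (- r) A *v (A *v v))) has_integral (mexp (- b) A - mexp (- a) A) *v v) {a..b}"
    by (simp add: mexp_uminus matrix_vector_mult_diff_rdistrib)
  from has_integral_neg[OF this] have "integral {a..b} (\<lambda>r. mexp (- r) A *v (A *v v)) = - ((mexp (- b) A - mexp (- a) A) *v v)"
    by (simp add: integral_unique)
  then show ?thesis by (simp add: set_borel_integral_eq_integral(2)[OF i])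
qed

lemma cadlag_mexp_integrand:
  fixes A :: "real^'n^'n"
  assumes x: "cadlag_on {0..t} x"
  shows "cadlag_on {0..t} (\<lambda>r. mexp (- r) A *v (A *v x r))"
proof -
  have "cadlag_on {0..t} (\<lambda>r. A *v x r)"
    by (rule cadlag_on_bilinear[OF bounded_bilinear_matrix_vector_mult cadlag_on_const x])
  moreover have "cadlag_on {0..t} (\<lambda>r. mexp (- r) A)"
    unfolding mexp_uminus by (rule continuous_imp_cadlag_on[OF mexp_continuous_on])
  ultimately show ?thesis
    using cadlag_on_bilinear[OF bounded_bilinear_matrix_vector_mult] by blast
qed

text \<open>Abel summation moves the increments from \<open>x\<close> to the exponential, whose
  increments are integrals of its derivative. The Riemann sum is therefore exactly the boundary
  terms plus an integral in which \<open>x\<close> is frozen at the right end of each cell. Only the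
  values of \<open>x\<close> enter, so its variation may be infinite, and right continuity suffices
  for the limit.\<close>

lemma riemann_sum_mexp:
  fixes A :: "real^'n^'n" and x :: "real \<Rightarrow> real^'n"
  assumes x: "cadlag_on {0..t} x" and t: "0 < t"
  shows "(\<lambda>N. \<Sum>j<2 ^ N. mexp (- (t * real j / 2 ^ N)) A *v (x (t * real (Suc j) / 2 ^ N) - x (t * real j / 2 ^ N)))
    \<longlonglongrightarrow> mexp (- t) A *v x t - x 0 + (LINT r:{0..t}|lborel. mexp (- r) A *v (A *v x r))"
proof -
  \<comment> \<open>The value of \<open>x\<close> at the right end of the dyadic cell containing
    \<open>r\<close>; the clipping keeps the argument in \<open>{0..t}\<close> for every real
    \<open>r\<close>.\<close>
  define h where "h N r = x (max 0 (min t (t * of_int \<lceil>r * 2 ^ N / t\<rceil> / 2 ^ N)))" for N :: nat and r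
  obtain X where "\<forall>r\<in>{0..t}. norm (x r) \<le> X"
    using cadlag_on_bounded[OF x] by (auto simp: bounded_iff)
  then have X: "\<And>r. r \<in> {0..t} \<Longrightarrow> norm (x r) \<le> X" by blast
  have hX: "norm (h N r) \<le> X" for N r unfolding h_def using t by (intro X) auto
  have hm: "h N \<in> borel_measurable borel" for N
  proof -
    have "(\<lambda>r. x (max 0 (min t (t * of_int \<lceil>r * 2 ^ N / t\<rceil> / 2 ^ N)))) \<in> borel_measurable borel"
      by measurable
    then show ?thesis unfolding h_def .
  qed
  obtain E where E: "E > 0" "\<And>r v. r \<in> {-t..0} \<Longrightarrow> norm (mexp r A *v v) \<le> E * norm v"
    by (rule mexp_bounded[of "-t" 0 A]) blast
  obtain a where a: "\<And>v. norm (A *v v) \<le> a * norm v" "a > 0"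
    using bounded_linear.pos_bounded[OF matrix_vector_mul_bounded_linear[of A]] by (auto simp: mult.commute)
  have bd: "norm (mexp (- r) A *v (A *v v)) \<le> E * (a * X)" if "r \<in> {0..t}" "norm v \<le> X" for r v
  proof -
    have "norm (mexp (- r) A *v (A *v v)) \<le> E * norm (A *v v)" using E(2)[of "- r"] that by auto
    also have "\<dots> \<le> E * (a * norm v)" using E(1) a(1) by (intro mult_left_mono) auto
    also have "\<dots> \<le> E * (a * X)" using E(1) a(2) that by (intro mult_left_mono) auto
    finally show ?thesis .
  qed
  have hint_m: "(\<lambda>r. mexp (- r) A *v (A *v h N r)) \<in> borel_measurable borel" for N
  proof -
    have 1: "(\<lambda>v. A *v v) \<in> borel_measurable borel"
      by (intro borel_measurable_continuous_onI linear_continuous_on matrix_vector_mul_bounded_linear)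
    have 2: "(\<lambda>p. mexp (- fst p) A *v snd p) \<in> borel_measurable (borel :: (real \<times> (real^'n)) measure)"
      by (intro borel_measurable_continuous_onI bounded_bilinear.continuous_on[OF bounded_bilinear_matrix_vector_mult]
           continuous_on_compose2[OF mexp_continuous_on[of UNIV A]] continuous_intros) auto
    have "(\<lambda>r. (r, A *v h N r)) \<in> borel_measurable borel"
      by (intro borel_measurable_Pair measurable_compose[OF hm 1]) auto
    from measurable_compose[OF this 2] show ?thesis by simp
  qed
  have hint: "set_integrable lborel {u..v} (\<lambda>r. mexp (- r) A *v (A *v h N r))" if "0 \<le> u" "v \<le> t" for N u v
    by (rule bounded_set_integrable[where K="E * (a * X)"])
       (use that hX bd in \<open>auto intro: measurable_restrict_space1[OF hint_m]\<close>)
  have hp: "h N r = x (t * real (Suc j) / 2 ^ N)"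
    if "t * real j / 2 ^ N < r" "r \<le> t * real (Suc j) / 2 ^ N" "j < 2 ^ N" for N r j
  proof -
    have "real j < r * 2 ^ N / t" "r * 2 ^ N / t \<le> real (Suc j)"
      using that(1,2) t by (simp_all add: field_simps)
    then have c: "\<lceil>r * 2 ^ N / t\<rceil> = int (Suc j)" by (intro ceiling_unique) auto
    have "real (Suc j) \<le> 2 ^ N" using that(3) by (metis Suc_leI of_nat_le_iff of_nat_numeral of_nat_power)
    then have "t * real (Suc j) \<le> t * 2 ^ N" using t by (intro mult_left_mono) auto
    then have "t * real (Suc j) / 2 ^ N \<le> t" by (simp add: divide_le_eq del: of_nat_Suc)
    then show ?thesis unfolding h_def c using t by (simp add: min_def max_def)
  qed
  have S: "(\<Sum>j<n. (mexp (- (t * real (Suc j) / 2 ^ N)) A - mexp (- (t * real j / 2 ^ N)) A) *v x (t * real (Suc j) / 2 ^ N))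
     = - (LINT r:{0..t * real n / 2 ^ N}|lborel. mexp (- r) A *v (A *v h N r))" if "n \<le> 2 ^ N" for n N
    using that
  proof (induction n)
    case 0
    have "(LINT r:{0..0}|lborel. mexp (- r) A *v (A *v h N r)) = 0"
      by (rule set_integral_singleton)
    then show ?case by simp
  next
    case (Suc n)
    let ?a = "t * real n / 2 ^ N" and ?b = "t * real (Suc n) / 2 ^ N"
    have ab: "0 \<le> ?a" "?a \<le> ?b" using t by (auto intro!: divide_right_mono mult_left_mono)
    have "real (Suc n) \<le> 2 ^ N" using Suc.prems by (metis of_nat_le_iff of_nat_numeral of_nat_power)
    then have "t * real (Suc n) \<le> t * 2 ^ N" using t by (intro mult_left_mono) auto
    then have bt: "?b \<le> t" by (simp add: divide_le_eq del: of_nat_Suc)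
    have "(LINT r:{?a..?b}|lborel. mexp (- r) A *v (A *v h N r)) = (LINT r:{?a..?b}|lborel. mexp (- r) A *v (A *v x ?b))"
      unfolding set_lebesgue_integral_def
    proof (rule integral_cong_AE)
      show "(\<lambda>r. indicat_real {?a..?b} r *\<^sub>R (mexp (- r) A *v (A *v h N r))) \<in> borel_measurable lborel"
        using hint_m[of N] by measurable
      have "continuous_on UNIV (\<lambda>r. mexp (- r) A *v (A *v x ?b))"
        unfolding mexp_uminus
        by (intro bounded_bilinear.continuous_on[OF bounded_bilinear_matrix_vector_mult] mexp_continuous_on continuous_intros)
      then have "(\<lambda>r. mexp (- r) A *v (A *v x ?b)) \<in> borel_measurable borel" by (rule borel_measurable_continuous_onI)
      then show "(\<lambda>r. indicat_real {?a..?b} r *\<^sub>R (mexp (- r) A *v (A *v x ?b))) \<in> borel_measurable lborel"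
        by measurable
      \<comment> \<open>At the left end point the ceiling returns that point itself, because the
        cells are open on the left; the exception is a null set.\<close>
      show "AE r in lborel. indicat_real {?a..?b} r *\<^sub>R (mexp (- r) A *v (A *v h N r)) = indicat_real {?a..?b} r *\<^sub>R (mexp (- r) A *v (A *v x ?b))"
        using AE_lborel_singleton[of ?a]
      proof eventually_elim
        case (elim r)
        then show ?case using hp[of n N r] Suc.prems by (cases "r \<in> {?a..?b}") auto
      qed
    qed
    moreover have "(LINT r:{0..?b}|lborel. mexp (- r) A *v (A *v h N r)) = (LINT r:{0..?a}|lborel. mexp (- r) A *v (A *v h N r)) + (LINT r:{?a..?b}|lborel. mexp (- r) A *v (A *v h N r))"
      by (rule set_integral_split[OF hint]) (use ab bt in auto)
    ultimately show ?case
      using Suc mexp_integral[OF ab(2), of A "x ?b"] by simp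
  qed
  have eq: "(\<Sum>j<2 ^ N. mexp (- (t * real j / 2 ^ N)) A *v (x (t * real (Suc j) / 2 ^ N) - x (t * real j / 2 ^ N)))
    = mexp (- t) A *v x t - x 0 + (LINT r:{0..t}|lborel. mexp (- r) A *v (A *v h N r))" for N
    using summation_by_parts[of "\<lambda>j. mexp (- (t * real j / 2 ^ N)) A" "\<lambda>j. x (t * real j / 2 ^ N)" "2 ^ N"] S[of "2 ^ N" N]
    by (simp add: mexp_0)
  have "(\<lambda>N. LINT r:{0..t}|lborel. mexp (- r) A *v (A *v h N r)) \<longlonglongrightarrow> (LINT r:{0..t}|lborel. mexp (- r) A *v (A *v x r))"
    unfolding set_lebesgue_integral_def
  proof (rule integral_dominated_convergence[where w="\<lambda>r. indicator {0..t} r *\<^sub>R (E * (a * X))"])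
    show "integrable lborel (\<lambda>r. indicat_real {0..t} r *\<^sub>R (E * (a * X)))"
      by (intro integrable_scaleR_left integrable_real_indicator) (auto simp: emeasure_lborel_Icc_eq)
    show "(\<lambda>r. indicat_real {0..t} r *\<^sub>R (mexp (- r) A *v (A *v h N r))) \<in> borel_measurable lborel" for N
      using hint_m[of N] by measurable
    show "(\<lambda>r. indicat_real {0..t} r *\<^sub>R (mexp (- r) A *v (A *v x r))) \<in> borel_measurable lborel"
      using cadlag_on_borel[OF cadlag_mexp_integrand[OF x, of A]] by (subst (asm) borel_measurable_restrict_space_iff) auto
    show "AE r in lborel. norm (indicat_real {0..t} r *\<^sub>R (mexp (- r) A *v (A *v h N r))) \<le> indicat_real {0..t} r *\<^sub>R (E * (a * X))" for N
      using bd hX by (intro AE_I2) (auto simp: indicator_def)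
    show "AE r in lborel. (\<lambda>N. indicat_real {0..t} r *\<^sub>R (mexp (- r) A *v (A *v h N r))) \<longlonglongrightarrow> indicat_real {0..t} r *\<^sub>R (mexp (- r) A *v (A *v x r))"
    proof (intro AE_I2)
      fix r
      show "(\<lambda>N. indicat_real {0..t} r *\<^sub>R (mexp (- r) A *v (A *v h N r))) \<longlonglongrightarrow> indicat_real {0..t} r *\<^sub>R (mexp (- r) A *v (A *v x r))"
      proof (cases "r \<in> {0..t}")
        case True
        let ?u = "\<lambda>N::nat. max 0 (min t (t * of_int \<lceil>r * 2 ^ N / t\<rceil> / 2 ^ N))"
        have lo: "r \<le> t * of_int \<lceil>r * 2 ^ N / t\<rceil> / 2 ^ N" for N :: nat
        proof -
          have "r * 2 ^ N / t \<le> of_int \<lceil>r * 2 ^ N / t\<rceil>" by linarith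
          then have "r * 2 ^ N \<le> t * of_int \<lceil>r * 2 ^ N / t\<rceil>" using t by (simp only: pos_divide_le_eq mult.commute)
          then show ?thesis by (simp add: pos_le_divide_eq)
        qed
        have hi: "t * of_int \<lceil>r * 2 ^ N / t\<rceil> / 2 ^ N \<le> r + t * (1/2) ^ N" for N :: nat
        proof -
          have "of_int \<lceil>r * 2 ^ N / t\<rceil> \<le> r * 2 ^ N / t + 1" by linarith
          then have "t * of_int \<lceil>r * 2 ^ N / t\<rceil> \<le> t * (r * 2 ^ N / t + 1)" using t by (intro mult_left_mono) auto
          then have "t * of_int \<lceil>r * 2 ^ N / t\<rceil> / 2 ^ N \<le> t * (r * 2 ^ N / t + 1) / 2 ^ N" by (rule divide_right_mono) simp
          also have "\<dots> = r + t * (1/2) ^ N" using t by (simp add: field_simps power_one_over)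
          finally show ?thesis .
        qed
        have "(\<lambda>N. r + t * (1/2) ^ N) \<longlonglongrightarrow> r + t * 0" by (intro tendsto_intros LIMSEQ_realpow_zero) auto
        then have "(\<lambda>N. r + t * (1/2) ^ N) \<longlonglongrightarrow> r" by simp
        then have ul: "?u \<longlonglongrightarrow> r"
        proof (rule tendsto_sandwich[OF _ _ tendsto_const, rotated 2])
          show "\<forall>\<^sub>F N in sequentially. r \<le> ?u N" using lo True by (auto simp: le_max_iff_disj)
          have p: "0 \<le> t * (1/2::real) ^ N" for N using t by simp
          show "\<forall>\<^sub>F N in sequentially. ?u N \<le> r + t * (1/2) ^ N"
            using hi True p by (intro always_eventually allI) (simp add: min_le_iff_disj)
        qed
        have "(\<lambda>N. x (?u N)) \<longlonglongrightarrow> x r"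
          by (rule cadlag_on_tendsto_right[OF x True _ _ ul]) (use lo True t in \<open>auto simp: le_max_iff_disj\<close>)
        then have hx: "(\<lambda>N. h N r) \<longlonglongrightarrow> x r" by (simp add: h_def)
        have "(\<lambda>N. A *v h N r) \<longlonglongrightarrow> A *v x r"
          by (rule bounded_bilinear.tendsto[OF bounded_bilinear_matrix_vector_mult tendsto_const hx])
        from bounded_bilinear.tendsto[OF bounded_bilinear_matrix_vector_mult tendsto_const this]
        show ?thesis using True by simp
      qed simp
    qed
  qed
  then show ?thesis unfolding eq by (intro tendsto_intros)
qed

text \<open>For \<open>t = 0\<close> the partition without any cell is admissible, so the integral
  is the limit of zero step integrals.\<close>

lemma stoch_int_at_0:
  assumes P: "prob_space P" and X: "is_stoch_int P L T f X" and T: "0 \<le> T"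
  shows "AE \<omega> in P. X 0 \<omega> = 0"
proof -
  interpret prob_space P by (rule P)
  have m[measurable]: "X 0 \<in> borel_measurable P" using X T unfolding is_stoch_int_def by auto
  have T0: "0 \<in> {0..T}" using T by simp
  have "conv_in_prob P (\<lambda>k. step_int L ((\<lambda>k i. 0) k) ((\<lambda>k i. 0) k) ((\<lambda>k. 0) k)) (X 0)"
  proof (rule X[unfolded is_stoch_int_def, rule_format, OF T0, THEN conjunct2, rule_format, of _ _ _ 0], intro conjI allI impI)
    show "AE s in lborel. s \<in> {0..0} \<longrightarrow> (\<lambda>k. step_fun (\<lambda>i. 0) (\<lambda>i. 0) 0 s) \<longlonglongrightarrow> f s"
      using AE_lborel_singleton[of 0] by eventually_elim auto
  qed auto
  then have "conv_in_prob P (\<lambda>k \<omega>. 0) (X 0)" by (simp add: step_int_def[abs_def])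
  from dprob_tendsto_conv_in_prob[OF _ m this] have "(\<lambda>n::nat. dprob P (\<lambda>\<omega>. 0) (X 0)) \<longlonglongrightarrow> 0" by simp
  then have "dprob P (\<lambda>\<omega>. 0) (X 0) = 0" using LIMSEQ_unique tendsto_const by blast
  then have "AE \<omega> in P. 0 = X 0 \<omega>" by (intro dprob_zero[OF _ m]) simp
  then show ?thesis by eventually_elim simp
qed

text \<open>If \<open>e^(-rA)\<close> is frozen on a coarse dyadic partition, the integral of \<open>e^(-rA) f(r)\<close> is exactly a
  Riemann sum over the increments of \<open>X\<close>, whose limit can be taken pathwise. A diagonal sequence of
  step functions identifies this limit with \<open>Y t\<close>.\<close>

lemma stoch_int_mexp_at:
  fixes A :: "real^'n^'n" and f :: "real \<Rightarrow> real^'d^'n" and L :: "real \<Rightarrow> 'a \<Rightarrow> real^'d"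
  assumes P: "prob_space P" and L: "\<And>t. 0 \<le> t \<Longrightarrow> L t \<in> borel_measurable P"
    and f: "f \<in> borel_measurable (restrict_space borel {0..T})" and fb: "bounded (f ` {0..T})"
    and X: "is_stoch_int P L T f X" and Xc: "AE \<omega> in P. cadlag_on {0..T} (\<lambda>t. X t \<omega>)"
    and Y: "is_stoch_int P L T (\<lambda>r. mexp (- r) A ** f r) Y" and t: "0 \<le> t" "t \<le> T"
  shows "AE \<omega> in P. Y t \<omega> = mexp (- t) A *v X t \<omega> + (LINT r:{0..t}|lborel. mexp (- r) A *v (A *v X r \<omega>))"
proof (cases "t = 0")
  case True
  have "0 \<le> T" using t by simp
  from stoch_int_at_0[OF P X this] stoch_int_at_0[OF P Y this]
  show ?thesis by eventually_elim (simp add: True set_integral_singleton[simplified])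
next
  case False
  then have t0: "0 < t" using t by simp
  interpret prob_space P by (rule P)
  have Xm: "X s \<in> borel_measurable P" if "0 \<le> s" "s \<le> T" for s using X that unfolding is_stoch_int_def by auto
  have Ym: "Y t \<in> borel_measurable P" using Y t unfolding is_stoch_int_def by auto
  obtain K where "\<forall>r\<in>{0..T}. norm (f r) \<le> K" using fb by (auto simp: bounded_iff)
  then have K: "\<And>r. r \<in> {0..T} \<Longrightarrow> norm (f r) \<le> K" by blast
  obtain \<kappa> c where \<kappa>: "\<And>n::nat. n \<le> \<kappa> n" and cK: "\<And>n i. norm (c n i) \<le> K"
    and conv: "AE s in lborel. s \<in> {0<..t} \<longrightarrow> (\<lambda>n. step_fun (\<lambda>i. t * real i / 2 ^ \<kappa> n) (c n) (2 ^ \<kappa> n) s) \<longlonglongrightarrow> f s"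
    by (rule dyadic_step_approximation[OF f K t0 t(2)]) (assumption, rule that)
  define p where "p n i = t * real i / 2 ^ \<kappa> n" for n and i :: nat
  define q where "q N j = t * real j / 2 ^ N" for N j :: nat
  define S where "S n m = step_int L (p n) (c n) m" for n m
  have p0: "0 \<le> p n i" for n i using t by (simp add: p_def)
  have pS: "p n i < p n (Suc i)" for n i using t0 by (simp add: p_def divide_strict_right_mono)
  have pmono: "p n i \<le> p n j" if "i \<le> j" for n i j
    using t0 that unfolding p_def by (intro divide_right_mono mult_left_mono) auto
  have qt1: "0 \<le> q N j" for N j using t by (simp add: q_def)
  have qt2: "q N j \<le> t" if "j \<le> 2 ^ N" for N j
  proof -
    have "real j \<le> 2 ^ N" using that by (metis of_nat_le_iff of_nat_numeral of_nat_power)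
    then have "t * real j \<le> t * 2 ^ N" using t0 by (intro mult_left_mono) auto
    then show ?thesis by (simp add: q_def divide_le_eq)
  qed
  have step_m: "step_int L (p n) d m \<in> borel_measurable P" for n m and d :: "nat \<Rightarrow> real^'d^'n"
    unfolding step_int_def
    by (intro borel_measurable_sum measurable_compose[OF borel_measurable_diff[OF L L] borel_measurable_continuous_onI[OF linear_continuous_on[OF matrix_vector_mul_bounded_linear]]] p0)
  have pow: "(2::real) ^ \<kappa> n = 2 ^ N * 2 ^ (\<kappa> n - N)" if "N \<le> n" for n N
    using order_trans[OF that \<kappa>[of n]] by (metis le_add_diff_inverse power_add)
  have pown: "(2::nat) ^ \<kappa> n = 2 ^ N * 2 ^ (\<kappa> n - N)" if "N \<le> n" for n N
    using order_trans[OF that \<kappa>[of n]] by (metis le_add_diff_inverse power_add)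
  have pq: "p n (j * 2 ^ (\<kappa> n - N)) = q N j" if "N \<le> n" for n N j
    unfolding p_def q_def pow[OF that] by simp
  \<comment> \<open>The shift by \<open>N\<close> ensures that the fine partition refines the dyadic
    one of level \<open>N\<close>; then \<open>q N j\<close> is one of its points, and the prefix up
    to it approximates \<open>X (q N j)\<close>.\<close>
  have Slim: "(\<lambda>n. dprob P (S (n + N) (j * 2 ^ (\<kappa> (n + N) - N))) (X (q N j))) \<longlonglongrightarrow> 0" if j: "j \<le> 2 ^ N" for N j
  proof (rule dprob_tendsto_conv_in_prob)
    show "S (n + N) (j * 2 ^ (\<kappa> (n + N) - N)) \<in> borel_measurable P" for n unfolding S_def by (rule step_m)
    have qT: "q N j \<in> {0..T}" using qt1[of N j] qt2[OF j] t by auto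
    then show "X (q N j) \<in> borel_measurable P" using Xm by auto
    have "conv_in_prob P (\<lambda>n. step_int L (p (n + N)) (c (n + N)) (j * 2 ^ (\<kappa> (n + N) - N))) (X (q N j))"
    proof (rule X[unfolded is_stoch_int_def, rule_format, OF qT, THEN conjunct2, rule_format, of "\<lambda>n. p (n + N)" "\<lambda>n. j * 2 ^ (\<kappa> (n + N) - N)" "\<lambda>n. c (n + N)" K], intro conjI allI impI)
      show "p (k + N) 0 = 0" for k by (simp add: p_def)
      show "p (k + N) (j * 2 ^ (\<kappa> (k + N) - N)) = q N j" for k by (rule pq) simp
      show "p (k + N) i < p (k + N) (Suc i)" for k i by (rule pS)
      show "norm (c (k + N) i) \<le> K" for k i by (rule cK)
      show "AE s in lborel. s \<in> {0..q N j} \<longrightarrow> (\<lambda>n. step_fun (p (n + N)) (c (n + N)) (j * 2 ^ (\<kappa> (n + N) - N)) s) \<longlonglongrightarrow> f s"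
        using conv AE_lborel_singleton[of 0]
      proof eventually_elim
        case (elim s)
        show ?case
        proof
          assume s: "s \<in> {0..q N j}"
          then have st: "s \<in> {0<..t}" using elim(2) qt2[OF j] by auto
          have "step_fun (p (n + N)) (c (n + N)) (j * 2 ^ (\<kappa> (n + N) - N)) s = step_fun (p (n + N)) (c (n + N)) (2 ^ \<kappa> (n + N)) s" for n
          proof (rule step_fun_prefix)
            show "j * 2 ^ (\<kappa> (n + N) - N) \<le> 2 ^ \<kappa> (n + N)" using pown[of N "n + N"] j by simp
            fix i assume "j * 2 ^ (\<kappa> (n + N) - N) \<le> i"
            from pmono[OF this, of "n + N"] pq[of N "n + N" j] s show "s \<le> p (n + N) i" by auto
          qed
          moreover have "(\<lambda>n. step_fun (p (n + N)) (c (n + N)) (2 ^ \<kappa> (n + N)) s) \<longlonglongrightarrow> f s"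
            using LIMSEQ_ignore_initial_segment[OF elim(1)[rule_format, OF st], of N] by (simp add: p_def[abs_def])
          ultimately show "(\<lambda>n. step_fun (p (n + N)) (c (n + N)) (j * 2 ^ (\<kappa> (n + N) - N)) s) \<longlonglongrightarrow> f s" by simp
        qed
      qed
    qed
    then show "conv_in_prob P (\<lambda>n. S (n + N) (j * 2 ^ (\<kappa> (n + N) - N))) (X (q N j))" by (simp add: S_def)
  qed
  define R where "R N \<omega> = (\<Sum>j<2 ^ N. mexp (- q N j) A *v (X (q N (Suc j)) \<omega> - X (q N j) \<omega>))" for N \<omega>
  \<comment> \<open>\<open>i div 2 ^ (\<kappa> n - N)\<close> is the index of the coarse cell of
    level \<open>N\<close> that contains the fine cell \<open>i\<close>; the exponential is frozen
    at the left end of the coarse cell.\<close>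
  define d where "d N n i = mexp (- q N (i div 2 ^ (\<kappa> n - N))) A ** c n i" for N n i
  have Rm: "R N \<in> borel_measurable P" for N
  proof -
    have "(\<lambda>\<omega>. \<Sum>j<2 ^ N. mexp (- q N j) A *v (X (q N (Suc j)) \<omega> - X (q N j) \<omega>)) \<in> borel_measurable P"
    proof (intro borel_measurable_sum measurable_compose[OF borel_measurable_diff borel_measurable_continuous_onI[OF linear_continuous_on[OF matrix_vector_mul_bounded_linear]]])
      fix j :: nat assume "j \<in> {..<2 ^ N}"
      then have "Suc j \<le> 2 ^ N" "j \<le> 2 ^ N" by auto
      then show "X (q N (Suc j)) \<in> borel_measurable P" "X (q N j) \<in> borel_measurable P"
        using Xm qt1 qt2 t by (meson order_trans)+
    qed
    then show ?thesis by (simp add: R_def[abs_def])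
  qed
  have dS: "step_int L (p n) (d N n) (2 ^ \<kappa> n) \<omega> =
      (\<Sum>j<2 ^ N. mexp (- q N j) A *v (S n (Suc j * 2 ^ (\<kappa> n - N)) \<omega> - S n (j * 2 ^ (\<kappa> n - N)) \<omega>))" if "N \<le> n" for n N \<omega>
  proof -
    let ?b = "2 ^ (\<kappa> n - N) :: nat"
    let ?g = "\<lambda>i. c n i *v (L (p n (Suc i)) \<omega> - L (p n i) \<omega>)"
    have "step_int L (p n) (d N n) (2 ^ \<kappa> n) \<omega> = (\<Sum>j<2 ^ N. \<Sum>i\<in>{j * ?b..<j * ?b + ?b}. d N n i *v (L (p n (Suc i)) \<omega> - L (p n i) \<omega>))"
      unfolding step_int_def pown[OF that] by (rule sum.nat_group[symmetric])
    also have "\<dots> = (\<Sum>j<2 ^ N. \<Sum>i\<in>{j * ?b..<j * ?b + ?b}. mexp (- q N j) A *v ?g i)"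
    proof (intro sum.cong refl)
      fix j i assume "i \<in> {j * ?b..<j * ?b + ?b}"
      then have "i div ?b = j" by (intro div_nat_eqI) (auto simp: mult.commute)
      then show "d N n i *v (L (p n (Suc i)) \<omega> - L (p n i) \<omega>) = mexp (- q N j) A *v ?g i"
        by (simp add: d_def matrix_vector_mul_assoc)
    qed
    also have "\<dots> = (\<Sum>j<2 ^ N. mexp (- q N j) A *v (S n (Suc j * ?b) \<omega> - S n (j * ?b) \<omega>))"
    proof (intro sum.cong refl)
      fix j :: nat
      have "S n (Suc j * ?b) \<omega> - S n (j * ?b) \<omega> = sum ?g {..<j * ?b + ?b} - sum ?g {..<j * ?b}"
        by (simp add: S_def step_int_def add.commute)
      also have "\<dots> = sum ?g {j * ?b..<j * ?b + ?b}"
        unfolding lessThan_atLeast0 by (rule sum_diff_nat_ivl) auto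
      finally show "(\<Sum>i\<in>{j * ?b..<j * ?b + ?b}. mexp (- q N j) A *v ?g i) = mexp (- q N j) A *v (S n (Suc j * ?b) \<omega> - S n (j * ?b) \<omega>)"
        by (simp add: linear_sum[OF matrix_vector_mul_linear])
    qed
    finally show ?thesis .
  qed
  have Dlim: "(\<lambda>n. dprob P (step_int L (p (n + N)) (d N (n + N)) (2 ^ \<kappa> (n + N))) (R N)) \<longlonglongrightarrow> 0" for N
  proof -
    let ?B = "\<lambda>j (v :: real^'n). mexp (- q N j) A *v v"
    let ?S = "\<lambda>n j \<omega>. S (n + N) (Suc j * 2 ^ (\<kappa> (n + N) - N)) \<omega> - S (n + N) (j * 2 ^ (\<kappa> (n + N) - N)) \<omega>"
    have Sm: "S n m \<in> borel_measurable P" for n m unfolding S_def by (rule step_m)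
    have "(\<lambda>n. dprob P (\<lambda>\<omega>. \<Sum>j<2 ^ N. ?B j (?S n j \<omega>)) (\<lambda>\<omega>. \<Sum>j<2 ^ N. ?B j (X (q N (Suc j)) \<omega> - X (q N j) \<omega>))) \<longlonglongrightarrow> 0"
    proof (rule dprob_tendsto_sum[where X="\<lambda>n j \<omega>. ?S n j \<omega>" and Y="\<lambda>j \<omega>. X (q N (Suc j)) \<omega> - X (q N j) \<omega>"])
      fix j :: nat assume "j \<in> {..<2 ^ N}"
      then have j: "Suc j \<le> 2 ^ N" "j \<le> 2 ^ N" by auto
      show "?S n j \<in> borel_measurable P" for n by (intro borel_measurable_diff Sm)
      have Xqm: "X (q N (Suc j)) \<in> borel_measurable P" "X (q N j) \<in> borel_measurable P"
        using j Xm qt1 qt2 t by (meson order_trans)+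
      then show "(\<lambda>\<omega>. X (q N (Suc j)) \<omega> - X (q N j) \<omega>) \<in> borel_measurable P" by (rule borel_measurable_diff)
      show "bounded_linear (?B j)" by (rule matrix_vector_mul_bounded_linear)
      \<comment> \<open>The difference is written as a signed sum over \<open>bool\<close>, so that
        \<open>dprob_tendsto_sum\<close> also gives the convergence of increments.\<close>
      let ?x = "\<lambda>n e. S (n + N) ((if e then Suc j else j) * 2 ^ (\<kappa> (n + N) - N))" and ?y = "\<lambda>e. X (q N (if e then Suc j else j))"
      have "(\<lambda>n. dprob P (\<lambda>\<omega>. \<Sum>e\<in>UNIV. (if e then 1 else -1::real) *\<^sub>R ?x n e \<omega>) (\<lambda>\<omega>. \<Sum>e\<in>UNIV. (if e then 1 else -1::real) *\<^sub>R ?y e \<omega>)) \<longlonglongrightarrow> 0"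
        by (rule dprob_tendsto_sum[where X="?x" and Y="?y"])
           (use j Slim Sm Xqm in \<open>auto intro: bounded_linear_scaleR_right\<close>)
      then show "(\<lambda>n. dprob P (?S n j) (\<lambda>\<omega>. X (q N (Suc j)) \<omega> - X (q N j) \<omega>)) \<longlonglongrightarrow> 0"
        by (simp add: UNIV_bool)
    qed auto
    moreover have "step_int L (p (n + N)) (d N (n + N)) (2 ^ \<kappa> (n + N)) = (\<lambda>\<omega>. \<Sum>j<2 ^ N. ?B j (?S n j \<omega>))" for n
      by (rule ext, rule dS) simp
    ultimately show ?thesis by (simp add: R_def[abs_def])
  qed
  \<comment> \<open>The diagonal choice: for each coarse level \<open>N\<close>, a fine level at
    which the step integral is already close to the Riemann sum \<open>R N\<close>.\<close>
  have "\<exists>n\<ge>N. dprob P (step_int L (p n) (d N n) (2 ^ \<kappa> n)) (R N) < 1 / real (Suc N)" for N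
  proof -
    have "eventually (\<lambda>n. dprob P (step_int L (p (n + N)) (d N (n + N)) (2 ^ \<kappa> (n + N))) (R N) < 1 / real (Suc N)) sequentially"
      by (rule order_tendstoD(2)[OF Dlim]) simp
    then show ?thesis unfolding eventually_sequentially by (metis le_add2 order_refl)
  qed
  then obtain n where n: "\<And>N. N \<le> n N" "\<And>N. dprob P (step_int L (p (n N)) (d N (n N)) (2 ^ \<kappa> (n N))) (R N) < 1 / real (Suc N)"
    by metis
  define D where "D N = step_int L (p (n N)) (d N (n N)) (2 ^ \<kappa> (n N))" for N
  have Dm: "D N \<in> borel_measurable P" for N unfolding D_def by (rule step_m)
  have DR: "(\<lambda>N. dprob P (D N) (R N)) \<longlonglongrightarrow> 0"
    by (rule tendsto_sandwich[OF always_eventually always_eventually tendsto_const LIMSEQ_Suc[OF lim_1_over_n]])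
       (use n(2) in \<open>auto simp: dprob_nonneg D_def intro: less_imp_le\<close>)
  have nlim: "filterlim n at_top sequentially"
    by (rule filterlim_at_top_mono[OF filterlim_ident]) (use n(1) in simp)
  \<comment> \<open>\<open>is_stoch_int\<close> asks for one bound on the coefficients of all step
    functions in the sequence.\<close>
  obtain K' where K': "\<And>N (i :: nat). i < 2 ^ \<kappa> (n N) \<Longrightarrow> norm (d N (n N) i) \<le> K'" 
  proof -
    have "bounded ((\<lambda>t. mexp t A) ` {-T..0})"
      by (intro compact_imp_bounded compact_continuous_image mexp_continuous_on) auto
    then obtain B where B: "B > 0" "\<And>r. r \<in> {-T..0} \<Longrightarrow> norm (mexp r A) \<le> B" by (auto simp: bounded_pos)
    obtain E where E: "E > 0" and "\<forall>(M :: real^'n^'n) (v :: real^'d^'n). norm (M ** v) \<le> norm M * norm v * E"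
      using bounded_bilinear.pos_bounded[OF bounded_bilinear_matrix_matrix_mult[where 'n='n and 'm='n and 'p='d]] by auto
    then have E2: "norm (M ** v) \<le> norm M * norm v * E" for M :: "real^'n^'n" and v :: "real^'d^'n" by simp
    have K0: "0 \<le> K" using cK[of 0 0] by (simp add: order_trans[OF norm_ge_zero])
    have B2: "norm (mexp (- q N j) A ** v) \<le> B * K * E" if "norm v \<le> K" "j < 2 ^ N" for N j and v :: "real^'d^'n"
    proof -
      have "norm (mexp (- q N j) A) \<le> B" using qt1[of N j] qt2[of j N] that(2) t by (intro B(2)) auto
      then have "norm (mexp (- q N j) A) * norm v * E \<le> B * K * E" using that K0 E B by (intro mult_right_mono mult_mono) auto
      then show ?thesis using E2 order_trans by blast
    qed
    show ?thesis
    proof (rule that[of "B * K * E"])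
      fix N i :: nat assume "i < 2 ^ \<kappa> (n N)"
      then have "i div 2 ^ (\<kappa> (n N) - N) < 2 ^ N"
        unfolding pown[OF n(1)[of N]] by (rule less_mult_imp_div_less)
      then show "norm (d N (n N) i) \<le> B * K * E" unfolding d_def by (rule B2[OF cK])
    qed
  qed
  have DY: "(\<lambda>N. dprob P (D N) (Y t)) \<longlonglongrightarrow> 0"
  proof (rule dprob_tendsto_conv_in_prob[OF Dm Ym])
    have tT: "t \<in> {0..T}" using t by simp
    have "conv_in_prob P (\<lambda>N. step_int L (p (n N)) (d N (n N)) (2 ^ \<kappa> (n N))) (Y t)"
    proof (rule Y[unfolded is_stoch_int_def, rule_format, OF tT, THEN conjunct2, rule_format, of "\<lambda>N. p (n N)" "\<lambda>N. 2 ^ \<kappa> (n N)" "\<lambda>N. d N (n N)" K'], intro conjI allI impI)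
      show "p (n N) 0 = 0" "p (n N) (2 ^ \<kappa> (n N)) = t" for N by (simp_all add: p_def)
      show "p (n N) i < p (n N) (Suc i)" for N i by (rule pS)
      show "norm (d N (n N) i) \<le> K'" if "i < 2 ^ \<kappa> (n N)" for N i by (rule K'[OF that])
      show "AE s in lborel. s \<in> {0..t} \<longrightarrow> (\<lambda>N. step_fun (p (n N)) (d N (n N)) (2 ^ \<kappa> (n N)) s) \<longlonglongrightarrow> mexp (- s) A ** f s"
        using conv AE_lborel_singleton[of 0]
      proof eventually_elim
        case (elim s)
        show ?case
        proof
          assume "s \<in> {0..t}"
          then have st: "s \<in> {0<..t}" using elim(2) by auto
          have "\<exists>u. \<bar>u - s\<bar> \<le> t * (1/2) ^ N \<and> step_fun (p (n N)) (d N (n N)) (2 ^ \<kappa> (n N)) s = mexp (- u) A ** step_fun (p (n N)) (c (n N)) (2 ^ \<kappa> (n N)) s" for N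
          proof -
            have st': "0 < s" "s \<le> t" using st by auto
            obtain i where i: "i < 2 ^ \<kappa> (n N)" "t * real i / 2 ^ \<kappa> (n N) < s" "s \<le> t * real (Suc i) / 2 ^ \<kappa> (n N)"
              "\<And>c :: nat \<Rightarrow> real^'d^'n. step_fun (\<lambda>i. t * real i / 2 ^ \<kappa> (n N)) c (2 ^ \<kappa> (n N)) s = c i"
              by (rule step_fun_dyadic[OF t0 st', where k="\<kappa> (n N)" and ?'b="real^'d^'n"]) (rule that)
            let ?b = "2 ^ (\<kappa> (n N) - N) :: nat"
            define j where "j = i div ?b"
            have "j * ?b \<le> i" unfolding j_def by (rule div_times_less_eq_dividend)
            then have 1: "q N j \<le> p (n N) i" using pmono pq[OF n(1)] by metis
            have "i < Suc j * ?b" unfolding j_def by (metis mod_less_divisor mult.commute dividend_less_times_div zero_less_power zero_less_numeral mult_Suc_right mult_Suc)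
            then have "Suc i \<le> Suc j * ?b" by simp
            then have 2: "p (n N) (Suc i) \<le> q N (Suc j)" using pmono pq[OF n(1)] by metis
            have 3: "q N (Suc j) = q N j + t * (1/2) ^ N" by (simp add: q_def field_simps power_one_over)
            have "\<bar>q N j - s\<bar> \<le> t * (1/2) ^ N" using 1 2 3 i(2,3) by (simp add: p_def)
            moreover have "step_fun (p (n N)) (d N (n N)) (2 ^ \<kappa> (n N)) s = mexp (- q N j) A ** step_fun (p (n N)) (c (n N)) (2 ^ \<kappa> (n N)) s"
              unfolding p_def i(4) by (simp add: d_def j_def)
            ultimately show ?thesis by blast
          qed
          then obtain u where u: "\<And>N. \<bar>u N - s\<bar> \<le> t * (1/2) ^ N"
            "\<And>N. step_fun (p (n N)) (d N (n N)) (2 ^ \<kappa> (n N)) s = mexp (- u N) A ** step_fun (p (n N)) (c (n N)) (2 ^ \<kappa> (n N)) s" by metis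
          have "(\<lambda>N. t * (1/2) ^ N) \<longlonglongrightarrow> t * 0" by (intro tendsto_intros LIMSEQ_realpow_zero) auto
          then have t00: "(\<lambda>N. t * (1/2) ^ N) \<longlonglongrightarrow> 0" by simp
          have us: "u \<longlonglongrightarrow> s"
            by (rule LIM_zero_cancel, rule Lim_null_comparison[OF always_eventually t00]) (use u(1) in simp)
          have "isCont (\<lambda>r. mexp r A) (- s)"
            using mexp_continuous_on[of UNIV A] by (simp add: continuous_on_eq_continuous_at)
          from isCont_tendsto_compose[OF this tendsto_minus[OF us]]
          have m: "(\<lambda>N. mexp (- u N) A) \<longlonglongrightarrow> mexp (- s) A" .
          have "(\<lambda>N. step_fun (p (n N)) (c (n N)) (2 ^ \<kappa> (n N)) s) \<longlonglongrightarrow> f s"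
            using filterlim_compose[OF elim(1)[rule_format, OF st] nlim] by (simp add: p_def[abs_def])
          from bounded_bilinear.tendsto[OF bounded_bilinear_matrix_matrix_mult m this]
          show "(\<lambda>N. step_fun (p (n N)) (d N (n N)) (2 ^ \<kappa> (n N)) s) \<longlonglongrightarrow> mexp (- s) A ** f s"
            unfolding u(2) .
        qed
      qed
    qed
    then show "conv_in_prob P D (Y t)" by (simp add: D_def[abs_def])
  qed
  \<comment> \<open>The comparison in \<open>dprob\<close> needs a measurable limit;
    \<open>Z\<close> is measurable by construction and equals the pathwise formula almost
    surely.\<close>
  define Z where "Z \<omega> = lim (\<lambda>N. R N \<omega>)" for \<omega>
  have Zm: "Z \<in> borel_measurable P" unfolding Z_def[abs_def] by (rule borel_measurable_lim_metric[OF Rm])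
  have T0: "0 \<le> T" using t by simp
  have RZ: "AE \<omega> in P. (\<lambda>N. R N \<omega>) \<longlonglongrightarrow> mexp (- t) A *v X t \<omega> + (LINT r:{0..t}|lborel. mexp (- r) A *v (A *v X r \<omega>))"
    using Xc stoch_int_at_0[OF P X T0]
  proof eventually_elim
    case (elim \<omega>)
    have "cadlag_on {0..t} (\<lambda>r. X r \<omega>)" by (rule cadlag_on_subset[OF elim(1)]) (use t in auto)
    from riemann_sum_mexp[OF this t0, of A] elim(2) show ?case by (simp add: R_def q_def)
  qed
  have "AE \<omega> in P. (\<lambda>N. R N \<omega>) \<longlonglongrightarrow> Z \<omega>"
    using RZ by eventually_elim (simp add: Z_def limI)
  from dprob_tendsto_AE[OF Rm Zm this] have RZ0: "(\<lambda>N. dprob P (R N) Z) \<longlonglongrightarrow> 0" .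
  have le: "dprob P (Y t) Z \<le> dprob P (D N) (Y t) + dprob P (D N) (R N) + dprob P (R N) Z" for N
    using dprob_triangle[OF Ym Dm[of N] Zm] dprob_triangle[OF Dm[of N] Rm[of N] Zm] by (simp add: dprob_commute)
  have "dprob P (Y t) Z \<le> 0"
    by (rule LIMSEQ_le_const[OF tendsto_add_zero[OF tendsto_add_zero[OF DY DR] RZ0]]) (use le in blast)
  then have "dprob P (Y t) Z = 0" using dprob_nonneg[of "Y t" Z] by simp
  from dprob_zero[OF Ym Zm this] RZ show ?thesis
    by eventually_elim (simp add: Z_def limI)
qed

text \<open>Both sides are cadlag in \<open>t\<close>, so the exceptional sets of countably many
  times suffice.\<close>

theorem stoch_int_mexp:
  fixes A :: "real^'n^'n" and f :: "real \<Rightarrow> real^'d^'n" and L :: "real \<Rightarrow> 'a \<Rightarrow> real^'d"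
  assumes P: "prob_space P" and L: "\<And>t. 0 \<le> t \<Longrightarrow> L t \<in> borel_measurable P"
    and f: "f \<in> borel_measurable (restrict_space borel {0..T})" and fb: "bounded (f ` {0..T})"
    and X: "is_stoch_int P L T f X" and Xc: "AE \<omega> in P. cadlag_on {0..T} (\<lambda>t. X t \<omega>)"
    and Y: "is_stoch_int P L T (\<lambda>r. mexp (- r) A ** f r) Y" and Yc: "AE \<omega> in P. cadlag_on {0..T} (\<lambda>t. Y t \<omega>)"
    and T: "0 \<le> T"
  shows "AE \<omega> in P. \<forall>t\<in>{0..T}. Y t \<omega> = mexp (- t) A *v X t \<omega> + (LINT r:{0..t}|lborel. mexp (- r) A *v (A *v X r \<omega>))"
proof -
  have "AE \<omega> in P. \<forall>t\<in>right_dense 0 T. Y t \<omega> = mexp (- t) A *v X t \<omega> + (LINT r:{0..t}|lborel. mexp (- r) A *v (A *v X r \<omega>))"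
    using stoch_int_mexp_at[OF P L f fb X Xc Y] right_dense_subset[OF T]
    by (subst AE_ball_countable[OF countable_right_dense]) auto
  with Xc Yc show ?thesis
  proof eventually_elim
    case (elim \<omega>)
    have i: "cadlag_on {0..T} (\<lambda>r. mexp (- r) A *v (A *v X r \<omega>))" by (rule cadlag_mexp_integrand[OF elim(1)])
    obtain B where "\<forall>r\<in>{0..T}. norm (mexp (- r) A *v (A *v X r \<omega>)) \<le> B"
      using cadlag_on_bounded[OF i] by (auto simp: bounded_iff)
    then have c2: "continuous_on {0..T} (\<lambda>t. LINT r:{0..t}|lborel. mexp (- r) A *v (A *v X r \<omega>))"
      by (intro set_integral_indefinite_continuous[OF cadlag_on_borel[OF i], of B]) blast
    have "cadlag_on {0..T} (\<lambda>t. mexp (- t) A *v X t \<omega>)"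
      unfolding mexp_uminus
      by (rule cadlag_on_bilinear[OF bounded_bilinear_matrix_vector_mult continuous_imp_cadlag_on[OF mexp_continuous_on] elim(1)])
    from cadlag_on_eqI[OF elim(2) cadlag_on_add[OF this continuous_imp_cadlag_on[OF c2]] elim(3)[rule_format]]
    show ?case by blast
  qed
qed

section \<open>Filtrations and the change of variables\<close>

text \<open>Turns adaptedness into membership in \<open>borel_measurable\<close>, so that
  compositions and limits of adapted variables are handled by the usual measurability rules.\<close>

definition FLM :: "'a measure \<Rightarrow> (real \<Rightarrow> 'a \<Rightarrow> real^'d) \<Rightarrow> real \<Rightarrow> real \<Rightarrow> 'a measure" where
  "FLM P L s t = sigma (space P) (FL P L s t)"

lemma sigma_algebra_FL: "sigma_algebra (space P) (FL P L s t)"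
proof -
  define G where "G = sigma_sets (space P) {(\<lambda>\<omega>. L r \<omega> - L s \<omega>) -` B \<inter> space P | r B. r \<in> {s..t} \<and> B \<in> sets borel}"
  have sG: "sigma_algebra (space P) G" unfolding G_def by (rule sigma_algebra_sigma_sets) auto
  interpret G: sigma_algebra "space P" G by (rule sG)
  have FL: "A \<in> FL P L s t \<longleftrightarrow> A \<subseteq> space P \<and> (\<exists>B\<in>G. \<exists>N\<in>null_sets P. (A - B) \<union> (B - A) \<subseteq> N)" for A
    unfolding FL_def Let_def G_def by (rule mem_Collect_eq)
  show ?thesis
    unfolding sigma_algebra_iff2
  proof (intro conjI ballI allI impI)
    show "FL P L s t \<subseteq> Pow (space P)"
    proof
      fix A assume "A \<in> FL P L s t"
      then show "A \<in> Pow (space P)" unfolding FL by blast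
    qed
    have "{} \<in> G" by (rule G.empty_sets)
    moreover have "{} \<in> null_sets P" by simp
    ultimately show "{} \<in> FL P L s t" unfolding FL by blast
    show "space P - A \<in> FL P L s t" if A: "A \<in> FL P L s t" for A
    proof -
      obtain B N where B: "A \<subseteq> space P" "B \<in> G" "N \<in> null_sets P" "(A - B) \<union> (B - A) \<subseteq> N" using A unfolding FL by blast
      have "(space P - A - (space P - B)) \<union> (space P - B - (space P - A)) \<subseteq> N" using B(4) by blast
      moreover have "space P - B \<in> G" using B(2) by (rule G.compl_sets)
      ultimately show ?thesis unfolding FL using B(3) by blast
    qed
    fix A :: "nat \<Rightarrow> 'a set" assume "range A \<subseteq> FL P L s t"
    then have "A i \<in> FL P L s t" for i by blast
    then have A: "A i \<subseteq> space P" "\<exists>p. fst p \<in> G \<and> snd p \<in> null_sets P \<and> (A i - fst p) \<union> (fst p - A i) \<subseteq> snd p" for i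
      unfolding FL by force+
    have "\<forall>i. \<exists>p. fst p \<in> G \<and> snd p \<in> null_sets P \<and> (A i - fst p) \<union> (fst p - A i) \<subseteq> snd p"
      using A(2) by blast
    from choice[OF this] obtain p where p: "\<And>i. fst (p i) \<in> G" "\<And>i. snd (p i) \<in> null_sets P" "\<And>i. (A i - fst (p i)) \<union> (fst (p i) - A i) \<subseteq> snd (p i)"
      by blast
    have "(\<Union>i. fst (p i)) \<in> G" using p(1) by (intro G.countable_UN) auto
    moreover have "(\<Union>i. snd (p i)) \<in> null_sets P" using p(2) by (rule null_sets_UN)
    moreover have "((\<Union>i. A i) - (\<Union>i. fst (p i))) \<union> ((\<Union>i. fst (p i)) - (\<Union>i. A i)) \<subseteq> (\<Union>i. snd (p i))" using p(3) by blast
    moreover have "(\<Union>i. A i) \<subseteq> space P" using A(1) by blast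
    ultimately show "(\<Union>i. A i) \<in> FL P L s t" unfolding FL by blast
  qed
qed

lemma space_FLM [simp]: "space (FLM P L s t) = space P"
  and sets_FLM: "sets (FLM P L s t) = FL P L s t"
  using sigma_algebra.space_measure_of_eq[OF sigma_algebra_FL] sigma_algebra.sets_measure_of_eq[OF sigma_algebra_FL]
  by (simp_all add: FLM_def)

lemma FLM_measurable_iff:
  "V \<in> borel_measurable (FLM P L s t) \<longleftrightarrow> (\<forall>B\<in>sets borel. V -` B \<inter> space P \<in> FL P L s t)"
  by (auto simp: measurable_def sets_FLM)

text \<open>An increment from \<open>s'\<close> is the difference of two increments from
  \<open>s\<close>.\<close>

lemma FL_mono:
  assumes "s \<le> s'" "s' \<le> t'" "t' \<le> t"
  shows "FL P L s' t' \<subseteq> FL P L s t"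
proof -
  define gen where "gen s t = {(\<lambda>\<omega>. L r \<omega> - L s \<omega>) -` B \<inter> space P | r B. r \<in> {s..t} \<and> B \<in> sets borel}" for s t
  define M where "M = sigma (space P) (gen s t)"
  have M: "space M = space P" "sets M = sigma_sets (space P) (gen s t)"
    unfolding M_def by (auto simp: gen_def intro!: space_measure_of sets_measure_of)
  have meas: "(\<lambda>\<omega>. L r \<omega> - L s \<omega>) \<in> borel_measurable M" if "r \<in> {s..t}" for r
    using that by (auto simp: measurable_def M gen_def intro!: sigma_sets.Basic)
  have "gen s' t' \<subseteq> sigma_sets (space P) (gen s t)"
  proof
    fix X assume "X \<in> gen s' t'"
    then obtain r B where X: "X = (\<lambda>\<omega>. L r \<omega> - L s' \<omega>) -` B \<inter> space P" "r \<in> {s'..t'}" "B \<in> sets borel" by (auto simp: gen_def)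
    have "(\<lambda>\<omega>. (L r \<omega> - L s \<omega>) - (L s' \<omega> - L s \<omega>)) \<in> borel_measurable M"
      by (intro borel_measurable_diff meas) (use X assms in auto)
    then have "(\<lambda>\<omega>. L r \<omega> - L s' \<omega>) \<in> borel_measurable M" by simp
    from measurable_sets[OF this X(3)] show "X \<in> sigma_sets (space P) (gen s t)" by (simp add: X(1) M)
  qed
  then have "sigma_sets (space P) (gen s' t') \<subseteq> sigma_sets (space P) (gen s t)"
    by (rule sigma_sets_mono)
  then show ?thesis unfolding FL_def Let_def gen_def by blast
qed

lemma FLM_mono:
  assumes "s \<le> s'" "s' \<le> t'" "t' \<le> t" "V \<in> borel_measurable (FLM P L s' t')"
  shows "V \<in> borel_measurable (FLM P L s t)"
  using assms FL_mono[OF assms(1-3)] unfolding FLM_measurable_iff by blast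

text \<open>This is what the completion in \<open>FL\<close> is for: an almost surely equal
  modification of an adapted variable stays adapted.\<close>

lemma FLM_AE:
  fixes U V :: "'a \<Rightarrow> 'b::topological_space"
  assumes P: "complete_measure P" and V: "V \<in> borel_measurable (FLM P L s t)" and ae: "AE \<omega> in P. V \<omega> = U \<omega>"
  shows "U \<in> borel_measurable (FLM P L s t)"
  unfolding FLM_measurable_iff
proof
  interpret complete_measure P by (rule P)
  fix B :: "'b set" assume "B \<in> sets borel"
  then have "V -` B \<inter> space P \<in> FL P L s t" using V FLM_measurable_iff by blast
  then obtain G N where G: "G \<in> sigma_sets (space P) {(\<lambda>\<omega>. L r \<omega> - L s \<omega>) -` B \<inter> space P | r B. r \<in> {s..t} \<and> B \<in> sets borel}"
    "N \<in> null_sets P" "(V -` B \<inter> space P - G) \<union> (G - V -` B \<inter> space P) \<subseteq> N"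
    unfolding FL_def Let_def by blast
  obtain N' where N': "N' \<in> null_sets P" "{\<omega> \<in> space P. V \<omega> \<noteq> U \<omega>} \<subseteq> N'"
    using ae by (auto elim!: AE_E simp: null_sets_def)
  have "N \<union> N' \<in> null_sets P" using G N' by auto
  moreover have "(U -` B \<inter> space P - G) \<union> (G - U -` B \<inter> space P) \<subseteq> N \<union> N'"
  proof -
    have "G \<subseteq> space P" by (rule sigma_sets_into_sp[OF _ G(1)]) auto
    moreover have "V x = U x" if "x \<in> space P" "x \<notin> N'" for x using N'(2) that by blast
    ultimately show ?thesis using G(3) by (auto simp: subset_iff)
  qed
  ultimately show "U -` B \<inter> space P \<in> FL P L s t" unfolding FL_def Let_def using G(1) by blast
qed

lemma FLM_subalgebra:
  fixes L :: "real \<Rightarrow> 'a \<Rightarrow> real^'d"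
  assumes P: "complete_measure P" and L: "\<And>t. 0 \<le> t \<Longrightarrow> L t \<in> borel_measurable P" and s: "0 \<le> s"
    and V: "V \<in> borel_measurable (FLM P L s t)"
  shows "V \<in> borel_measurable P"
proof -
  interpret complete_measure P by (rule P)
  have "FL P L s t \<subseteq> sets P"
  proof
    fix A assume "A \<in> FL P L s t"
    then obtain B N where A: "A \<subseteq> space P" "B \<in> sigma_sets (space P) {(\<lambda>\<omega>. L r \<omega> - L s \<omega>) -` B \<inter> space P | r B. r \<in> {s..t} \<and> B \<in> sets borel}"
      "N \<in> null_sets P" "(A - B) \<union> (B - A) \<subseteq> N" unfolding FL_def Let_def by blast
    have "sigma_sets (space P) {(\<lambda>\<omega>. L r \<omega> - L s \<omega>) -` B \<inter> space P | r B. r \<in> {s..t} \<and> B \<in> sets borel} \<subseteq> sets P"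
    proof (rule sets.sigma_sets_subset, clarify)
      fix r and B :: "(real^'d) set" assume "r \<in> {s..t}" "B \<in> sets borel"
      then show "(\<lambda>\<omega>. L r \<omega> - L s \<omega>) -` B \<inter> space P \<in> sets P"
        using s by (intro measurable_sets[OF borel_measurable_diff[OF L L]]) auto
    qed
    then have B: "B \<in> sets P" using A(2) by blast
    have 0: "A - B \<subseteq> N" "B - A \<subseteq> N" using A(4) by blast+
    have 1: "A - B \<in> sets P" "B - A \<in> sets P" by (rule complete[OF 0(1) A(3)], rule complete[OF 0(2) A(3)])
    have "A = (B - (B - A)) \<union> (A - B)" by blast
    moreover have "(B - (B - A)) \<union> (A - B) \<in> sets P" by (intro sets.Un sets.Diff B 1)
    ultimately show "A \<in> sets P" by simp
  qed
  then show ?thesis using V unfolding FLM_measurable_iff by (auto simp: measurable_def)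
qed

text \<open>The derivative vanishes everywhere. This takes the place of a product rule for functions
  that are only differentiable almost everywhere.\<close>

lemma quadratic_increment_constant:
  fixes H :: "real \<Rightarrow> 'b::real_normed_vector"
  assumes "\<And>t t'. a \<le> t \<Longrightarrow> t \<le> t' \<Longrightarrow> t' \<le> b \<Longrightarrow> norm (H t' - H t) \<le> C * (t' - t)\<^sup>2" and t: "t \<in> {a..b}"
  shows "H t = H a"
proof -
  have q: "norm (H y - H x) \<le> C * \<bar>y - x\<bar> * \<bar>y - x\<bar>" if "x \<in> {a..b}" "y \<in> {a..b}" for x y
    using assms(1)[of x y] assms(1)[of y x] that by (cases "x \<le> y") (auto simp: norm_minus_commute power2_eq_square mult.assoc)
  have "(H has_derivative (\<lambda>h. 0)) (at x within {a..b})" if x: "x \<in> {a..b}" for x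
    unfolding has_derivative_within
  proof (intro conjI bounded_linear_zero)
    have "((\<lambda>y. C * \<bar>y - x\<bar>) \<longlongrightarrow> C * \<bar>x - x\<bar>) (at x within {a..b})"
      by (intro tendsto_intros)
    then have l0: "((\<lambda>y. C * \<bar>y - x\<bar>) \<longlongrightarrow> 0) (at x within {a..b})" by simp
    have "eventually (\<lambda>y. norm ((1 / norm (y - x)) *\<^sub>R (H y - (H x + 0))) \<le> C * \<bar>y - x\<bar>) (at x within {a..b})"
      unfolding eventually_at_filter
    proof (intro always_eventually allI impI)
      fix y assume "y \<noteq> x" "y \<in> {a..b}"
      then show "norm ((1 / norm (y - x)) *\<^sub>R (H y - (H x + 0))) \<le> C * \<bar>y - x\<bar>"
        using q[OF x, of y] by (simp add: divide_le_eq)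
    qed
    from Lim_null_comparison[OF this l0] show "((\<lambda>y. (1 / norm (y - x)) *\<^sub>R (H y - (H x + 0))) \<longlongrightarrow> 0) (at x within {a..b})" .
  qed
  then obtain c where "\<And>x. x \<in> {a..b} \<Longrightarrow> H x = c"
    using has_derivative_zero_constant[of "{a..b}" H] by auto
  then show ?thesis using t by auto
qed

lemma mexp_integrand_measurable:
  fixes A :: "real^'n^'n"
  assumes "g \<in> borel_measurable (restrict_space borel S)"
  shows "(\<lambda>r. mexp (- r) A *v g r) \<in> borel_measurable (restrict_space borel S)"
proof -
  have 2: "(\<lambda>p. mexp (- fst p) A *v snd p) \<in> borel_measurable (borel :: (real \<times> (real^'n)) measure)"
    by (intro borel_measurable_continuous_onI bounded_bilinear.continuous_on[OF bounded_bilinear_matrix_vector_mult]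
         continuous_on_compose2[OF mexp_continuous_on[of UNIV A]] continuous_intros) auto
  have "(\<lambda>r. (r, g r)) \<in> borel_measurable (restrict_space borel S)"
    by (rule borel_measurable_Pair) (use assms in \<open>auto intro: measurable_restrict_space1\<close>)
  from measurable_compose[OF this 2] show ?thesis by simp
qed

lemma matrix_vector_bound:
  fixes A :: "real^'n^'n"
  obtains a where "0 < a" "\<And>v. norm (A *v v) \<le> a * norm v"
proof -
  obtain a where "0 < a" "\<forall>v. norm (A *v v) \<le> norm v * a"
    using bounded_linear.pos_bounded[OF matrix_vector_mul_bounded_linear[of A]] by blast
  then show ?thesis by (intro that[of a]) (simp_all add: mult.commute)
qed

text \<open>As \<open>F\<close> is merely measurable, \<open>N\<close> is Lipschitz but need not be
  differentiable at every point. The difference \<open>H\<close> of the two sides has increments of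
  quadratic order, however, and is therefore constant.\<close>

lemma mexp_integration_by_parts:
  fixes A :: "real^'n^'n" and F :: "real \<Rightarrow> real^'n"
  assumes s: "0 \<le> s" and F: "F \<in> borel_measurable (restrict_space borel {s..T})" and K: "\<And>r. r \<in> {s..T} \<Longrightarrow> norm (F r) \<le> K"
    and N: "\<And>t. t \<in> {s..T} \<Longrightarrow> N t = c + (LINT r:{s..t}|lborel. F r)" and t: "t \<in> {s..T}"
  shows "mexp (- t) A *v N t = mexp (- s) A *v c + (LINT r:{s..t}|lborel. mexp (- r) A *v (F r - A *v N r))"
proof -
  have K0: "0 \<le> K" using K[OF t] norm_ge_zero order_trans by blast
  have Fi: "set_integrable lborel {u..v} F" if "s \<le> u" "v \<le> T" for u v
    by (rule set_integrable_subset[OF bounded_set_integrable[OF F K]]) (use that in auto)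
  have Nc: "continuous_on {s..T} N"
  proof -
    have "continuous_on {s..T} (\<lambda>t. c + (LINT r:{s..t}|lborel. F r))"
      by (intro continuous_intros set_integral_indefinite_continuous[OF F, of K]) (rule K)
    then show ?thesis by (subst continuous_on_cong[OF refl N]) auto
  qed
  have Ninc: "N v - N u = (LINT r:{u..v}|lborel. F r)" "norm (N v - N u) \<le> K * (v - u)" if "s \<le> u" "u \<le> v" "v \<le> T" for u v
  proof -
    show e: "N v - N u = (LINT r:{u..v}|lborel. F r)"
      using set_integral_split[OF Fi[of s v], of u] N[of u] N[of v] that by auto
    show "norm (N v - N u) \<le> K * (v - u)"
      unfolding e by (rule set_integral_bound[OF Fi]) (use that K in auto)
  qed
  obtain E where E: "E > 0" "\<And>r v. r \<in> {-T..0} \<Longrightarrow> norm (mexp r A *v v) \<le> E * norm v" by (rule mexp_bounded[of "-T" 0 A]) blast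
  obtain a where a: "0 < a" "\<And>v. norm (A *v v) \<le> a * norm v" by (rule matrix_vector_bound[of A]) blast
  let ?G = "\<lambda>r. F r - A *v N r"
  have Nm: "N \<in> borel_measurable (restrict_space borel {s..T})" by (rule borel_measurable_continuous_on_restrict[OF Nc])
  have ANm: "(\<lambda>r. A *v N r) \<in> borel_measurable (restrict_space borel {s..T})"
    by (rule measurable_compose[OF Nm]) (intro borel_measurable_continuous_onI linear_continuous_on matrix_vector_mul_bounded_linear)
  have Gm: "(\<lambda>r. mexp (- r) A *v ?G r) \<in> borel_measurable (restrict_space borel {s..T})"
    by (intro mexp_integrand_measurable borel_measurable_diff F ANm)
  have Nb: "norm (N r) \<le> norm c + K * T" if "r \<in> {s..T}" for r
  proof -
    have "N s = c" using N[of s] that by (simp add: set_integral_singleton[simplified])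
    then have "norm (N r - c) \<le> K * (r - s)" using Ninc(2)[of s r] that by auto
    also have "\<dots> \<le> K * T" using that s K0 by (intro mult_left_mono) auto
    finally show ?thesis using norm_triangle_sub[of "N r" c] by simp
  qed
  have ANi: "norm (A *v N r) \<le> a * (norm c + K * T)" if "r \<in> {s..T}" for r
    using a(2)[of "N r"] Nb[OF that] a(1) by (meson mult_left_mono less_imp_le order_trans)
  have Eb: "norm (mexp (- r) A *v v) \<le> E * norm v" if "r \<in> {s..T}" for r v using E(2)[of "- r" v] that s by auto
  have Gi: "set_integrable lborel {u..v} (\<lambda>r. mexp (- r) A *v ?G r)" if "s \<le> u" "v \<le> T" for u v
  proof (rule set_integrable_subset[OF bounded_set_integrable[OF Gm]])
    fix r assume r: "r \<in> {s..T}"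
    have "norm (mexp (- r) A *v ?G r) \<le> E * norm (?G r)" by (rule Eb[OF r])
    also have "\<dots> \<le> E * (K + a * (norm c + K * T))"
      using E(1) K[OF r] ANi[OF r] norm_triangle_ineq4[of "F r" "A *v N r"] by (intro mult_left_mono) auto
    finally show "norm (mexp (- r) A *v ?G r) \<le> E * (K + a * (norm c + K * T))" .
  qed (use that in auto)
  define H where "H t = mexp (- t) A *v N t - (LINT r:{s..t}|lborel. mexp (- r) A *v ?G r)" for t
  have Glip: "norm ((mexp (- v) A - mexp (- r) A) *v w) \<le> E * a * norm w * (v - r)" if "s \<le> r" "r \<le> v" "v \<le> T" for r v w
  proof -
    have "continuous_on {r..v} (\<lambda>q. mexp (- q) A *v (A *v w))"
      unfolding mexp_uminus by (intro bounded_bilinear.continuous_on[OF bounded_bilinear_matrix_vector_mult] mexp_continuous_on continuous_intros)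
    then have "(\<lambda>q. mexp (- q) A *v (A *v w)) \<in> borel_measurable (restrict_space borel {r..v})" by (rule borel_measurable_continuous_on_restrict)
    moreover have bd: "norm (mexp (- q) A *v (A *v w)) \<le> E * a * norm w" if "q \<in> {r..v}" for q
    proof -
      have "norm (mexp (- q) A *v (A *v w)) \<le> E * norm (A *v w)" using that \<open>s \<le> r\<close> \<open>v \<le> T\<close> by (intro Eb) auto
      also have "\<dots> \<le> E * (a * norm w)" using E(1) a(2) by (intro mult_left_mono) auto
      finally show ?thesis by (simp add: mult.assoc)
    qed
    ultimately show ?thesis
      unfolding mexp_integral[OF that(2)] norm_minus_cancel
      by (intro set_integral_bound bounded_set_integrable that(2))
  qed
  have "H t = H s"
  proof (rule quadratic_increment_constant[where C="E * a * K + E * a * K", OF _ t])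
    fix u v assume uv: "s \<le> u" "u \<le> v" "v \<le> T"
    have i1: "set_integrable lborel {u..v} (\<lambda>r. mexp (- v) A *v F r)"
    proof (rule set_integrable_subset[OF bounded_set_integrable[where s=s and t=T and K="E * K"]])
      show "(\<lambda>r. mexp (- v) A *v F r) \<in> borel_measurable (restrict_space borel {s..T})"
        by (rule measurable_compose[OF F]) (intro borel_measurable_continuous_onI linear_continuous_on matrix_vector_mul_bounded_linear)
      show "norm (mexp (- v) A *v F r) \<le> E * K" if "r \<in> {s..T}" for r
        using Eb[of v "F r"] K[OF that] E(1) uv by (meson atLeastAtMost_iff less_imp_le mult_left_mono order_trans)
    qed (use uv in auto)
    have i2: "set_integrable lborel {u..v} (\<lambda>r. mexp (- r) A *v (A *v N u))"
    proof -
      have "continuous_on {s..T} (\<lambda>q. mexp (- q) A *v (A *v N u))"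
        unfolding mexp_uminus by (intro bounded_bilinear.continuous_on[OF bounded_bilinear_matrix_vector_mult] mexp_continuous_on continuous_intros)
      then show ?thesis
        using uv borel_integrable_compact[of "{u..v}" "\<lambda>q. mexp (- q) A *v (A *v N u)"] continuous_on_subset[of "{s..T}" _ "{u..v}"]
        by (auto simp: set_integrable_def indicator_scaleR_eq_if)
    qed
    have "H v - H u = (mexp (- v) A *v N v - mexp (- u) A *v N u) - (LINT r:{u..v}|lborel. mexp (- r) A *v ?G r)"
      using set_integral_split[OF Gi[of s v], of u] uv by (simp add: H_def)
    also have "mexp (- v) A *v N v - mexp (- u) A *v N u = mexp (- v) A *v (N v - N u) + (mexp (- v) A - mexp (- u) A) *v N u"
      by (simp add: matrix_vector_mult_diff_distrib matrix_vector_mult_diff_rdistrib)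
    also have "mexp (- v) A *v (N v - N u) = (LINT r:{u..v}|lborel. mexp (- v) A *v F r)"
      unfolding Ninc(1)[OF uv] set_lebesgue_integral_def
      using integral_bounded_linear[OF matrix_vector_mul_bounded_linear, of lborel "\<lambda>x. indicat_real {u..v} x *\<^sub>R F x" "mexp (- v) A"] Fi[OF uv(1,3)]
      by (simp add: set_integrable_def matrix_vector_mult_scaleR)
    also have "(mexp (- v) A - mexp (- u) A) *v N u = - (LINT r:{u..v}|lborel. mexp (- r) A *v (A *v N u))"
      by (rule mexp_integral[OF uv(2)])
    also have "(LINT r:{u..v}|lborel. mexp (- v) A *v F r) + - (LINT r:{u..v}|lborel. mexp (- r) A *v (A *v N u)) - (LINT r:{u..v}|lborel. mexp (- r) A *v ?G r)
      = (LINT r:{u..v}|lborel. (mexp (- v) A *v F r - mexp (- r) A *v (A *v N u)) - mexp (- r) A *v ?G r)"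
      using i1 i2 Gi[OF uv(1,3)] by (simp add: set_integral_diff)
    finally have He: "H v - H u = (LINT r:{u..v}|lborel. (mexp (- v) A *v F r - mexp (- r) A *v (A *v N u)) - mexp (- r) A *v ?G r)" .
    have "norm (H v - H u) \<le> ((E * a * K + E * a * K) * (v - u)) * (v - u)"
      unfolding He
    proof (rule set_integral_bound)
      show "set_integrable lborel {u..v} (\<lambda>r. mexp (- v) A *v F r - mexp (- r) A *v (A *v N u) - mexp (- r) A *v ?G r)"
        by (intro set_integral_diff(1) i1 i2 Gi uv(1,3))
      fix r assume r: "r \<in> {u..v}"
      have rT: "r \<in> {s..T}" using r uv by auto
      \<comment> \<open>After the cancellations only an increment of the exponential and an
        increment of \<open>N\<close> within \<open>{u..v}\<close> are left. Both are of order
        \<open>v - u\<close>, and the integration over \<open>{u..v}\<close> supplies the second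
        power.\<close>
      have eq: "mexp (- v) A *v F r - mexp (- r) A *v (A *v N u) - mexp (- r) A *v ?G r
          = (mexp (- v) A - mexp (- r) A) *v F r + mexp (- r) A *v (A *v (N r - N u))"
        by (simp add: matrix_vector_mult_diff_distrib matrix_vector_mult_diff_rdistrib)
      have 1: "norm ((mexp (- v) A - mexp (- r) A) *v F r) \<le> E * a * K * (v - u)"
      proof -
        have "norm ((mexp (- v) A - mexp (- r) A) *v F r) \<le> E * a * norm (F r) * (v - r)" by (rule Glip) (use r uv in auto)
        also have "\<dots> \<le> E * a * K * (v - u)" using E(1) a(1) K[OF rT] K0 r by (intro mult_mono mult_left_mono) auto
        finally show ?thesis .
      qed
      have 2: "norm (mexp (- r) A *v (A *v (N r - N u))) \<le> E * a * K * (v - u)"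
      proof -
        have "norm (mexp (- r) A *v (A *v (N r - N u))) \<le> E * norm (A *v (N r - N u))" by (rule Eb[OF rT])
        also have "\<dots> \<le> E * (a * norm (N r - N u))" using E(1) a(2) by (intro mult_left_mono) auto
        also have "\<dots> \<le> E * (a * (K * (r - u)))" using E(1) a(1) Ninc(2)[of u r] r uv by (intro mult_left_mono) auto
        also have "\<dots> \<le> E * (a * (K * (v - u)))" using E(1) a(1) K0 r by (intro mult_left_mono) auto
        finally show ?thesis by (simp add: mult.assoc)
      qed
      show "norm (mexp (- v) A *v F r - mexp (- r) A *v (A *v N u) - mexp (- r) A *v ?G r) \<le> (E * a * K + E * a * K) * (v - u)"
        unfolding eq using norm_triangle_le[OF add_mono[OF 1 2]] by (simp add: distrib_right)
    qed (use uv in auto)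
    then show "norm (H v - H u) \<le> (E * a * K + E * a * K) * (v - u)\<^sup>2" by (simp add: power2_eq_square mult.assoc)
  qed
  moreover have "H s = mexp (- s) A *v c" using N[of s] t by (simp add: H_def set_integral_singleton[simplified])
  ultimately show ?thesis by (simp add: H_def algebra_simps)
qed

text \<open>Integration by parts is applied to \<open>V - N\<close>, which is Lipschitz along each
  path although \<open>V\<close> jumps; the transformed noise is supplied by the pathwise formula
  for \<open>N'\<close>. Used with \<open>A\<close> it leads from (E) to (D), with
  \<open>- A\<close> back again. The argument \<open>max s t\<close> freezes the exponential before
  \<open>s\<close>, where the process has to stay constant.\<close>

lemma strong_sol_mexp:
  fixes A :: "real^'n^'n" and F :: "real \<Rightarrow> real^'n \<Rightarrow> real^'n"
  assumes s: "s \<in> {0..T}"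
    and Fm: "(\<lambda>(t, x). F t x) \<in> borel_measurable (restrict_space borel ({0..T} \<times> UNIV))"
    and Fb: "\<And>R. \<exists>K. \<forall>t\<in>{0..T}. \<forall>x. norm x \<le> R \<longrightarrow> norm (F t x) \<le> K"
    and Nc: "AE \<omega> in P. cadlag_on {0..T} (\<lambda>t. N t \<omega>)"
    and NN: "AE \<omega> in P. \<forall>t\<in>{0..T}. N' t \<omega> = mexp (- t) A *v N t \<omega> + (LINT r:{0..t}|lborel. mexp (- r) A *v (A *v N r \<omega>))"
    and V: "strong_sol P L T s x F N V"
  shows "strong_sol P L T s (mexp (- s) A *v x) (\<lambda>r u. mexp (- r) A *v (F r (mexp r A *v u) - A *v (mexp r A *v u))) N'
     (\<lambda>t \<omega>. mexp (- max s t) A *v V t \<omega>)"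
  unfolding strong_sol_def
proof (intro conjI)
  show "\<forall>t\<in>{0..s}. \<forall>\<omega>\<in>space P. mexp (- max s t) A *v V t \<omega> = mexp (- s) A *v x"
    using V by (auto simp: strong_sol_def max_def)
  show "\<forall>t\<in>{s..T}. \<forall>B\<in>sets borel. (\<lambda>\<omega>. mexp (- max s t) A *v V t \<omega>) -` B \<inter> space P \<in> FL P L s t"
  proof
    fix t assume "t \<in> {s..T}"
    then have "V t \<in> borel_measurable (FLM P L s t)" using V unfolding strong_sol_def FLM_measurable_iff by blast
    then have "(\<lambda>\<omega>. mexp (- max s t) A *v V t \<omega>) \<in> borel_measurable (FLM P L s t)"
      by (rule measurable_compose) (intro borel_measurable_continuous_onI linear_continuous_on matrix_vector_mul_bounded_linear)
    then show "\<forall>B\<in>sets borel. (\<lambda>\<omega>. mexp (- max s t) A *v V t \<omega>) -` B \<inter> space P \<in> FL P L s t"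
      unfolding FLM_measurable_iff .
  qed
  have V3: "AE \<omega> in P. cadlag_on {s..T} (\<lambda>t. V t \<omega>) \<and> cadlag_on {0..T} (\<lambda>t. L t \<omega>) \<and> L 0 \<omega> = 0 \<and>
        (\<forall>t\<in>{s..T}. V t \<omega> = x + (LINT r:{s..t}|lborel. F r (V r \<omega>)) + N t \<omega> - N s \<omega>)"
    using V unfolding strong_sol_def by blast
  show "AE \<omega> in P. cadlag_on {s..T} (\<lambda>t. mexp (- max s t) A *v V t \<omega>) \<and> cadlag_on {0..T} (\<lambda>t. L t \<omega>) \<and> L 0 \<omega> = 0 \<and>
        (\<forall>t\<in>{s..T}. mexp (- max s t) A *v V t \<omega> = mexp (- s) A *v x +
          (LINT r:{s..t}|lborel. mexp (- r) A *v (F r (mexp r A *v (mexp (- max s r) A *v V r \<omega>)) - A *v (mexp r A *v (mexp (- max s r) A *v V r \<omega>)))) + N' t \<omega> - N' s \<omega>)"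
    using V3 Nc NN
  proof eventually_elim
    case (elim \<omega>)
    define v n where "v = (\<lambda>t. V t \<omega>)" and "n = (\<lambda>t. N t \<omega>)"
    have vc: "cadlag_on {s..T} v" and nc: "cadlag_on {0..T} n" using elim by (auto simp: v_def n_def)
    have ve: "v t = x + (LINT r:{s..t}|lborel. F r (v r)) + n t - n s" if "t \<in> {s..T}" for t
      using elim(1) that by (auto simp: v_def n_def)
    have "cadlag_on {s..T} (\<lambda>t. mexp (- t) A *v v t)"
      unfolding mexp_uminus by (rule cadlag_on_bilinear[OF bounded_bilinear_matrix_vector_mult continuous_imp_cadlag_on[OF mexp_continuous_on] vc])
    moreover have "cadlag_on {s..T} (\<lambda>t. mexp (- t) A *v v t) \<longleftrightarrow> cadlag_on {s..T} (\<lambda>t. mexp (- max s t) A *v v t)"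
      by (rule cadlag_on_cong) (simp add: max_def)
    ultimately have 1: "cadlag_on {s..T} (\<lambda>t. mexp (- max s t) A *v v t)" by simp
    obtain R where R: "\<forall>r\<in>{s..T}. norm (v r) \<le> R" using cadlag_on_bounded[OF vc] by (auto simp: bounded_iff)
    obtain K where K: "\<forall>t\<in>{0..T}. \<forall>x. norm x \<le> R \<longrightarrow> norm (F t x) \<le> K" using Fb by blast
    have s0: "0 \<le> s" "s \<le> T" using s by auto
    have gm: "(\<lambda>r. F r (v r)) \<in> borel_measurable (restrict_space borel {s..T})"
      by (rule caratheodory_borel[OF Fm cadlag_on_borel[OF vc] s0(1) order_refl])
    have gK: "norm (F r (v r)) \<le> K" if "r \<in> {s..T}" for r using K R that s0 by auto
    have Vc: "v t - n t = (x - n s) + (LINT r:{s..t}|lborel. F r (v r))" if "t \<in> {s..T}" for t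
      using ve[OF that] by simp
    have 2: "mexp (- t) A *v v t = mexp (- s) A *v x + (LINT r:{s..t}|lborel. mexp (- r) A *v (F r (v r) - A *v v r)) + N' t \<omega> - N' s \<omega>"
      if t: "t \<in> {s..T}" for t
    proof -
      let ?I1 = "LINT r:{s..t}|lborel. mexp (- r) A *v (F r (v r) - A *v (v r - n r))"
      let ?I2 = "LINT r:{s..t}|lborel. mexp (- r) A *v (A *v n r)"
      have p: "mexp (- t) A *v (v t - n t) = mexp (- s) A *v (x - n s) + ?I1"
        by (rule mexp_integration_by_parts[OF s0(1) gm gK Vc t])
      have ic: "cadlag_on {0..T} (\<lambda>r. mexp (- r) A *v (A *v n r))" by (rule cadlag_mexp_integrand[OF nc])
      obtain B where B: "\<forall>r\<in>{0..T}. norm (mexp (- r) A *v (A *v n r)) \<le> B" using cadlag_on_bounded[OF ic] by (auto simp: bounded_iff)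
      have ii: "set_integrable lborel {0..T} (\<lambda>r. mexp (- r) A *v (A *v n r))"
        by (rule bounded_set_integrable[OF cadlag_on_borel[OF ic]]) (use B in blast)
      have ii2: "set_integrable lborel {u..w} (\<lambda>r. mexp (- r) A *v (A *v n r))" if "0 \<le> u" "w \<le> T" for u w
        by (rule set_integrable_subset[OF ii]) (use that in auto)
      have sp: "(LINT r:{0..t}|lborel. mexp (- r) A *v (A *v n r)) = (LINT r:{0..s}|lborel. mexp (- r) A *v (A *v n r)) + ?I2"
        by (rule set_integral_split[OF ii2]) (use t s0 in auto)
      have nn: "N' t \<omega> - N' s \<omega> = mexp (- t) A *v n t - mexp (- s) A *v n s + ?I2"
        using elim(3) t s0 sp by (simp add: n_def)
      have c2: "cadlag_on {s..T} (\<lambda>r. mexp (- r) A *v (A *v (v r - n r)))"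
        unfolding mexp_uminus
        by (intro cadlag_on_bilinear[OF bounded_bilinear_matrix_vector_mult] continuous_imp_cadlag_on[OF mexp_continuous_on]
            cadlag_on_const cadlag_on_diff vc cadlag_on_subset[OF nc]) (use s0 in auto)
      obtain B2 where B2: "\<forall>r\<in>{s..T}. norm (mexp (- r) A *v (A *v (v r - n r))) \<le> B2" using cadlag_on_bounded[OF c2] by (auto simp: bounded_iff)
      have i2: "set_integrable lborel {s..T} (\<lambda>r. mexp (- r) A *v (A *v (v r - n r)))"
        by (rule bounded_set_integrable[OF cadlag_on_borel[OF c2]]) (use B2 in blast)
      obtain E where E: "E > 0" "\<And>r w. r \<in> {-T..0} \<Longrightarrow> norm (mexp r A *v w) \<le> E * norm w" by (rule mexp_bounded[of "-T" 0 A]) blast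
      have i3: "set_integrable lborel {s..T} (\<lambda>r. mexp (- r) A *v F r (v r))"
      proof (rule bounded_set_integrable[OF mexp_integrand_measurable[OF gm]])
        fix r assume r: "r \<in> {s..T}"
        have "norm (mexp (- r) A *v F r (v r)) \<le> E * norm (F r (v r))" using r s0 by (intro E(2)) auto
        also have "\<dots> \<le> E * K" using E(1) gK[OF r] by (intro mult_left_mono) auto
        finally show "norm (mexp (- r) A *v F r (v r)) \<le> E * K" .
      qed
      have i1: "set_integrable lborel {s..t} (\<lambda>r. mexp (- r) A *v (F r (v r) - A *v (v r - n r)))"
        using set_integral_diff(1)[OF i3 i2] t
        by (intro set_integrable_subset[of lborel "{s..T}" _ "{s..t}"]) (auto simp: matrix_vector_mult_diff_distrib)
      have "?I1 - ?I2 = (LINT r:{s..t}|lborel. mexp (- r) A *v (F r (v r) - A *v (v r - n r)) - mexp (- r) A *v (A *v n r))"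
        by (rule set_integral_diff(2)[symmetric, OF i1 ii2]) (use t s0 in auto)
      also have "\<dots> = (LINT r:{s..t}|lborel. mexp (- r) A *v (F r (v r) - A *v v r))"
        by (simp add: matrix_vector_mult_diff_distrib algebra_simps)
      finally have e: "?I1 = (LINT r:{s..t}|lborel. mexp (- r) A *v (F r (v r) - A *v v r)) + ?I2"
        by (simp only: diff_eq_eq)
      have "mexp (- t) A *v v t = mexp (- t) A *v (v t - n t) + mexp (- t) A *v n t"
        by (simp only: matrix_vector_mult_diff_distrib diff_add_cancel)
      also have "\<dots> = mexp (- s) A *v x - mexp (- s) A *v n s + ((LINT r:{s..t}|lborel. mexp (- r) A *v (F r (v r) - A *v v r)) + ?I2) + mexp (- t) A *v n t"
        unfolding p e by (simp only: matrix_vector_mult_diff_distrib)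
      also have "\<dots> = mexp (- s) A *v x + (LINT r:{s..t}|lborel. mexp (- r) A *v (F r (v r) - A *v v r)) + (N' t \<omega> - N' s \<omega>)"
        unfolding nn by (simp only: add.assoc add.commute add.left_commute diff_conv_add_uminus)
      finally show ?thesis by (simp only: add_diff_eq)
    qed
    have 3: "(LINT r:{s..t}|lborel. mexp (- r) A *v (F r (v r) - A *v v r)) =
       (LINT r:{s..t}|lborel. mexp (- r) A *v (F r (mexp r A *v (mexp (- max s r) A *v v r)) - A *v (mexp r A *v (mexp (- max s r) A *v v r))))" for t
      by (rule set_lebesgue_integral_cong) (auto simp: matrix_vector_mul_assoc mexp_mult_minus max_def)
    show ?case
      using 1 2 elim(1) unfolding 3 by (auto simp: v_def max_def)
  qed
qed

section \<open>Strong solutions of (E) and of (D) as images of one another\<close>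

locale levy_filtration =
  fixes P :: "'a measure" and L :: "real \<Rightarrow> 'a \<Rightarrow> real^'d"
  assumes prob: "prob_space P" and complete: "complete_measure P"
    and L_meas: "\<And>t. 0 \<le> t \<Longrightarrow> L t \<in> borel_measurable P"
begin

lemma strong_sol_measurable:
  assumes "strong_sol P L T s x F N U" "0 \<le> s" "t \<in> {0..T}" shows "U t \<in> borel_measurable P"
proof (cases "t < s")
  case True
  then have "U t \<omega> = x" if "\<omega> \<in> space P" for \<omega> using assms that unfolding strong_sol_def by auto
  then have "U t \<in> borel_measurable P \<longleftrightarrow> (\<lambda>_. x) \<in> borel_measurable P" by (rule measurable_cong)
  then show ?thesis by simp
next
  case False
  then have "U t \<in> borel_measurable (FLM P L s t)" using assms unfolding strong_sol_def FLM_measurable_iff by auto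
  then show ?thesis by (rule FLM_subalgebra[OF complete _ assms(2), rotated]) (rule L_meas)
qed

end

locale levy_sde = levy_filtration P L
  for P :: "'a measure" and L :: "real \<Rightarrow> 'a \<Rightarrow> real^'d" +
  fixes T K :: real
    and b :: "real \<Rightarrow> real^'n \<Rightarrow> real^'n" and \<sigma> :: "real \<Rightarrow> real^'d^'n" and A :: "real^'n^'n"
    and M Mt :: "real \<Rightarrow> 'a \<Rightarrow> real^'n"
  assumes T_pos: "0 < T"
    and b_meas: "(\<lambda>(t, x). b t x) \<in> borel_measurable (restrict_space borel ({0..T} \<times> UNIV))"
    and b_bdd: "\<And>t x. t \<in> {0..T} \<Longrightarrow> norm (b t x) \<le> K"
    and sigma_meas: "\<sigma> \<in> borel_measurable (restrict_space borel {0..T})"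
    and sigma_bdd: "bounded (\<sigma> ` {0..T})"
    and M_int: "is_stoch_int P L T \<sigma> M"
    and M_cadlag: "AE \<omega> in P. cadlag_on {0..T} (\<lambda>t. M t \<omega>)"
    and Mt_int: "is_stoch_int P L T (\<lambda>r. mexp (- r) A ** \<sigma> r) Mt"
    and Mt_cadlag: "AE \<omega> in P. cadlag_on {0..T} (\<lambda>t. Mt t \<omega>)"
    and H1: "H1 P L T b A M"
begin

lemma Mt_of_M: "AE \<omega> in P. \<forall>t\<in>{0..T}. Mt t \<omega> = mexp (- t) A *v M t \<omega> + (LINT r:{0..t}|lborel. mexp (- r) A *v (A *v M r \<omega>))"
  by (rule stoch_int_mexp[OF prob L_meas sigma_meas sigma_bdd M_int M_cadlag Mt_int Mt_cadlag]) (use T_pos in auto)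

text \<open>The same formula with \<open>- A\<close>: multiplying the integrand of \<open>Mt\<close>
  by the inverse exponential gives back \<open>\<sigma>\<close>, so \<open>M\<close> is the
  corresponding integral.\<close>

lemma M_of_Mt: "AE \<omega> in P. \<forall>t\<in>{0..T}. M t \<omega> = mexp (- t) (- A) *v Mt t \<omega> + (LINT r:{0..t}|lborel. mexp (- r) (- A) *v ((- A) *v Mt r \<omega>))"
proof (rule stoch_int_mexp[OF prob L_meas _ _ Mt_int Mt_cadlag _ M_cadlag])
  let ?f = "\<lambda>r. mexp (- r) A ** \<sigma> r"
  have 2: "(\<lambda>p. mexp (- fst p) A ** snd p) \<in> borel_measurable (borel :: (real \<times> (real^'d^'n)) measure)"
    by (intro borel_measurable_continuous_onI bounded_bilinear.continuous_on[OF bounded_bilinear_matrix_matrix_mult]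
         continuous_on_compose2[OF mexp_continuous_on[of UNIV A]] continuous_intros) auto
  have "(\<lambda>r. (r, \<sigma> r)) \<in> borel_measurable (restrict_space borel {0..T})"
    by (rule borel_measurable_Pair) (use sigma_meas in \<open>auto intro: measurable_restrict_space1\<close>)
  from measurable_compose[OF this 2] show "?f \<in> borel_measurable (restrict_space borel {0..T})" by simp
  show "bounded (?f ` {0..T})"
  proof -
    have "bounded ((\<lambda>t. mexp t A) ` {-T..0})"
      by (intro compact_imp_bounded compact_continuous_image mexp_continuous_on) auto
    then obtain B where B: "B > 0" "\<And>r. r \<in> {-T..0} \<Longrightarrow> norm (mexp r A) \<le> B" by (auto simp: bounded_pos)
    obtain S where S: "S > 0" "\<forall>r\<in>{0..T}. norm (\<sigma> r) \<le> S" using sigma_bdd by (auto simp: bounded_pos)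
    obtain E where E: "E > 0" and "\<forall>(M :: real^'n^'n) (v :: real^'d^'n). norm (M ** v) \<le> norm M * norm v * E"
      using bounded_bilinear.pos_bounded[OF bounded_bilinear_matrix_matrix_mult[where 'n='n and 'm='n and 'p='d]] by auto
    then have E2: "norm (M ** v) \<le> norm M * norm v * E" for M :: "real^'n^'n" and v :: "real^'d^'n" by simp
    have "norm (?f r) \<le> B * S * E" if r: "r \<in> {0..T}" for r
    proof -
      have "norm (?f r) \<le> norm (mexp (- r) A) * norm (\<sigma> r) * E" by (rule E2)
      also have "\<dots> \<le> B * S * E" using r B(1) B(2)[of "- r"] S E by (intro mult_right_mono mult_mono) auto
      finally show ?thesis .
    qed
    then show ?thesis unfolding bounded_iff by (intro exI[of _ "B * S * E"]) blast
  qed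
  have "mexp (- r) (- A) ** (mexp (- r) A ** \<sigma> r) = \<sigma> r" for r
    using mexp_mult_minus[of r A] mexp_uminus[of r "- A"] by (simp add: matrix_mul_assoc)
  then show "is_stoch_int P L T (\<lambda>r. mexp (- r) (- A) ** (mexp (- r) A ** \<sigma> r)) M" using M_int by simp
qed (use T_pos in auto)

lemma btilde_meas: "(\<lambda>(t, x). btilde A b t x) \<in> borel_measurable (restrict_space borel ({0..T} \<times> UNIV))"
proof -
  let ?R = "restrict_space borel ({0..T} \<times> UNIV) :: (real \<times> (real^'n)) measure"
  have c: "continuous_on UNIV (\<lambda>p. (fst p, mexp (fst p) A *v (snd p :: real^'n)))"
    by (intro continuous_intros bounded_bilinear.continuous_on[OF bounded_bilinear_matrix_vector_mult]
         continuous_on_compose2[OF mexp_continuous_on[of UNIV A]]) auto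
  have "(\<lambda>p. (fst p, mexp (fst p) A *v snd p)) \<in> measurable ?R ?R"
    by (rule measurable_restrict_space3[OF borel_measurable_continuous_onI[OF c]]) auto
  from measurable_compose[OF this b_meas]
  have 1: "(\<lambda>p. b (fst p) (mexp (fst p) A *v snd p)) \<in> borel_measurable ?R" by simp
  have f: "fst \<in> borel_measurable ?R"
    by (intro measurable_restrict_space1 borel_measurable_continuous_onI continuous_on_fst continuous_on_id)
  have 2: "(\<lambda>p. mexp (- fst p) A *v snd p) \<in> borel_measurable (borel :: (real \<times> (real^'n)) measure)"
    by (intro borel_measurable_continuous_onI bounded_bilinear.continuous_on[OF bounded_bilinear_matrix_vector_mult]
         continuous_on_compose2[OF mexp_continuous_on[of UNIV A]] continuous_intros) auto
  from measurable_compose[OF borel_measurable_Pair[OF f 1] 2]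
  show ?thesis by (simp add: btilde_def case_prod_unfold)
qed

lemma btilde_bdd: obtains K' where "\<And>t x. t \<in> {0..T} \<Longrightarrow> norm (btilde A b t x) \<le> K'"
proof -
  obtain E where E: "E > 0" "\<And>r w. r \<in> {-T..0} \<Longrightarrow> norm (mexp r A *v w) \<le> E * norm w" by (rule mexp_bounded[of "-T" 0 A]) blast
  have "norm (btilde A b t x) \<le> E * K" if t: "t \<in> {0..T}" for t x
  proof -
    have "norm (btilde A b t x) \<le> E * norm (b t (mexp t A *v x))" unfolding btilde_def using t by (intro E(2)) auto
    also have "\<dots> \<le> E * K" using E(1) b_bdd[OF t] by (intro mult_left_mono) auto
    finally show ?thesis .
  qed
  then show ?thesis by (rule that)
qed

lemma strong_sol_D_of_E:
  assumes s: "s \<in> {0..T}" and Z: "strong_sol P L T s x (\<lambda>r z. b r z + A *v z) M Z"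
  shows "strong_sol P L T s (mexp (- s) A *v x) (btilde A b) Mt (\<lambda>t \<omega>. mexp (- max s t) A *v Z t \<omega>)"
proof -
  let ?R = "restrict_space borel ({0..T} \<times> UNIV) :: (real \<times> (real^'n)) measure"
  have "strong_sol P L T s (mexp (- s) A *v x) (\<lambda>r u. mexp (- r) A *v (b r (mexp r A *v u) + A *v (mexp r A *v u) - A *v (mexp r A *v u))) Mt (\<lambda>t \<omega>. mexp (- max s t) A *v Z t \<omega>)"
  proof (rule strong_sol_mexp[OF s _ _ M_cadlag Mt_of_M Z])
    have "(\<lambda>p. A *v snd p) \<in> borel_measurable ?R"
      by (intro measurable_restrict_space1 borel_measurable_continuous_onI bounded_bilinear.continuous_on[OF bounded_bilinear_matrix_vector_mult] continuous_intros)
    with b_meas show "(\<lambda>(t, x). b t x + A *v x) \<in> borel_measurable ?R"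
      unfolding case_prod_unfold by (rule borel_measurable_add)
    obtain a where a: "0 < a" "\<And>v. norm (A *v v) \<le> a * norm v" by (rule matrix_vector_bound[of A]) blast
    fix R
    have "norm (b t x + A *v x) \<le> K + a * R" if "t \<in> {0..T}" "norm x \<le> R" for t x
    proof -
      have "norm (A *v x) \<le> a * R" using a(2)[of x] mult_left_mono[OF that(2), of a] a(1) by linarith
      then show ?thesis by (intro norm_triangle_mono b_bdd that(1))
    qed
    then show "\<exists>K. \<forall>t\<in>{0..T}. \<forall>x. norm x \<le> R \<longrightarrow> norm (b t x + A *v x) \<le> K" by blast
  qed
  then show ?thesis by (simp add: btilde_def[abs_def])
qed

lemma strong_sol_E_of_D:
  assumes s: "s \<in> {0..T}" and U: "strong_sol P L T s x (btilde A b) Mt U"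
  shows "strong_sol P L T s (mexp s A *v x) (\<lambda>r z. b r z + A *v z) M (\<lambda>t \<omega>. mexp (max s t) A *v U t \<omega>)"
proof -
  have m1: "mexp (- r) (- A) = mexp r A" "mexp r (- A) = mexp (- r) A" for r using mexp_uminus[of r "- A"] mexp_uminus[of r A] by simp_all
  have "strong_sol P L T s (mexp (- s) (- A) *v x) (\<lambda>r u. mexp (- r) (- A) *v (btilde A b r (mexp r (- A) *v u) - (- A) *v (mexp r (- A) *v u))) M (\<lambda>t \<omega>. mexp (- max s t) (- A) *v U t \<omega>)"
  proof (rule strong_sol_mexp[OF s btilde_meas _ Mt_cadlag M_of_Mt U])
    fix R
    obtain K' where "\<And>t x. t \<in> {0..T} \<Longrightarrow> norm (btilde A b t x) \<le> K'" by (rule btilde_bdd) blast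
    then show "\<exists>K. \<forall>t\<in>{0..T}. \<forall>x. norm x \<le> R \<longrightarrow> norm (btilde A b t x) \<le> K" by blast
  qed
  moreover have "mexp r A *v (btilde A b r (mexp (- r) A *v u) - (- A) *v (mexp (- r) A *v u)) = b r u + A *v u" for r u
  proof -
    have "mexp r A *v btilde A b r (mexp (- r) A *v u) = b r u"
      by (simp add: btilde_def matrix_vector_mul_assoc mexp_mult_minus)
    moreover have "mexp r A *v (A *v (mexp (- r) A *v u)) = A *v u"
    proof -
      have "mexp r A *v (A *v w) = A *v (mexp r A *v w)" for w by (simp only: matrix_vector_mul_assoc mexp_commute)
      moreover have "mexp r A *v (mexp (- r) A *v u) = u" by (simp add: matrix_vector_mul_assoc mexp_mult_minus)
      ultimately show ?thesis by simp
    qed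
    moreover have "(- A) *v w = - (A *v w)" for w by (rule bounded_bilinear.minus_left[OF bounded_bilinear_matrix_vector_mult])
    ultimately show ?thesis by (simp add: vec.add matrix_vector_right_distrib)
  qed
  ultimately show ?thesis by (simp add: m1)
qed

lemma strong_sol_D_exists:
  assumes s: "s \<in> {0..T}" shows "\<exists>U. strong_sol P L T s x (btilde A b) Mt U"
proof -
  obtain Z where "strong_sol P L T s (mexp s A *v x) (\<lambda>r z. b r z + A *v z) M Z"
    using H1[unfolded H1_def Let_def, THEN conjunct1] s by blast
  from strong_sol_D_of_E[OF s this] show ?thesis by (auto simp: matrix_vector_mul_assoc mexp_minus_mult)
qed

text \<open>The supremum is taken over a countable set that does not depend on \<open>s\<close>, so
  that it is measurable and the same functional serves all starting times.\<close>

lemma strong_sol_D_moment: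
  assumes p: "2 \<le> p"
  obtains C where "0 \<le> C" "\<And>s x y U U'. \<lbrakk>s \<in> {0..T}; strong_sol P L T s x (btilde A b) Mt U; strong_sol P L T s y (btilde A b) Mt U'\<rbrakk>
    \<Longrightarrow> (\<integral>\<^sup>+\<omega>. (\<Squnion>t\<in>right_dense 0 T. ennreal (norm (U t \<omega> - U' t \<omega>) powr p)) \<partial>P) \<le> ennreal (C * norm (x - y) powr p)"
proof -
  obtain C where C: "C > 0" "\<And>s x y Z Z'. s \<in> {0..T} \<Longrightarrow>
     strong_sol P L T s x (\<lambda>r z. b r z + A *v z) M Z \<Longrightarrow> strong_sol P L T s y (\<lambda>r z. b r z + A *v z) M Z' \<Longrightarrow>
          (\<integral>\<^sup>+ \<omega>. (\<Squnion>t\<in>{s..T}. ennreal (norm (Z t \<omega> - Z' t \<omega>) powr p)) \<partial>P)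
            \<le> ennreal (C * norm (x - y) powr p)"
    using H1[unfolded H1_def Let_def, THEN conjunct2, rule_format, OF p] by blast
  obtain E where E: "E > 0" "\<And>r w. r \<in> {-T..T} \<Longrightarrow> norm (mexp r A *v w) \<le> E * norm w" by (rule mexp_bounded[of "-T" T A]) blast
  show ?thesis
  \<comment> \<open>One factor \<open>E powr p\<close> is the price of returning from
    \<open>Z\<close> to \<open>U\<close>, the other that of the starting points
    \<open>mexp s A *v x\<close> and \<open>mexp s A *v y\<close>.\<close>
  proof (rule that[of "E powr p * (C * E powr p)"])
    show "0 \<le> E powr p * (C * E powr p)" using C(1) by simp
    fix s x y U U' assume s: "s \<in> {0..T}" and U: "strong_sol P L T s x (btilde A b) Mt U" and U': "strong_sol P L T s y (btilde A b) Mt U'"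
    define Z Z' where "Z = (\<lambda>t \<omega>. mexp (max s t) A *v U t \<omega>)" and "Z' = (\<lambda>t \<omega>. mexp (max s t) A *v U' t \<omega>)"
    have Z: "strong_sol P L T s (mexp s A *v x) (\<lambda>r z. b r z + A *v z) M Z" unfolding Z_def by (rule strong_sol_E_of_D[OF s U])
    have Z': "strong_sol P L T s (mexp s A *v y) (\<lambda>r z. b r z + A *v z) M Z'" unfolding Z'_def by (rule strong_sol_E_of_D[OF s U'])
    \<comment> \<open>A countable set, to keep the supremum measurable; \<open>s\<close> is added
      because before time \<open>s\<close> the processes have their value at
      \<open>s\<close>.\<close>
    define S where "S = insert s (right_dense 0 T \<inter> {s..T})"
    have S: "countable S" "S \<subseteq> {s..T}" unfolding S_def using countable_right_dense s by auto
    have Zm: "(\<lambda>\<omega>. ennreal (norm (Z t \<omega> - Z' t \<omega>) powr p)) \<in> borel_measurable P" if "t \<in> S" for t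
    proof -
      have "t \<in> {0..T}" "0 \<le> s" using that S(2) s by auto
      then have "Z t \<in> borel_measurable P" "Z' t \<in> borel_measurable P" using strong_sol_measurable[OF Z] strong_sol_measurable[OF Z'] by auto
      then have "(\<lambda>\<omega>. norm (Z t \<omega> - Z' t \<omega>) powr p) \<in> borel_measurable P" by measurable
      then show ?thesis by measurable
    qed
    have le: "(\<Squnion>t\<in>right_dense 0 T. ennreal (norm (U t \<omega> - U' t \<omega>) powr p)) \<le> ennreal (E powr p) * (\<Squnion>t\<in>S. ennreal (norm (Z t \<omega> - Z' t \<omega>) powr p))"
      if \<omega>: "\<omega> \<in> space P" for \<omega>
    proof (rule SUP_least)
      fix t assume t: "t \<in> right_dense 0 T"
      then have tT: "t \<in> {0..T}" using right_dense_subset[of 0 T] T_pos by auto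
      define q where "q = max s t"
      have q: "q \<in> S" using t tT s by (auto simp: S_def q_def max_def)
      have UU: "U t \<omega> = U q \<omega>" "U' t \<omega> = U' q \<omega>"
        using U U' \<omega> tT s unfolding strong_sol_def q_def max_def by auto
      have "q \<in> {0..T}" using q S(2) s by auto
      have "max s q = q" by (simp add: q_def)
      then have "U q \<omega> - U' q \<omega> = mexp (- q) A *v (Z q \<omega> - Z' q \<omega>)"
        by (simp add: Z_def Z'_def matrix_vector_mult_diff_distrib matrix_vector_mul_assoc mexp_minus_mult)
      also have "norm \<dots> \<le> E * norm (Z q \<omega> - Z' q \<omega>)" using \<open>q \<in> {0..T}\<close> by (intro E(2)) auto
      finally have "norm (U t \<omega> - U' t \<omega>) powr p \<le> (E * norm (Z q \<omega> - Z' q \<omega>)) powr p"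
        unfolding UU using p by (intro powr_mono2) auto
      also have "\<dots> = E powr p * norm (Z q \<omega> - Z' q \<omega>) powr p" using E(1) by (simp add: powr_mult)
      finally have "ennreal (norm (U t \<omega> - U' t \<omega>) powr p) \<le> ennreal (E powr p) * ennreal (norm (Z q \<omega> - Z' q \<omega>) powr p)"
        by (simp add: ennreal_mult[symmetric] ennreal_leI)
      also have "\<dots> \<le> ennreal (E powr p) * (\<Squnion>t\<in>S. ennreal (norm (Z t \<omega> - Z' t \<omega>) powr p))"
        by (intro mult_left_mono SUP_upper q) auto
      finally show "ennreal (norm (U t \<omega> - U' t \<omega>) powr p) \<le> ennreal (E powr p) * (\<Squnion>t\<in>S. ennreal (norm (Z t \<omega> - Z' t \<omega>) powr p))" .
    qed
    have "(\<integral>\<^sup>+\<omega>. (\<Squnion>t\<in>right_dense 0 T. ennreal (norm (U t \<omega> - U' t \<omega>) powr p)) \<partial>P) \<le> (\<integral>\<^sup>+\<omega>. ennreal (E powr p) * (\<Squnion>t\<in>S. ennreal (norm (Z t \<omega> - Z' t \<omega>) powr p)) \<partial>P)"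
      by (rule nn_integral_mono) (rule le)
    also have "\<dots> = ennreal (E powr p) * (\<integral>\<^sup>+\<omega>. (\<Squnion>t\<in>S. ennreal (norm (Z t \<omega> - Z' t \<omega>) powr p)) \<partial>P)"
      by (rule nn_integral_cmult[OF borel_measurable_SUP[OF S(1) Zm]])
    also have "\<dots> \<le> ennreal (E powr p) * (\<integral>\<^sup>+\<omega>. (\<Squnion>t\<in>{s..T}. ennreal (norm (Z t \<omega> - Z' t \<omega>) powr p)) \<partial>P)"
      by (intro mult_left_mono nn_integral_mono SUP_subset_mono S(2)) auto
    also have "\<dots> \<le> ennreal (E powr p) * ennreal (C * norm (mexp s A *v x - mexp s A *v y) powr p)"
      by (intro mult_left_mono C(2)[OF s Z Z']) auto
    also have "\<dots> = ennreal (E powr p * (C * norm (mexp s A *v x - mexp s A *v y) powr p))"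
      using C(1) by (simp add: ennreal_mult)
    also have "\<dots> \<le> ennreal (E powr p * (C * (E powr p * norm (x - y) powr p)))"
    proof (intro ennreal_leI mult_left_mono)
      have "norm (mexp s A *v x - mexp s A *v y) \<le> E * norm (x - y)"
        using E(2)[of s "x - y"] s by (simp add: matrix_vector_mult_diff_distrib)
      then have "norm (mexp s A *v x - mexp s A *v y) powr p \<le> (E * norm (x - y)) powr p" using p by (intro powr_mono2) auto
      then show "norm (mexp s A *v x - mexp s A *v y) powr p \<le> E powr p * norm (x - y) powr p" using E(1) by (simp add: powr_mult)
    qed (use C(1) in auto)
    finally show "(\<integral>\<^sup>+\<omega>. (\<Squnion>t\<in>right_dense 0 T. ennreal (norm (U t \<omega> - U' t \<omega>) powr p)) \<partial>P) \<le> ennreal (E powr p * (C * E powr p) * norm (x - y) powr p)"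
      by (simp add: mult.assoc)
  qed
qed

end

section \<open>The stochastic flow\<close>

lemma dyadic_floor_borel: "(dyadic_floor k :: real^'n \<Rightarrow> real^'n) \<in> borel_measurable borel"
proof (subst borel_measurable_euclidean_space, intro ballI)
  fix i :: "real^'n" assume "i \<in> Basis"
  then obtain c where i: "i = axis c 1" unfolding Basis_vec_def[where 'b='n and 'a=real] by auto
  have "(\<lambda>x :: real^'n. x $ c) \<in> borel_measurable borel"
    by (intro borel_measurable_continuous_onI continuous_intros)
  then have "(\<lambda>x :: real^'n. real_of_int \<lfloor>2 ^ k * x $ c\<rfloor> / 2 ^ k) \<in> borel_measurable borel"
    by measurable
  then show "(\<lambda>x :: real^'n. dyadic_floor k x \<bullet> i) \<in> borel_measurable borel"
    unfolding i inner_axis by (simp add: dyadic_floor_def)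
qed

lemma dyadic_floor_count_space: "(dyadic_floor k :: real^'n \<Rightarrow> real^'n) \<in> measurable borel (count_space dyadic_points)"
proof (subst measurable_count_space_eq_countable[OF countable_dyadic_points], intro conjI ballI)
  show "dyadic_floor k \<in> space borel \<rightarrow> (dyadic_points :: (real^'n) set)" using dyadic_floor_dyadic_points by auto
  show "dyadic_floor k -` {a} \<inter> space borel \<in> sets borel" for a :: "real^'n"
    by (rule measurable_sets[OF dyadic_floor_borel]) auto
qed

lemma hoelder_moment_measurable:
  assumes "\<And>x y. (\<lambda>p. \<rho> p x y) \<in> borel_measurable M"
  shows "(\<lambda>p. hoelder_moment m (\<rho> p)) \<in> borel_measurable M"
  unfolding hoelder_moment_def case_prod_unfold
  by (intro borel_measurable_suminf_order borel_measurable_sum borel_measurable_times_ennreal assms borel_measurable_const)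

text \<open>The mean of the weighted sum at level \<open>k\<close> is O(2^(k (1 - a))), a geometric
  sequence since \<open>a > 1\<close>. The series over \<open>k\<close> therefore has finite mean,
  and its terms tend to zero almost surely.\<close>

lemma grid_sum_AE_tendsto:
  fixes h :: "real \<Rightarrow> 'a \<Rightarrow> ennreal"
  assumes T: "0 < T" and a: "1 < a" and B0: "0 \<le> B"
    and meas: "\<And>s. s \<in> dyadic_grid T \<Longrightarrow> h s \<in> borel_measurable P" and P: "prob_space P"
    and B: "\<And>s. s \<in> dyadic_grid T \<Longrightarrow> (\<integral>\<^sup>+\<omega>. h s \<omega> \<partial>P) \<le> ennreal B"
  shows "AE \<omega> in P. (\<forall>s\<in>dyadic_grid T. h s \<omega> < \<infinity>) \<and>
     (\<lambda>k. (T / 2 ^ k) powr a * (\<Sum>i\<le>2 ^ k. 1 + enn2real (h (T * real i / 2 ^ k) \<omega>))) \<longlonglongrightarrow> 0"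
proof -
  interpret prob_space P by (rule P)
  have fin: "AE \<omega> in P. \<forall>s\<in>dyadic_grid T. h s \<omega> < \<infinity>"
  proof (subst AE_ball_countable[OF countable_dyadic_grid], intro ballI)
    fix s assume s: "s \<in> dyadic_grid T"
    have "(\<integral>\<^sup>+\<omega>. h s \<omega> \<partial>P) \<noteq> \<infinity>" using B[OF s] by (metis ennreal_neq_top infinity_ennreal_def neq_top_trans)
    from nn_integral_noteq_infinite[OF meas[OF s] this] show "AE \<omega> in P. h s \<omega> < \<infinity>"
      by eventually_elim (simp add: less_top)
  qed
  define S where "S k \<omega> = ennreal ((T / 2 ^ k) powr a) * (\<Sum>i\<le>2 ^ k. 1 + h (T * real i / 2 ^ k) \<omega>)" for k :: nat and \<omega>
  have hm: "h (T * real i / 2 ^ k) \<in> borel_measurable P" if "i \<le> 2 ^ k" for i k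
    by (rule meas[OF dyadic_gridI[OF that]])
  have sm: "(\<lambda>\<omega>. \<Sum>i\<le>2 ^ k. 1 + h (T * real i / 2 ^ k) \<omega>) \<in> borel_measurable P" for k
    by (intro borel_measurable_sum borel_measurable_add borel_measurable_const hm) auto
  then have Sm: "S k \<in> borel_measurable P" for k
    unfolding S_def[abs_def] by (intro borel_measurable_times_ennreal borel_measurable_const)
  define q where "q = 2 powr (1 - a)"
  have q: "0 < q" "q < 1" using a powr_less_mono[of "1 - a" 0 2] by (simp_all add: q_def)
  \<comment> \<open>The factor 2 comes from \<open>2 ^ k + 1 \<le> 2 * 2 ^ k\<close> grid points,
    and \<open>T powr a\<close> from the mesh.\<close>
  define D where "D = T powr a * 2 * (1 + B)"
  have D0: "0 \<le> D" using B0 by (simp add: D_def)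
  have SI: "(\<integral>\<^sup>+\<omega>. S k \<omega> \<partial>P) \<le> ennreal (D * q ^ k)" for k
  proof -
    have "(\<integral>\<^sup>+\<omega>. S k \<omega> \<partial>P) = ennreal ((T / 2 ^ k) powr a) * (\<integral>\<^sup>+\<omega>. (\<Sum>i\<le>2 ^ k. 1 + h (T * real i / 2 ^ k) \<omega>) \<partial>P)"
      unfolding S_def by (rule nn_integral_cmult[OF sm])
    also have "(\<integral>\<^sup>+\<omega>. (\<Sum>i\<le>2 ^ k. 1 + h (T * real i / 2 ^ k) \<omega>) \<partial>P) = (\<Sum>i\<le>2 ^ k. \<integral>\<^sup>+\<omega>. 1 + h (T * real i / 2 ^ k) \<omega> \<partial>P)"
      by (rule nn_integral_sum) (auto intro: borel_measurable_add hm)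
    also have "\<dots> \<le> (\<Sum>i\<le>(2::nat) ^ k. ennreal (1 + B))"
    proof (rule sum_mono)
      fix i :: nat assume i: "i \<in> {..2 ^ k}"
      have "(\<integral>\<^sup>+\<omega>. 1 + h (T * real i / 2 ^ k) \<omega> \<partial>P) = 1 + (\<integral>\<^sup>+\<omega>. h (T * real i / 2 ^ k) \<omega> \<partial>P)"
        using i hm by (subst nn_integral_add) (auto simp: emeasure_space_1)
      also have "\<dots> \<le> 1 + ennreal B" using i by (intro add_left_mono B dyadic_gridI) auto
      finally show "(\<integral>\<^sup>+\<omega>. 1 + h (T * real i / 2 ^ k) \<omega> \<partial>P) \<le> ennreal (1 + B)" using B0 by (simp add: ennreal_plus)
    qed
    also have "\<dots> = ennreal ((2 ^ k + 1) * (1 + B))"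
    proof -
      have "real (Suc (2 ^ k)) = 2 ^ k + 1" by simp
      then show ?thesis using B0 by (simp add: ennreal_mult ennreal_of_nat_eq_real_of_nat add.commute del: of_nat_Suc)
    qed
    also have "ennreal ((T / 2 ^ k) powr a) * ennreal ((2 ^ k + 1) * (1 + B)) = ennreal ((T / 2 ^ k) powr a * ((2 ^ k + 1) * (1 + B)))"
      using B0 by (simp add: ennreal_mult)
    also have "\<dots> \<le> ennreal (D * q ^ k)"
    proof (rule ennreal_leI)
      have "(T / 2 ^ k) powr a * ((2 ^ k + 1) * (1 + B)) \<le> (T / 2 ^ k) powr a * ((2 * 2 ^ k) * (1 + B))"
        using B0 by (intro mult_left_mono mult_right_mono) auto
      also have "\<dots> = D * ((2 ^ k) * inverse ((2 ^ k) powr a))"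
        using T powr_divide[of T "2 ^ k" a] by (simp add: D_def divide_inverse)
      also have "(2 ^ k) * inverse ((2 ^ k) powr a) = q ^ k"
      proof -
        have "((2::real) ^ k) powr a = (2 powr a) ^ k" by (simp add: powr_realpow[symmetric] powr_powr mult.commute)
        moreover have "q = 2 * inverse (2 powr a)" by (simp add: q_def powr_diff divide_inverse)
        ultimately show ?thesis by (simp add: power_mult_distrib power_inverse)
      qed
      finally show "(T / 2 ^ k) powr a * ((2 ^ k + 1) * (1 + B)) \<le> D * q ^ k" .
    qed
    finally show ?thesis by (simp add: mult_left_mono)
  qed
  have "(\<integral>\<^sup>+\<omega>. (\<Sum>k. S k \<omega>) \<partial>P) = (\<Sum>k. \<integral>\<^sup>+\<omega>. S k \<omega> \<partial>P)" by (rule nn_integral_suminf[OF Sm])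
  also have "\<dots> \<le> (\<Sum>k. ennreal (D * q ^ k))" by (intro suminf_le SI summableI)
  also have "\<dots> = ennreal (D * (1 / (1 - q)))"
    using q D0 by (intro suminf_ennreal_eq sums_mult geometric_sums) auto
  finally have "(\<integral>\<^sup>+\<omega>. (\<Sum>k. S k \<omega>) \<partial>P) \<noteq> \<infinity>" by (metis ennreal_neq_top infinity_ennreal_def neq_top_trans)
  from nn_integral_noteq_infinite[OF borel_measurable_suminf_order[OF Sm] this]
  have "AE \<omega> in P. (\<Sum>k. S k \<omega>) \<noteq> \<infinity>" .
  with fin show ?thesis
  proof eventually_elim
    case (elim \<omega>)
    let ?r = "\<lambda>k. (T / 2 ^ k) powr a * (\<Sum>i\<le>2 ^ k. 1 + enn2real (h (T * real i / 2 ^ k) \<omega>))"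
    have "S k \<omega> = ennreal (?r k)" for k
    proof -
      have "1 + h (T * real i / 2 ^ k) \<omega> = ennreal (1 + enn2real (h (T * real i / 2 ^ k) \<omega>))" if "i \<le> 2 ^ k" for i
        using elim(1) dyadic_gridI[OF that, of T] by (subst ennreal_plus) (auto simp: ennreal_enn2real less_top)
      then have "(\<Sum>i\<le>2 ^ k. 1 + h (T * real i / 2 ^ k) \<omega>) = (\<Sum>i\<le>2 ^ k. ennreal (1 + enn2real (h (T * real i / 2 ^ k) \<omega>)))"
        by (intro sum.cong) auto
      also have "\<dots> = ennreal (\<Sum>i\<le>2 ^ k. 1 + enn2real (h (T * real i / 2 ^ k) \<omega>))" by (rule sum_ennreal) simp
      finally show ?thesis unfolding S_def by (simp add: ennreal_mult sum_nonneg)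
    qed
    then have "summable ?r" using elim(2) by (intro summable_suminf_not_top) (auto intro!: mult_nonneg_nonneg sum_nonneg)
    then show ?case using elim(1) summable_LIMSEQ_zero by blast
  qed
qed

text \<open>Equation (D) with the properties it has inherited from (E), in abstract form: from here
  on \<open>A\<close>, \<open>b\<close> and (H1) enter only through the drift \<open>B\<close>, the
  noise \<open>N\<close>, existence and the moment bounds.\<close>

locale strong_flow = levy_filtration P L
  for P :: "'a measure" and L :: "real \<Rightarrow> 'a \<Rightarrow> real^'d" +
  fixes T K C \<beta> :: real
    and B :: "real \<Rightarrow> real^'n \<Rightarrow> real^'n" and N :: "real \<Rightarrow> 'a \<Rightarrow> real^'n"
  assumes T_pos: "0 < T"
    and B_meas: "(\<lambda>(t, x). B t x) \<in> borel_measurable (restrict_space borel ({0..T} \<times> UNIV))"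
    and B_bdd: "\<And>t x. t \<in> {0..T} \<Longrightarrow> norm (B t x) \<le> K"
    and B_hoelder: "\<And>t x y. t \<in> {0..T} \<Longrightarrow> norm (B t x - B t y) \<le> C * norm (x - y) powr \<beta>"
    and C_nonneg: "0 \<le> C" and beta_pos: "0 < \<beta>"
    and N_cadlag: "AE \<omega> in P. cadlag_on {0..T} (\<lambda>t. N t \<omega>)"
    and sol_exists: "\<And>s x. s \<in> {0..T} \<Longrightarrow> \<exists>U. strong_sol P L T s x B N U"
    and sol_moment: "\<And>p. 2 \<le> p \<Longrightarrow> \<exists>D\<ge>0. \<forall>s x y U U'. s \<in> {0..T} \<longrightarrow> strong_sol P L T s x B N U \<longrightarrow> strong_sol P L T s y B N U' \<longrightarrow>
       (\<integral>\<^sup>+\<omega>. (\<Squnion>t\<in>right_dense 0 T. ennreal (norm (U t \<omega> - U' t \<omega>) powr p)) \<partial>P) \<le> ennreal (D * norm (x - y) powr p)"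
begin

lemma noisy_pathI:
  assumes "cadlag_on {0..T} (\<lambda>t. N t \<omega>)" shows "noisy_path B (\<lambda>t. N t \<omega>) T K C \<beta>"
  by unfold_locales (use T_pos B_meas B_bdd B_hoelder C_nonneg beta_pos assms in auto)

lemma strong_sol_noisy_sol:
  assumes "strong_sol P L T s x B N U"
  shows "AE \<omega> in P. noisy_path.noisy_sol B (\<lambda>t. N t \<omega>) s T x (\<lambda>t. U t \<omega>)"
proof -
  have "AE \<omega> in P. cadlag_on {s..T} (\<lambda>t. U t \<omega>) \<and> cadlag_on {0..T} (\<lambda>t. L t \<omega>) \<and> L 0 \<omega> = 0 \<and>
        (\<forall>t\<in>{s..T}. U t \<omega> = x + (LINT r:{s..t}|lborel. B r (U r \<omega>)) + N t \<omega> - N s \<omega>)"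
    using assms unfolding strong_sol_def by blast
  with N_cadlag show ?thesis
    by eventually_elim (simp add: noisy_path.noisy_sol_def[OF noisy_pathI])
qed

text \<open>With equal starting points the moment bound is zero, so the solutions agree on a
  right-dense countable set and hence, being cadlag, at all times.\<close>

lemma strong_sol_unique:
  assumes s: "s \<in> {0..T}" and U: "strong_sol P L T s x B N U" and U': "strong_sol P L T s x B N U'"
  shows "AE \<omega> in P. \<forall>t\<in>{s..T}. U t \<omega> = U' t \<omega>"
proof -
  obtain D where "\<forall>s x y U U'. s \<in> {0..T} \<longrightarrow> strong_sol P L T s x B N U \<longrightarrow> strong_sol P L T s y B N U' \<longrightarrow>
       (\<integral>\<^sup>+\<omega>. (\<Squnion>t\<in>right_dense 0 T. ennreal (norm (U t \<omega> - U' t \<omega>) powr 2)) \<partial>P) \<le> ennreal (D * norm (x - y) powr 2)"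
    using sol_moment[of 2] by auto
  then have "(\<integral>\<^sup>+\<omega>. (\<Squnion>t\<in>right_dense 0 T. ennreal (norm (U t \<omega> - U' t \<omega>) powr 2)) \<partial>P) \<le> ennreal (D * norm (x - x) powr 2)"
    using s U U' by blast
  then have i0: "(\<integral>\<^sup>+\<omega>. (\<Squnion>t\<in>right_dense 0 T. ennreal (norm (U t \<omega> - U' t \<omega>) powr 2)) \<partial>P) = 0" by simp
  have m: "(\<lambda>\<omega>. ennreal (norm (U t \<omega> - U' t \<omega>) powr 2)) \<in> borel_measurable P" if "t \<in> right_dense 0 T" for t
  proof -
    have "t \<in> {0..T}" using that right_dense_subset[of 0 T] T_pos by auto
    then have "U t \<in> borel_measurable P" "U' t \<in> borel_measurable P" using strong_sol_measurable[OF U] strong_sol_measurable[OF U'] s by auto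
    then have "(\<lambda>\<omega>. norm (U t \<omega> - U' t \<omega>) powr 2) \<in> borel_measurable P" by measurable
    then show ?thesis by measurable
  qed
  have "AE \<omega> in P. (\<Squnion>t\<in>right_dense 0 T. ennreal (norm (U t \<omega> - U' t \<omega>) powr 2)) = 0"
    using nn_integral_0_iff_AE[OF borel_measurable_SUP[OF countable_right_dense m]] i0 by simp
  moreover have "AE \<omega> in P. cadlag_on {s..T} (\<lambda>t. U t \<omega>)" using U unfolding strong_sol_def by (auto elim: AE_mp)
  moreover have "AE \<omega> in P. cadlag_on {s..T} (\<lambda>t. U' t \<omega>)" using U' unfolding strong_sol_def by (auto elim: AE_mp)
  ultimately show ?thesis
  proof eventually_elim
    case (elim \<omega>)
    have "U t \<omega> = U' t \<omega>" if "t \<in> right_dense s T" for t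
    proof -
      have "t \<in> right_dense 0 T" using that s by (auto simp: right_dense_def)
      then have "ennreal (norm (U t \<omega> - U' t \<omega>) powr 2) \<le> 0" unfolding elim(1)[symmetric] by (rule SUP_upper)
      then have "norm (U t \<omega> - U' t \<omega>) powr 2 \<le> 0" by (simp add: ennreal_eq_0_iff)
      then have "norm (U t \<omega> - U' t \<omega>) powr 2 = 0" by (intro antisym) auto
      then show ?thesis by simp
    qed
    from cadlag_on_eqI[OF elim(2,3) this] show ?case by blast
  qed
qed

definition sol :: "real \<Rightarrow> real^'n \<Rightarrow> real \<Rightarrow> 'a \<Rightarrow> real^'n" where
  "sol s x = (SOME U. strong_sol P L T s x B N U)"

lemma sol: "s \<in> {0..T} \<Longrightarrow> strong_sol P L T s x B N (sol s x)"
  unfolding sol_def by (rule someI_ex[OF sol_exists])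

definition increment_sup :: "nat \<Rightarrow> (real^'n \<Rightarrow> real \<Rightarrow> 'a \<Rightarrow> real^'n) \<Rightarrow> 'a \<Rightarrow> real^'n \<Rightarrow> real^'n \<Rightarrow> ennreal" where
  "increment_sup m V \<omega> x y = (\<Squnion>t\<in>right_dense 0 T. ennreal (norm (V x t \<omega> - V y t \<omega>) powr (2 * real m)))"

lemma increment_sup_measurable:
  assumes s: "s \<in> {0..T}" and V: "\<And>x. strong_sol P L T s x B N (V x)"
  shows "(\<lambda>\<omega>. increment_sup m V \<omega> x y) \<in> borel_measurable P"
  unfolding increment_sup_def
proof (rule borel_measurable_SUP[OF countable_right_dense])
  fix t assume "t \<in> right_dense 0 T"
  then have "t \<in> {0..T}" using right_dense_subset[of 0 T] T_pos by auto
  then have "V x t \<in> borel_measurable P" "V y t \<in> borel_measurable P"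
    using strong_sol_measurable[OF V[of x]] strong_sol_measurable[OF V[of y]] s by auto
  then have "(\<lambda>\<omega>. norm (V x t \<omega> - V y t \<omega>) powr (2 * real m)) \<in> borel_measurable P" by measurable
  then show "(\<lambda>\<omega>. ennreal (norm (V x t \<omega> - V y t \<omega>) powr (2 * real m))) \<in> borel_measurable P" by measurable
qed

text \<open>The bound is the same for all \<open>s\<close> and for every choice \<open>V\<close> of
  solutions. It is applied to the chosen solutions \<open>sol\<close> at dyadic times, and to the
  final flow at every \<open>s\<close>.\<close>

lemma hoelder_moment_sol:
  assumes m: "2 * CARD('n) < m"
  obtains D where "0 \<le> D" "\<And>s V. s \<in> {0..T} \<Longrightarrow> (\<And>x. strong_sol P L T s x B N (V x)) \<Longrightarrow>
    (\<integral>\<^sup>+\<omega>. hoelder_moment m (increment_sup m V \<omega>) \<partial>P) \<le> ennreal D"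
proof -
  have "2 \<le> 2 * real m" using m by simp
  from sol_moment[OF this] obtain D where D: "0 \<le> D" "\<And>s x y U U'. s \<in> {0..T} \<Longrightarrow> strong_sol P L T s x B N U \<Longrightarrow> strong_sol P L T s y B N U' \<Longrightarrow>
       (\<integral>\<^sup>+\<omega>. (\<Squnion>t\<in>right_dense 0 T. ennreal (norm (U t \<omega> - U' t \<omega>) powr (2 * real m))) \<partial>P) \<le> ennreal (D * norm (x - y) powr (2 * real m))"
    by blast
  obtain E where E: "\<And>P (\<rho> :: 'a \<Rightarrow> real^'n \<Rightarrow> real^'n \<Rightarrow> ennreal) C. \<lbrakk>0 \<le> C; \<And>x y. (\<lambda>\<omega>. \<rho> \<omega> x y) \<in> borel_measurable P;
     \<And>x y. (\<integral>\<^sup>+\<omega>. \<rho> \<omega> x y \<partial>P) \<le> ennreal (C * norm (x - y) powr (2 * real m))\<rbrakk>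
     \<Longrightarrow> (\<integral>\<^sup>+\<omega>. hoelder_moment m (\<rho> \<omega>) \<partial>P) \<le> ennreal (C * E)"
    by (rule hoelder_moment_bound[OF m, where 'a='a]) (erule that)
  show ?thesis
  proof (rule that[of "max 0 (D * E)"])
    fix s V assume s: "s \<in> {0..T}" and V: "\<And>x. strong_sol P L T s x B N (V x)"
    have "(\<integral>\<^sup>+\<omega>. hoelder_moment m (increment_sup m V \<omega>) \<partial>P) \<le> ennreal (D * E)"
      by (rule E[OF D(1) increment_sup_measurable[OF s V]]) (use D(2)[OF s V V] in \<open>auto simp: increment_sup_def\<close>)
    also have "\<dots> \<le> ennreal (max 0 (D * E))" by (rule ennreal_leI) simp
    finally show "(\<integral>\<^sup>+\<omega>. hoelder_moment m (increment_sup m V \<omega>) \<partial>P) \<le> ennreal (max 0 (D * E))" .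
  qed simp
qed

lemma increment_sup_hoelder:
  assumes m: "2 * CARD('n) < m"
  defines "\<gamma> \<equiv> (real m - 2 * real CARD('n)) / real m" and "e \<equiv> (2 * real CARD('n) + 1) / real m"
  obtains D where "1 \<le> D" "\<And>s V \<omega> x y t. \<lbrakk>hoelder_moment m (increment_sup m V \<omega>) < \<infinity>; 0 \<le> s;
      \<And>x. x \<in> dyadic_points \<Longrightarrow> cadlag_on {s..T} (\<lambda>t. V x t \<omega>); x \<in> dyadic_points; y \<in> dyadic_points; t \<in> {s..T}\<rbrakk>
     \<Longrightarrow> norm (V x t \<omega> - V y t \<omega>) \<le> D * (1 + enn2real (hoelder_moment m (increment_sup m V \<omega>))) * hoelder_weight \<gamma> e x y"
proof -
  obtain D where D: "0 \<le> D" "\<And>(X :: real^'n \<Rightarrow> real^'n) \<rho> w x y. \<lbrakk>0 \<le> w; hoelder_moment m \<rho> \<le> ennreal w;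
      \<And>x y. ennreal (norm (X x - X y) powr (2 * real m)) \<le> \<rho> x y; x \<in> dyadic_points; y \<in> dyadic_points\<rbrakk>
     \<Longrightarrow> norm (X x - X y) \<le> D * (1 + w) * (norm (x - y) powr \<gamma> * max (max (norm x) (norm y) powr e) 1)"
    by (fact hoelder_moment_estimate[OF m, where 'b="real^'n", folded \<gamma>_def e_def])
  show ?thesis
  \<comment> \<open>A constant of at least 1 keeps the later bounds infinite whenever the moment is
    infinite.\<close>
  proof (rule that[of "max 1 D"])
    fix s t :: real and V :: "real^'n \<Rightarrow> real \<Rightarrow> 'a \<Rightarrow> real^'n" and \<omega> and x y :: "real^'n"
    assume fin: "hoelder_moment m (increment_sup m V \<omega>) < \<infinity>" and s: "0 \<le> s" and c: "\<And>x. x \<in> dyadic_points \<Longrightarrow> cadlag_on {s..T} (\<lambda>t. V x t \<omega>)"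
      and x: "x \<in> dyadic_points" and y: "y \<in> dyadic_points" and t: "t \<in> {s..T}"
    let ?w = "enn2real (hoelder_moment m (increment_sup m V \<omega>))"
    have w: "hoelder_moment m (increment_sup m V \<omega>) = ennreal ?w" using fin by (simp add: ennreal_enn2real)
    have r: "norm (V x u \<omega> - V y u \<omega>) \<le> max 1 D * (1 + ?w) * hoelder_weight \<gamma> e x y" if u: "u \<in> right_dense 0 T" for u
    proof -
      have "norm (V x u \<omega> - V y u \<omega>) \<le> D * (1 + ?w) * (norm (x - y) powr \<gamma> * max (max (norm x) (norm y) powr e) 1)"
      proof (rule D(2)[where X="\<lambda>x. V x u \<omega>", OF enn2real_nonneg eq_refl[OF w] _ x y])
        show "ennreal (norm (V x u \<omega> - V y u \<omega>) powr (2 * real m)) \<le> increment_sup m V \<omega> x y" for x y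
          unfolding increment_sup_def by (rule SUP_upper[OF u])
      qed
      also have "\<dots> = D * ((1 + ?w) * hoelder_weight \<gamma> e x y)" by (simp add: hoelder_weight_def mult.assoc)
      also have "\<dots> \<le> max 1 D * ((1 + ?w) * hoelder_weight \<gamma> e x y)"
        by (intro mult_right_mono mult_nonneg_nonneg hoelder_weight_nonneg) (auto intro: add_nonneg_nonneg)
      finally show ?thesis by (simp add: mult.assoc)
    qed
    obtain h where h: "\<And>k. h k \<in> right_dense s T" "\<And>k. t \<le> h k" "h \<longlonglongrightarrow> t"
      by (rule right_dense_tendsto[OF t]) blast
    have hs: "h k \<in> {s..T}" for k using h(1)[of k] right_dense_subset[of s T] t by auto
    have h0: "h k \<in> right_dense 0 T" for k using h(1)[of k] s by (auto simp: right_dense_def)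
    have "(\<lambda>k. norm (V x (h k) \<omega> - V y (h k) \<omega>)) \<longlonglongrightarrow> norm (V x t \<omega> - V y t \<omega>)"
      by (intro tendsto_intros cadlag_on_tendsto_right[OF c t hs h(2,3)] x y)
    then show "norm (V x t \<omega> - V y t \<omega>) \<le> max 1 D * (1 + ?w) * hoelder_weight \<gamma> e x y"
      by (rule LIMSEQ_le_const2) (use r[OF h0] in blast)
  qed simp
qed

end

section \<open>Hoelder and flow properties of strong solutions on countable sets of data, and the
  almost sure solution map\<close>

context strong_flow
begin

lemma sol_hoelder_AE:
  assumes m: "2 * CARD('n) < m"
  defines "\<gamma> \<equiv> (real m - 2 * real CARD('n)) / real m" and "e \<equiv> (2 * real CARD('n) + 1) / real m"
  obtains D where "1 \<le> D" "\<And>s. s \<in> {0..T} \<Longrightarrow> AE \<omega> in P. hoelder_moment m (increment_sup m (sol s) \<omega>) < \<infinity> \<longrightarrow>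
     (\<forall>x\<in>dyadic_points. \<forall>y\<in>dyadic_points. \<forall>t\<in>{s..T}. norm (sol s x t \<omega> - sol s y t \<omega>)
        \<le> D * (1 + enn2real (hoelder_moment m (increment_sup m (sol s) \<omega>))) * hoelder_weight \<gamma> e x y)"
proof -
  obtain D where D: "1 \<le> D" "\<And>s V \<omega> x y t. \<lbrakk>hoelder_moment m (increment_sup m V \<omega>) < \<infinity>; 0 \<le> s;
      \<And>x. x \<in> dyadic_points \<Longrightarrow> cadlag_on {s..T} (\<lambda>t. V x t \<omega>); x \<in> dyadic_points; y \<in> dyadic_points; t \<in> {s..T}\<rbrakk>
     \<Longrightarrow> norm (V x t \<omega> - V y t \<omega>) \<le> D * (1 + enn2real (hoelder_moment m (increment_sup m V \<omega>))) * hoelder_weight \<gamma> e x y"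
    by (fact increment_sup_hoelder[OF m, folded \<gamma>_def e_def])
  show ?thesis
  proof (rule that[OF D(1)])
    fix s assume s: "s \<in> {0..T}"
    have "AE \<omega> in P. \<forall>x\<in>dyadic_points. cadlag_on {s..T} (\<lambda>t. sol s x t \<omega>)"
      using sol[OF s] unfolding strong_sol_def
      by (subst AE_ball_countable[OF countable_dyadic_points]) (auto elim: AE_mp)
    then show "AE \<omega> in P. hoelder_moment m (increment_sup m (sol s) \<omega>) < \<infinity> \<longrightarrow>
     (\<forall>x\<in>dyadic_points. \<forall>y\<in>dyadic_points. \<forall>t\<in>{s..T}. norm (sol s x t \<omega> - sol s y t \<omega>)
        \<le> D * (1 + enn2real (hoelder_moment m (increment_sup m (sol s) \<omega>))) * hoelder_weight \<gamma> e x y)"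
    proof eventually_elim
      case (elim \<omega>)
      then show ?case using s by (intro impI ballI D(2)) auto
    qed
  qed
qed

lemma sol_noisy_sol_AE:
  assumes s: "s \<in> {0..T}"
  shows "AE \<omega> in P. \<forall>x\<in>dyadic_points. noisy_path.noisy_sol B (\<lambda>t. N t \<omega>) s T x (\<lambda>t. sol s x t \<omega>)"
  by (subst AE_ball_countable[OF countable_dyadic_points]) (use strong_sol_noisy_sol[OF sol[OF s]] in auto)

text \<open>The process that follows \<open>sol s x\<close> up to time \<open>s'\<close> and the extended flow from \<open>s'\<close> afterwards is an
  adapted solution starting from \<open>x\<close> at time \<open>s\<close>; by the moment bound it is indistinguishable from
  \<open>sol s x\<close>.\<close>

lemma sol_flow_AE:
  assumes s: "s \<in> {0..T}" and s': "s' \<in> {0..T}" "s < s'" and x: "x \<in> dyadic_points"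
  shows "AE \<omega> in P. \<forall>t\<in>{s'..T}. (\<lambda>k. sol s' (dyadic_floor k (sol s x s' \<omega>)) t \<omega>) \<longlonglongrightarrow> sol s x t \<omega>"
proof -
  \<comment> \<open>Every admissible \<open>m\<close> would do: only continuity in the starting
    point is at stake here, so the order \<open>\<gamma>\<close> may be small.\<close>
  define m where "m = Suc (2 * CARD('n))"
  have m: "2 * CARD('n) < m" by (simp add: m_def)
  define \<gamma> e where "\<gamma> = (real m - 2 * real CARD('n)) / real m" and "e = (2 * real CARD('n) + 1) / real m"
  have ge: "0 < \<gamma>" "0 < e" using m by (auto simp: \<gamma>_def e_def intro!: divide_pos_pos)
  obtain D where D: "1 \<le> D" "\<And>s. s \<in> {0..T} \<Longrightarrow> AE \<omega> in P. hoelder_moment m (increment_sup m (sol s) \<omega>) < \<infinity> \<longrightarrow>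
     (\<forall>x\<in>dyadic_points. \<forall>y\<in>dyadic_points. \<forall>t\<in>{s..T}. norm (sol s x t \<omega> - sol s y t \<omega>)
        \<le> D * (1 + enn2real (hoelder_moment m (increment_sup m (sol s) \<omega>))) * hoelder_weight \<gamma> e x y)"
    by (fact sol_hoelder_AE[OF m, folded \<gamma>_def e_def])
  obtain E where E: "0 \<le> E" "\<And>s V. s \<in> {0..T} \<Longrightarrow> (\<And>x. strong_sol P L T s x B N (V x)) \<Longrightarrow>
    (\<integral>\<^sup>+\<omega>. hoelder_moment m (increment_sup m V \<omega>) \<partial>P) \<le> ennreal E"
    by (fact hoelder_moment_sol[OF m])
  have hfin: "AE \<omega> in P. hoelder_moment m (increment_sup m (sol s') \<omega>) < \<infinity>"
  proof -
    have "(\<integral>\<^sup>+\<omega>. hoelder_moment m (increment_sup m (sol s') \<omega>) \<partial>P) \<noteq> \<infinity>"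
      using E(2)[OF s'(1) sol[OF s'(1)]] by (metis ennreal_neq_top infinity_ennreal_def neq_top_trans)
    from nn_integral_noteq_infinite[OF hoelder_moment_measurable[OF increment_sup_measurable[OF s'(1) sol[OF s'(1)]]] this]
    show ?thesis by eventually_elim (simp add: less_top)
  qed
  \<comment> \<open>The solutions \<open>sol s' y\<close> are chosen separately for each
    \<open>y\<close> and are related to each other only at dyadic \<open>y\<close>. The random
    starting point is therefore rounded to dyadic points: each approximation is a composition with a
    countably valued variable, hence adapted, and so is the limit.\<close>
  define V where "V t \<omega> = (if t < s' then sol s x t \<omega> else lim (\<lambda>k. sol s' (dyadic_floor k (sol s x s' \<omega>)) t \<omega>))" for t \<omega>
  have path: "AE \<omega> in P. noisy_path.noisy_sol B (\<lambda>t. N t \<omega>) s T x (\<lambda>t. V t \<omega>) \<and>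
      (\<forall>t\<in>{s'..T}. (\<lambda>k. sol s' (dyadic_floor k (sol s x s' \<omega>)) t \<omega>) \<longlonglongrightarrow> V t \<omega>)"
    using N_cadlag hfin D(2)[OF s'(1)] sol_noisy_sol_AE[OF s] sol_noisy_sol_AE[OF s'(1)]
  proof eventually_elim
    case (elim \<omega>)
    interpret noisy_path B "\<lambda>t. N t \<omega>" T K C \<beta> by (rule noisy_pathI[OF elim(1)])
    define W where "W = D * (1 + enn2real (hoelder_moment m (increment_sup m (sol s') \<omega>)))"
    have W: "0 \<le> W" using D(1) by (simp add: W_def)
    obtain \<Psi> where \<Psi>: "\<And>y. noisy_sol s' T y (\<lambda>t. \<Psi> t y)" "\<And>y t. t \<in> {s'..T} \<Longrightarrow> (\<lambda>k. sol s' (dyadic_floor k y) t \<omega>) \<longlonglongrightarrow> \<Psi> t y"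
    proof (rule flow_extension[of s' \<gamma> e W dyadic_floor dyadic_points "\<lambda>x t. sol s' x t \<omega>"])
      show "norm (sol s' x t \<omega> - sol s' y t \<omega>) \<le> W * hoelder_weight \<gamma> e x y"
        if "x \<in> dyadic_points" "y \<in> dyadic_points" "t \<in> {s'..T}" for x y t
        using elim(2,3) that unfolding W_def by blast
    qed (use s' ge W dyadic_floor_dyadic_points dyadic_floor_tendsto elim(5) in auto)
    let ?y = "sol s x s' \<omega>"
    have V2: "V t \<omega> = \<Psi> t ?y" if "t \<in> {s'..T}" for t
      using limI[OF \<Psi>(2)[OF that, of ?y]] that by (simp add: V_def)
    have z1: "ode_sol s s' (x - N s \<omega>) (\<lambda>t. sol s x t \<omega> - N t \<omega>)"
    proof -
      have "noisy_sol s T x (\<lambda>t. sol s x t \<omega>)" using elim(4) x by blast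
      then have "ode_sol s T (x - N s \<omega>) (\<lambda>t. sol s x t \<omega> - N t \<omega>)" by (subst (asm) noisy_sol_iff) (use s in auto)
      then show ?thesis unfolding ode_sol_def using s' by (auto intro: continuous_on_subset)
    qed
    have z2: "ode_sol s' T (?y - N s' \<omega>) (\<lambda>t. \<Psi> t ?y - N t \<omega>)"
      using \<Psi>(1)[of ?y] by (subst (asm) noisy_sol_iff) (use s' in auto)
    have "ode_sol s T (x - N s \<omega>) (\<lambda>t. if t < s' then sol s x t \<omega> - N t \<omega> else \<Psi> t ?y - N t \<omega>)"
      by (rule ode_sol_concat[OF z1 z2]) (use s s' in auto)
    then have "noisy_sol s T x (\<lambda>t. (if t < s' then sol s x t \<omega> - N t \<omega> else \<Psi> t ?y - N t \<omega>) + N t \<omega>)"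
      by (subst noisy_sol_iff) (use s in auto)
    moreover have "(if t < s' then sol s x t \<omega> - N t \<omega> else \<Psi> t ?y - N t \<omega>) + N t \<omega> = V t \<omega>" if "t \<in> {s..T}" for t
      using V2[of t] that by (auto simp: V_def)
    ultimately have "noisy_sol s T x (\<lambda>t. V t \<omega>)" by (rule noisy_sol_cong)
    moreover have "\<forall>t\<in>{s'..T}. (\<lambda>k. sol s' (dyadic_floor k (sol s x s' \<omega>)) t \<omega>) \<longlonglongrightarrow> V t \<omega>"
      using \<Psi>(2) V2 by simp
    ultimately show ?case by blast
  qed
  have "strong_sol P L T s x B N V"
    unfolding strong_sol_def
  proof (intro conjI)
    show "\<forall>t\<in>{0..s}. \<forall>\<omega>\<in>space P. V t \<omega> = x"
      using sol[OF s, of x] s' unfolding strong_sol_def by (auto simp: V_def)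
    show "\<forall>t\<in>{s..T}. \<forall>B\<in>sets borel. V t -` B \<inter> space P \<in> FL P L s t"
    proof
      fix t assume t: "t \<in> {s..T}"
      have solm: "sol s x u \<in> borel_measurable (FLM P L s u)" if "u \<in> {s..T}" for u
        using sol[OF s, of x] that unfolding strong_sol_def FLM_measurable_iff by blast
      have "V t \<in> borel_measurable (FLM P L s t)"
      proof (cases "t < s'")
        case True
        then have "V t = sol s x t" by (simp add: V_def fun_eq_iff)
        then show ?thesis using solm[OF t] by simp
      next
        case False
        have Y: "sol s x s' \<in> borel_measurable (FLM P L s t)"
          by (rule FLM_mono[OF _ _ _ solm]) (use False s' t in auto)
        have Us': "sol s' y t \<in> borel_measurable (FLM P L s t)" for y
        proof (rule FLM_mono)
          show "sol s' y t \<in> borel_measurable (FLM P L s' t)"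
            using sol[OF s'(1), of y] False t unfolding strong_sol_def FLM_measurable_iff by auto
        qed (use False s' in auto)
        have "(\<lambda>\<omega>. sol s' (dyadic_floor k (sol s x s' \<omega>)) t \<omega>) \<in> borel_measurable (FLM P L s t)" for k
          by (rule measurable_compose_countable'[OF Us' measurable_compose[OF Y dyadic_floor_count_space] countable_dyadic_points])
        then have "(\<lambda>\<omega>. lim (\<lambda>k. sol s' (dyadic_floor k (sol s x s' \<omega>)) t \<omega>)) \<in> borel_measurable (FLM P L s t)"
          by (rule borel_measurable_lim_metric)
        moreover have "V t = (\<lambda>\<omega>. lim (\<lambda>k. sol s' (dyadic_floor k (sol s x s' \<omega>)) t \<omega>))" using False by (simp add: V_def fun_eq_iff)
        ultimately show ?thesis by simp
      qed
      then show "\<forall>B\<in>sets borel. V t -` B \<inter> space P \<in> FL P L s t" unfolding FLM_measurable_iff .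
    qed
    have "AE \<omega> in P. cadlag_on {0..T} (\<lambda>t. L t \<omega>) \<and> L 0 \<omega> = 0"
      using sol[OF s, of x] unfolding strong_sol_def by (auto elim: AE_mp)
    with path N_cadlag show "AE \<omega> in P. cadlag_on {s..T} (\<lambda>t. V t \<omega>) \<and> cadlag_on {0..T} (\<lambda>t. L t \<omega>) \<and> L 0 \<omega> = 0 \<and>
        (\<forall>t\<in>{s..T}. V t \<omega> = x + (LINT r:{s..t}|lborel. B r (V r \<omega>)) + N t \<omega> - N s \<omega>)"
      by eventually_elim (simp add: noisy_path.noisy_sol_def[OF noisy_pathI])
  qed
  from strong_sol_unique[OF s sol[OF s] this] path show ?thesis
  proof eventually_elim
    case (elim \<omega>)
    then show ?case using s' by auto
  qed
qed

text \<open>The hypotheses of \<open>solution_map_exists\<close> are collected on one event. The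
  Hoelder estimates, the equations and the flow relations are countably many almost sure statements,
  and the grid sums are controlled by their means.\<close>

theorem solution_map_AE:
  "AE \<omega> in P. cadlag_on {0..T} (\<lambda>t. N t \<omega>) \<and> (\<exists>Z. noisy_path.solution_map B (\<lambda>t. N t \<omega>) T Z)"
proof -
  note gb = dyadic_grid_bounds[OF less_imp_le[OF T_pos]]
  have gT: "s \<in> {0..T}" if "s \<in> dyadic_grid T" for s using gb[OF that] by simp
  define n where "n = real CARD('n)"
  \<comment> \<open>The condition amounts to (1 + beta) (m - 2n) > m, that is
    \<open>1 < (1 + \<beta>) * \<gamma>\<close>.\<close>
  obtain m where m: "2 * n * (1 + \<beta>) / \<beta> < real m" using reals_Archimedean2 by blast
  have "2 * n \<le> 2 * n * (1 + \<beta>) / \<beta>"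
    using beta_pos by (simp add: n_def field_simps)
  then have m2: "2 * n < real m" using m by linarith
  then have mn: "2 * CARD('n) < m" unfolding n_def by linarith
  have m0: "0 < real m" using m2 by (simp add: n_def)
  define \<gamma> e where "\<gamma> = (real m - 2 * real CARD('n)) / real m" and "e = (2 * real CARD('n) + 1) / real m"
  have ge: "0 < \<gamma>" "0 < e" using mn m0 by (auto simp: \<gamma>_def e_def intro!: divide_pos_pos)
  have a: "1 < (1 + \<beta>) * \<gamma>"
  proof -
    have "2 * n * (1 + \<beta>) < real m * \<beta>" using m beta_pos by (simp add: pos_divide_less_eq)
    then have "real m < (1 + \<beta>) * (real m - 2 * n)" by (simp add: algebra_simps)
    then show ?thesis using m0 by (simp add: \<gamma>_def n_def pos_less_divide_eq)
  qed
  obtain D where D: "1 \<le> D" "\<And>s. s \<in> {0..T} \<Longrightarrow> AE \<omega> in P. hoelder_moment m (increment_sup m (sol s) \<omega>) < \<infinity> \<longrightarrow>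
     (\<forall>x\<in>dyadic_points. \<forall>y\<in>dyadic_points. \<forall>t\<in>{s..T}. norm (sol s x t \<omega> - sol s y t \<omega>)
        \<le> D * (1 + enn2real (hoelder_moment m (increment_sup m (sol s) \<omega>))) * hoelder_weight \<gamma> e x y)"
    by (fact sol_hoelder_AE[OF mn, folded \<gamma>_def e_def])
  obtain E where E: "0 \<le> E" "\<And>s V. s \<in> {0..T} \<Longrightarrow> (\<And>x. strong_sol P L T s x B N (V x)) \<Longrightarrow>
    (\<integral>\<^sup>+\<omega>. hoelder_moment m (increment_sup m V \<omega>) \<partial>P) \<le> ennreal E"
    by (fact hoelder_moment_sol[OF mn])
  define h where "h s \<omega> = hoelder_moment m (increment_sup m (sol s) \<omega>)" for s \<omega>
  have hm: "h s \<in> borel_measurable P" if "s \<in> dyadic_grid T" for s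
    unfolding h_def by (intro hoelder_moment_measurable increment_sup_measurable[OF gT[OF that]] sol gT that)
  have hE: "(\<integral>\<^sup>+\<omega>. h s \<omega> \<partial>P) \<le> ennreal E" if "s \<in> dyadic_grid T" for s
    unfolding h_def by (rule E(2)[OF gT[OF that] sol[OF gT[OF that]]])
  have "AE \<omega> in P. \<forall>s\<in>dyadic_grid T. h s \<omega> < \<infinity> \<longrightarrow>
     (\<forall>x\<in>dyadic_points. \<forall>y\<in>dyadic_points. \<forall>t\<in>{s..T}. norm (sol s x t \<omega> - sol s y t \<omega>) \<le> D * (1 + enn2real (h s \<omega>)) * hoelder_weight \<gamma> e x y)"
    unfolding h_def by (subst AE_ball_countable[OF countable_dyadic_grid]) (use D(2) gT in blast)
  moreover have "AE \<omega> in P. \<forall>s\<in>dyadic_grid T. \<forall>x\<in>dyadic_points. noisy_path.noisy_sol B (\<lambda>t. N t \<omega>) s T x (\<lambda>t. sol s x t \<omega>)"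
    by (subst AE_ball_countable[OF countable_dyadic_grid]) (use sol_noisy_sol_AE gT in blast)
  moreover have "AE \<omega> in P. \<forall>p\<in>dyadic_grid T \<times> dyadic_grid T \<times> dyadic_points. fst p < fst (snd p) \<longrightarrow>
      (\<forall>t\<in>{fst (snd p)..T}. (\<lambda>k. sol (fst (snd p)) (dyadic_floor k (sol (fst p) (snd (snd p)) (fst (snd p)) \<omega>)) t \<omega>) \<longlonglongrightarrow> sol (fst p) (snd (snd p)) t \<omega>)"
  proof (subst AE_ball_countable, intro countable_SIGMA countable_dyadic_grid countable_dyadic_points, intro ballI)
    fix p :: "real \<times> real \<times> (real^'n)" assume p: "p \<in> dyadic_grid T \<times> dyadic_grid T \<times> dyadic_points"
    show "AE \<omega> in P. fst p < fst (snd p) \<longrightarrow> (\<forall>t\<in>{fst (snd p)..T}. (\<lambda>k. sol (fst (snd p)) (dyadic_floor k (sol (fst p) (snd (snd p)) (fst (snd p)) \<omega>)) t \<omega>) \<longlonglongrightarrow> sol (fst p) (snd (snd p)) t \<omega>)"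
    proof (cases "fst p < fst (snd p)")
      case True
      have "fst p \<in> {0..T}" "fst (snd p) \<in> {0..T}" "snd (snd p) \<in> dyadic_points" using p gT by (auto simp: mem_Times_iff)
      from sol_flow_AE[OF this(1,2) True this(3)] show ?thesis by eventually_elim simp
    qed simp
  qed
  moreover have "AE \<omega> in P. (\<forall>s\<in>dyadic_grid T. h s \<omega> < \<infinity>) \<and>
     (\<lambda>k. (T / 2 ^ k) powr ((1 + \<beta>) * \<gamma>) * (\<Sum>i\<le>2 ^ k. 1 + enn2real (h (T * real i / 2 ^ k) \<omega>))) \<longlonglongrightarrow> 0"
    by (rule grid_sum_AE_tendsto[OF T_pos a E(1) hm prob hE])
  moreover note N_cadlag
  ultimately show ?thesis
  proof eventually_elim
    case (elim \<omega>)
    interpret noisy_path B "\<lambda>t. N t \<omega>" T K C \<beta> by (rule noisy_pathI[OF elim(5)])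
    have "\<exists>Z. solution_map Z"
    proof (rule solution_map_exists[where \<gamma>=\<gamma> and e=e and A=dyadic_points and a=dyadic_floor
          and u="\<lambda>s x t. sol s x t \<omega>" and W="\<lambda>s. D * (1 + enn2real (h s \<omega>))"])
      show "noisy_sol s T x (\<lambda>t. sol s x t \<omega>)" if "s \<in> dyadic_grid T" "x \<in> dyadic_points" for s x
        using elim(2) that by blast
      show "norm (sol s x t \<omega> - sol s y t \<omega>) \<le> D * (1 + enn2real (h s \<omega>)) * hoelder_weight \<gamma> e x y"
        if "s \<in> dyadic_grid T" "x \<in> dyadic_points" "y \<in> dyadic_points" "t \<in> {s..T}" for s x y t
        using elim(1,4) that by blast
      show "(\<lambda>k. sol s' (dyadic_floor k (sol s x s' \<omega>)) t \<omega>) \<longlonglongrightarrow> sol s x t \<omega>"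
        if "s \<in> dyadic_grid T" "s' \<in> dyadic_grid T" "s < s'" "x \<in> dyadic_points" "t \<in> {s'..T}" for s s' x t
        using elim(3)[rule_format, of "(s, s', x)"] that by simp
      have "(\<lambda>k. D * ((T / 2 ^ k) powr ((1 + \<beta>) * \<gamma>) * (\<Sum>i\<le>2 ^ k. 1 + enn2real (h (T * real i / 2 ^ k) \<omega>)))) \<longlonglongrightarrow> D * 0"
        using elim(4) by (intro tendsto_mult tendsto_const) blast
      then show "(\<lambda>k. (T / 2 ^ k) powr ((1 + \<beta>) * \<gamma>) * (\<Sum>i\<le>2 ^ k. D * (1 + enn2real (h (T * real i / 2 ^ k) \<omega>)))) \<longlonglongrightarrow> 0"
        by (simp only: sum_distrib_left[symmetric] mult.left_commute[of D] mult_zero_right)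
    qed (use ge D(1) dyadic_floor_dyadic_points dyadic_floor_tendsto in auto)
    then show ?case using elim(5) by blast
  qed
qed

end

text \<open>Joint right continuity in both times and continuity in \<open>x\<close>. It makes the
  flow a limit of its values at countably many arguments, which yields joint measurability.\<close>

lemma (in noisy_path) noisy_flow_joint_tendsto:
  assumes Z: "solution_map Z" and s: "s \<in> {0..T}" and t: "t \<in> {0..T}"
    and sk: "\<And>k. sk k \<in> {0..T}" "\<And>k. s \<le> sk k" "sk \<longlonglongrightarrow> s"
    and tk: "\<And>k. tk k \<in> {0..T}" "\<And>k. t \<le> tk k" "tk \<longlonglongrightarrow> t"
    and xk: "xk \<longlonglongrightarrow> x"
  shows "(\<lambda>k. noisy_flow Z (sk k) (tk k) (xk k)) \<longlonglongrightarrow> noisy_flow Z s t x"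
proof -
  have ms: "(\<lambda>k. m (sk k)) \<longlonglongrightarrow> m s"
    by (rule cadlag_on_tendsto_right[OF m_cadlag s sk(1,2,3)])
  have mx: "(\<lambda>k. m (max (sk k) (tk k))) \<longlonglongrightarrow> m (max s t)"
  proof (rule cadlag_on_tendsto_right[OF m_cadlag])
    show "max s t \<in> {0..T}" using s t by (auto simp: max_def)
    show "max (sk k) (tk k) \<in> {0..T}" for k using sk(1)[of k] tk(1)[of k] by (auto simp: max_def)
    show "max s t \<le> max (sk k) (tk k)" for k using sk(2)[of k] tk(2)[of k] by (auto simp: max_def)
    show "(\<lambda>k. max (sk k) (tk k)) \<longlonglongrightarrow> max s t" by (intro tendsto_max sk tk)
  qed
  have c: "continuous_on ({0..T} \<times> {0..T} \<times> UNIV) (\<lambda>(s, t, c). Z s t c)" using Z by (simp add: solution_map_def)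
  have p: "(\<lambda>k. (sk k, tk k, xk k - m (sk k))) \<longlonglongrightarrow> (s, t, x - m s)"
    by (intro tendsto_Pair sk tk tendsto_diff xk ms)
  have "((\<lambda>(s, t, c). Z s t c) \<circ> (\<lambda>k. (sk k, tk k, xk k - m (sk k)))) \<longlonglongrightarrow> (\<lambda>(s, t, c). Z s t c) (s, t, x - m s)"
    using c[unfolded continuous_on_sequentially, rule_format, OF _ conjI, OF _ _ p] s t sk tk by auto
  then have "(\<lambda>k. Z (sk k) (tk k) (xk k - m (sk k))) \<longlonglongrightarrow> Z s t (x - m s)" by (simp add: o_def)
  from tendsto_add[OF this mx] show ?thesis by (simp add: noisy_flow_def)
qed

text \<open>By Tonelli's theorem the integral over time has finite mean, so it is almost surely
  finite.\<close>

lemma nn_integral_AE_finite_sections: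
  fixes V :: "real \<Rightarrow> 'a \<Rightarrow> ennreal"
  assumes P: "prob_space P" and T: "0 < T" and E: "0 \<le> E"
    and V: "(\<lambda>(s, \<omega>). V s \<omega>) \<in> borel_measurable (restrict_space borel {0..T} \<Otimes>\<^sub>M P)"
    and b: "\<And>s. s \<in> {0..T} \<Longrightarrow> (\<integral>\<^sup>+\<omega>. V s \<omega> \<partial>P) \<le> ennreal E"
  shows "AE \<omega> in P. (\<integral>\<^sup>+ s\<in>{0..T}. V s \<omega> \<partial>lborel) < \<infinity>"
proof -
  interpret prob_space P by (rule P)
  interpret pair_sigma_finite lborel P by unfold_locales
  \<comment> \<open>Clipping the time extends \<open>V\<close> measurably from \<open>{0..T}\<close>
    to the real line; the indicator removes what was added.\<close>
  define F where "F = (\<lambda>(s, \<omega>). V (max 0 (min T s)) \<omega> * indicator {0..T} s)"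
  have clip: "(\<lambda>s. max 0 (min T s)) \<in> measurable borel (restrict_space borel {0..T})"
    by (rule measurable_restrict_space2) (use T in \<open>auto simp: max_def min_def\<close>)
  have "(\<lambda>p. (max 0 (min T (fst p)), snd p)) \<in> measurable (lborel \<Otimes>\<^sub>M P) (restrict_space borel {0..T} \<Otimes>\<^sub>M P)"
    by (rule measurable_Pair) (auto intro: measurable_compose[OF measurable_fst'' clip] measurable_compose[OF measurable_fst] simp: clip)
  from measurable_compose[OF this V] have 1: "(\<lambda>p. V (max 0 (min T (fst p))) (snd p)) \<in> borel_measurable (lborel \<Otimes>\<^sub>M P)" by simp
  have "(\<lambda>p. indicator {0..T} (fst p) :: ennreal) \<in> borel_measurable (lborel \<Otimes>\<^sub>M P)" by measurable
  from borel_measurable_times_ennreal[OF 1 this] have Fm: "F \<in> borel_measurable (lborel \<Otimes>\<^sub>M P)"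
    by (simp add: F_def case_prod_unfold)
  have eq: "F (s, \<omega>) = V s \<omega> * indicator {0..T} s" for s \<omega>
    by (auto simp: F_def indicator_def max_def min_def)
  have "(\<integral>\<^sup>+\<omega>. (\<integral>\<^sup>+s. F (s, \<omega>) \<partial>lborel) \<partial>P) = (\<integral>\<^sup>+s. (\<integral>\<^sup>+\<omega>. F (s, \<omega>) \<partial>P) \<partial>lborel)"
    by (rule Fubini[OF Fm])
  also have "\<dots> \<le> (\<integral>\<^sup>+s. ennreal E * indicator {0..T} s \<partial>lborel)"
  proof (rule nn_integral_mono)
    fix s
    show "(\<integral>\<^sup>+\<omega>. F (s, \<omega>) \<partial>P) \<le> ennreal E * indicator {0..T} s"
      using b[of s] by (cases "s \<in> {0..T}") (auto simp: eq)
  qed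
  also have "\<dots> = ennreal E * ennreal T" using T by (subst nn_integral_cmult_indicator) (auto simp: emeasure_lborel_Icc_eq)
  also have "\<dots> < \<infinity>" using E T by (simp add: ennreal_mult[symmetric])
  finally have fin: "(\<integral>\<^sup>+\<omega>. (\<integral>\<^sup>+s. F (s, \<omega>) \<partial>lborel) \<partial>P) \<noteq> \<infinity>" by simp
  have "(\<lambda>(\<omega>, s). F (s, \<omega>)) \<in> borel_measurable (P \<Otimes>\<^sub>M lborel)"
    using measurable_compose[OF measurable_pair_swap' Fm] by (simp add: case_prod_unfold)
  then have m: "(\<lambda>\<omega>. \<integral>\<^sup>+s. F (s, \<omega>) \<partial>lborel) \<in> borel_measurable P"
    by (rule lborel.borel_measurable_nn_integral)
  from nn_integral_noteq_infinite[OF m fin] show ?thesis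
    by eventually_elim (simp add: eq less_top)
qed

section \<open>The flow \<open>psi\<close>: measurability, adaptedness and the Hoelder
  estimate\<close>

context strong_flow
begin

definition good :: "'a set" where
  "good = {\<omega> \<in> space P. cadlag_on {0..T} (\<lambda>t. N t \<omega>) \<and> (\<exists>Z. noisy_path.solution_map B (\<lambda>t. N t \<omega>) T Z)}"

definition Z_of :: "'a \<Rightarrow> real \<Rightarrow> real \<Rightarrow> real^'n \<Rightarrow> real^'n" where
  "Z_of \<omega> = (SOME Z. noisy_path.solution_map B (\<lambda>t. N t \<omega>) T Z)"

text \<open>Off \<open>good\<close> the value \<open>x\<close> keeps the process equal to
  \<open>x\<close> before time \<open>s\<close> at every point of the space, as
  \<open>strong_sol\<close> demands, and makes the approximations in the proof of joint
  measurability converge there too.\<close>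

definition psi :: "real \<Rightarrow> real \<Rightarrow> real^'n \<Rightarrow> 'a \<Rightarrow> real^'n" where
  "psi s t x \<omega> = (if \<omega> \<in> good then noisy_path.noisy_flow (\<lambda>t. N t \<omega>) (Z_of \<omega>) s t x else x)"

lemma AE_good: "AE \<omega> in P. \<omega> \<in> good"
  using solution_map_AE AE_space by eventually_elim (simp add: good_def)

text \<open>The good event is described by the existence of a solution map, which is not visibly
  measurable; completeness settles this.\<close>

lemma AE_imp_sets:
  assumes "AE \<omega> in P. Q \<omega>" shows "{\<omega> \<in> space P. Q \<omega>} \<in> sets P"
proof -
  interpret complete_measure P by (rule complete)
  from assms obtain N' where N': "{\<omega> \<in> space P. \<not> Q \<omega>} \<subseteq> N'" "N' \<in> null_sets P" by (auto elim!: AE_E simp: null_sets_def)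
  have "space P - {\<omega> \<in> space P. \<not> Q \<omega>} \<in> sets P"
    by (intro sets.compl_sets complete[OF N'])
  moreover have "space P - {\<omega> \<in> space P. \<not> Q \<omega>} = {\<omega> \<in> space P. Q \<omega>}" by auto
  ultimately show ?thesis by simp
qed

lemma goodD:
  assumes "\<omega> \<in> good"
  shows "noisy_path B (\<lambda>t. N t \<omega>) T K C \<beta>" "noisy_path.solution_map B (\<lambda>t. N t \<omega>) T (Z_of \<omega>)"
    "psi s t x \<omega> = noisy_path.noisy_flow (\<lambda>t. N t \<omega>) (Z_of \<omega>) s t x"
  using assms noisy_pathI someI_ex[of "\<lambda>Z. noisy_path.solution_map B (\<lambda>t. N t \<omega>) T Z"]
  by (auto simp: good_def Z_of_def psi_def)

lemma psi_before: "s \<in> {0..T} \<Longrightarrow> t \<le> s \<Longrightarrow> psi s t x \<omega> = x"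
  using noisy_path.noisy_flow_before[OF goodD(1) goodD(2)] goodD(3) by (cases "\<omega> \<in> good") (auto simp: psi_def)

lemma psi_noisy_sol: "\<omega> \<in> good \<Longrightarrow> s \<in> {0..T} \<Longrightarrow> noisy_path.noisy_sol B (\<lambda>t. N t \<omega>) s T x (\<lambda>t. psi s t x \<omega>)"
  using noisy_path.noisy_flow_sol[OF goodD(1) goodD(2)] by (simp add: goodD(3))

lemma psi_cadlag: "\<omega> \<in> good \<Longrightarrow> s \<in> {0..T} \<Longrightarrow> cadlag_on {s..T} (\<lambda>t. psi s t x \<omega>)"
  using psi_noisy_sol[of \<omega> s x] noisy_path.noisy_sol_def[OF goodD(1)] by blast

lemma psi_eq:
  assumes "\<omega> \<in> good" "s \<in> {0..T}" "t \<in> {s..T}"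
  shows "psi s t x \<omega> = x + (LINT r:{s..t}|lborel. B r (psi s r x \<omega>)) + N t \<omega> - N s \<omega>"
  using iffD1[OF noisy_path.noisy_sol_def[OF goodD(1)[OF assms(1)]] psi_noisy_sol[OF assms(1,2), of x], THEN conjunct2, THEN bspec, OF assms(3)] .

lemma psi_sol_AE:
  assumes s: "s \<in> {0..T}" shows "AE \<omega> in P. \<forall>t\<in>{s..T}. sol s x t \<omega> = psi s t x \<omega>"
  using AE_good strong_sol_noisy_sol[OF sol[OF s, of x]]
proof eventually_elim
  case (elim \<omega>)
  show ?case
  proof
    fix t assume "t \<in> {s..T}"
    then show "sol s x t \<omega> = psi s t x \<omega>"
      using noisy_path.noisy_flow_unique[OF goodD(1) goodD(2) elim(2), OF elim(1) elim(1), of t] s by (simp add: goodD(3)[OF elim(1)])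
  qed
qed

lemma psi_strong_sol:
  assumes s: "s \<in> {0..T}" shows "strong_sol P L T s x B N (\<lambda>t \<omega>. psi s t x \<omega>)"
  unfolding strong_sol_def
proof (intro conjI)
  show "\<forall>t\<in>{0..s}. \<forall>\<omega>\<in>space P. psi s t x \<omega> = x" using psi_before s by auto
  show "\<forall>t\<in>{s..T}. \<forall>B\<in>sets borel. (\<lambda>\<omega>. psi s t x \<omega>) -` B \<inter> space P \<in> FL P L s t"
  proof
    fix t assume t: "t \<in> {s..T}"
    have "sol s x t \<in> borel_measurable (FLM P L s t)"
      using sol[OF s, of x] t unfolding strong_sol_def FLM_measurable_iff by blast
    then have "(\<lambda>\<omega>. psi s t x \<omega>) \<in> borel_measurable (FLM P L s t)"
    proof (rule FLM_AE[OF complete])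
      show "AE \<omega> in P. sol s x t \<omega> = psi s t x \<omega>" using psi_sol_AE[OF s, of x] by eventually_elim (use t in blast)
    qed
    then show "\<forall>B\<in>sets borel. (\<lambda>\<omega>. psi s t x \<omega>) -` B \<inter> space P \<in> FL P L s t" unfolding FLM_measurable_iff .
  qed
  have "AE \<omega> in P. cadlag_on {0..T} (\<lambda>t. L t \<omega>) \<and> L 0 \<omega> = 0"
    using sol[OF s, of x] unfolding strong_sol_def by (auto elim: AE_mp)
  with AE_good show "AE \<omega> in P. cadlag_on {s..T} (\<lambda>t. psi s t x \<omega>) \<and> cadlag_on {0..T} (\<lambda>t. L t \<omega>) \<and> L 0 \<omega> = 0 \<and>
        (\<forall>t\<in>{s..T}. psi s t x \<omega> = x + (LINT r:{s..t}|lborel. B r (psi s r x \<omega>)) + N t \<omega> - N s \<omega>)"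
    by eventually_elim (use psi_cadlag psi_eq s in blast)
qed

text \<open>Both times are rounded up and \<open>x\<close> is rounded to a dyadic point. The
  approximations select among countably many random variables, and they converge by joint right
  continuity.\<close>

theorem psi_measurable:
  "(\<lambda>((s, t, x), \<omega>). psi s t x \<omega>) \<in> borel_measurable (restrict_space borel ({0..T} \<times> {0..T} \<times> UNIV) \<Otimes>\<^sub>M P)"
proof -
  let ?R = "restrict_space borel ({0..T} \<times> {0..T} \<times> UNIV) :: (real \<times> real \<times> (real^'n)) measure"
  define up where "up k j = max 0 (min T ((real_of_int j + 1) / real (Suc k)))" for k :: nat and j :: int
  define fl where "fl k s = \<lfloor>s * real (Suc k)\<rfloor>" for k :: nat and s :: real
  have upT: "up k j \<in> {0..T}" for k j using T_pos by (auto simp: up_def)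
  have up_ge: "s \<le> up k (fl k s)" and up_le: "up k (fl k s) \<le> s + 1 / real (Suc k)" if s: "s \<in> {0..T}" for k s
  proof -
    have "s * real (Suc k) \<le> real_of_int (fl k s) + 1" unfolding fl_def by linarith
    then have "s \<le> (real_of_int (fl k s) + 1) / real (Suc k)" by (simp add: pos_le_divide_eq del: of_nat_Suc)
    then show "s \<le> up k (fl k s)" using s by (auto simp: up_def max_def min_def)
    have "(real_of_int (fl k s) + 1) / real (Suc k) \<le> (s * real (Suc k) + 1) / real (Suc k)"
      unfolding fl_def by (intro divide_right_mono) auto
    also have "\<dots> = s + 1 / real (Suc k)" by (simp add: add_divide_distrib del: of_nat_Suc)
    finally have a: "(real_of_int (fl k s) + 1) / real (Suc k) \<le> s + 1 / real (Suc k)" .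
    have "0 \<le> s + 1 / real (Suc k)" using s by auto
    then show "up k (fl k s) \<le> s + 1 / real (Suc k)" using a unfolding up_def by linarith
  qed
  have up_lim: "(\<lambda>k. up k (fl k s)) \<longlonglongrightarrow> s" if s: "s \<in> {0..T}" for s
  proof (rule tendsto_sandwich[of "\<lambda>_. s" _ _ "\<lambda>k. s + 1 / real (Suc k)"])
    have "(\<lambda>k. s + 1 / real (Suc k)) \<longlonglongrightarrow> s + 0" by (intro tendsto_intros LIMSEQ_Suc[OF lim_1_over_n])
    then show "(\<lambda>k. s + 1 / real (Suc k)) \<longlonglongrightarrow> s" by simp
  qed (use up_ge[OF s] up_le[OF s] in auto)
  define A where "A k p = psi (up k (fl k (fst (fst p)))) (up k (fl k (fst (snd (fst p))))) (dyadic_floor k (snd (snd (fst p)))) (snd p)"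
    for k and p :: "(real \<times> real \<times> (real^'n)) \<times> 'a"
  have "(\<lambda>p. psi (fst (fst p)) (fst (snd (fst p))) (snd (snd (fst p))) (snd p)) \<in> borel_measurable (?R \<Otimes>\<^sub>M P)"
  proof (rule borel_measurable_LIMSEQ_metric[of A])
    fix k
    have fixed: "psi (up k i) (up k j) y \<in> borel_measurable P" for i j y
      using strong_sol_measurable[OF psi_strong_sol[OF upT[of k i], of y] _ upT[of k j]] upT[of k i] by auto
    have i: "(\<lambda>p. (fst (fst p))) \<in> borel_measurable (?R \<Otimes>\<^sub>M P)"
      "(\<lambda>p. (fst (snd (fst p)))) \<in> borel_measurable (?R \<Otimes>\<^sub>M P)" "(\<lambda>p. (snd (snd (fst p)))) \<in> borel_measurable (?R \<Otimes>\<^sub>M P)"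
      by (rule measurable_compose[OF measurable_fst], intro measurable_restrict_space1 borel_measurable_continuous_onI continuous_intros)+
    have f: "(\<lambda>p. fl k (fst (fst p))) \<in> measurable (?R \<Otimes>\<^sub>M P) (count_space UNIV)"
      "(\<lambda>p. fl k (fst (snd (fst p)))) \<in> measurable (?R \<Otimes>\<^sub>M P) (count_space UNIV)"
      unfolding fl_def by (rule measurable_compose[OF borel_measurable_times[OF i(1) borel_measurable_const] measurable_real_floor],
        rule measurable_compose[OF borel_measurable_times[OF i(2) borel_measurable_const] measurable_real_floor])
    have d: "(\<lambda>p. dyadic_floor k (snd (snd (fst p)))) \<in> measurable (?R \<Otimes>\<^sub>M P) (count_space dyadic_points)"
      by (rule measurable_compose[OF i(3) dyadic_floor_count_space])
    have "(\<lambda>p. psi (up k i) (up k j) y (snd p)) \<in> borel_measurable (?R \<Otimes>\<^sub>M P)" for i j y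
      by (rule measurable_compose[OF measurable_snd fixed])
    then have "(\<lambda>p. psi (up k i) (up k j) (dyadic_floor k (snd (snd (fst p)))) (snd p)) \<in> borel_measurable (?R \<Otimes>\<^sub>M P)" for i j
      by (rule measurable_compose_countable'[OF _ d countable_dyadic_points])
    then have "(\<lambda>p. psi (up k i) (up k (fl k (fst (snd (fst p))))) (dyadic_floor k (snd (snd (fst p)))) (snd p)) \<in> borel_measurable (?R \<Otimes>\<^sub>M P)" for i
      by (rule measurable_compose_countable[OF _ f(2)])
    then show "A k \<in> borel_measurable (?R \<Otimes>\<^sub>M P)"
      unfolding A_def[abs_def] by (rule measurable_compose_countable[OF _ f(1)])
  next
    fix p assume "p \<in> space (?R \<Otimes>\<^sub>M P)"
    then obtain s t x \<omega> where p: "p = ((s, t, x), \<omega>)" "s \<in> {0..T}" "t \<in> {0..T}"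
      by (auto simp: space_pair_measure space_restrict_space)
    show "(\<lambda>k. A k p) \<longlonglongrightarrow> psi (fst (fst p)) (fst (snd (fst p))) (snd (snd (fst p))) (snd p)"
    proof (cases "\<omega> \<in> good")
      case False
      then show ?thesis using dyadic_floor_tendsto[of x] by (simp add: A_def psi_def p(1))
    next
      case True
      from noisy_path.noisy_flow_joint_tendsto[OF goodD(1)[OF True] goodD(2)[OF True] p(2,3) upT up_ge[OF p(2)] up_lim[OF p(2)] upT up_ge[OF p(3)] up_lim[OF p(3)] dyadic_floor_tendsto[of x]]
      show ?thesis by (simp add: A_def p(1) goodD(3)[OF True])
    qed
  qed
  then show ?thesis by (simp add: case_prod_unfold)
qed

lemma psi_section_measurable:
  assumes "t \<in> {0..T}"
  shows "(\<lambda>(s, \<omega>). psi s t x \<omega>) \<in> borel_measurable (restrict_space borel {0..T} \<Otimes>\<^sub>M P)"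
proof -
  let ?R = "restrict_space borel ({0..T} \<times> {0..T} \<times> UNIV) :: (real \<times> real \<times> (real^'n)) measure"
  have "(\<lambda>s. (s, t, x)) \<in> measurable (restrict_space borel {0..T}) ?R"
    by (rule measurable_restrict_space3) (use assms in \<open>auto intro!: borel_measurable_continuous_onI continuous_intros\<close>)
  then have "(\<lambda>p. ((fst p, t, x), snd p)) \<in> measurable (restrict_space borel {0..T} \<Otimes>\<^sub>M P) (?R \<Otimes>\<^sub>M P)"
    by (intro measurable_Pair measurable_compose[OF measurable_fst] measurable_snd)
  from measurable_compose[OF this psi_measurable] show ?thesis by (simp add: case_prod_unfold)
qed

abbreviation psi_moment :: "nat \<Rightarrow> real \<Rightarrow> 'a \<Rightarrow> ennreal" where
  "psi_moment m s \<omega> \<equiv> hoelder_moment m (increment_sup m (\<lambda>x t \<omega>. psi s t x \<omega>) \<omega>)"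

lemma psi_moment_measurable:
  "(\<lambda>(s, \<omega>). psi_moment m s \<omega>) \<in> borel_measurable (restrict_space borel {0..T} \<Otimes>\<^sub>M P)"
  unfolding case_prod_unfold
proof (rule hoelder_moment_measurable)
  fix x y
  show "(\<lambda>p. increment_sup m (\<lambda>x t \<omega>. psi (fst p) t x \<omega>) (snd p) x y) \<in> borel_measurable (restrict_space borel {0..T} \<Otimes>\<^sub>M P)"
    unfolding increment_sup_def
  proof (rule borel_measurable_SUP[OF countable_right_dense])
    fix t assume "t \<in> right_dense 0 T"
    then have t: "t \<in> {0..T}" using right_dense_subset[of 0 T] T_pos by auto
    have "(\<lambda>p. psi (fst p) t z (snd p)) \<in> borel_measurable (restrict_space borel {0..T} \<Otimes>\<^sub>M P)" for z
      using psi_section_measurable[OF t, of z] by (simp add: case_prod_unfold)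
    then have "(\<lambda>p. norm (psi (fst p) t x (snd p) - psi (fst p) t y (snd p)) powr (2 * real m)) \<in> borel_measurable (restrict_space borel {0..T} \<Otimes>\<^sub>M P)"
      by measurable
    then show "(\<lambda>p. ennreal (norm (psi (fst p) t x (snd p) - psi (fst p) t y (snd p)) powr (2 * real m))) \<in> borel_measurable (restrict_space borel {0..T} \<Otimes>\<^sub>M P)"
      by measurable
  qed
qed

lemma psi_hoelder:
  assumes m: "2 * CARD('n) < m"
  defines "\<gamma> \<equiv> (real m - 2 * real CARD('n)) / real m" and "e \<equiv> (2 * real CARD('n) + 1) / real m"
  obtains D where "1 \<le> D" "\<And>\<omega> s x y. \<omega> \<in> good \<Longrightarrow> s \<in> {0..T} \<Longrightarrow>
     (\<Squnion>t\<in>{0..T}. ennreal (dist (psi s t x \<omega>) (psi s t y \<omega>))) \<le> ennreal D * (1 + psi_moment m s \<omega>) * ennreal (hoelder_weight \<gamma> e x y)"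
proof -
  have m0: "0 < real m" using m by simp
  have ge: "0 < \<gamma>" "0 < e" using m m0 by (auto simp: \<gamma>_def e_def intro!: divide_pos_pos)
  obtain D where D: "1 \<le> D" "\<And>s V \<omega> x y t. \<lbrakk>hoelder_moment m (increment_sup m V \<omega>) < \<infinity>; 0 \<le> s;
      \<And>x. x \<in> dyadic_points \<Longrightarrow> cadlag_on {s..T} (\<lambda>t. V x t \<omega>); x \<in> dyadic_points; y \<in> dyadic_points; t \<in> {s..T}\<rbrakk>
     \<Longrightarrow> norm (V x t \<omega> - V y t \<omega>) \<le> D * (1 + enn2real (hoelder_moment m (increment_sup m V \<omega>))) * hoelder_weight \<gamma> e x y"
    by (fact increment_sup_hoelder[OF m, folded \<gamma>_def e_def])
  show ?thesis
  proof (rule that[OF D(1)], rule SUP_least)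
    fix \<omega> s x y t assume \<omega>: "\<omega> \<in> good" and s: "s \<in> {0..T}" and t: "t \<in> {0..T}"
    show "ennreal (dist (psi s t x \<omega>) (psi s t y \<omega>)) \<le> ennreal D * (1 + psi_moment m s \<omega>) * ennreal (hoelder_weight \<gamma> e x y)"
    proof (cases "psi_moment m s \<omega> < \<infinity>")
      \<comment> \<open>An infinite moment makes the right-hand side infinite, unless
        \<open>x = y\<close>, where both sides vanish.\<close>
      case False
      show ?thesis
      proof (cases "x = y")
        case False
        then have "0 < hoelder_weight \<gamma> e x y" by (auto simp: hoelder_weight_def intro!: mult_pos_pos)
        then show ?thesis using \<open>\<not> psi_moment m s \<omega> < \<infinity>\<close> D(1) by (auto simp: less_top[symmetric] ennreal_mult_top ennreal_top_mult ennreal_mult_eq_top_iff)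
      qed simp
    next
      case True
      define w where "w = D * (1 + enn2real (psi_moment m s \<omega>))"
      have w: "ennreal D * (1 + psi_moment m s \<omega>) = ennreal w"
      proof -
        have "psi_moment m s \<omega> = ennreal (enn2real (psi_moment m s \<omega>))" using True by (simp add: ennreal_enn2real)
        then have "1 + psi_moment m s \<omega> = ennreal (1 + enn2real (psi_moment m s \<omega>))" by (simp add: ennreal_plus)
        then show ?thesis using D(1) by (simp add: w_def ennreal_mult)
      qed
      have w0: "0 \<le> w" using D(1) by (simp add: w_def)
      \<comment> \<open>Before \<open>s\<close> the flow is frozen at its value at time
        \<open>s\<close>, so the estimate on \<open>{s..T}\<close> covers all of
        \<open>{0..T}\<close>.\<close>
      define u where "u = max s t"
      have u: "u \<in> {s..T}" "u \<in> {0..T}" using s t by (auto simp: u_def)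
      have pu: "psi s t z \<omega> = psi s u z \<omega>" for z
        using psi_before[OF s] s by (cases "t \<le> s") (auto simp: u_def max_def)
      have dy: "norm (psi s u (dyadic_floor k x) \<omega> - psi s u (dyadic_floor k y) \<omega>) \<le> w * hoelder_weight \<gamma> e (dyadic_floor k x) (dyadic_floor k y)" for k
        unfolding w_def
        by (rule D(2)[where V="\<lambda>x t \<omega>. psi s t x \<omega>", OF True _ _ dyadic_floor_dyadic_points dyadic_floor_dyadic_points u(1)])
           (use s psi_cadlag[OF \<omega> s] in auto)
      have lim: "(\<lambda>k. psi s u (dyadic_floor k z) \<omega>) \<longlonglongrightarrow> psi s u z \<omega>" for z
      proof -
        have "(\<lambda>k. noisy_path.noisy_flow (\<lambda>t. N t \<omega>) (Z_of \<omega>) s u (dyadic_floor k z)) \<longlonglongrightarrow> noisy_path.noisy_flow (\<lambda>t. N t \<omega>) (Z_of \<omega>) s u z"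
          by (rule noisy_path.noisy_flow_joint_tendsto[OF goodD(1)[OF \<omega>] goodD(2)[OF \<omega>] s u(2)])
             (use s u dyadic_floor_tendsto in auto)
        then show ?thesis by (simp add: goodD(3)[OF \<omega>])
      qed
      have "norm (psi s u x \<omega> - psi s u y \<omega>) \<le> w * hoelder_weight \<gamma> e x y"
      proof (rule LIMSEQ_le)
        show "(\<lambda>k. norm (psi s u (dyadic_floor k x) \<omega> - psi s u (dyadic_floor k y) \<omega>)) \<longlonglongrightarrow> norm (psi s u x \<omega> - psi s u y \<omega>)"
          by (intro tendsto_intros lim)
        show "(\<lambda>k. w * hoelder_weight \<gamma> e (dyadic_floor k x) (dyadic_floor k y)) \<longlonglongrightarrow> w * hoelder_weight \<gamma> e x y"
          by (intro tendsto_intros hoelder_weight_tendsto ge dyadic_floor_tendsto)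
      qed (use dy in blast)
      then show ?thesis
        unfolding pu dist_norm w using w0 by (simp add: ennreal_mult[symmetric] hoelder_weight_nonneg ennreal_leI)
    qed
  qed
qed

text \<open>\<open>psi\<close> is a strong solution for every \<open>s\<close>, not only for the
  dyadic ones, so the mean of its moment is bounded uniformly over \<open>{0..T}\<close> and can be
  integrated in \<open>s\<close>.\<close>

lemma psi_moment_integrable:
  assumes m: "2 * CARD('n) < m"
  shows "AE \<omega> in P. (\<integral>\<^sup>+ s\<in>{0..T}. ennreal D * (1 + psi_moment m s \<omega>) \<partial>lborel) < \<infinity>"
proof -
  interpret P: prob_space P by (rule prob)
  obtain E where E: "0 \<le> E" "\<And>s V. s \<in> {0..T} \<Longrightarrow> (\<And>x. strong_sol P L T s x B N (V x)) \<Longrightarrow>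
    (\<integral>\<^sup>+\<omega>. hoelder_moment m (increment_sup m V \<omega>) \<partial>P) \<le> ennreal E"
    by (fact hoelder_moment_sol[OF m])
  show ?thesis
  proof (rule nn_integral_AE_finite_sections[OF prob T_pos, of "max 0 D * (1 + E)"])
    show "0 \<le> max 0 D * (1 + E)" using E(1) by simp
    show "(\<lambda>(s, \<omega>). ennreal D * (1 + psi_moment m s \<omega>)) \<in> borel_measurable (restrict_space borel {0..T} \<Otimes>\<^sub>M P)"
      using psi_moment_measurable[of m] unfolding case_prod_unfold
      by (intro borel_measurable_times_ennreal borel_measurable_const borel_measurable_add)
    fix s assume s: "s \<in> {0..T}"
    have pm: "(\<lambda>\<omega>. psi_moment m s \<omega>) \<in> borel_measurable P"
      by (intro hoelder_moment_measurable increment_sup_measurable[OF s] psi_strong_sol[OF s])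
    have "(\<integral>\<^sup>+\<omega>. ennreal D * (1 + psi_moment m s \<omega>) \<partial>P) = ennreal D * (1 + (\<integral>\<^sup>+\<omega>. psi_moment m s \<omega> \<partial>P))"
      using pm by (subst nn_integral_cmult) (auto simp: nn_integral_add P.emeasure_space_1)
    also have "\<dots> \<le> ennreal (max 0 D) * (1 + ennreal E)"
      by (intro mult_mono add_left_mono E(2)[OF s psi_strong_sol[OF s]] ennreal_leI) auto
    also have "\<dots> = ennreal (max 0 D * (1 + E))" using E(1) by (simp add: ennreal_mult ennreal_plus)
    finally show "(\<integral>\<^sup>+\<omega>. ennreal D * (1 + psi_moment m s \<omega>) \<partial>P) \<le> ennreal (max 0 D * (1 + E))" .
  qed
qed

end

theorem theorem3p6:
  fixes P :: "'a measure"
    and L :: "real \<Rightarrow> 'a \<Rightarrow> real^'d"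
    and Q :: "real^'d^'d" and \<nu> :: "(real^'d) measure"
    and T \<beta> \<theta> :: real
    and b :: "real \<Rightarrow> real^'n \<Rightarrow> real^'n"
    and \<sigma> :: "real \<Rightarrow> real^'d^'n"
    and A :: "real^'n^'n"
    and M Mt :: "real \<Rightarrow> 'a \<Rightarrow> real^'n"
  assumes T: "T > 0"
    and dim: "CARD('d) \<le> CARD('n)"
    and complete: "complete_measure P"
    and levy: "levy_process_triplet P L Q \<nu>"
    and moment: "\<theta> \<in> {0<..<1}" "(\<integral>\<^sup>+ \<omega>. ennreal (norm (L 1 \<omega>) powr \<theta>) \<partial>P) < \<infinity>"
    and beta: "\<beta> \<in> {0<..<1}"
    and b_meas: "(\<lambda>(t, x). b t x) \<in> borel_measurable (restrict_space borel ({0..T} \<times> UNIV))"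
    and b_bdd: "\<exists>K. \<forall>t\<in>{0..T}. \<forall>x. norm (b t x) \<le> K"
    and b_hoelder: "\<exists>C. \<forall>t\<in>{0..T}. \<forall>x y. dist (b t x) (b t y) \<le> C * dist x y powr \<beta>"
    and sigma_meas: "\<sigma> \<in> borel_measurable (restrict_space borel {0..T})"
    and sigma_bdd: "bounded (\<sigma> ` {0..T})"
    and M_int: "is_stoch_int P L T \<sigma> M"
    and M_cadlag: "AE \<omega> in P. cadlag_on {0..T} (\<lambda>t. M t \<omega>)"
    and Mt_int: "is_stoch_int P L T (\<lambda>r. mexp (- r) A ** \<sigma> r) Mt"
    and Mt_cadlag: "AE \<omega> in P. cadlag_on {0..T} (\<lambda>t. Mt t \<omega>)"
    and H1: "H1 P L T b A M"
  shows "\<exists>\<psi> :: real \<Rightarrow> real \<Rightarrow> real^'n \<Rightarrow> 'a \<Rightarrow> real^'n.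
     (\<lambda>((s, t, x), \<omega>). \<psi> s t x \<omega>)
        \<in> borel_measurable (restrict_space borel ({0..T} \<times> {0..T} \<times> UNIV) \<Otimes>\<^sub>M P) \<and>
     (\<forall>s\<in>{0..T}. \<forall>x. strong_sol P L T s x (btilde A b) Mt (\<lambda>t \<omega>. \<psi> s t x \<omega>)) \<and>
     (\<exists>\<Omega>'\<in>sets P. prob_space.prob P \<Omega>' = 1 \<and>
       \<comment> \<open>(i) right continuity and left limits in s, uniformly on compacts in x and in t\<close>
       (\<forall>\<omega>\<in>\<Omega>'. \<forall>s\<in>{0..<T}. \<forall>R>0. \<forall>r :: nat \<Rightarrow> real.
          (\<forall>k. s < r k \<and> r k \<le> T) \<and> r \<longlonglongrightarrow> s \<longrightarrow>
          (\<lambda>k. \<Squnion>x\<in>cball 0 R. \<Squnion>t\<in>{0..T}. ennreal (dist (\<psi> (r k) t x \<omega>) (\<psi> s t x \<omega>))) \<longlonglongrightarrow> 0) \<and>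
       (\<forall>\<omega>\<in>\<Omega>'. \<forall>s\<in>{0<..T}. \<exists>\<psi>m :: real \<Rightarrow> real^'n \<Rightarrow> real^'n. \<forall>R>0. \<forall>r :: nat \<Rightarrow> real.
          (\<forall>k. 0 \<le> r k \<and> r k < s) \<and> r \<longlonglongrightarrow> s \<longrightarrow>
          (\<lambda>k. \<Squnion>x\<in>cball 0 R. \<Squnion>t\<in>{0..T}. ennreal (dist (\<psi> (r k) t x \<omega>) (\<psi>m t x))) \<longlonglongrightarrow> 0) \<and>
       \<comment> \<open>(ii) the equation holds for all s, x, t on the single event\<close>
       (\<forall>\<omega>\<in>\<Omega>'. \<forall>s\<in>{0..T}. \<forall>x.
          (\<forall>t\<in>{0..s}. \<psi> s t x \<omega> = x) \<and>
          (\<forall>t\<in>{s..T}. \<psi> s t x \<omega> =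
              x + (LINT r:{s..t}|lborel. btilde A b r (\<psi> s r x \<omega>)) + Mt t \<omega> - Mt s \<omega>)) \<and>
       \<comment> \<open>(iii) continuity in x uniformly in t, and the Hoelder-type estimate\<close>
       (\<forall>\<omega>\<in>\<Omega>'. \<forall>s\<in>{0..T}. \<forall>x. \<forall>\<epsilon>>0. \<exists>\<delta>>0. \<forall>y. dist y x < \<delta> \<longrightarrow>
          (\<forall>t\<in>{0..T}. dist (\<psi> s t y \<omega>) (\<psi> s t x \<omega>) < \<epsilon>)) \<and>
       (\<forall>m::nat. m > 2 * CARD('n) \<longrightarrow>
          (\<exists>V :: real \<Rightarrow> 'a \<Rightarrow> ennreal.
             (\<lambda>(s, \<omega>). V s \<omega>) \<in> borel_measurable (restrict_space borel {0..T} \<Otimes>\<^sub>M P) \<and>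
             (\<forall>\<omega>\<in>\<Omega>'. (\<integral>\<^sup>+ s\<in>{0..T}. V s \<omega> \<partial>lborel) < \<infinity> \<and>
                (\<forall>s\<in>{0..T}. \<forall>x y.
                   (\<Squnion>t\<in>{0..T}. ennreal (dist (\<psi> s t x \<omega>) (\<psi> s t y \<omega>)))
                   \<le> V s \<omega> * ennreal (norm (x - y) powr ((real m - 2 * real CARD('n)) / real m)
                        * max ((max (norm x) (norm y)) powr ((2 * real CARD('n) + 1) / real m)) 1))))) \<and>
       \<comment> \<open>(iv) flow property\<close>
       (\<forall>\<omega>\<in>\<Omega>'. \<forall>s r t. 0 \<le> s \<and> s < r \<and> r \<le> t \<and> t \<le> T \<longrightarrow>
          (\<forall>x. \<psi> s t x \<omega> = \<psi> r t (\<psi> s r x \<omega>) \<omega>)) \<and>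
       \<comment> \<open>(v) pathwise uniqueness on random intervals [s0,tau)\<close>
       (\<forall>\<omega>\<in>\<Omega>'. \<forall>s0\<in>{0..<T}. \<forall>\<tau>\<in>{s0<..T}. \<forall>x.
          (let sol = (\<lambda>g. cadlag_on {s0..<\<tau>} g \<and>
                 (\<forall>t\<in>{s0..<\<tau>}. g t = x + (LINT r:{s0..t}|lborel. btilde A b r (g r)) + Mt t \<omega> - Mt s0 \<omega>))
           in sol (\<lambda>r. \<psi> s0 r x \<omega>) \<and>
              (\<forall>g. sol g \<longrightarrow> (\<forall>r\<in>{s0..<\<tau>}. g r = \<psi> s0 r x \<omega>)))))"
proof -
  interpret P: prob_space P using levy unfolding levy_process_triplet_def by blast
  obtain K where K: "\<And>t x. t \<in> {0..T} \<Longrightarrow> norm (b t x) \<le> K" using b_bdd by blast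
  obtain C where C: "\<And>t x y. t \<in> {0..T} \<Longrightarrow> dist (b t x) (b t y) \<le> C * dist x y powr \<beta>" using b_hoelder by blast
  interpret lv: levy_sde P L T K b \<sigma> A M Mt
  proof
    show "L t \<in> borel_measurable P" if "0 \<le> t" for t using levy that unfolding levy_process_triplet_def by blast
    show "\<And>A B. B \<subseteq> A \<Longrightarrow> A \<in> null_sets P \<Longrightarrow> B \<in> sets P" using complete by (rule complete_measure.complete)
  qed (use assms K P.emeasure_space_1 in auto)
  obtain K' where K': "\<And>t x. t \<in> {0..T} \<Longrightarrow> norm (btilde A b t x) \<le> K'" by (rule lv.btilde_bdd) blast
  obtain E where E: "E > 0" "\<And>r w. r \<in> {-T..T} \<Longrightarrow> norm (mexp r A *v w) \<le> E * norm w" by (rule mexp_bounded[of "-T" T A]) blast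
  \<comment> \<open>\<open>E\<close> bounds the exponential outside \<open>b\<close>, and
    \<open>E powr \<beta>\<close> stems from the one inside; \<open>max 0 C\<close> provides the
    nonnegative constant that the locale asks for.\<close>
  interpret sf: strong_flow P L T K' "E * (max 0 C * E powr \<beta>)" \<beta> "btilde A b" Mt
  proof
    show "norm (btilde A b t x - btilde A b t y) \<le> E * (max 0 C * E powr \<beta>) * norm (x - y) powr \<beta>" if t: "t \<in> {0..T}" for t x y
    proof -
      have "norm (btilde A b t x - btilde A b t y) = norm (mexp (- t) A *v (b t (mexp t A *v x) - b t (mexp t A *v y)))"
        by (simp add: btilde_def matrix_vector_mult_diff_distrib)
      also have "\<dots> \<le> E * norm (b t (mexp t A *v x) - b t (mexp t A *v y))" using t by (intro E(2)) auto
      also have "\<dots> \<le> E * (max 0 C * norm (mexp t A *v x - mexp t A *v y) powr \<beta>)"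
      proof (rule mult_left_mono)
        have "norm (b t (mexp t A *v x) - b t (mexp t A *v y)) \<le> C * norm (mexp t A *v x - mexp t A *v y) powr \<beta>"
          using C[OF t] by (simp add: dist_norm)
        also have "\<dots> \<le> max 0 C * norm (mexp t A *v x - mexp t A *v y) powr \<beta>" by (intro mult_right_mono) auto
        finally show "norm (b t (mexp t A *v x) - b t (mexp t A *v y)) \<le> max 0 C * norm (mexp t A *v x - mexp t A *v y) powr \<beta>" .
      qed (use E(1) in simp)
      also have "\<dots> \<le> E * (max 0 C * (E * norm (x - y)) powr \<beta>)"
      proof (intro mult_left_mono powr_mono2)
        show "norm (mexp t A *v x - mexp t A *v y) \<le> E * norm (x - y)"
          using E(2)[of t "x - y"] t by (simp add: matrix_vector_mult_diff_distrib)
      qed (use E(1) beta in auto)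
      also have "\<dots> = E * (max 0 C * E powr \<beta>) * norm (x - y) powr \<beta>" using E(1) by (simp add: powr_mult)
      finally show ?thesis .
    qed
    show "\<exists>D\<ge>0. \<forall>s x y U U'. s \<in> {0..T} \<longrightarrow> strong_sol P L T s x (btilde A b) Mt U \<longrightarrow> strong_sol P L T s y (btilde A b) Mt U' \<longrightarrow>
       (\<integral>\<^sup>+\<omega>. (\<Squnion>t\<in>right_dense 0 T. ennreal (norm (U t \<omega> - U' t \<omega>) powr p)) \<partial>P) \<le> ennreal (D * norm (x - y) powr p)" if p: "2 \<le> p" for p
      by (rule lv.strong_sol_D_moment[OF p]) blast
  qed (use T K' E(1) beta lv.L_meas lv.btilde_meas Mt_cadlag lv.strong_sol_D_exists complete_measure.complete[OF complete] P.emeasure_space_1 in auto)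
  let ?w = "\<lambda>m x y. norm (x - y) powr ((real m - 2 * real CARD('n)) / real m)
                        * max ((max (norm x) (norm y)) powr ((2 * real CARD('n) + 1) / real m)) 1"
  \<comment> \<open>The constants are chosen for all \<open>m\<close> at once, before the event is
    formed, because the single event \<open>\<Omega>'\<close> must carry the integrability of every
    \<open>V m\<close>.\<close>
  have "\<exists>D. 2 * CARD('n) < m \<longrightarrow> (\<forall>\<omega>\<in>sf.good. \<forall>s\<in>{0..T}. \<forall>x y.
      (\<Squnion>t\<in>{0..T}. ennreal (dist (sf.psi s t x \<omega>) (sf.psi s t y \<omega>))) \<le> ennreal D * (1 + sf.psi_moment m s \<omega>) * ennreal (?w m x y))" for m
  proof (cases "2 * CARD('n) < m")
    case True
    show ?thesis unfolding hoelder_weight_def[symmetric] by (rule sf.psi_hoelder[OF True]) blast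
  qed simp
  then have "\<forall>m. \<exists>D. 2 * CARD('n) < m \<longrightarrow> (\<forall>\<omega>\<in>sf.good. \<forall>s\<in>{0..T}. \<forall>x y.
      (\<Squnion>t\<in>{0..T}. ennreal (dist (sf.psi s t x \<omega>) (sf.psi s t y \<omega>))) \<le> ennreal D * (1 + sf.psi_moment m s \<omega>) * ennreal (?w m x y))"
    by (rule allI)
  from choice[OF this] obtain D where "\<forall>m. 2 * CARD('n) < m \<longrightarrow> (\<forall>\<omega>\<in>sf.good. \<forall>s\<in>{0..T}. \<forall>x y.
      (\<Squnion>t\<in>{0..T}. ennreal (dist (sf.psi s t x \<omega>) (sf.psi s t y \<omega>))) \<le> ennreal (D m) * (1 + sf.psi_moment m s \<omega>) * ennreal (?w m x y))" ..
  then have D: "\<And>m \<omega> s x y. 2 * CARD('n) < m \<Longrightarrow> \<omega> \<in> sf.good \<Longrightarrow> s \<in> {0..T} \<Longrightarrow>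
      (\<Squnion>t\<in>{0..T}. ennreal (dist (sf.psi s t x \<omega>) (sf.psi s t y \<omega>))) \<le> ennreal (D m) * (1 + sf.psi_moment m s \<omega>) * ennreal (?w m x y)"
    by blast
  define V where "V m s \<omega> = ennreal (D m) * (1 + sf.psi_moment m s \<omega>)" for m s \<omega>
  define \<Omega>' where "\<Omega>' = {\<omega> \<in> space P. \<omega> \<in> sf.good \<and> (\<forall>m. 2 * CARD('n) < m \<longrightarrow> (\<integral>\<^sup>+ s\<in>{0..T}. V m s \<omega> \<partial>lborel) < \<infinity>)}"
  have "AE \<omega> in P. \<forall>m. 2 * CARD('n) < m \<longrightarrow> (\<integral>\<^sup>+ s\<in>{0..T}. V m s \<omega> \<partial>lborel) < \<infinity>"
    unfolding AE_all_countable V_def by (intro allI AE_impI sf.psi_moment_integrable)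
  with sf.AE_good have AE: "AE \<omega> in P. \<omega> \<in> sf.good \<and> (\<forall>m. 2 * CARD('n) < m \<longrightarrow> (\<integral>\<^sup>+ s\<in>{0..T}. V m s \<omega> \<partial>lborel) < \<infinity>)"
    by eventually_elim blast
  have \<Omega>'_sets: "\<Omega>' \<in> sets P" unfolding \<Omega>'_def by (rule sf.AE_imp_sets[OF AE])
  have "AE \<omega> in P. \<omega> \<in> \<Omega>'" using AE AE_space by eventually_elim (simp add: \<Omega>'_def)
  then have \<Omega>'_prob: "measure P \<Omega>' = 1" using P.prob_eq_1[OF \<Omega>'_sets] by blast
  have good: "\<omega> \<in> sf.good" if "\<omega> \<in> \<Omega>'" for \<omega> using that by (simp add: \<Omega>'_def)
  note path = sf.goodD(1)[OF good] and smap = sf.goodD(2)[OF good] and psi = sf.goodD(3)[OF good]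
  have i1: "\<forall>\<omega>\<in>\<Omega>'. \<forall>s\<in>{0..<T}. \<forall>R>0. \<forall>r :: nat \<Rightarrow> real.
          (\<forall>k. s < r k \<and> r k \<le> T) \<and> r \<longlonglongrightarrow> s \<longrightarrow>
          (\<lambda>k. \<Squnion>x\<in>cball 0 R. \<Squnion>t\<in>{0..T}. ennreal (dist (sf.psi (r k) t x \<omega>) (sf.psi s t x \<omega>))) \<longlonglongrightarrow> 0"
  proof (intro ballI allI impI, elim conjE)
    fix \<omega> s and R :: real and r :: "nat \<Rightarrow> real"
    assume \<omega>: "\<omega> \<in> \<Omega>'" and s: "s \<in> {0..<T}" and r: "\<forall>k. s < r k \<and> r k \<le> T" "r \<longlonglongrightarrow> s"
    show "(\<lambda>k. \<Squnion>x\<in>cball 0 R. \<Squnion>t\<in>{0..T}. ennreal (dist (sf.psi (r k) t x \<omega>) (sf.psi s t x \<omega>))) \<longlonglongrightarrow> 0"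
      unfolding psi[OF \<omega>] by (rule noisy_path.noisy_flow_right[OF path[OF \<omega>] smap[OF \<omega>] s _ r(2)]) (use r(1) in blast)
  qed
  have i2: "\<forall>\<omega>\<in>\<Omega>'. \<forall>s\<in>{0<..T}. \<exists>\<psi>m :: real \<Rightarrow> real^'n \<Rightarrow> real^'n. \<forall>R>0. \<forall>r :: nat \<Rightarrow> real.
          (\<forall>k. 0 \<le> r k \<and> r k < s) \<and> r \<longlonglongrightarrow> s \<longrightarrow>
          (\<lambda>k. \<Squnion>x\<in>cball 0 R. \<Squnion>t\<in>{0..T}. ennreal (dist (sf.psi (r k) t x \<omega>) (\<psi>m t x))) \<longlonglongrightarrow> 0"
  proof (intro ballI)
    fix \<omega> s assume \<omega>: "\<omega> \<in> \<Omega>'" and s: "s \<in> {0<..T}"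
    show "\<exists>\<psi>m :: real \<Rightarrow> real^'n \<Rightarrow> real^'n. \<forall>R>0. \<forall>r :: nat \<Rightarrow> real.
          (\<forall>k. 0 \<le> r k \<and> r k < s) \<and> r \<longlonglongrightarrow> s \<longrightarrow>
          (\<lambda>k. \<Squnion>x\<in>cball 0 R. \<Squnion>t\<in>{0..T}. ennreal (dist (sf.psi (r k) t x \<omega>) (\<psi>m t x))) \<longlonglongrightarrow> 0"
      unfolding psi[OF \<omega>] by (rule noisy_path.noisy_flow_left[OF path[OF \<omega>] smap[OF \<omega>] s])
  qed
  have ii: "\<forall>\<omega>\<in>\<Omega>'. \<forall>s\<in>{0..T}. \<forall>x.
          (\<forall>t\<in>{0..s}. sf.psi s t x \<omega> = x) \<and>
          (\<forall>t\<in>{s..T}. sf.psi s t x \<omega> =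
              x + (LINT r:{s..t}|lborel. btilde A b r (sf.psi s r x \<omega>)) + Mt t \<omega> - Mt s \<omega>)"
    by (intro ballI allI conjI sf.psi_before sf.psi_eq good) auto
  have iii1: "\<forall>\<omega>\<in>\<Omega>'. \<forall>s\<in>{0..T}. \<forall>x. \<forall>\<epsilon>>0. \<exists>\<delta>>0. \<forall>y. dist y x < \<delta> \<longrightarrow>
          (\<forall>t\<in>{0..T}. dist (sf.psi s t y \<omega>) (sf.psi s t x \<omega>) < \<epsilon>)"
  proof (intro ballI allI impI)
    fix \<omega> s x and \<epsilon> :: real assume \<omega>: "\<omega> \<in> \<Omega>'" and s: "s \<in> {0..T}" and e: "0 < \<epsilon>"
    show "\<exists>\<delta>>0. \<forall>y. dist y x < \<delta> \<longrightarrow> (\<forall>t\<in>{0..T}. dist (sf.psi s t y \<omega>) (sf.psi s t x \<omega>) < \<epsilon>)"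
      unfolding psi[OF \<omega>] by (rule noisy_path.noisy_flow_continuous[OF path[OF \<omega>] smap[OF \<omega>] s e, of x]) blast
  qed
  have iii2: "\<forall>m::nat. m > 2 * CARD('n) \<longrightarrow>
          (\<exists>V :: real \<Rightarrow> 'a \<Rightarrow> ennreal.
             (\<lambda>(s, \<omega>). V s \<omega>) \<in> borel_measurable (restrict_space borel {0..T} \<Otimes>\<^sub>M P) \<and>
             (\<forall>\<omega>\<in>\<Omega>'. (\<integral>\<^sup>+ s\<in>{0..T}. V s \<omega> \<partial>lborel) < \<infinity> \<and>
                (\<forall>s\<in>{0..T}. \<forall>x y.
                   (\<Squnion>t\<in>{0..T}. ennreal (dist (sf.psi s t x \<omega>) (sf.psi s t y \<omega>)))
                   \<le> V s \<omega> * ennreal (?w m x y))))"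
  proof (intro allI impI)
    fix m :: nat assume m: "2 * CARD('n) < m"
    show "\<exists>V :: real \<Rightarrow> 'a \<Rightarrow> ennreal.
             (\<lambda>(s, \<omega>). V s \<omega>) \<in> borel_measurable (restrict_space borel {0..T} \<Otimes>\<^sub>M P) \<and>
             (\<forall>\<omega>\<in>\<Omega>'. (\<integral>\<^sup>+ s\<in>{0..T}. V s \<omega> \<partial>lborel) < \<infinity> \<and>
                (\<forall>s\<in>{0..T}. \<forall>x y.
                   (\<Squnion>t\<in>{0..T}. ennreal (dist (sf.psi s t x \<omega>) (sf.psi s t y \<omega>)))
                   \<le> V s \<omega> * ennreal (?w m x y)))"
    proof (rule exI[of _ "V m"], intro conjI ballI allI)
      show "(\<lambda>(s, \<omega>). V m s \<omega>) \<in> borel_measurable (restrict_space borel {0..T} \<Otimes>\<^sub>M P)"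
        using sf.psi_moment_measurable[of m] unfolding case_prod_unfold V_def
        by (intro borel_measurable_times_ennreal borel_measurable_const borel_measurable_add)
      fix \<omega> assume \<omega>: "\<omega> \<in> \<Omega>'"
      then show "(\<integral>\<^sup>+ s\<in>{0..T}. V m s \<omega> \<partial>lborel) < \<infinity>" using m by (simp add: \<Omega>'_def)
      show "(\<Squnion>t\<in>{0..T}. ennreal (dist (sf.psi s t x \<omega>) (sf.psi s t y \<omega>))) \<le> V m s \<omega> * ennreal (?w m x y)" if "s \<in> {0..T}" for s x y
        unfolding V_def by (rule D[OF m good[OF \<omega>] that])
    qed
  qed
  have iv: "\<forall>\<omega>\<in>\<Omega>'. \<forall>s r t. 0 \<le> s \<and> s < r \<and> r \<le> t \<and> t \<le> T \<longrightarrow>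
          (\<forall>x. sf.psi s t x \<omega> = sf.psi r t (sf.psi s r x \<omega>) \<omega>)"
    using noisy_path.noisy_flow_flow[OF path smap] by (simp add: psi)
  have v: "\<forall>\<omega>\<in>\<Omega>'. \<forall>s0\<in>{0..<T}. \<forall>\<tau>\<in>{s0<..T}. \<forall>x.
          (let sol = (\<lambda>g. cadlag_on {s0..<\<tau>} g \<and>
                 (\<forall>t\<in>{s0..<\<tau>}. g t = x + (LINT r:{s0..t}|lborel. btilde A b r (g r)) + Mt t \<omega> - Mt s0 \<omega>))
           in sol (\<lambda>r. sf.psi s0 r x \<omega>) \<and>
              (\<forall>g. sol g \<longrightarrow> (\<forall>r\<in>{s0..<\<tau>}. g r = sf.psi s0 r x \<omega>)))"
    unfolding Let_def
  proof (intro ballI allI conjI impI)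
    fix \<omega> s0 \<tau> x assume \<omega>: "\<omega> \<in> \<Omega>'" and s0: "s0 \<in> {0..<T}" and \<tau>: "\<tau> \<in> {s0<..T}"
    have s0T: "s0 \<in> {0..T}" using s0 by auto
    show "cadlag_on {s0..<\<tau>} (\<lambda>r. sf.psi s0 r x \<omega>)"
      by (rule cadlag_on_subset[OF sf.psi_cadlag[OF good[OF \<omega>] s0T]]) (use \<tau> in auto)
    show "sf.psi s0 t x \<omega> = x + (LINT r:{s0..t}|lborel. btilde A b r (sf.psi s0 r x \<omega>)) + Mt t \<omega> - Mt s0 \<omega>" if "t \<in> {s0..<\<tau>}" for t
      by (rule sf.psi_eq[OF good[OF \<omega>] s0T]) (use that \<tau> in auto)
    fix g r assume g: "cadlag_on {s0..<\<tau>} g \<and> (\<forall>t\<in>{s0..<\<tau>}. g t = x + (LINT r:{s0..t}|lborel. btilde A b r (g r)) + Mt t \<omega> - Mt s0 \<omega>)"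
      and r: "r \<in> {s0..<\<tau>}"
    have sub: "{s0..r} \<subseteq> {s0..<\<tau>}" using r by auto
    have "noisy_path.noisy_sol (btilde A b) (\<lambda>t. Mt t \<omega>) s0 r x g"
      unfolding noisy_path.noisy_sol_def[OF path[OF \<omega>]] using g sub cadlag_on_subset[of "{s0..<\<tau>}" g "{s0..r}"] by blast
    from noisy_path.noisy_flow_unique[OF path[OF \<omega>] smap[OF \<omega>] this, of r] show "g r = sf.psi s0 r x \<omega>"
      unfolding psi[OF \<omega>] using s0 \<tau> r by auto
  qed
  have sol: "\<forall>s\<in>{0..T}. \<forall>x. strong_sol P L T s x (btilde A b) Mt (\<lambda>t \<omega>. sf.psi s t x \<omega>)"
    using sf.psi_strong_sol by blast
  show ?thesis
    by (rule exI[of _ sf.psi], rule conjI[OF sf.psi_measurable], rule conjI[OF sol], rule bexI[OF _ \<Omega>'_sets],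
        intro conjI; fact \<Omega>'_prob i1 i2 ii iii1 iii2 iv v)
qed

end
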